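(* Assume that all $\mathbb F$-martingales are continuous. Then, for any random time $\tau$, NUPBR holds before $\tau$ (i.e. in the market $(S^\tau,\mathbb G)$). A $\mathbb G$-local martingale deflator for $S^\tau$ is given by $$dL_t=-\frac{L_t}{Z_t}\,d\widehat m_t.$$
   Context: Setting: $(\Omega,\mathcal A,\mathbb F,\mathbb P)$ is a filtered probability space with $\mathbb F$ satisfying the usual hypotheses and $\mathcal F_\infty\subset\mathcal A$; $\tau$ is a random time ($\mathcal A$-measurable, $[0,\infty]$-valued); $S$ is a positive $(\mathbb P,\mathbb F)$-local martingale (zero interest rate, infinite horizon). $\mathbb G=(\mathcal G_t)$ with $\mathcal G_t=\bigcap_{\epsilon>0}\big(\mathcal F_{t+\epsilon}\vee\sigma(\tau\wedge(t+\epsilon))\big)$. $Z_t=\mathbb P(\tau>t\mid\mathcal F_t)$, and it is assumed that $Z>0$. $A^o$ is the $\mathbb F$-dual optional projection of $A=\mathbf 1_{[\![\tau,\infty[\![}$ (the unique integrable $\mathbb F$-optional increasing process with $\mathbb E\int_{[0,\infty)}U_s\,dA_s=\mathbb E\int_{[0,\infty)}U_s\,dA^o_s$ for every positive $\mathbb F$-optional $U$), and $m:=Z+A^o$, an $\mathbb F$-martingale. $\widehat m$ is the $\mathbb G$-local martingale stopped at $\tau$ given by $\widehat m_t=m_{t\wedge\tau}-\int_0^{t\wedge\tau}\frac{d\langle m,m\rangle^{\mathbb F}_s}{Z_s}$. $L_0=1$. Local martingale deflator: a strictly positive $\mathbb G$-local martingale $L$ with $L_0=1$, $L_\infty>0$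 a.s., is a $\mathbb G$-local martingale deflator for $S^\tau$ if $LS^\tau$ is a $\mathbb G$-local martingale. NUPBR for a price process $X$ in filtration $\mathbb G$: $\theta$ ($\mathbb G$-predictable, $X$-integrable) is $x$-admissible if $\int_0^t\theta_s\,dX_s\ge-x$ a.s. for all $t\ge0$ and $\int_0^\infty\theta_s\,dX_s$ exists as a limit; NUPBR holds if there is no nonnegative $\mathcal G_\infty$-measurable $\xi$ with $\mathbb P(\xi>0)>0$ such that for every $x>0$ there is an $x$-admissible $\theta^x$ with $x+\int_0^\infty\theta^x_s\,dX_s\ge\xi$ a.s. *)

theory Defs
  imports "HOL-Probability.Probability"
begin

text \<open>
  Processes are functions \<open>X :: real \<Rightarrow> 'a \<Rightarrow> real\<close> of which only the times \<open>t \<ge> 0\<close> matter, and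
  filtrations are functions \<open>F :: real \<Rightarrow> 'a measure\<close> of which only the spaces and \<open>\<sigma>\<close>-algebras
  matter. Random times and stopping times take values in \<open>[0,\<infty>]\<close>, i.e. in \<^typ>\<open>ennreal\<close>.
  Path properties of processes are required almost surely.
\<close>

section \<open>Filtrations, processes, local martingales\<close>

definition filtered :: "'a measure \<Rightarrow> (real \<Rightarrow> 'a measure) \<Rightarrow> bool" where
  "filtered M F \<longleftrightarrow>
     (\<forall>t\<ge>0. subalgebra M (F t)) \<and> (\<forall>s t. 0 \<le> s \<and> s \<le> t \<longrightarrow> subalgebra (F t) (F s))"

definition usual_hypotheses :: "'a measure \<Rightarrow> (real \<Rightarrow> 'a measure) \<Rightarrow> bool" where
  "usual_hypotheses M F \<longleftrightarrow>
     filtered M F \<and>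
     (\<forall>t\<ge>0. sets (F t) = (\<Inter>s\<in>{t<..}. sets (F s))) \<and>
     (\<forall>N\<in>null_sets M. \<forall>A\<subseteq>N. A \<in> sets (F 0))"

definition sigma_infinity :: "'a measure \<Rightarrow> (real \<Rightarrow> 'a measure) \<Rightarrow> 'a measure" where
  "sigma_infinity M F = sigma (space M) (\<Union>t\<in>{0..}. sets (F t))"

definition adapted :: "(real \<Rightarrow> 'a measure) \<Rightarrow> (real \<Rightarrow> 'a \<Rightarrow> real) \<Rightarrow> bool" where
  "adapted F X \<longleftrightarrow> (\<forall>t\<ge>0. X t \<in> borel_measurable (F t))"

definition cadlag_path :: "(real \<Rightarrow> real) \<Rightarrow> bool" where
  "cadlag_path x \<longleftrightarrow>
     (\<forall>t\<ge>0. (x \<longlongrightarrow> x t) (at_right t)) \<and> (\<forall>t>0. \<exists>l. (x \<longlongrightarrow> l) (at_left t))"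

definition increasing_path :: "(real \<Rightarrow> real) \<Rightarrow> bool" where
  "increasing_path x \<longleftrightarrow>
     0 \<le> x 0 \<and> mono_on {0..} x \<and> (\<forall>t\<ge>0. (x \<longlongrightarrow> x t) (at_right t))"

definition cadlag_adapted :: "'a measure \<Rightarrow> (real \<Rightarrow> 'a measure) \<Rightarrow> (real \<Rightarrow> 'a \<Rightarrow> real) \<Rightarrow> bool" where
  "cadlag_adapted M F X \<longleftrightarrow> adapted F X \<and> (AE \<omega> in M. cadlag_path (\<lambda>t. X t \<omega>))"

definition martingale :: "'a measure \<Rightarrow> (real \<Rightarrow> 'a measure) \<Rightarrow> (real \<Rightarrow> 'a \<Rightarrow> real) \<Rightarrow> bool" where
  "martingale M F X \<longleftrightarrow>
     cadlag_adapted M F X \<and>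
     (\<forall>t\<ge>0. integrable M (X t)) \<and>
     (\<forall>s t. 0 \<le> s \<and> s \<le> t \<longrightarrow> (AE \<omega> in M. real_cond_exp M (F s) (X t) \<omega> = X s \<omega>))"

text \<open>The library's \<^const>\<open>stopping_time\<close> takes values in the index set of the filtration, which
  excludes the value \<open>\<infty>\<close> here.\<close>

definition ext_stopping_time :: "(real \<Rightarrow> 'a measure) \<Rightarrow> ('a \<Rightarrow> ennreal) \<Rightarrow> bool" where
  "ext_stopping_time F T \<longleftrightarrow> (\<forall>t\<ge>0. Measurable.pred (F t) (\<lambda>\<omega>. T \<omega> \<le> ennreal t))"

definition min_time :: "real \<Rightarrow> ennreal \<Rightarrow> real" where
  "min_time t u = enn2real (min (ennreal t) u)"

definition stopped :: "(real \<Rightarrow> 'a \<Rightarrow> real) \<Rightarrow> ('a \<Rightarrow> ennreal) \<Rightarrow> real \<Rightarrow> 'a \<Rightarrow> real" where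
  "stopped X T t \<omega> = X (min_time t (T \<omega>)) \<omega>"

text \<open>The factor \<open>1\<^bsub>{T\<^sub>n > 0}\<^esub>\<close> spares an integrability condition on the initial value.\<close>

definition local_martingale :: "'a measure \<Rightarrow> (real \<Rightarrow> 'a measure) \<Rightarrow> (real \<Rightarrow> 'a \<Rightarrow> real) \<Rightarrow> bool" where
  "local_martingale M F X \<longleftrightarrow>
     cadlag_adapted M F X \<and>
     (\<exists>T :: nat \<Rightarrow> 'a \<Rightarrow> ennreal.
        (\<forall>n. ext_stopping_time F (T n)) \<and>
        (AE \<omega> in M. incseq (\<lambda>n. T n \<omega>) \<and> (\<lambda>n. T n \<omega>) \<longlonglongrightarrow> \<infinity>) \<and>
        (\<forall>n. martingale M F (\<lambda>t \<omega>. if T n \<omega> > 0 then stopped X (T n) t \<omega> else 0)))"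


section \<open>Optional and predictable processes, dual optional projection, bracket\<close>

definition optional_sigma :: "'a measure \<Rightarrow> (real \<Rightarrow> 'a measure) \<Rightarrow> (real \<times> 'a) measure" where
  "optional_sigma M F = sigma ({0..} \<times> space M)
     {{(t, \<omega>) \<in> {0..} \<times> space M. X t \<omega> \<in> B} | X B.
        adapted F X \<and> (\<forall>\<omega>\<in>space M. cadlag_path (\<lambda>t. X t \<omega>)) \<and> B \<in> sets (borel :: real measure)}"

definition predictable_sigma :: "'a measure \<Rightarrow> (real \<Rightarrow> 'a measure) \<Rightarrow> (real \<times> 'a) measure" where
  "predictable_sigma M F = sigma ({0..} \<times> space M)
     ({{0} \<times> A | A. A \<in> sets (F 0)} \<union>
      {{s<..t} \<times> A | s t A. 0 \<le> s \<and> s \<le> t \<and> A \<in> sets (F s)})"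

definition optional :: "'a measure \<Rightarrow> (real \<Rightarrow> 'a measure) \<Rightarrow>
    (real \<Rightarrow> 'a \<Rightarrow> 'b::topological_space) \<Rightarrow> bool" where
  "optional M F X \<longleftrightarrow> (\<lambda>(t, \<omega>). X t \<omega>) \<in> borel_measurable (optional_sigma M F)"

definition predictable :: "'a measure \<Rightarrow> (real \<Rightarrow> 'a measure) \<Rightarrow> (real \<Rightarrow> 'a \<Rightarrow> real) \<Rightarrow> bool" where
  "predictable M F X \<longleftrightarrow> (\<lambda>(t, \<omega>). X t \<omega>) \<in> borel_measurable (predictable_sigma M F)"

text \<open>Stieltjes measure \<open>dx\<close> of an increasing path, with the convention \<open>x\<^bsub>0-\<^esub> = 0\<close>: it has mass
  \<open>x\<^sub>0\<close> at time \<open>0\<close>.\<close>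

definition path_measure :: "(real \<Rightarrow> real) \<Rightarrow> real measure" where
  "path_measure x = interval_measure (\<lambda>t. if t < 0 then 0 else x t)"

text \<open>\<open>Ao\<close> is the dual optional projection of the (not necessarily adapted) increasing process \<open>A\<close>.\<close>

definition dual_optional_projection ::
    "'a measure \<Rightarrow> (real \<Rightarrow> 'a measure) \<Rightarrow> (real \<Rightarrow> 'a \<Rightarrow> real) \<Rightarrow> (real \<Rightarrow> 'a \<Rightarrow> real) \<Rightarrow> bool" where
  "dual_optional_projection M F A Ao \<longleftrightarrow>
     optional M F Ao \<and>
     (AE \<omega> in M. increasing_path (\<lambda>t. Ao t \<omega>)) \<and>
     (\<integral>\<^sup>+\<omega>. emeasure (path_measure (\<lambda>t. Ao t \<omega>)) {0..} \<partial>M) < \<infinity> \<and>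
     (\<forall>U :: real \<Rightarrow> 'a \<Rightarrow> ennreal. optional M F U \<longrightarrow>
        (\<integral>\<^sup>+\<omega>. (\<integral>\<^sup>+s\<in>{0..}. U s \<omega> \<partial>path_measure (\<lambda>t. A t \<omega>)) \<partial>M) =
        (\<integral>\<^sup>+\<omega>. (\<integral>\<^sup>+s\<in>{0..}. U s \<omega> \<partial>path_measure (\<lambda>t. Ao t \<omega>)) \<partial>M))"

text \<open>\<open>V\<close> is the angle bracket \<open>\<langle>X,X\<rangle>\<^sup>F\<close> of \<open>X\<close>.\<close>

definition predictable_bracket ::
    "'a measure \<Rightarrow> (real \<Rightarrow> 'a measure) \<Rightarrow> (real \<Rightarrow> 'a \<Rightarrow> real) \<Rightarrow> (real \<Rightarrow> 'a \<Rightarrow> real) \<Rightarrow> bool" where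
  "predictable_bracket M F X V \<longleftrightarrow>
     predictable M F V \<and>
     (AE \<omega> in M. V 0 \<omega> = 0 \<and> increasing_path (\<lambda>t. V t \<omega>)) \<and>
     local_martingale M F (\<lambda>t \<omega>. (X t \<omega>)\<^sup>2 - V t \<omega>)"


section \<open>Stochastic integral with respect to a semimartingale\<close>

text \<open>
  \<open>elementary_integral M F X H Y\<close>: \<open>H\<close> is a bounded elementary predictable process and
  \<open>Y\<^sub>t = \<integral>\<^bsub>(0,t]\<^esub> H dX\<close>.
\<close>

inductive elementary_integral :: "'a measure \<Rightarrow> (real \<Rightarrow> 'a measure) \<Rightarrow> (real \<Rightarrow> 'a \<Rightarrow> real) \<Rightarrow>
    (real \<Rightarrow> 'a \<Rightarrow> real) \<Rightarrow> (real \<Rightarrow> 'a \<Rightarrow> real) \<Rightarrow> bool"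
  for M F X where
  at_zero:
    "k \<in> borel_measurable (F 0) \<Longrightarrow> \<forall>\<omega>\<in>space M. \<bar>k \<omega>\<bar> \<le> c \<Longrightarrow>
     elementary_integral M F X (\<lambda>t \<omega>. if t = 0 then k \<omega> else 0) (\<lambda>t \<omega>. 0)"
| on_interval:
    "0 \<le> a \<Longrightarrow> a \<le> b \<Longrightarrow> k \<in> borel_measurable (F a) \<Longrightarrow> \<forall>\<omega>\<in>space M. \<bar>k \<omega>\<bar> \<le> c \<Longrightarrow>
     elementary_integral M F X
       (\<lambda>t \<omega>. if a < t \<and> t \<le> b then k \<omega> else 0)
       (\<lambda>t \<omega>. k \<omega> * (X (min t b) \<omega> - X (min t a) \<omega>))"
| add:
    "elementary_integral M F X H Y \<Longrightarrow> elementary_integral M F X H' Y' \<Longrightarrow>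
     elementary_integral M F X (\<lambda>t \<omega>. H t \<omega> + H' t \<omega>) (\<lambda>t \<omega>. Y t \<omega> + Y' t \<omega>)"

text \<open>Uniform convergence on compact time intervals in probability. Under the usual hypotheses the
  events below are measurable if the processes are adapted with almost surely cadlag paths.\<close>

definition ucp_tendsto :: "'a measure \<Rightarrow> (nat \<Rightarrow> real \<Rightarrow> 'a \<Rightarrow> real) \<Rightarrow> (real \<Rightarrow> 'a \<Rightarrow> real) \<Rightarrow> bool" where
  "ucp_tendsto M Yn Y \<longleftrightarrow>
     (\<forall>t\<ge>0. \<forall>\<epsilon>>0.
        (\<lambda>n. measure M {\<omega> \<in> space M. \<exists>s\<in>{0..t}. \<bar>Yn n s \<omega> - Y s \<omega>\<bar> > \<epsilon>}) \<longlonglongrightarrow> 0)"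

text \<open>
  \<open>bounded_integral M F X H Y\<close>: \<open>H\<close> is bounded and predictable and \<open>Y\<close> is (a version of) \<open>H \<bullet> X\<close>.
  For a semimartingale \<open>X\<close> the integral of bounded predictable processes is the unique extension
  of the elementary integral obeying the dominated convergence theorem: if \<open>H\<^sub>n \<rightarrow> H\<close> pointwise and
  boundedly, then \<open>H\<^sub>n \<bullet> X \<rightarrow> H \<bullet> X\<close> ucp. The bounded predictable processes form the closure of the
  elementary ones under bounded pointwise sequential limits, so that the graph of the integral is the
  closure of the elementary integral under these limits.
\<close>

inductive bounded_integral :: "'a measure \<Rightarrow> (real \<Rightarrow> 'a measure) \<Rightarrow> (real \<Rightarrow> 'a \<Rightarrow> real) \<Rightarrow>
    (real \<Rightarrow> 'a \<Rightarrow> real) \<Rightarrow> (real \<Rightarrow> 'a \<Rightarrow> real) \<Rightarrow> bool"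
  for M F X where
  elementary:
    "elementary_integral M F X H Y \<Longrightarrow> bounded_integral M F X H Y"
| bounded_limit:
    "(\<And>n :: nat. bounded_integral M F X (Hn n) (Yn n)) \<Longrightarrow>
     \<forall>n. \<forall>t\<ge>0. \<forall>\<omega>\<in>space M. \<bar>Hn n t \<omega>\<bar> \<le> c \<Longrightarrow>
     \<forall>t\<ge>0. \<forall>\<omega>\<in>space M. (\<lambda>n. Hn n t \<omega>) \<longlonglongrightarrow> H t \<omega> \<Longrightarrow>
     cadlag_adapted M F Y \<Longrightarrow> ucp_tendsto M Yn Y \<Longrightarrow>
     bounded_integral M F X H Y"

text \<open>
  Convergence in the Emery (semimartingale) topology of processes vanishing at time \<open>0\<close>: the elementary
  integrals \<open>K \<bullet> (Y\<^sub>n - Y)\<close> tend to \<open>0\<close> ucp, uniformly in the elementary predictable \<open>K\<close> with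
  \<open>\<bar>K\<bar> \<le> 1\<close>.
\<close>

definition emery_tendsto :: "'a measure \<Rightarrow> (real \<Rightarrow> 'a measure) \<Rightarrow>
    (nat \<Rightarrow> real \<Rightarrow> 'a \<Rightarrow> real) \<Rightarrow> (real \<Rightarrow> 'a \<Rightarrow> real) \<Rightarrow> bool" where
  "emery_tendsto M F Yn Y \<longleftrightarrow>
     (\<forall>t\<ge>0. \<forall>\<epsilon>>0. \<exists>N. \<forall>n\<ge>N. \<forall>K J.
        elementary_integral M F (\<lambda>s \<omega>. Yn n s \<omega> - Y s \<omega>) K J \<and>
        (\<forall>s\<ge>0. \<forall>\<omega>\<in>space M. \<bar>K s \<omega>\<bar> \<le> 1) \<longrightarrow>
        measure M {\<omega> \<in> space M. \<exists>s\<in>{0..t}. \<bar>J s \<omega>\<bar> > \<epsilon>} \<le> \<epsilon>)"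

text \<open>
  \<open>stochastic_integral M F X H Y\<close>: the predictable process \<open>H\<close> is \<open>X\<close>-integrable and
  \<open>Y\<^sub>t = \<integral>\<^bsub>(0,t]\<^esub> H dX\<close>. Integrability is in the general sense of semimartingale theory
  (Chou, Meyer and Stricker): the integrals of the truncations \<open>H 1\<^bsub>{\<bar>H\<bar> \<le> n}\<^esub>\<close> converge in the
  Emery topology.
\<close>

definition stochastic_integral :: "'a measure \<Rightarrow> (real \<Rightarrow> 'a measure) \<Rightarrow> (real \<Rightarrow> 'a \<Rightarrow> real) \<Rightarrow>
    (real \<Rightarrow> 'a \<Rightarrow> real) \<Rightarrow> (real \<Rightarrow> 'a \<Rightarrow> real) \<Rightarrow> bool" where
  "stochastic_integral M F X H Y \<longleftrightarrow>
     predictable M F H \<and> cadlag_adapted M F Y \<and> (AE \<omega> in M. Y 0 \<omega> = 0) \<and>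
     (\<exists>Yn. (\<forall>n :: nat. bounded_integral M F X
                (\<lambda>t \<omega>. if \<bar>H t \<omega>\<bar> \<le> real n then H t \<omega> else 0) (Yn n)) \<and>
           emery_tendsto M F Yn Y)"


section \<open>NUPBR and local martingale deflators\<close>

text \<open>\<open>\<theta>\<close> is \<open>x\<close>-admissible for \<open>X\<close>, with \<open>W\<^sub>t = \<integral>\<^bsub>(0,t]\<^esub> \<theta> dX\<close> and \<open>Winf\<close> its limit.\<close>

definition admissible :: "'a measure \<Rightarrow> (real \<Rightarrow> 'a measure) \<Rightarrow> (real \<Rightarrow> 'a \<Rightarrow> real) \<Rightarrow> real \<Rightarrow>
    (real \<Rightarrow> 'a \<Rightarrow> real) \<Rightarrow> (real \<Rightarrow> 'a \<Rightarrow> real) \<Rightarrow> ('a \<Rightarrow> real) \<Rightarrow> bool" where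
  "admissible M G X x \<theta> W Winf \<longleftrightarrow>
     stochastic_integral M G X \<theta> W \<and>
     (\<forall>t\<ge>0. AE \<omega> in M. W t \<omega> \<ge> - x) \<and>
     (AE \<omega> in M. ((\<lambda>t. W t \<omega>) \<longlongrightarrow> Winf \<omega>) at_top)"

definition NUPBR :: "'a measure \<Rightarrow> (real \<Rightarrow> 'a measure) \<Rightarrow> (real \<Rightarrow> 'a \<Rightarrow> real) \<Rightarrow> bool" where
  "NUPBR M G X \<longleftrightarrow>
     \<not> (\<exists>\<xi>. \<xi> \<in> borel_measurable (sigma_infinity M G) \<and>
            (\<forall>\<omega>\<in>space M. \<xi> \<omega> \<ge> 0) \<and>
            measure M {\<omega> \<in> space M. \<xi> \<omega> > 0} > 0 \<and>
            (\<forall>x>0. \<exists>\<theta> W Winf. admissible M G X x \<theta> W Winf \<and>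
                     (AE \<omega> in M. x + Winf \<omega> \<ge> \<xi> \<omega>)))"

definition local_martingale_deflator ::
    "'a measure \<Rightarrow> (real \<Rightarrow> 'a measure) \<Rightarrow> (real \<Rightarrow> 'a \<Rightarrow> real) \<Rightarrow> (real \<Rightarrow> 'a \<Rightarrow> real) \<Rightarrow> bool" where
  "local_martingale_deflator M G X L \<longleftrightarrow>
     local_martingale M G L \<and>
     (AE \<omega> in M. \<forall>t\<ge>0. L t \<omega> > 0) \<and>
     (AE \<omega> in M. L 0 \<omega> = 1) \<and>
     (AE \<omega> in M. \<exists>l>0. ((\<lambda>t. L t \<omega>) \<longlongrightarrow> l) at_top) \<and>
     local_martingale M G (\<lambda>t \<omega>. L t \<omega> * X t \<omega>)"


section \<open>Progressive enlargement with a random time\<close>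

definition progressive_enlargement ::
    "'a measure \<Rightarrow> (real \<Rightarrow> 'a measure) \<Rightarrow> ('a \<Rightarrow> ennreal) \<Rightarrow> real \<Rightarrow> 'a measure" where
  "progressive_enlargement M F \<tau> t = sigma (space M)
     (\<Inter>\<epsilon>\<in>{0<..}. sigma_sets (space M)
        (sets (F (t + \<epsilon>)) \<union>
         {(\<lambda>\<omega>. min (\<tau> \<omega>) (ennreal (t + \<epsilon>))) -` B \<inter> space M | B. B \<in> sets borel}))"

text \<open>The intersection is already a \<open>\<sigma>\<close>-algebra, so that nothing is added by generating one.\<close>

lemma sigma_algebra_INT:
  assumes "I \<noteq> {}" "\<And>i. i \<in> I \<Longrightarrow> sigma_algebra \<Omega> (A i)"
  shows "sigma_algebra \<Omega> (\<Inter>i\<in>I. A i)"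
proof -
  have "A i \<subseteq> Pow \<Omega> \<and> {} \<in> A i \<and> (\<forall>s\<in>A i. \<Omega> - s \<in> A i) \<and>
      (\<forall>f. range f \<subseteq> A i \<longrightarrow> (\<Union>j::nat. f j) \<in> A i)" if "i \<in> I" for i
    using assms(2)[OF that] unfolding sigma_algebra_iff2 .
  then show ?thesis
    unfolding sigma_algebra_iff2 using assms(1) by (auto simp: subset_iff)
qed

lemma sets_progressive_enlargement:
  assumes "filtered M F" "t \<ge> 0"
  shows "sets (progressive_enlargement M F \<tau> t) =
     (\<Inter>\<epsilon>\<in>{0<..}. sigma_sets (space M)
        (sets (F (t + \<epsilon>)) \<union>
         {(\<lambda>\<omega>. min (\<tau> \<omega>) (ennreal (t + \<epsilon>))) -` B \<inter> space M | B. B \<in> sets borel}))"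
    (is "_ = (\<Inter>\<epsilon>\<in>{0<..}. sigma_sets (space M) (?G \<epsilon>))")
proof -
  have "?G \<epsilon> \<subseteq> Pow (space M)" if "\<epsilon> > 0" for \<epsilon>
  proof -
    have "subalgebra M (F (t + \<epsilon>))"
      using assms that by (auto simp: filtered_def)
    then have "space (F (t + \<epsilon>)) = space M"
      by (simp add: subalgebra_def)
    then show ?thesis
      using sets.sets_into_space[of _ "F (t + \<epsilon>)"] by auto
  qed
  then have "sigma_algebra (space M) (sigma_sets (space M) (?G \<epsilon>))" if "\<epsilon> > 0" for \<epsilon>
    using that by (intro sigma_algebra_sigma_sets) auto
  then have "sigma_algebra (space M) (\<Inter>\<epsilon>\<in>{0<..}. sigma_sets (space M) (?G \<epsilon>))"
    by (intro sigma_algebra_INT) auto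
  then show ?thesis
    unfolding progressive_enlargement_def
    by (simp add: sigma_algebra.sets_measure_of_eq)
qed

text \<open>\<open>Z\<close> is the cadlag (optional) version of \<open>Z\<^sub>t = P(\<tau> > t | F\<^sub>t)\<close>.\<close>

definition azema_supermartingale ::
    "'a measure \<Rightarrow> (real \<Rightarrow> 'a measure) \<Rightarrow> ('a \<Rightarrow> ennreal) \<Rightarrow> (real \<Rightarrow> 'a \<Rightarrow> real) \<Rightarrow> bool" where
  "azema_supermartingale M F \<tau> Z \<longleftrightarrow>
     optional M F Z \<and> (AE \<omega> in M. cadlag_path (\<lambda>t. Z t \<omega>)) \<and>
     (\<forall>t\<ge>0. AE \<omega> in M.
        Z t \<omega> = real_cond_exp M (F t) (indicator {\<omega> \<in> space M. \<tau> \<omega> > ennreal t}) \<omega>)"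

text \<open>\<open>m\<^bsub>t\<and>\<tau>\<^esub> - \<integral>\<^bsub>(0,t\<and>\<tau>]\<^esub> dV\<^sub>s / Z\<^sub>s\<close>, to be used with \<open>V = \<langle>m,m\<rangle>\<^sup>F\<close>.\<close>

definition hat_process :: "('a \<Rightarrow> ennreal) \<Rightarrow> (real \<Rightarrow> 'a \<Rightarrow> real) \<Rightarrow> (real \<Rightarrow> 'a \<Rightarrow> real) \<Rightarrow>
    (real \<Rightarrow> 'a \<Rightarrow> real) \<Rightarrow> real \<Rightarrow> 'a \<Rightarrow> real" where
  "hat_process \<tau> Z m V t \<omega> =
     stopped m \<tau> t \<omega> -
     (LINT s:{0<..min_time t (\<tau> \<omega>)}|path_measure (\<lambda>u. V u \<omega>). 1 / Z s \<omega>)"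

end

theory Submission
  imports Defs
begin

text \<open>The reason for the theorem is a multiplicative decomposition of Azema's supermartingale \<open>Z = m - A\<^sup>o\<close>. Let E be the
 Stieltjes exponential with \<open>dE = E\<^sub>- dA\<^sup>o / Z\<close>. Then N = Z E satisfies \<open>dN = E\<^sub>- dm\<close>, so it is a strictly positive
 continuous local martingale of F, and 1/E = Z/N decreases with \<open>d(1/E) = - dA\<^sup>o / N\<close>. The deflator is
 \<open>L = N\<^sub>0 / N\<^sup>\<tau>\<close>.

 A continuous F-adapted process Y becomes, when stopped at \<tau>, a local martingale of the enlarged filtration G
 as soon as \<open>Y Z + \<integral> Y dA\<^sup>o\<close> is one of F (\<open>Lam_imp_clm\<close>). Indeed the dual optional projection turns the value of Y
 at \<tau> into the integral (\<open>dual_projection\<close>), and before \<tau> the events of G are traces of events of F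
 (\<open>presets_trace\<close>). For Y = X / N with a local martingale X of F the condition reads that X (1/E) - \<integral> X d(1/E)
 is a local martingale, which is integration by parts. With X = 1 and X = S this makes L and \<open>L S\<^sup>\<tau>\<close> local
 martingales of G. It also yields the Jeulin-Yor formula, by which U = m - \<integral> d\<langle>m,m\<rangle> / Z, stopped at \<tau>, is the
 process mhat.

 That L solves \<open>dL = - (L/Z) dU\<^sup>\<tau>\<close> is read off from brackets, which Ito's formula in F and the same transfer to G
 provide: a continuous local martingale with the brackets of \<integral> H dX is this integral
 (\<open>stochastic_integral_of_brackets\<close>). The integrand is predictable, because in a filtration with continuous
 martingales every stopping time, hence every increasing adapted process, is predictable (\<open>increasing_predictable\<close>).
 The difference D of two solutions has the bracket \<open>\<integral> (D/Z)\<^sup>2 d\<langle>m,m\<rangle>\<close> up to \<tau> and vanishes by Gronwall's lemma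
 (\<open>clm_gronwall\<close>), so that every solution is this deflator. Finally, L times the value of an admissible portfolio
 is a nonnegative local martingale, and L has a positive limit, so that a claim with arbitrarily small price vanishes (\<open>NUPBR_before\<close>).

 Throughout, continuous local martingales are limits, uniform on compacts in probability, of bounded continuous
 martingales, and the bracket of X and W is expressed by the statement that X W - \<integral> h dV is a local martingale.
 That martingales of F belong to this class (\<open>martingale_clm\<close>) requires continuous versions of conditional
 expectations, which are constructed by counting oscillations.\<close>

section \<open>Filtered probability spaces under the usual hypotheses\<close>

notation (input) tendsto (infixr "--->" 55)

abbreviation (input) seq_limit :: "(nat => 'a::topological_space) => 'a => bool" (infixr "---->" 60) where
 "X ----> l == X \<longlonglongrightarrow> l"

abbreviation (input) iff :: "bool => bool => bool" (infixr "<->" 25) where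
 "A <-> B == A = B"

abbreviation (input) meas :: "'a measure => ('a => 'b::topological_space) set" where
 "meas == borel_measurable"

lemma continuous_on_halfline:
 fixes f :: "real => real"
 assumes "!!T. T >= 0 ==> continuous_on {0..T} f"
 shows "continuous_on {0..} f"
 unfolding continuous_on_eq_continuous_within
proof
 fix x :: real assume x: "x : {0..}"
 have "continuous (at x within {0..x+1}) f"
  using assms[of "x+1"] x by (simp add: continuous_on_eq_continuous_within)
 moreover have "at x within {0..} = at x within {0..x+1}"
  using x by (intro at_within_nhd[where S="{..<x+1}"]) auto
 ultimately show "continuous (at x within {0..}) f"
  by simp
qed

lemma cont_right_limit:
 fixes f :: "real => real"
 assumes "continuous_on {0..} f" "s >= 0"
 shows "(f ---> f s) (at_right s)"
proof -
 have "(f ---> f s) (at s within {0..})"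
  using assms by (auto simp: continuous_on_def)
 moreover have "at_right s <= at s within {0..}"
  using assms by (intro at_le) auto
 ultimately show ?thesis
  by (rule tendsto_mono[rotated])
qed

lemma cont_left_limit:
 fixes f :: "real => real"
 assumes "continuous_on {0..} f" "s > 0"
 shows "(f ---> f s) (at_left s)"
proof -
 have "(f ---> f s) (at s within {0..})"
  using assms by (auto simp: continuous_on_def)
 moreover have "at s within {0..} = at s"
  using assms by (intro at_within_interior) (auto simp: interior_real_atLeast)
 moreover have "at_left s <= at s"
  by (intro at_le) auto
 ultimately show ?thesis
  using tendsto_mono by metis
qed

lemma continuous_on_imp_cadlag_path: "continuous_on {0..} f ==> cadlag_path f"
 unfolding cadlag_path_def
 using cont_right_limit cont_left_limit by blast

abbreviation (input) traj :: "('b => 'a => 'c) => 'a => 'b => 'c" where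
 "traj X w == %t. X t w"

abbreviation (input) loc_uniform :: "(nat => real => real) => (real => real) => bool" where
 "loc_uniform f g == ALL T>=0. uniform_limit {0..T} f g sequentially"

abbreviation (input) ulim :: "real => (nat => real => real) => (real => real) => bool" where
 "ulim T f g == uniform_limit {0..T} f g sequentially"

locale usual_filtration = prob_space M for M :: "'a measure" +
 fixes F :: "real => 'a measure"
 assumes usual: "usual_hypotheses M F"
begin

abbreviation (input) exceeds :: "(real => 'a => real) => real => real => 'a set" where
 "exceeds X t c == {w:space M. EX s:{0..t}. abs (X s w) > c}"

abbreviation (input) expect_on :: "'a set => ('a => real) => real" where
 "expect_on A f == \<integral>w. indicator A w * f w \<partial>M"

lemma filtered: "filtered M F"
 using usual by (simp add: usual_hypotheses_def)

lemma sub_F: "t >= 0 ==> subalgebra M (F t)"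
 using filtered by (simp add: filtered_def)

lemma space_F: "t >= 0 ==> space (F t) = space M"
 using sub_F by (simp add: subalgebra_def)

lemma sets_F: "t >= 0 ==> A : sets (F t) ==> A : sets M"
 using sub_F by (auto simp: subalgebra_def)

lemma sets_F_mono: "0 <= s ==> s <= t ==> A : sets (F s) ==> A : sets (F t)"
 using filtered unfolding filtered_def subalgebra_def by blast

lemma sub_F_F: "0 <= s ==> s <= t ==> subalgebra (F t) (F s)"
 using filtered by (simp add: filtered_def)

lemma meas_F_mono: "0 <= s ==> s <= t ==> f : meas (F s) ==> f : meas (F t)"
 using measurable_from_subalg[OF sub_F_F] .

lemma meas_F_M: "t >= 0 ==> f : meas (F t) ==> f : meas M"
 using measurable_from_subalg[OF sub_F] .

lemma null_F:
 assumes "N : null_sets M" "A <= N" "t >= 0"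
 shows "A : sets (F t)"
proof -
 have "A : sets (F 0)"
  using usual assms unfolding usual_hypotheses_def by blast
 thus ?thesis
  using sets_F_mono[of 0 t] assms by simp
qed

lemma AE_set_F:
 assumes "AE w in M. P w" "t >= 0"
 shows "{w:space M. P w} : sets (F t)"
proof -
 obtain N where N: "{w:space M. ~ P w} <= N" "N : null_sets M"
  using assms(1) by (auto simp: eventually_ae_filter)
 have "{w:space M. ~ P w} : sets (F t)"
  using null_F[OF N(2,1) assms(2)] .
 hence "space (F t) - {w:space M. ~ P w} : sets (F t)"
  by blast
 moreover have "space (F t) - {w:space M. ~ P w} = {w:space M. P w}"
  using space_F[OF assms(2)] by auto
 ultimately show ?thesis by simp
qed

lemma AE_eq_set_F:
 assumes "A : sets (F t)" "B <= space M" "AE w in M. w : A <-> w : B" "t >= 0"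
 shows "B : sets (F t)"
proof -
 obtain N where N: "{w:space M. ~ (w : A <-> w : B)} <= N" "N : null_sets M"
  using assms(3) by (auto simp: eventually_ae_filter)
 have A: "A <= space M"
  using sets.sets_into_space[OF assms(1)] space_F[OF assms(4)] by simp
 have "B - A : sets (F t)"
  by (rule null_F[OF N(2)]) (use N(1) assms in auto)
 moreover have "A - B : sets (F t)"
  by (rule null_F[OF N(2)]) (use N(1) assms A in auto)
 ultimately have "(A - (A - B)) Un (B - A) : sets (F t)"
  using assms(1) by blast
 moreover have "(A - (A - B)) Un (B - A) = B" by auto
 ultimately show ?thesis by simp
qed

lemma AE_eq_meas_F:
 fixes f g :: "'a => 'b::topological_space"
 assumes "f : meas (F t)" "AE w in M. f w = g w" "t >= 0"
 shows "g : meas (F t)"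
proof (rule measurableI)
 fix A :: "'b set" assume A: "A : sets borel"
 show "g -` A Int space (F t) : sets (F t)"
 proof (rule AE_eq_set_F[OF _ _ _ assms(3)])
  show "f -` A Int space (F t) : sets (F t)"
   using assms(1) A by (rule measurable_sets)
  show "g -` A Int space (F t) <= space M"
   using space_F[OF assms(3)] by auto
  show "AE w in M. (w : f -` A Int space (F t)) = (w : g -` A Int space (F t))"
   using assms(2) by eventually_elim auto
 qed
qed auto

lemma AE_lim_meas_F:
 fixes f :: "nat => 'a => real"
 assumes "!!n. f n : meas (F t)" "AE w in M. traj f w ----> g w" "t >= 0"
 shows "g : meas (F t)"
proof (rule AE_eq_meas_F[OF _ _ assms(3)])
 show "(%w. lim (traj f w)) : meas (F t)"
  using assms(1) by (rule borel_measurable_lim_metric)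
 show "AE w in M. lim (traj f w) = g w"
  using assms(2) by eventually_elim (rule limI)
qed

lemma AE_eq_meas_M:
 fixes f g :: "'a => real"
 assumes "f : meas M" "AE w in M. f w = g w"
 shows "g : meas M"
proof -
 have "(%w. g w - f w) : meas (F 0)"
  by (rule AE_eq_meas_F[where f="%_. 0"]) (use assms(2) in auto)
 hence "(%w. (g w - f w) + f w) : meas M"
  using meas_F_M[of 0] assms(1) by (intro borel_measurable_add) blast+
 thus ?thesis by simp
qed

lemma right_meas_F:
 fixes g :: "'a => real"
 assumes "!!s. s > t ==> g : meas (F s)" "t >= 0"
 shows "g : meas (F t)"
proof (rule measurableI)
 fix A :: "real set" assume A: "A : sets borel"
 have "g -` A Int space (F s) : sets (F s)" if "s > t" for s
  using assms(1)[OF that] A by (rule measurable_sets)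
 moreover have "space (F s) = space (F t)" if "s > t" for s
  using space_F assms(2) that by auto
 ultimately have "ALL s:{t<..}. g -` A Int space (F t) : sets (F s)"
  by auto
 thus "g -` A Int space (F t) : sets (F t)"
  using usual assms(2) unfolding usual_hypotheses_def by blast
qed auto

lemma prob_tendsto_0:
 assumes "!!n. B n : sets M" "AE w in M. eventually (%n. w ~: B n) sequentially"
 shows "(%n. prob (B n)) ----> 0"
proof -
 have "(%n. \<integral>w. indicator (B n) w \<partial>M) ----> (LINT w|M. (0::real))"
 proof (rule integral_dominated_convergence[where w="%_. 1"])
  show "AE w in M. (%n. indicator (B n) w :: real) ----> 0"
   using assms(2)
  proof eventually_elim
   case (elim w)
   thus ?case
    by (intro tendsto_eventually) (auto elim: eventually_mono)
  qed
 qed (use assms(1) in "auto simp: indicator_def")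
 thus ?thesis
  using assms(1) by (simp add: sets.Int_space_eq2)
qed

subsection \<open>Continuous adapted processes and closeness in probability\<close>

definition right_cont :: "(real => 'a => real) => bool" where
 "right_cont X <-> adapted F X & (AE w in M. ALL s>=0. (traj X w ---> X s w) (at_right s))"

definition cont_adapted :: "(real => 'a => real) => bool" where
 "cont_adapted X <-> adapted F X & (AE w in M. continuous_on {0..} (traj X w))"

lemma adaptedD: "adapted F X ==> t >= 0 ==> X t : meas (F t)"
 by (simp add: adapted_def)

lemma adapted_M: "adapted F X ==> t >= 0 ==> X t : meas M"
 using meas_F_M adaptedD by blast

lemma cont_adaptedD: "cont_adapted X ==> t >= 0 ==> X t : meas (F t)"
 by (simp add: cont_adapted_def adaptedD)

lemma cont_adapted_M: "cont_adapted X ==> t >= 0 ==> X t : meas M"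
 using meas_F_M cont_adaptedD by blast

lemma cont_right_cont: "cont_adapted X ==> right_cont X"
 unfolding cont_adapted_def right_cont_def
 by (auto elim!: eventually_mono intro: cont_right_limit)

lemma cadlag_right_cont: "cadlag_adapted M F X ==> right_cont X"
 unfolding cadlag_adapted_def right_cont_def cadlag_path_def by auto

lemma right_cont_diff: "right_cont X ==> right_cont Y ==> right_cont (%t w. X t w - Y t w)"
 unfolding right_cont_def adapted_def by (auto intro!: borel_measurable_diff tendsto_diff)

lemma cont_adapted_diff: "cont_adapted X ==> cont_adapted Y ==> cont_adapted (%t w. X t w - Y t w)"
 unfolding cont_adapted_def adapted_def by (auto intro!: borel_measurable_diff continuous_intros)

lemma cont_adapted_add: "cont_adapted X ==> cont_adapted Y ==> cont_adapted (%t w. X t w + Y t w)"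
 unfolding cont_adapted_def adapted_def by (auto intro!: borel_measurable_add continuous_intros)

lemma cont_adapted_mult: "cont_adapted X ==> cont_adapted Y ==> cont_adapted (%t w. X t w * Y t w)"
 unfolding cont_adapted_def adapted_def by (auto intro!: borel_measurable_times continuous_intros)

lemma cont_adapted_const: "k : meas (F 0) ==> cont_adapted (%t. k)"
 unfolding cont_adapted_def adapted_def using meas_F_mono[of 0] by auto

lemma cont_adapted_stop_const:
 assumes "cont_adapted X" "a >= 0"
 shows "cont_adapted (%t. X (min t a))"
proof -
 have "AE w in M. continuous_on {0..} (%t. X (min t a) w)"
  using assms unfolding cont_adapted_def
 proof (elim conjE eventually_mono)
  fix w assume "continuous_on {0..} (traj X w)"
  thus "continuous_on {0..} (%t. X (min t a) w)"
   by (rule continuous_on_compose2) (use assms in "auto intro!: continuous_intros")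
 qed
 moreover have "X (min t a) : meas (F t)" if "t >= 0" for t
  using cont_adaptedD[OF assms(1), of "min t a"] meas_F_mono[of "min t a" t] assms that by auto
 ultimately show ?thesis
  by (auto simp: cont_adapted_def adapted_def)
qed

lemma cont_adapted_tail:
 assumes "cont_adapted X" "a >= 0" "k : meas (F a)"
 shows "cont_adapted (%t w. k w * (X t w - X (min t a) w))"
proof -
 have *: "cont_adapted (%t w. X t w - X (min t a) w)"
  by (intro cont_adapted_diff cont_adapted_stop_const assms)
 have "(%w. k w * (X t w - X (min t a) w)) : meas (F t)" if "t >= 0" for t
 proof (cases "t <= a")
  case True
  thus ?thesis by simp
 next
  case False
  hence "k : meas (F t)"
   using meas_F_mono[of a t k] assms by auto
  thus ?thesis
   using cont_adaptedD[OF * that] by simp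
 qed
 moreover have "AE w in M. continuous_on {0..} (%t. k w * (X t w - X (min t a) w))"
  using * unfolding cont_adapted_def by (auto intro!: continuous_intros elim!: eventually_mono)
 ultimately show ?thesis
  by (auto simp: cont_adapted_def adapted_def)
qed

text \<open>Right-continuity reduces suprema over an interval to its rational points, and completeness
 absorbs the exceptional paths.\<close>

lemma ex_event_F:
 assumes "right_cont X" "open U" "t >= 0"
 shows "{w:space M. EX s:{0..t}. X s w : U} : sets (F t)"
proof (rule AE_eq_set_F[OF _ _ _ assms(3)])
 let ?D = "insert t (\<rat> Int {0..t})"
 have meas: "{w:space M. X q w : U} : sets (F t)" if "q : ?D" for q
 proof -
  have q: "0 <= q" "q <= t" using that assms(3) by auto
  hence "X q : meas (F t)"
   using assms(1) meas_F_mono[of q t] by (auto simp: right_cont_def adapted_def)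
  from measurable_sets[OF this, of U] assms(2) show ?thesis
   using space_F[OF assms(3)] by (simp add: vimage_def Int_def conj_commute)
 qed
 have "countable ?D"
  by (simp add: countable_rat)
 thus "(UN q:?D. {w:space M. X q w : U}) : sets (F t)"
  using meas by (intro sets.countable_UN') auto
 show "AE w in M. (w : (UN q:?D. {w:space M. X q w : U})) = (w : {w:space M. EX s:{0..t}. X s w : U})"
  using assms(1) unfolding right_cont_def
 proof (elim conjE eventually_mono)
  fix w assume rc: "ALL s>=0. (traj X w ---> X s w) (at_right s)"
  have "EX q:?D. X q w : U" if s: "s : {0..t}" "X s w : U" for s
  proof (cases "s = t")
   case False
   hence st: "s < t" using s by auto
   have "eventually (%u. X u w : U) (at_right s)"
    using rc s assms(2) by (auto intro: topological_tendstoD)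
   then obtain b where b: "b > s" "!!u. s < u ==> u < b ==> X u w : U"
    unfolding eventually_at_right_field by blast
   obtain q where q: "q : \<rat>" "s < q" "q < min b t"
    using Rats_dense_in_real[of s "min b t"] b st by auto
   hence "q : ?D" "X q w : U"
    using b s by auto
   thus ?thesis by blast
  qed (use s in auto)
  thus "(w : (UN q:?D. {w:space M. X q w : U})) = (w : {w:space M. EX s:{0..t}. X s w : U})"
   using assms(3) by auto
 qed
qed auto

text \<open>Closeness in probability, uniformly on a compact time interval. The exceptional event only has
 to be covered, so that no measurability is presupposed.\<close>

definition near :: "real => real => (real => 'a => real) => (real => 'a => real) => bool" where
 "near t e X Y <->
  (EX B:sets M. prob B <= e & (AE w in M. w ~: B --> (ALL s:{0..t}. abs (X s w - Y s w) <= e)))"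

lemma near_add:
 assumes "near t e X X'" "near t d Y Y'"
 shows "near t (e + d) (%s w. X s w + Y s w) (%s w. X' s w + Y' s w)"
proof -
 obtain B where B: "B : sets M" "prob B <= e" "AE w in M. w ~: B --> (ALL s:{0..t}. abs (X s w - X' s w) <= e)"
  using assms(1) by (auto simp: near_def)
 obtain C where C: "C : sets M" "prob C <= d" "AE w in M. w ~: C --> (ALL s:{0..t}. abs (Y s w - Y' s w) <= d)"
  using assms(2) by (auto simp: near_def)
 have "prob (B Un C) <= e + d"
  using B C measure_Un_le[of B M C] by simp
 moreover have "AE w in M. w ~: B Un C -->
   (ALL s:{0..t}. abs ((X s w + Y s w) - (X' s w + Y' s w)) <= e + d)"
  using B(3) C(3) by eventually_elim (smt (verit) UnCI)
 ultimately show ?thesis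
  unfolding near_def using B C by (intro bexI[of _ "B Un C"]) auto
qed

lemma near_trans:
 assumes "near t e X Y" "near t d Y Z"
 shows "near t (e + d) X Z"
 using near_add[OF assms] by (simp add: near_def algebra_simps)

lemma near_AE_eq:
 assumes "AE w in M. ALL s>=0. X s w = Y s w" "e >= 0"
 shows "near t e X Y"
 unfolding near_def
 by (rule bexI[of _ "{}"]) (use assms in "auto elim!: eventually_mono")

lemma near_of_tendsto:
 assumes "!!n. right_cont (Xn n)" "right_cont X" "t >= 0" "e > 0"
  and "AE w in M. ulim t (%n s. Xn n s w) (traj X w)"
 shows "eventually (%n. near t e (Xn n) X) sequentially"
proof -
 define B where "B n = {w:space M. EX s:{0..t}. Xn n s w - X s w : {x. abs x > e}}" for n
 have "open {x::real. abs x > e}"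
  by (intro open_Collect_less continuous_intros)
 hence B: "B n : sets M" for n
  unfolding B_def using ex_event_F[OF right_cont_diff[OF assms(1,2)]] sets_F assms(3) by blast
 have "AE w in M. eventually (%n. w ~: B n) sequentially"
  using assms(5)
 proof eventually_elim
  case (elim w)
  from uniform_limitD[OF elim assms(4)] show ?case
   by eventually_elim (force simp: B_def dist_real_def)
 qed
 from order_tendstoD(2)[OF prob_tendsto_0[OF B this] assms(4)] show ?thesis
 proof eventually_elim
  case (elim n)
  thus ?case
   unfolding near_def using B by (intro bexI[of _ "B n"]) (auto simp: B_def not_less)
 qed
qed

subsection \<open>Bounded continuous martingales\<close>

text \<open>Bounded continuous martingales, in integrated form: X t - X s has mean 0 on every event of F s.\<close>

definition bm :: "(real => 'a => real) => bool" where
 "bm X <-> cont_adapted X & (EX c. AE w in M. ALL t>=0. abs (X t w) <= c) &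
  (ALL s t A. 0 <= s & s <= t & A : sets (F s) -->
    expect_on A (X t) = expect_on A (X s))"

lemma sigma_finite_F: "t >= 0 ==> sigma_finite_subalgebra M (F t)"
 using sub_F finite_measure_axioms finite_measure_subalgebra_is_sigma_finite
 unfolding finite_measure_subalgebra_def finite_measure_subalgebra_axioms_def by blast

lemma cond_exp_of_tests:
 assumes "s >= 0" "integrable M x" "integrable M y" "y : meas (F s)"
  and "!!A. A : sets (F s) ==> (LINT w|M. indicator A w * x w) = (LINT w|M. indicator A w * y w)"
 shows "AE w in M. real_cond_exp M (F s) x w = y w"
proof -
 interpret sigma_finite_subalgebra M "F s" by (rule sigma_finite_F[OF assms(1)])
 show ?thesis
  using assms by (intro real_cond_exp_charact) (auto simp: set_lebesgue_integral_def)
qed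

lemma test_of_cond_exp:
 fixes k :: "'a => real"
 assumes "s >= 0" "integrable M x" "k : meas (F s)" "AE w in M. abs (k w) <= c"
  and "AE w in M. real_cond_exp M (F s) x w = y w" "y : meas M"
 shows "(LINT w|M. k w * x w) = (LINT w|M. k w * y w)"
proof -
 interpret sigma_finite_subalgebra M "F s" by (rule sigma_finite_F[OF assms(1)])
 have k: "k : meas M"
  using meas_F_M[OF assms(1,3)] .
 have "integrable M (%w. k w * x w)"
 proof (rule Bochner_Integration.integrable_bound)
  show "integrable M (%w. c * x w)" using assms(2) by simp
  show "AE w in M. norm (k w * x w) <= norm (c * x w)"
   using assms(4) by eventually_elim (auto simp: abs_mult intro!: mult_right_mono)
 qed (use k assms(2) in auto)
 hence "(LINT w|M. k w * x w) = (LINT w|M. k w * real_cond_exp M (F s) x w)"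
  using assms by (intro real_cond_exp_intg(2)[symmetric]) auto
 also have "... = (LINT w|M. k w * y w)"
  using assms(5,6) k by (intro integral_cong_AE) (auto elim: eventually_mono)
 finally show ?thesis .
qed

lemma bmE:
 assumes "bm X"
 obtains c where "c > 0" "cont_adapted X" "AE w in M. ALL t>=0. abs (X t w) <= c"
proof -
 obtain c where "cont_adapted X" "AE w in M. ALL t>=0. abs (X t w) <= c"
  using assms by (auto simp: bm_def)
 thus thesis
  using that[of "max c 1"] by (smt (verit, ccfv_SIG) eventually_mono)
qed

lemma bm_integrable:
 assumes "bm X" "t >= 0" shows "integrable M (X t)"
proof -
 obtain c where c: "cont_adapted X" "AE w in M. ALL t>=0. abs (X t w) <= c"
  using assms(1) by (auto simp: bm_def)
 show ?thesis
  using cont_adapted_M[OF c(1) assms(2)] c(2) assms(2)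
  by (intro integrable_const_bound[where B=c]) (auto elim: eventually_mono)
qed

lemma bm_cond_exp:
 assumes "bm X" "0 <= s" "s <= t"
 shows "AE w in M. real_cond_exp M (F s) (X t) w = X s w"
 using assms bm_integrable[OF assms(1)]
 by (intro cond_exp_of_tests) (auto simp: bm_def cont_adaptedD)

lemma bm_test:
 assumes "bm X" "0 <= s" "s <= t" "k : meas (F s)" "AE w in M. abs (k w) <= c"
 shows "(LINT w|M. k w * X t w) = (LINT w|M. k w * X s w)"
 using assms bm_integrable[OF assms(1)]
 by (intro test_of_cond_exp[OF _ _ _ _ bm_cond_exp[OF assms(1-3)]]) auto

lemma bm_martingale: "bm X ==> martingale M F X"
 unfolding martingale_def
 using bm_integrable bm_cond_exp
 by (auto simp: bm_def cadlag_adapted_def cont_adapted_def elim!: eventually_mono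
   intro: continuous_on_imp_cadlag_path)

lemma integrable_bounded_mult:
 fixes x k :: "'a => real"
 assumes "integrable M x" "k : meas M" "AE w in M. abs (k w) <= c"
 shows "integrable M (%w. k w * x w)"
proof (rule Bochner_Integration.integrable_bound)
 show "integrable M (%w. c * x w)" using assms(1) by simp
 show "AE w in M. norm (k w * x w) <= norm (c * x w)"
  using assms(3) by eventually_elim (auto simp: abs_mult intro!: mult_right_mono)
qed (use assms in auto)

lemma bm_add:
 assumes "bm X" "bm Y"
 shows "bm (%t w. X t w + Y t w)"
proof -
 obtain c where c: "cont_adapted X" "AE w in M. ALL t>=0. abs (X t w) <= c" using bmE[OF assms(1)] by blast
 obtain d where d: "cont_adapted Y" "AE w in M. ALL t>=0. abs (Y t w) <= d" using bmE[OF assms(2)] by blast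
 have "AE w in M. ALL t>=0. abs (X t w + Y t w) <= c + d"
  using c(2) d(2) by eventually_elim (meson abs_triangle_ineq add_mono order_trans)
 moreover have "(LINT w|M. indicator A w * (X t w + Y t w)) = (LINT w|M. indicator A w * (X s w + Y s w))"
  if "0 <= s" "s <= t" "A : sets (F s)" for s t A
 proof -
  have int: "integrable M (%w. indicator A w * X u w)" "integrable M (%w. indicator A w * Y u w)" if "u >= 0" for u
   using bm_integrable[OF assms(1) that] bm_integrable[OF assms(2) that] sets_F[OF \<open>0 <= s\<close> \<open>A : _\<close>]
   by (auto intro!: integrable_mult_indicator[where 'b=real, simplified])
  show ?thesis
   using assms that int[of s] int[of t] unfolding bm_def by (simp add: distrib_left)
 qed
 ultimately show ?thesis
  unfolding bm_def using cont_adapted_add[OF c(1) d(1)] by blast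
qed

lemma bm_tail:
 assumes "bm X" "a >= 0" "k : meas (F a)" "AE w in M. abs (k w) <= d"
 shows "bm (%t w. k w * (X t w - X (min t a) w))"
proof -
 obtain c where c: "c > 0" "cont_adapted X" "AE w in M. ALL t>=0. abs (X t w) <= c" using bmE[OF assms(1)] by blast
 have kM: "k : meas M" using meas_F_M assms by blast
 have "AE w in M. ALL t>=0. abs (k w * (X t w - X (min t a) w)) <= d * (2 * c)"
  using c(3) assms(4)
 proof eventually_elim
  case (elim w)
  have "abs (X t w - X (min t a) w) <= 2 * c" if "t >= 0" for t
   using elim(1)[rule_format, of t] elim(1)[rule_format, of "min t a"] that assms(2) by auto
  thus ?case
   using elim(2) unfolding abs_mult by (intro allI impI mult_mono) auto
 qed
 moreover have "(LINT w|M. indicator A w * (k w * (X t w - X (min t a) w))) =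
   (LINT w|M. indicator A w * (k w * (X s w - X (min s a) w)))"
  if st: "0 <= s" "s <= t" "A : sets (F s)" for s t A
 proof (cases "t <= a")
  case False
  define r where "r = max s a"
  have r: "0 <= r" "r <= t" "a <= r" "s <= r" using False st assms(2) by (auto simp: r_def)
  define h where "h = (%w. indicator A w * k w)"
  have "A : sets (F r)" using sets_F_mono[of s r A] st r by auto
  hence h: "h : meas (F r)"
   unfolding h_def using meas_F_mono[of a r k] assms r by (intro borel_measurable_times) auto
  hence hM: "h : meas M" using meas_F_M r by blast
  have hb: "AE w in M. abs (h w) <= d"
   using assms(4) by eventually_elim (auto simp: h_def indicator_def)
  have int: "integrable M (%w. h w * X u w)" if "u >= 0" for u
   by (rule integrable_bounded_mult[OF bm_integrable[OF assms(1) that] hM hb])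
  have "(LINT w|M. indicator A w * (k w * (X t w - X (min t a) w))) = (LINT w|M. h w * X t w) - (LINT w|M. h w * X a w)"
   using False int[of t] int[of a] assms(2) st
   by (simp add: h_def algebra_simps flip: Bochner_Integration.integral_diff)
  also have "(LINT w|M. h w * X t w) = (LINT w|M. h w * X r w)"
   using bm_test[OF assms(1) r(1,2) h hb] .
  also have "(LINT w|M. h w * X r w) - (LINT w|M. h w * X a w) = (LINT w|M. indicator A w * (k w * (X s w - X (min s a) w)))"
  proof (cases "s <= a")
   case True
   thus ?thesis by (simp add: r_def max_def)
  next
   case False
   thus ?thesis
    using int[of s] int[of a] assms(2) st
    by (simp add: r_def h_def algebra_simps flip: Bochner_Integration.integral_diff)
  qed
  finally show ?thesis .
 qed (use st in simp)
 ultimately show ?thesis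
  unfolding bm_def using cont_adapted_tail[OF c(2) assms(2,3)] by blast
qed

lemma bm_const:
 assumes "k : meas (F 0)" "AE w in M. abs (k w) <= c"
 shows "bm (%t. k)"
 unfolding bm_def using assms cont_adapted_const[OF assms(1)] by auto

subsection \<open>Continuous local martingales\<close>

text \<open>A continuous local martingale is what bounded continuous martingales approximate
 uniformly on compacts in probability. In this form the class is closed under such limits by
 definition; that its members have localizing sequences is a theorem about stopping.\<close>

definition clm :: "(real => 'a => real) => bool" where
 "clm X <-> cont_adapted X & (ALL t>=0. ALL e>0. EX Y. bm Y & near t e Y X)"

lemma clm_cont: "clm X ==> cont_adapted X"
 by (simp add: clm_def)

lemma bm_clm: "bm X ==> clm X"
 unfolding clm_def using near_AE_eq[of X X] by (metis AE_I2 bm_def less_imp_le)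

lemma clm_near:
 assumes "cont_adapted X" "!!t e. t >= 0 ==> e > 0 ==> EX Y. clm Y & near t e Y X"
 shows "clm X"
 unfolding clm_def
proof (intro conjI allI impI assms)
 fix t e :: real assume te: "t >= 0" "e > 0"
 obtain Y where Y: "clm Y" "near t (e/2) Y X" using assms(2)[of t "e/2"] te by auto
 obtain W where W: "bm W" "near t (e/2) W Y" using Y(1) te unfolding clm_def by (meson half_gt_zero)
 show "EX Y. bm Y & near t e Y X"
  using W near_trans[OF W(2) Y(2)] by auto
qed

lemma cont_adapted_limit:
 assumes "!!n. cont_adapted (Xn n)"
  and "AE w in M. loc_uniform (%n s. Xn n s w) (traj X w)"
 shows "cont_adapted X"
 unfolding cont_adapted_def adapted_def
proof (intro conjI allI impI)
 fix t :: real assume t: "t >= 0"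
 show "X t : meas (F t)"
 proof (rule AE_lim_meas_F[OF _ _ t])
  show "Xn n t : meas (F t)" for n
   using cont_adaptedD[OF assms(1) t] .
  show "AE w in M. (%n. Xn n t w) ----> X t w"
   using assms(2) by eventually_elim (use t in "auto intro: tendsto_uniform_limitI")
 qed
next
 have "AE w in M. ALL n. continuous_on {0..} (%s. Xn n s w)"
  using assms(1) by (auto simp: AE_all_countable cont_adapted_def)
 thus "AE w in M. continuous_on {0..} (traj X w)"
  using assms(2)
 proof eventually_elim
  case (elim w)
  show ?case
  proof (rule continuous_on_halfline)
   fix T :: real assume "T >= 0"
   show "continuous_on {0..T} (traj X w)"
    by (rule uniform_limit_theorem[OF _ elim(2)[rule_format, OF \<open>T >= 0\<close>]])
     (use elim(1) in \<open>auto intro!: always_eventually continuous_on_subset[of "{0..}" _ "{0..T}"]\<close>)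
  qed
 qed
qed

lemma clm_limit:
 assumes "!!n. clm (Xn n)"
  and "AE w in M. loc_uniform (%n s. Xn n s w) (traj X w)"
 shows "clm X"
proof (rule clm_near)
 show X: "cont_adapted X"
  using cont_adapted_limit[OF clm_cont[OF assms(1)] assms(2)] .
 fix t e :: real assume te: "t >= 0" "e > 0"
 have "AE w in M. ulim t (%n s. Xn n s w) (traj X w)"
  using assms(2) by eventually_elim (use te in auto)
 from near_of_tendsto[OF _ _ te this] have "eventually (%n. near t e (Xn n) X) sequentially"
  using X assms(1) by (auto intro: cont_right_cont clm_cont)
 then obtain n where "near t e (Xn n) X"
  using eventually_happens' by force
 thus "EX Y. clm Y & near t e Y X"
  using assms(1) by blast
qed

lemma cont_adapted_cong:
 assumes "cont_adapted X" "AE w in M. ALL t>=0. X t w = Y t w"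
 shows "cont_adapted Y"
proof -
 have "AE w in M. continuous_on {0..} (traj Y w)"
  using assms(2) assms(1)[unfolded cont_adapted_def, THEN conjunct2]
  by eventually_elim (auto cong: continuous_on_cong_simp intro: continuous_on_eq)
 moreover have "Y t : meas (F t)" if "t >= 0" for t
  by (rule AE_eq_meas_F[OF cont_adaptedD[OF assms(1) that] _ that])
   (use assms(2) that in "auto elim: eventually_mono")
 ultimately show ?thesis by (auto simp: cont_adapted_def adapted_def)
qed

lemma clm_cong:
 assumes "clm X" "AE w in M. ALL t>=0. X t w = Y t w"
 shows "clm Y"
 using clm_near[OF cont_adapted_cong[OF clm_cont[OF assms(1)] assms(2)]] assms near_AE_eq[OF assms(2)]
 by fastforce

lemma clm_add:
 assumes "clm X" "clm Y"
 shows "clm (%t w. X t w + Y t w)"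
 unfolding clm_def
proof (intro conjI allI impI)
 show "cont_adapted (%t w. X t w + Y t w)"
  using assms by (auto intro: cont_adapted_add clm_cont)
 fix t e :: real assume "t >= 0" "e > 0"
 then obtain X' Y' where "bm X'" "near t (e/2) X' X" "bm Y'" "near t (e/2) Y' Y"
  using assms unfolding clm_def by (meson half_gt_zero)
 thus "EX Ya. bm Ya & near t e Ya (%t w. X t w + Y t w)"
  using bm_add near_add[of t "e/2" X' X "e/2" Y' Y] by fastforce
qed

lemma uniform_limit_eventually_eq:
 fixes f :: "nat => real => real"
 assumes "eventually (%n. ALL s:S. f n s = g s) sequentially"
 shows "uniform_limit S f g sequentially"
 using assms by (intro uniform_limitI) (auto elim!: eventually_mono)

lemma clm_const:
 assumes "k : meas (F 0)"
 shows "clm (%t. k)"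
proof (rule clm_limit[where Xn="%n t w. if \<bar>k w\<bar> <= real n then k w else 0"])
 show "clm (%t w. if \<bar>k w\<bar> <= real n then k w else 0)" for n
  using assms by (intro bm_clm bm_const[where c="real n"]) auto
 have ev: "eventually (%n. ALL s:{0..T}. (if \<bar>k w\<bar> <= real n then k w else 0) = k w) sequentially" for w and T :: real
  using eventually_ge_at_top[of "nat \<lceil>abs (k w)\<rceil>"] by eventually_elim (auto simp: nat_le_iff ceiling_le_iff)
 show "AE w in M. loc_uniform (%n s. if \<bar>k w\<bar> <= real n then k w else 0) (%s. k w)"
  by (rule AE_I2, intro allI impI uniform_limit_eventually_eq ev)
qed

text \<open>Bounded coefficients are covered by \<open>bm_tail\<close>; a general one is cut off at level n, and each path of the
 truncated products is eventually that of the product.\<close>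

lemma clm_tail:
 assumes "clm X" "a >= 0" "k : meas (F a)"
 shows "clm (%t w. k w * (X t w - X (min t a) w))"
proof -
 have bounded: "clm (%t w. k w * (X t w - X (min t a) w))"
  if k: "k : meas (F a)" and b: "!!w. abs (k w) <= c" and c: "c >= 1" for k c
  unfolding clm_def
 proof (intro conjI allI impI)
  show "cont_adapted (%t w. k w * (X t w - X (min t a) w))"
   using cont_adapted_tail[OF clm_cont[OF assms(1)] assms(2) k] .
  fix t e :: real assume te: "t >= 0" "e > 0"
  (* k multiplies two errors of size d. *)
  define d where "d = e / (2 * c)"
  have d: "d > 0" using te c by (simp add: d_def)
  obtain X' where X': "bm X'" "near t d X' X"
   using assms(1) te d unfolding clm_def by meson
  obtain B where B: "B : sets M" "prob B <= d" "AE w in M. w ~: B --> (ALL s:{0..t}. abs (X' s w - X s w) <= d)"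
   using X'(2) by (auto simp: near_def)
  have de: "d <= e" "c * (2 * d) = e"
   using te c by (auto simp: d_def field_simps)
  have "AE w in M. w ~: B --> (ALL s:{0..t}. abs (k w * (X' s w - X' (min s a) w) - k w * (X s w - X (min s a) w)) <= e)"
   using B(3)
  proof eventually_elim
   case (elim w)
   show ?case
   proof (intro impI ballI)
    fix s assume "w ~: B" "s : {0..t}"
    hence "abs (X' s w - X s w) <= d" "abs (X' (min s a) w - X (min s a) w) <= d"
     using elim assms(2) by auto
    hence "abs ((X' s w - X' (min s a) w) - (X s w - X (min s a) w)) <= 2 * d"
     by linarith
    hence "abs (k w * ((X' s w - X' (min s a) w) - (X s w - X (min s a) w))) <= c * (2 * d)"
     unfolding abs_mult using b c by (intro mult_mono) auto
    thus "abs (k w * (X' s w - X' (min s a) w) - k w * (X s w - X (min s a) w)) <= e"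
     using de by (simp add: algebra_simps)
   qed
  qed
  hence "near t e (%s w. k w * (X' s w - X' (min s a) w)) (%s w. k w * (X s w - X (min s a) w))"
   unfolding near_def using B de by (intro bexI[of _ B]) auto
  thus "EX Y. bm Y & near t e Y (%t w. k w * (X t w - X (min t a) w))"
   using bm_tail[OF X'(1) assms(2) k, OF AE_I2] b by blast
 qed
 show ?thesis
 proof (rule clm_limit[where Xn="%n t w. (if \<bar>k w\<bar> <= real n then k w else 0) * (X t w - X (min t a) w)"])
  show "clm (%t w. (if \<bar>k w\<bar> <= real n then k w else 0) * (X t w - X (min t a) w))" for n
   using assms(3) by (intro bounded[of _ "real n + 1"]) auto
  show "AE w in M. loc_uniform (%n t. (if \<bar>k w\<bar> <= real n then k w else 0) * (X t w - X (min t a) w)) (%t. k w * (X t w - X (min t a) w))"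
  proof (intro AE_I2 allI impI uniform_limit_eventually_eq)
   fix w and T :: real
   show "eventually (%n. ALL t:{0..T}. (if \<bar>k w\<bar> <= real n then k w else 0) * (X t w - X (min t a) w) = k w * (X t w - X (min t a) w)) sequentially"
    using eventually_ge_at_top[of "nat \<lceil>abs (k w)\<rceil>"] by eventually_elim (auto simp: nat_le_iff ceiling_le_iff)
  qed
 qed
qed

lemma clm_mult_F0:
 assumes "clm X" "k : meas (F 0)"
 shows "clm (%t w. k w * X t w)"
proof -
 have "clm (%t w. k w * (X t w - X (min t 0) w) + k w * X 0 w)"
  using assms cont_adaptedD[OF clm_cont[OF assms(1)], of 0]
  by (intro clm_add clm_tail clm_const borel_measurable_times) auto
 thus ?thesis
  by (rule clm_cong) (auto simp: algebra_simps min_def)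
qed

lemma clm_cmult: "clm X ==> clm (%t w. c * X t w)"
 by (rule clm_mult_F0) auto

lemma clm_diff: "clm X ==> clm Y ==> clm (%t w. X t w - Y t w)"
 using clm_add[OF _ clm_cmult[of Y "-1"], of X] by simp

lemma clm_sum:
 assumes "!!i. i : I ==> clm (X i)"
 shows "clm (%t w. SUM i:I. X i t w)"
proof (cases "finite I")
 case True
 thus ?thesis
  using assms by induction (auto intro: clm_add clm_const)
qed (auto intro: clm_const)

lemma clm_increment:
 assumes "clm X" "0 <= a" "a <= b" "k : meas (F a)"
 shows "clm (%t w. k w * (X (min t b) w - X (min t a) w))"
proof -
 have "k : meas (F b)"
  using meas_F_mono assms by blast
 hence "clm (%t w. k w * (X t w - X (min t a) w) - k w * (X t w - X (min t b) w))"
  using assms by (intro clm_diff clm_tail) auto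
 thus ?thesis by (simp add: algebra_simps)
qed

end

section \<open>Stopping\<close>

lemma min_time_top: "t >= 0 ==> min_time t top = t"
 by (simp add: min_time_def min_def top_unique)

lemma min_time_ennreal: "t >= 0 ==> r >= 0 ==> min_time t (ennreal r) = min t r"
 by (simp add: min_time_def min_def ennreal_le_iff)

lemma min_time_eq:
 assumes "t >= 0"
 obtains r where "r >= 0" "min_time t u = min t r" "!!x. 0 <= x ==> x <= K ==> ennreal x < u <-> x < r"
  "!!x. 0 <= x ==> x <= K ==> min_time x u = min x r"
proof (cases u)
 case (real r)
 thus thesis
  using that[of r] assms by (auto simp: min_time_ennreal ennreal_less_iff)
next
 case top
 thus thesis
  using that[of "max t K + 1"] assms by (auto simp: min_time_top)
qed

lemma min_time_bounds:
 assumes "t >= 0" shows "0 <= min_time t u" "min_time t u <= t"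
 using assms min_time_eq[of t u 0] by (metis min.bounded_iff min.cobounded1)+

lemma min_time_le: "t >= 0 ==> ennreal (min_time t u) <= u"
 by (cases u) (auto simp: min_time_ennreal min_def intro: ennreal_leI)

lemma min_time_id: "t >= 0 ==> ennreal t <= u ==> min_time t u = t"
 by (simp add: min_time_def min_def)

lemma min_time_0 [simp]: "min_time 0 u = 0"
 using min_time_bounds[of 0 u] by simp

lemma min_time_zero [simp]: "t >= 0 ==> min_time t 0 = 0"
 using min_time_ennreal[of t 0] by simp

lemma min_time_lipschitz:
 assumes "s >= 0" "t >= 0" shows "abs (min_time s u - min_time t u) <= abs (s - t)"
proof -
 obtain r where "min_time s u = min s r" "min_time t u = min t r"
  using min_time_eq[of s u "max s t"] assms by (metis max.cobounded1 max.cobounded2)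
 thus ?thesis by linarith
qed

lemma continuous_on_stopped:
 assumes "continuous_on {0..} (traj X w)"
 shows "continuous_on {0..} (%t. stopped X T t w)"
proof -
 have "continuous_on {0..} (%t. min_time t (T w))"
  unfolding continuous_on_iff dist_real_def
  by (metis atLeast_iff min_time_lipschitz order_le_less_trans)
 from continuous_on_compose2[OF assms this] show ?thesis
  by (auto simp: stopped_def min_time_bounds image_subset_iff)
qed

lemma dyadic_le: "real j / 2^n <= real (Suc j) / 2^n"
 by (simp add: divide_right_mono)

text \<open>Increments of X over the dyadic intervals that start before T add up to X stopped at T
 rounded up to the dyadic grid.\<close>

definition stop_sum :: "(real => 'a => real) => ('a => ennreal) => nat => real => 'a => real" where
 "stop_sum X T n t w = X 0 w + (SUM j<4^n. of_bool (ennreal (real j / 2^n) < T w) *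
  (X (min t (real (Suc j) / 2^n)) w - X (min t (real j / 2^n)) w))"

text \<open>The last cell that starts before T ends within \<open>1/2\<^sup>n\<close> after T, and the sum telescopes up to that point.\<close>

lemma stop_sum_eq:
 assumes t: "0 <= t" "t <= 2^n"
 obtains v where "stop_sum X T n t w = X v w" "min_time t (T w) <= v" "v <= t" "v <= min_time t (T w) + 1/2^n"
proof -
 obtain r where r: "r >= 0" "min_time t (T w) = min t r"
   "!!x. 0 <= x ==> x <= 2^n ==> ennreal x < T w <-> x < r"
  using min_time_eq[OF t(1), of "T w" "2^n"] by metis
 define c where "c = real (nat \<lceil>r * 2^n\<rceil>) / 2^n"
 have c1: "r <= c" unfolding c_def using r(1) by (simp add: pos_le_divide_eq)
 have "real (nat \<lceil>r * 2^n\<rceil>) <= r * 2^n + 1" using r(1) by (simp add: of_nat_nat)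
 hence c2: "c <= r + 1/2^n" unfolding c_def by (simp add: field_simps)
 have key: "real j / 2^n < r <-> j < nat \<lceil>r * 2^n\<rceil>" for j
  by (simp add: pos_divide_less_eq zless_nat_eq_int_zless less_ceiling_iff)
 have "X 0 w + (SUM j<N. of_bool (ennreal (real j / 2^n) < T w) *
  (X (min t (real (Suc j) / 2^n)) w - X (min t (real j / 2^n)) w)) = X (min t (min (real N / 2^n) c)) w"
  if "N <= 4^n" for N
  using that
 proof (induction N)
  case 0
  thus ?case using t r c1 by (simp add: min_def)
 next
  case (Suc N)
  have "real N <= 4^n" using Suc.prems by (metis Suc_leD of_nat_le_iff of_nat_numeral of_nat_power)
  hence "real N / 2^n <= 2^n"
   by (simp add: pos_divide_le_eq power_mult_distrib[symmetric])
  hence b: "ennreal (real N / 2^n) < T w <-> N < nat \<lceil>r * 2^n\<rceil>"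
   using r(3)[of "real N / 2^n"] key[of N] by simp
  show ?case
  proof (cases "N < nat \<lceil>r * 2^n\<rceil>")
   case True
   hence "N <= nat \<lceil>r * 2^n\<rceil>" "Suc N <= nat \<lceil>r * 2^n\<rceil>" by linarith+
   hence "real N / 2^n <= c" "real (Suc N) / 2^n <= c"
    unfolding c_def by (intro divide_right_mono; simp only: of_nat_le_iff; simp)+
   thus ?thesis using Suc b True by (simp add: min_absorb1)
  next
   case False
   hence "nat \<lceil>r * 2^n\<rceil> <= N" "nat \<lceil>r * 2^n\<rceil> <= Suc N" by linarith+
   hence "c <= real N / 2^n" "c <= real (Suc N) / 2^n"
    unfolding c_def by (intro divide_right_mono; simp only: of_nat_le_iff; simp)+
   thus ?thesis using Suc b False by (simp add: min_absorb2)
  qed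
 qed
 from this[of "4^n"] have "stop_sum X T n t w = X (min t (min (real (4^n) / 2^n) c)) w"
  unfolding stop_sum_def by simp
 moreover have "real (4^n) / 2^n = 2^n"
  by (simp add: field_simps power_mult_distrib[symmetric])
 ultimately have "stop_sum X T n t w = X (min t c) w"
  using t by (simp add: min_def)
 thus thesis
  using that[of "min t c"] c1 c2 r(2) by (auto simp: min_def)
qed

lemma eventually_le_pow2: "eventually (%n. (K::real) <= 2^n) sequentially"
proof -
 obtain n0 where "K < 2^n0" using real_arch_pow[of 2 K] by auto
 hence "K <= 2^n" if "n >= n0" for n
  using power_increasing[OF that, of "2::real"] by linarith
 thus ?thesis by (auto simp: eventually_sequentially)
qed

lemma eventually_real_ge: "eventually (%n. (c::real) <= real n) sequentially"
 using filterlim_real_sequentially by (auto simp: filterlim_at_top)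

lemma uniform_limit_stop_sum:
 assumes "continuous_on {0..} (traj X w)" "K >= 0"
 shows "ulim K (%n t. stop_sum X T n t w) (%t. stopped X T t w)"
proof (rule uniform_limitI)
 fix e :: real assume e: "e > 0"
 have "uniformly_continuous_on {0..K} (traj X w)"
  by (intro compact_uniformly_continuous continuous_on_subset[OF assms(1)]) auto
 then obtain d where d: "d > 0" "!!s t. s : {0..K} ==> t : {0..K} ==> dist s t < d ==> dist (X s w) (X t w) < e"
  using e unfolding uniformly_continuous_on_def by metis
 have "(%n. (1/2)^n) ----> (0::real)" by (intro LIMSEQ_power_zero) auto
 hence "eventually (%n. (1/2)^n < d) sequentially" using d(1) by (rule order_tendstoD)
 moreover have "eventually (%n. K <= 2^n) sequentially"
  by (rule eventually_le_pow2)
 ultimately show "\<forall>\<^sub>F n in sequentially. ALL t:{0..K}. dist (stop_sum X T n t w) (stopped X T t w) < e"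
 proof eventually_elim
  case (elim n)
  show ?case
  proof
   fix t assume t: "t : {0..K}"
   then obtain v where "stop_sum X T n t w = X v w" "min_time t (T w) <= v" "v <= t" "v <= min_time t (T w) + 1/2^n"
    using stop_sum_eq[of t n X T w] elim by auto
   moreover have "0 <= min_time t (T w)" "min_time t (T w) <= t" using min_time_bounds t by auto
   ultimately show "dist (stop_sum X T n t w) (stopped X T t w) < e"
    using d(2)[of v "min_time t (T w)"] t elim by (auto simp: stopped_def dist_real_def power_divide)
  qed
 qed
qed

definition hit_time :: "(real => real) => real => ennreal" where
 "hit_time x c = Inf {ennreal t | t. t >= 0 & abs (x t) >= c}"

abbreviation hit :: "(real => 'a => real) => real => 'a => ennreal" where
 "hit X c == %w. hit_time (traj X w) c"

lemma hit_le_iff: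
 assumes "continuous_on {0..} x" "t >= 0"
 shows "hit_time x c <= ennreal t <-> (EX s:{0..t}. abs (x s) >= c)"
proof
 assume "EX s:{0..t}. abs (x s) >= c"
 then obtain s where "0 <= s" "s <= t" "abs (x s) >= c" by auto
 hence "hit_time x c <= ennreal s" unfolding hit_time_def by (intro Inf_lower) auto
 thus "hit_time x c <= ennreal t" using \<open>s <= t\<close> by (meson ennreal_leI order_trans)
next
 assume le: "hit_time x c <= ennreal t"
 show "EX s:{0..t}. abs (x s) >= c"
 proof (rule ccontr)
  assume "~ ?thesis"
  hence less: "abs (x s) < c" if "s : {0..t}" for s using that by force
  have "((%t. abs (x t)) ---> abs (x t)) (at_right t)"
   using cont_right_limit[OF assms] by (rule tendsto_rabs)
  hence "eventually (%s. abs (x s) < c) (at_right t)"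
   using less[of t] assms(2) by (intro order_tendstoD) auto
  then obtain b where b: "b > t" "!!s. t < s ==> s < b ==> abs (x s) < c"
   unfolding eventually_at_right_field by blast
  have "ennreal b <= hit_time x c"
   unfolding hit_time_def
  proof (rule Inf_greatest, clarify)
   fix s assume "0 <= s" "c <= abs (x s)"
   thus "ennreal b <= ennreal s"
    using less[of s] b(2)[of s] by (intro ennreal_leI) force
  qed
  thus False using le b assms(2) ennreal_lessI[of b t] by fastforce
 qed
qed

lemma before_hit:
 assumes "continuous_on {0..} x" "abs (x 0) < c" "0 <= u" "ennreal u <= hit_time x c"
 shows "abs (x u) <= c"
proof (rule ccontr)
 assume "~ ?thesis"
 hence g: "abs (x u) > c" "u > 0" using assms(2,3) by (auto simp: order_less_le)
 have "((%t. abs (x t)) ---> abs (x u)) (at_left u)"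
  using cont_left_limit[OF assms(1) g(2)] by (rule tendsto_rabs)
 hence "eventually (%s. abs (x s) > c) (at_left u)"
  using g by (intro order_tendstoD) auto
 then obtain b where b: "b < u" "!!s. b < s ==> s < u ==> abs (x s) > c"
  unfolding eventually_at_left_field by blast
 define s where "s = (max b 0 + u) / 2"
 have s: "0 <= s" "b < s" "s < u" using b g by (auto simp: s_def)
 hence "hit_time x c <= ennreal s"
  using b(2)[of s] hit_le_iff[OF assms(1), of s c] by force
 hence "ennreal u <= ennreal s" using assms(4) by (rule order_trans[rotated])
 thus False using s g by (simp add: ennreal_le_iff)
qed

lemma at_hit:
 assumes "continuous_on {0..} x" "abs (x 0) < c" "0 <= t" "hit_time x c <= ennreal t"
 shows "abs (x (min_time t (hit_time x c))) = c"
proof -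
 obtain r where r: "r >= 0" "hit_time x c = ennreal r"
  using assms(4) by (cases "hit_time x c") (auto simp: top_unique)
 hence rt: "min_time t (hit_time x c) = r"
  using assms by (simp add: min_time_ennreal ennreal_le_iff)
 obtain s where s: "s : {0..r}" "abs (x s) >= c"
  using hit_le_iff[OF assms(1) r(1), of c] r by auto
 have "hit_time x c <= ennreal s"
  using s hit_le_iff[OF assms(1), of s c] by auto
 hence "s = r" using s r by (simp add: ennreal_le_iff)
 thus ?thesis
  using s before_hit[OF assms(1,2) r(1)] r rt by simp
qed

lemma hit_gt:
 assumes "continuous_on {0..} x" "t >= 0"
 shows "EX K. ALL c>K. hit_time x c > ennreal t"
proof -
 have "compact (x ` {0..t})"
  by (intro compact_continuous_image continuous_on_subset[OF assms(1)]) auto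
 then obtain K where "ALL s:{0..t}. abs (x s) <= K"
  unfolding compact_eq_bounded_closed bounded_iff by auto
 thus ?thesis
  using hit_le_iff[OF assms] by (intro exI[of _ K]) (force simp: not_le[symmetric])
qed

context usual_filtration begin

lemma ex_event_M:
 assumes "right_cont X" "open U" "t >= 0"
 shows "{w:space M. EX s:{0..t}. X s w : U} : sets M"
 by (rule sets_F[OF assms(3) ex_event_F[OF assms]])

lemma exceed_M:
 assumes "right_cont X" "t >= 0" shows "exceeds X t eps : sets M"
 using ex_event_M[OF assms(1) _ assms(2), of "{x. abs x > eps}"] open_Collect_less[of "%_. eps" abs]
 by (simp add: continuous_on_rabs continuous_on_id)

lemma stopping_coeff:
 assumes "ext_stopping_time F T" "a >= 0"
 shows "(%w. of_bool (ennreal a < T w) :: real) : meas (F a)"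
proof -
 have [measurable]: "Measurable.pred (F a) (%w. T w <= ennreal a)"
  using assms by (simp add: ext_stopping_time_def)
 have "(%w. of_bool (~ T w <= ennreal a) :: real) : meas (F a)" by measurable
 thus ?thesis by (simp add: not_le)
qed

lemma cont_adapted_increment:
 assumes "cont_adapted X" "0 <= a" "a <= b" "k : meas (F a)"
 shows "cont_adapted (%t w. k w * (X (min t b) w - X (min t a) w))"
proof -
 have "k : meas (F b)" using meas_F_mono assms by blast
 hence "cont_adapted (%t w. k w * (X t w - X (min t a) w) - k w * (X t w - X (min t b) w))"
  using assms by (intro cont_adapted_diff cont_adapted_tail) auto
 thus ?thesis by (simp add: algebra_simps)
qed

lemma cont_adapted_sum:
 assumes "!!i. i : I ==> cont_adapted (X i)" "finite I"
 shows "cont_adapted (%t w. SUM i:I. X i t w)"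
 using assms(2,1) by induction (auto intro: cont_adapted_add cont_adapted_const)

lemma bm_increment:
 assumes "bm X" "0 <= a" "a <= b" "k : meas (F a)" "AE w in M. abs (k w) <= d"
 shows "bm (%t w. k w * (X (min t b) w - X (min t a) w))"
proof -
 have "k : meas (F b)" using meas_F_mono assms by blast
 hence "bm (%t w. k w * (X t w - X (min t a) w) + (- k w) * (X t w - X (min t b) w))"
  using assms by (intro bm_add bm_tail[where d=d]) auto
 thus ?thesis by (simp add: algebra_simps)
qed

lemma bm_sum:
 assumes "!!i. i : I ==> bm (X i)" "finite I"
 shows "bm (%t w. SUM i:I. X i t w)"
 using assms(2,1) by induction (auto intro: bm_add bm_const[where c=0])

lemma AE_cont: "cont_adapted X ==> AE w in M. continuous_on {0..} (traj X w)"
 by (simp add: cont_adapted_def)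

lemma AE_stop_sum:
 "cont_adapted X ==> AE w in M. loc_uniform (%n t. stop_sum X T n t w) (%t. stopped X T t w)"
 by (drule AE_cont) (auto elim!: eventually_mono intro: uniform_limit_stop_sum)

lemma cont_adapted_stopped:
 assumes "cont_adapted X" "ext_stopping_time F T"
 shows "cont_adapted (stopped X T)"
proof (rule cont_adapted_limit[OF _ AE_stop_sum[OF assms(1)]])
 show "cont_adapted (stop_sum X T n)" for n
  unfolding stop_sum_def using assms dyadic_le
  by (intro cont_adapted_add cont_adapted_sum cont_adapted_increment cont_adapted_const stopping_coeff)
   (auto intro: cont_adaptedD)
qed

lemma clm_stopped:
 assumes "clm X" "ext_stopping_time F T"
 shows "clm (stopped X T)"
proof (rule clm_limit[OF _ AE_stop_sum[OF clm_cont[OF assms(1)]]])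
 show "clm (stop_sum X T n)" for n
  unfolding stop_sum_def using assms dyadic_le
  by (intro clm_add clm_sum clm_increment clm_const stopping_coeff)
   (auto intro: cont_adaptedD clm_cont)
qed

text \<open>Optional stopping for bounded continuous martingales: the stopped grid sums are martingales and
 take only values of X, so dominated convergence applies.\<close>

lemma bm_stopped:
 assumes "bm X" "ext_stopping_time F T"
 shows "bm (stopped X T)"
proof -
 obtain c where c: "c > 0" "cont_adapted X" "AE w in M. ALL t>=0. abs (X t w) <= c" using bmE[OF assms(1)] by blast
 have bs: "bm (stop_sum X T n)" for n
  unfolding stop_sum_def
 proof (intro bm_add bm_sum)
  show "bm (%t. X 0)"
   using c by (intro bm_const[where c=c] cont_adaptedD) (auto elim: eventually_mono)
  show "bm (%t w. of_bool (ennreal (real j / 2^n) < T w) * (X (min t (real (Suc j) / 2^n)) w - X (min t (real j / 2^n)) w))" for j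
   using assms dyadic_le by (intro bm_increment[where d=1] stopping_coeff) auto
 qed auto
 have lim: "(%n. \<integral>w. indicator A w * stop_sum X T n t w \<partial>M) ----> (LINT w|M. indicator A w * stopped X T t w)"
  if t: "0 <= t" and A: "A : sets M" for t A
 proof -
  obtain n0 where n0: "t < 2^n0" using real_arch_pow[of 2 t] by auto
  have tn: "t <= 2^(n + n0)" for n
   using n0 power_increasing[of n0 "n + n0" "2::real"] by linarith
  have "(%n. \<integral>w. indicator A w * stop_sum X T (n + n0) t w \<partial>M) ----> (LINT w|M. indicator A w * stopped X T t w)"
  proof (rule integral_dominated_convergence[where w="%_. c"])
   show "AE w in M. (%n. indicator A w * stop_sum X T (n + n0) t w) ----> indicator A w * stopped X T t w"
    using AE_stop_sum[OF c(2), of T]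
   proof eventually_elim
    case (elim w)
    have "(%n. stop_sum X T n t w) ----> stopped X T t w"
     using t by (intro tendsto_uniform_limitI[OF elim[rule_format, OF t]]) auto
    thus ?case by (intro tendsto_intros LIMSEQ_ignore_initial_segment)
   qed
   show "AE w in M. norm (indicator A w * stop_sum X T (n + n0) t w) <= c" for n
    using c(3)
   proof eventually_elim
    case (elim w)
    obtain v where "stop_sum X T (n + n0) t w = X v w" "min_time t (T w) <= v"
     using stop_sum_eq[OF t tn, where X=X and T=T and w=w] by metis
    thus ?case
     using elim c(1) min_time_bounds(1)[OF t, of "T w"] by (auto simp: abs_mult indicator_def)
   qed
  qed (use A t cont_adapted_M[OF cont_adapted_stopped[OF c(2) assms(2)] t] cont_adapted_M bs in "auto simp: bm_def")
  thus ?thesis by (rule LIMSEQ_offset)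
 qed
 have "AE w in M. ALL t>=0. abs (stopped X T t w) <= c"
  using c(3) by eventually_elim (auto simp: stopped_def min_time_bounds)
 moreover have "(LINT w|M. indicator A w * stopped X T t w) = (LINT w|M. indicator A w * stopped X T s w)"
  if "0 <= s" "s <= t" "A : sets (F s)" for s t A
  using lim[of t A] lim[of s A] bs that sets_F[of s A] unfolding bm_def by (intro LIMSEQ_unique) auto
 ultimately show ?thesis
  using cont_adapted_stopped[OF c(2) assms(2)] unfolding bm_def by blast
qed

text \<open>On a compact interval \<bar>X\<bar> attains its maximum, which is at least c iff it exceeds all c - 1/k; these events are
 known at time t.\<close>

lemma hit_stopping_time:
 assumes "cont_adapted X"
 shows "ext_stopping_time F (hit X c)"
 unfolding ext_stopping_time_def
proof (intro allI impI)
 fix t :: real assume t: "t >= 0"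
 define E where "E k = {w:space M. EX s:{0..t}. X s w : {x. abs x > c - 1 / real (Suc k)}}" for k
 have "open {x::real. abs x > c - 1 / real (Suc k)}" for k
  by (intro open_Collect_less continuous_intros)
 hence E: "E k : sets (F t)" for k
  unfolding E_def using ex_event_F[OF cont_right_cont[OF assms]] t by blast
 have "{w:space M. hit X c w <= ennreal t} : sets (F t)"
 proof (rule AE_eq_set_F[OF _ _ _ t])
  show "(INT k. E k) : sets (F t)" using E by blast
  show "AE w in M. (w : (INT k. E k)) = (w : {w:space M. hit X c w <= ennreal t})"
   using AE_cont[OF assms] AE_space
  proof eventually_elim
   case (elim w)
   have "continuous_on {0..t} (%s. abs (X s w))"
    by (intro continuous_intros continuous_on_subset[OF elim(1)]) auto
   then obtain s where s: "s : {0..t}" "!!u. u : {0..t} ==> abs (X u w) <= abs (X s w)"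
    using continuous_attains_sup[of "{0..t}" "%s. abs (X s w)"] t by auto
   have "w : (INT k. E k) <-> (ALL k. abs (X s w) > c - 1 / real (Suc k))"
   proof -
    have "(EX u:{0..t}. X u w : {x. abs x > d}) <-> abs (X s w) > d" for d
     using s by (metis (no_types, lifting) mem_Collect_eq less_le_trans)
    thus ?thesis unfolding E_def using elim(2) by auto
   qed
   also have "... <-> abs (X s w) >= c"
   proof
    assume *: "ALL k. abs (X s w) > c - 1 / real (Suc k)"
    have "(%k. c - 1 / real (Suc k)) ----> c - 0"
     by (intro tendsto_intros LIMSEQ_Suc lim_1_over_n)
    thus "abs (X s w) >= c"
     using * by (intro LIMSEQ_le_const2[of _ c]) (auto intro: less_imp_le)
   next
    assume "abs (X s w) >= c"
    moreover have "c - 1 / real (Suc k) < c" for k by simp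
    ultimately show "ALL k. abs (X s w) > c - 1 / real (Suc k)" by (meson less_le_trans)
   qed
   also have "... <-> w : {w:space M. hit X c w <= ennreal t}"
   proof -
    have "(EX u:{0..t}. abs (X u w) >= c) <-> abs (X s w) >= c"
     using s by (metis order_trans)
    thus ?thesis using hit_le_iff[OF elim(1) t, of c] elim(2) by simp
   qed
   finally show ?case .
  qed
 qed auto
 thus "Measurable.pred (F t) (%w. hit X c w <= ennreal t)"
  unfolding pred_def using space_F[OF t] by simp
qed

text \<open>A continuous local martingale dominated by an integrable variable is a martingale: stop the
 approximating martingales when they are at distance 1 from it.\<close>

lemma clm_dominated:
 assumes X: "clm X" and ze: "integrable M ze" "AE w in M. ALL t>=0. abs (X t w) <= ze w"
  and st: "0 <= s" "s <= t" and A: "A : sets (F s)"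
 shows "expect_on A (X t) = expect_on A (X s)"
proof -
 have cX: "cont_adapted X" by (rule clm_cont[OF X])
 have "EX Y. bm Y & near t ((1/2)^Suc n) Y X" for n
  using X st unfolding clm_def by auto
 hence "ALL n. EX Y. bm Y & near t ((1/2)^Suc n) Y X" by blast
 from choice[OF this] obtain Y where Y: "!!n. bm (Y n)" "!!n. near t ((1/2)^Suc n) (Y n) X"
  by blast
 hence "ALL n. EX B. B : sets M & prob B <= (1/2)^Suc n & (AE w in M. w ~: B --> (ALL s:{0..t}. abs (Y n s w - X s w) <= (1/2)^Suc n))"
  unfolding near_def by blast
 from choice[OF this] obtain B where B: "!!n. B n : sets M" "!!n. prob (B n) <= (1/2)^Suc n"
   "!!n. AE w in M. w ~: B n --> (ALL s:{0..t}. abs (Y n s w - X s w) <= (1/2)^Suc n)"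
  by blast
 have "summable (%n. prob (B n))"
  by (rule summable_comparison_test'[of "%n. (1/2)^Suc n"]) (use B(2) in \<open>auto simp: summable_Suc_iff[of "%n. (1/2)^n"] simp del: power_Suc\<close>)
 hence ev: "AE w in M. eventually (%n. w : space M - B n) sequentially"
  using B(1) by (intro borel_cantelli_AE1) (auto simp: emeasure_eq_measure)
 have cY: "cont_adapted (Y n)" for n using Y(1) by (simp add: bm_def)
 define D where "D n = (%t w. Y n t w - X t w)" for n
 have cD: "cont_adapted (D n)" for n
  unfolding D_def using cont_adapted_diff[OF cY cX] .
 define k where "k n w = (of_bool (abs (D n 0 w) < 1) :: real)" for n w
 define W where "W n = stopped (Y n) (hit (D n) 1)" for n
 have W: "bm (W n)" for n
  unfolding W_def by (rule bm_stopped[OF Y(1) hit_stopping_time[OF cD]])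
 have k: "k n : meas (F 0)" for n
  unfolding k_def using cont_adaptedD[OF cD, of 0 n] by measurable
 have allB: "AE w in M. ALL n. w ~: B n --> (ALL s:{0..t}. abs (Y n s w - X s w) <= (1/2)^Suc n)"
  using B(3) by (simp add: AE_all_countable)
 have allD: "AE w in M. ALL n. continuous_on {0..} (%t. D n t w)"
  using AE_cont[OF cD] by (simp add: AE_all_countable)
 have lim: "(%n. \<integral>w. (indicator A w * k n w) * W n u w \<partial>M) ----> expect_on A (X u)"
  if u: "0 <= u" "u <= t" for u
 proof (rule integral_dominated_convergence[where w="%w. ze w + 1"])
  show "AE w in M. (%n. (indicator A w * k n w) * W n u w) ----> indicator A w * X u w"
   using ev allB allD
  proof eventually_elim
   case (elim w)
   have ev2: "eventually (%n. k n w = 1 & W n u w = Y n u w & abs (Y n u w - X u w) <= (1/2)^Suc n) sequentially"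
    using elim(1)
   proof eventually_elim
    case (elim n)
    hence b: "abs (D n s w) <= (1/2)^Suc n" if "s : {0..t}" for s
     using \<open>ALL n. w ~: B n --> _\<close> that by (auto simp: D_def)
    have half: "(1/2)^Suc n <= (1/2::real)" using power_decreasing[of 1 "Suc n" "1/2::real"] by simp
    have lt: "abs (D n s w) < 1" if "s : {0..t}" for s
     using b[OF that] half by linarith
    hence "~ hit (D n) 1 w <= ennreal u"
     using hit_le_iff[of "%t. D n t w" u 1] \<open>ALL n. continuous_on _ _\<close> u by force
    hence "W n u w = Y n u w" unfolding W_def stopped_def using u by (simp add: min_time_id)
    moreover have "k n w = 1" using lt[of 0] u by (simp add: k_def)
    ultimately show ?case using b[of u] u by (simp add: D_def)
   qed
   have "(%n. (1/2)^Suc n) ----> (0::real)" by (intro LIMSEQ_Suc LIMSEQ_power_zero) auto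
   hence "(%n. Y n u w - X u w) ----> 0"
    using ev2 by (elim Lim_null_comparison[rotated]) (auto elim: eventually_mono)
   hence "(%n. Y n u w) ----> X u w" by (rule LIM_zero_cancel)
   hence "(%n. indicator A w * Y n u w) ----> indicator A w * X u w"
    by (intro tendsto_intros)
   thus ?case
    by (rule Lim_transform_eventually) (rule eventually_mono[OF ev2], simp)
  qed
  show "AE w in M. norm (indicator A w * k n w * W n u w) <= ze w + 1" for n
   using ze(2) AE_cont[OF cD[of n]]
  proof eventually_elim
   case (elim w)
   define v where "v = min_time u (hit (D n) 1 w)"
   have v: "0 <= v" "ennreal v <= hit (D n) 1 w"
    using u min_time_bounds min_time_le by (auto simp: v_def)
   have "abs (W n u w) <= ze w + 1" if "abs (D n 0 w) < 1"
    using before_hit[OF elim(2) that v] elim(1)[rule_format, OF v(1)]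
    by (auto simp: W_def stopped_def v_def D_def)
   moreover have "0 <= ze w" using elim(1)[rule_format, of 0] by auto
   ultimately show ?case by (auto simp: k_def indicator_def)
  qed
  have [measurable]: "A : sets M" using sets_F[OF st(1) A] .
  have [measurable]: "k n : meas M" for n using meas_F_M[OF order_refl k] .
  have [measurable]: "W n u : meas M" "X u : meas M" for n
   using cont_adapted_M[OF _ u(1)] W cX unfolding bm_def by blast+
  show "(%w. indicator A w * X u w) : meas M" by measurable
  show "(%w. indicator A w * k n w * W n u w) : meas M" for n by measurable
  show "integrable M (%w. ze w + 1)" using ze(1) by simp
 qed
 have "(LINT w|M. (indicator A w * k n w) * W n t w) = (LINT w|M. (indicator A w * k n w) * W n s w)" for n
  by (rule bm_test[OF W st, where c=1])
   (use borel_measurable_times[OF borel_measurable_indicator[OF A] meas_F_mono[OF order_refl st(1) k]] in "auto simp: k_def split: split_indicator")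
 thus ?thesis
  using lim[of t] lim[of s] st LIMSEQ_unique by auto
qed

lemma clm_bounded_bm:
 assumes "clm X" "AE w in M. ALL t>=0. abs (X t w) <= c"
 shows "bm X"
 unfolding bm_def using clm_dominated[OF assms(1) _ assms(2)] assms clm_cont by auto

text \<open>Paths starting above the level n are set to 0; the others are bounded by n up to its hitting time.\<close>

lemma clm_localized:
 assumes "clm X"
 shows "bm (%t w. if hit X (real n) w > 0 then stopped X (hit X (real n)) t w else 0)"
proof (rule clm_bounded_bm[OF clm_cong])
 note cX = clm_cont[OF assms]
 have [measurable]: "X 0 : meas (F 0)" using cont_adaptedD[OF cX, of 0] by simp
 have "(%w. of_bool (abs (X 0 w) < real n)) : meas (F 0)" by measurable
 thus "clm (%t w. of_bool (abs (X 0 w) < real n) * stopped X (hit X (real n)) t w)"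
  using assms cX by (intro clm_mult_F0 clm_stopped hit_stopping_time)
 have pos: "hit X (real n) w > 0 <-> abs (X 0 w) < real n" if "continuous_on {0..} (traj X w)" for w
  using hit_le_iff[OF that, of 0 "real n"] by (auto simp: not_le[symmetric])
 show "AE w in M. ALL t>=0. of_bool (abs (X 0 w) < real n) * stopped X (hit X (real n)) t w =
   (if hit X (real n) w > 0 then stopped X (hit X (real n)) t w else 0)"
  using AE_cont[OF cX] by eventually_elim (auto simp: pos)
 show "AE w in M. ALL t>=0. abs (if hit X (real n) w > 0 then stopped X (hit X (real n)) t w else 0) <= real n"
  using AE_cont[OF cX]
 proof eventually_elim
  case (elim w)
  show ?case
   using before_hit[OF elim] by (auto simp: pos[OF elim] stopped_def min_time_bounds min_time_le)
 qed
qed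

lemma clm_local_martingale:
 assumes "clm X"
 shows "local_martingale M F X"
 unfolding local_martingale_def
proof (intro conjI exI[of _ "%n. hit X (real n)"] allI)
 note cX = clm_cont[OF assms]
 show "cadlag_adapted M F X"
  using cX unfolding cont_adapted_def cadlag_adapted_def
  by (auto elim!: eventually_mono intro: continuous_on_imp_cadlag_path)
 show "ext_stopping_time F (hit X (real n))" for n by (rule hit_stopping_time[OF cX])
 show "martingale M F (%t w. if 0 < hit X (real n) w then stopped X (hit X (real n)) t w else 0)" for n
  by (rule bm_martingale[OF clm_localized[OF assms]])
 show "AE w in M. incseq (%n. hit X (real n) w) & (%n. hit X (real n) w) ----> \<infinity>"
  using AE_cont[OF cX]
 proof eventually_elim
  case (elim w)
  have "incseq (%n. hit X (real n) w)"
   unfolding incseq_def hit_time_def by (intro allI impI Inf_superset_mono) force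
  moreover have "(%n. hit X (real n) w) ----> \<infinity>"
   unfolding infinity_ennreal_def tendsto_top_iff_ennreal
  proof (intro allI impI)
   fix l :: real assume "0 <= l"
   then obtain K where K: "ALL c>K. hit X c w > ennreal l" using hit_gt[OF elim] by blast
   have "K < real n" if "n > nat \<lceil>K\<rceil>" for n using that by linarith
   with K have "ennreal l < hit X (real n) w" if "n > nat \<lceil>K\<rceil>" for n using that by blast
   thus "eventually (%n. ennreal l < hit X (real n) w) sequentially"
    by (intro eventually_mono[OF eventually_gt_at_top[of "nat \<lceil>K\<rceil>"]])
  qed
  ultimately show ?case by simp
 qed
qed

subsection \<open>Inequalities for continuous local martingales\<close>

lemma clm_hit_expectation:
 assumes "clm U" "AE w in M. U 0 w = x" "abs x < c" "t >= 0"
 shows "(LINT w|M. stopped U (hit U c) t w) = x" "integrable M (stopped U (hit U c) t)"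
proof -
 note cU = clm_cont[OF assms(1)]
 have "bm (stopped U (hit U c))"
 proof (rule clm_bounded_bm[OF clm_stopped[OF assms(1) hit_stopping_time[OF cU]]])
  show "AE w in M. ALL t>=0. abs (stopped U (hit U c) t w) <= c"
   using AE_cont[OF cU] assms(2)
  proof eventually_elim
   case (elim w)
   show ?case
    using before_hit[OF elim(1)] elim(2) assms(3) by (auto simp: stopped_def min_time_bounds min_time_le)
  qed
 qed
 note b = this
 thus "integrable M (stopped U (hit U c) t)" using bm_integrable assms(4) by blast
 have "(LINT w|M. indicator (space M) w * stopped U (hit U c) t w) = (LINT w|M. indicator (space M) w * stopped U (hit U c) 0 w)"
  using b assms(4) sets.top[of "F 0"] space_F[of 0] unfolding bm_def by auto
 also have "... = (LINT w|M. x)"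
  using assms(2) cont_adapted_M[OF cU, of 0]
  by (intro integral_cong_AE) (auto simp: stopped_def elim!: eventually_mono)
 finally show "(LINT w|M. stopped U (hit U c) t w) = x"
  by (simp add: prob_space cong: Bochner_Integration.integral_cong)
qed

text \<open>Stopping at the levels n gives processes of constant expectation, and Fatou's lemma lets n go to infinity.\<close>

lemma clm_nonneg_expectation:
 assumes "clm U" "AE w in M. U 0 w = x" "AE w in M. ALL t>=0. U t w >= 0" "t >= 0"
 shows "(\<integral>\<^sup>+w. ennreal (U t w) \<partial>M) <= ennreal x"
proof -
 note cU = clm_cont[OF assms(1)]
 define V where "V n = stopped U (hit U (abs x + 1 + real n)) t" for n
 have "AE w in M. ennreal (U t w) <= liminf (%n. ennreal (V n w))"
  using AE_cont[OF cU]
 proof eventually_elim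
  case (elim w)
  obtain K where K: "ALL c>K. hit U c w > ennreal t" using hit_gt[OF elim assms(4)] by blast
  have "eventually (%n. ennreal (V n w) = ennreal (U t w)) sequentially"
   using eventually_gt_at_top[of "nat \<lceil>K\<rceil>"]
  proof eventually_elim
   case (elim n)
   hence "K < abs x + 1 + real n" by linarith
   hence "hit U (abs x + 1 + real n) w > ennreal t" using K by blast
   thus ?case using assms(4) by (simp add: V_def stopped_def min_time_id)
  qed
  hence "(%n. ennreal (V n w)) ----> ennreal (U t w)" by (rule tendsto_eventually)
  thus ?case by (simp add: lim_imp_Liminf)
 qed
 hence "(\<integral>\<^sup>+w. ennreal (U t w) \<partial>M) <= (\<integral>\<^sup>+w. liminf (%n. ennreal (V n w)) \<partial>M)"
  by (rule nn_integral_mono_AE)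
 also have "... <= liminf (%n. \<integral>\<^sup>+w. ennreal (V n w) \<partial>M)"
 proof (intro nn_integral_liminf)
  show "(%w. ennreal (V n w)) : meas M" for n
   using clm_hit_expectation(2)[OF assms(1,2) _ assms(4), of "abs x + 1 + real n"] by (auto simp: V_def)
 qed
 finally have "(\<integral>\<^sup>+w. ennreal (U t w) \<partial>M) <= liminf (%n. \<integral>\<^sup>+w. ennreal (V n w) \<partial>M)" .
 moreover have "(\<integral>\<^sup>+w. ennreal (V n w) \<partial>M) = ennreal x" for n
 proof -
  have "AE w in M. 0 <= V n w"
   using assms(3) by eventually_elim (use assms(4) in "auto simp: V_def stopped_def min_time_bounds")
  thus ?thesis
   using clm_hit_expectation[OF assms(1,2) _ assms(4), of "abs x + 1 + real n"]
   by (subst nn_integral_eq_integral) (auto simp: V_def)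
 qed
 ultimately show ?thesis by (simp add: Liminf_const)
qed

text \<open>The maximal inequality for nonnegative supermartingales: up to the hitting time of c the expectation is at most
 x, so that c is reached with probability at most x / c.\<close>

lemma clm_nonneg_bounded_paths:
 assumes "clm U" "AE w in M. U 0 w = x" "AE w in M. ALL t>=0. U t w >= 0"
 shows "AE w in M. EX K. ALL t>=0. U t w <= K"
proof -
 note cU = clm_cont[OF assms(1)]
 define E where "E c = {w:space M. EX s:{0..}. U s w > c}" for c
 define En where "En c t = {w:space M. EX s:{0..real t}. U s w : {c<..}}" for c and t :: nat
 have EnF: "En c t : sets M" for c t
  unfolding En_def by (rule ex_event_M[OF cont_right_cont[OF cU]]) auto
 have E_eq: "E c = (UN t. En c t)" for c
  unfolding E_def En_def using real_arch_simple by fastforce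
 have bound: "prob (En c t) <= abs x / c" if c: "c > abs x" for c t
 proof -
  have "prob (En c t) * c = (LINT w|M. indicator (En c t) w * c)" using EnF by simp
  also have "... <= (LINT w|M. stopped U (hit U c) (real t) w)"
  proof (rule integral_mono_AE)
   show "AE w in M. indicator (En c t) w * c <= stopped U (hit U c) (real t) w"
    using AE_cont[OF cU] assms(2,3)
   proof eventually_elim
    case (elim w)
    show ?case
    proof (cases "w : En c t")
     case True
     hence "hit U c w <= ennreal (real t)"
      using hit_le_iff[OF elim(1), of "real t" c] unfolding En_def by force
     from at_hit[OF elim(1) _ _ this] show ?thesis
      using elim c by (auto simp: stopped_def True min_time_bounds)
    qed (use elim in "auto simp: stopped_def min_time_bounds")
   qed
   show "integrable M (%w. indicator (En c t) w * c)" using EnF by (intro integrable_const_bound[where B="abs c"]) (auto simp: indicator_def)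
  qed (use clm_hit_expectation(2)[OF assms(1,2) c] in auto)
  also have "... = x" using clm_hit_expectation(1)[OF assms(1,2) c] by simp
  finally show ?thesis using c by (simp add: pos_le_divide_eq)
 qed
 have "prob (E c) <= abs x / c" if c: "c > abs x" for c
 proof -
  have "incseq (En c)" unfolding incseq_def En_def by force
  hence "(%t. prob (En c t)) ----> prob (E c)"
   unfolding E_eq using EnF by (intro finite_Lim_measure_incseq) auto
  thus ?thesis using bound[OF c] by (intro LIMSEQ_le_const2) auto
 qed
 hence le: "prob (INT n. E (real n)) <= abs x / real n" if "real n > abs x" for n
  using that EnF finite_measure_mono[of "INT n. E (real n)" "E (real n)"] unfolding E_eq by (force intro: order_trans)
 have "(%n. abs x / real n) ----> 0" by (intro lim_const_over_n)
 moreover have "eventually (%n. prob (INT n. E (real n)) <= abs x / real n) sequentially"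
  using eventually_gt_at_top[of "nat \<lceil>abs x\<rceil>"] by eventually_elim (rule le, linarith)
 ultimately have "prob (INT n. E (real n)) <= 0"
  by (intro tendsto_lowerbound[of "%n. abs x / real n"]) auto
 hence "(INT n. E (real n)) : null_sets M"
  using EnF by (auto simp: null_sets_def emeasure_eq_measure E_eq measure_le_0_iff)
 from AE_not_in[OF this] AE_space show ?thesis
  by eventually_elim (auto simp: E_def not_less)
qed

text \<open>Lenglart's inequality: stopped when Y reaches eps or A reaches dl, the process \<open>Y\<^sup>2 - A\<close> is a bounded martingale, so that
 \<open>Y\<^sup>2\<close> has expectation at most dl at that time.\<close>

lemma lenglart:
 assumes Y: "cont_adapted Y" "AE w in M. Y 0 w = 0"
  and A: "cont_adapted A" "AE w in M. A 0 w = 0"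
  and YA: "clm (%t w. (Y t w)\<^sup>2 - A t w)"
  and eps: "eps > 0" and dl: "dl > 0" and t: "t >= 0"
 shows "prob (exceeds Y t eps) <= dl / eps\<^sup>2 + prob (exceeds A t (dl / 2))"
proof -
 define T where "T = hit Y eps"
 define R where "R = hit A dl"
 define U where "U = stopped (stopped (%t w. (Y t w)\<^sup>2 - A t w) T) R"
 define u where "u w = min_time (min_time t (R w)) (T w)" for w
 have U_clm: "clm U"
  unfolding U_def T_def R_def by (intro clm_stopped YA hit_stopping_time Y A)
 define BY where "BY = {w:space M. EX s:{0..t}. Y s w : {x. abs x > eps}}"
 define BA where "BA = {w:space M. EX s:{0..t}. A s w : {x. abs x > dl / 2}}"
 have "open {x::real. abs x > e}" for e by (intro open_Collect_less continuous_intros)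
 hence BM: "BY : sets M" "BA : sets M"
  unfolding BY_def BA_def using ex_event_M[OF cont_right_cont] Y A t by blast+
 have good: "AE w in M. continuous_on {0..} (traj Y w) & continuous_on {0..} (traj A w) & Y 0 w = 0 & A 0 w = 0"
  using AE_cont[OF Y(1)] AE_cont[OF A(1)] Y(2) A(2) by eventually_elim auto
 have bds: "abs (Y v w) <= eps & abs (A v w) <= dl"
  if g: "continuous_on {0..} (traj Y w) & continuous_on {0..} (traj A w) & Y 0 w = 0 & A 0 w = 0"
   and s: "s >= 0" and v: "v = min_time (min_time s (R w)) (T w)" for v s w
 proof -
  have p: "0 <= min_time s (R w)" using s by (rule min_time_bounds(1))
  have v0: "0 <= v" unfolding v using p by (rule min_time_bounds(1))
  have "ennreal v <= ennreal (min_time s (R w))" unfolding v using p by (intro ennreal_leI min_time_bounds(2))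
  also have "... <= hit A dl w" unfolding R_def using s by (rule min_time_le)
  finally have "ennreal v <= hit A dl w" .
  moreover have "ennreal v <= hit Y eps w" unfolding v T_def using p by (rule min_time_le)
  ultimately show ?thesis
   using before_hit[of "traj Y w" eps v] before_hit[of "traj A w" dl v] g v0 eps dl by auto
 qed
 have "bm U"
 proof (rule clm_bounded_bm[OF U_clm, of "eps\<^sup>2 + dl"])
  show "AE w in M. ALL s>=0. abs (U s w) <= eps\<^sup>2 + dl"
   using good
  proof eventually_elim
   case (elim w)
   have "abs ((Y v w)\<^sup>2 - A v w) <= eps\<^sup>2 + dl" if "abs (Y v w) <= eps & abs (A v w) <= dl" for v
    using that abs_le_square_iff[of "Y v w" eps] eps zero_le_power2[of "Y v w"] by linarith
   thus ?case using bds[OF elim] by (auto simp: U_def stopped_def)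
  qed
 qed
 have EU: "(LINT w|M. U t w) = 0"
 proof -
  have "(LINT w|M. indicator (space M) w * U t w) = (LINT w|M. indicator (space M) w * U 0 w)"
   using \<open>bm U\<close> t sets.top[of "F 0"] space_F[of 0] unfolding bm_def by auto
  also have "... = (LINT w|M. 0)"
  proof (rule integral_cong_AE)
   show "(%w. indicator (space M) w * U 0 w) : meas M"
    using cont_adapted_M[OF clm_cont[OF U_clm], of 0] by (intro borel_measurable_times) auto
   show "AE w in M. indicator (space M) w * U 0 w = 0"
    using good by eventually_elim (auto simp: U_def stopped_def)
  qed simp
  finally show ?thesis by (simp cong: Bochner_Integration.integral_cong)
 qed
 have "prob (BY - BA) * eps\<^sup>2 - dl = (LINT w|M. indicator (BY - BA) w * eps\<^sup>2 - dl)"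
  using BM prob_space by (subst Bochner_Integration.integral_diff) (auto simp: emeasure_eq_measure)
 also have "... <= (LINT w|M. U t w)"
 proof (rule integral_mono_AE)
  show "integrable M (%w. indicator (BY - BA) w * eps\<^sup>2 - dl)"
   using BM eps dl by (intro Bochner_Integration.integrable_diff) (auto simp: emeasure_eq_measure)
  show "integrable M (U t)" using \<open>bm U\<close> t by (rule bm_integrable)
  show "AE w in M. indicator (BY - BA) w * eps\<^sup>2 - dl <= U t w"
   using good
  proof eventually_elim
   case (elim w)
   have U: "U t w = (Y (u w) w)\<^sup>2 - A (u w) w" by (simp add: U_def stopped_def u_def)
   have b: "abs (Y (u w) w) <= eps" "A (u w) w <= dl" using bds[OF elim t u_def] by auto
   show ?case
   proof (cases "w : BY - BA")
    case True
    hence "~ hit A dl w <= ennreal t"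
     using hit_le_iff[of "traj A w" t dl] elim t dl by (auto simp: BA_def BY_def not_le)
    hence "u w = min_time t (T w)" using t by (simp add: u_def R_def min_time_id)
    moreover have "hit Y eps w <= ennreal t"
     using True hit_le_iff[of "traj Y w" t eps] elim t by (auto simp: BY_def intro: less_imp_le)
    ultimately have "abs (Y (u w) w) = eps"
     using at_hit[of "traj Y w" eps t] elim eps t by (simp add: T_def)
    hence "(Y (u w) w)\<^sup>2 = eps\<^sup>2" by (metis power2_abs)
    thus ?thesis using True b U by simp
   qed (use b U zero_le_power2[of "Y (u w) w"] in "simp, linarith")
  qed
 qed
 finally have "prob (BY - BA) <= dl / eps\<^sup>2" using EU eps by (simp add: pos_le_divide_eq)
 moreover have "prob BY <= prob (BY - BA) + prob BA"
  using measure_Un_le[of "BY - BA" M BA] finite_measure_mono[of BY "(BY - BA) Un BA"] BM by auto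
 ultimately show ?thesis by (simp add: BY_def BA_def)
qed

end

section \<open>Regularity of martingale paths\<close>

text \<open>A greedy walk along a sequence y: the reference value is replaced whenever y has moved away
 from it by more than eps, and the replacements are counted.\<close>

fun ref_val :: "real => (nat => real) => nat => real" where
 "ref_val eps y 0 = y 0"
| "ref_val eps y (Suc i) = (if \<bar>y (Suc i) - ref_val eps y i\<bar> > eps then y (Suc i) else ref_val eps y i)"

fun moves :: "real => (nat => real) => nat => nat" where
 "moves eps y 0 = 0"
| "moves eps y (Suc i) = moves eps y i + (if \<bar>y (Suc i) - ref_val eps y i\<bar> > eps then 1 else 0)"

text \<open>Between two moves the squared distance to the reference value grows by a martingale increment plus
 the square of an increment. Summing up bounds the number of moves by the total quadratic growth, in
 place of Doob's upcrossing estimate.\<close>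

lemma moves_bound:
 "eps > 0 ==> eps\<^sup>2 * real (moves eps y n) + (y n - ref_val eps y n)\<^sup>2 <=
  (y n)\<^sup>2 - (y 0)\<^sup>2 - 2 * (SUM i<n. ref_val eps y i * (y (Suc i) - y i))"
proof (induction n)
 case (Suc n)
 show ?case
 proof (cases "abs (y (Suc n) - ref_val eps y n) > eps")
  case True
  hence "eps\<^sup>2 <= (y (Suc n) - ref_val eps y n)\<^sup>2"
   using Suc.prems abs_le_square_iff[of eps "y (Suc n) - ref_val eps y n"] by auto
  thus ?thesis using Suc True by (simp add: power2_eq_square algebra_simps)
 next
  case False
  thus ?thesis using Suc by (simp add: power2_eq_square algebra_simps)
 qed
qed simp

lemma ref_val_close: "eps > 0 ==> abs (y n - ref_val eps y n) <= eps"
 by (cases n) auto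

lemma ref_val_bound: "(!!i. abs (y i) <= c) ==> abs (ref_val eps y n) <= c"
 by (induction n) auto

lemma moves_incseq: "i <= j ==> moves eps y i <= moves eps y j"
 by (induction rule: dec_induct) auto

lemma moves_const: "i <= j ==> moves eps y j = moves eps y i ==> ref_val eps y j = ref_val eps y i"
proof (induction rule: dec_induct)
 case (step n)
 thus ?case using moves_incseq[OF step(1), of eps y] by (auto split: if_splits)
qed simp

lemma moves_less:
 assumes "eps > 0" "i <= j" "abs (y i - y j) > 2 * eps"
 shows "moves eps y i < moves eps y j"
proof (rule ccontr)
 assume "~ ?thesis"
 hence "moves eps y j = moves eps y i" using moves_incseq[OF assms(2), of eps y] by simp
 hence "ref_val eps y j = ref_val eps y i" by (rule moves_const[OF assms(2)])
 thus False
  using ref_val_close[OF assms(1), of y i] ref_val_close[OF assms(1), of y j] assms(3) by linarith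
qed

definition dyadics :: "real set" where "dyadics = {real j / 2^n | j n. True}"

lemma dyadics_nonneg: "p : dyadics ==> p >= 0"
 by (auto simp: dyadics_def)

lemma dyadicsI: "real j / 2^n : dyadics"
 by (auto simp: dyadics_def)

definition rdyad :: "nat => real => real" where
 "rdyad n t = real (Suc (nat \<lfloor>t * 2^n\<rfloor>)) / 2^n"

lemma rdyad:
 assumes "t >= 0"
 shows "rdyad n t : dyadics" "t < rdyad n t" "rdyad n t <= t + (1/2)^n"
proof -
 have f: "real (nat \<lfloor>t * 2^n\<rfloor>) = of_int \<lfloor>t * 2^n\<rfloor>" using assms by (simp add: of_nat_nat)
 show "rdyad n t : dyadics" unfolding rdyad_def by (rule dyadicsI)
 have "t * 2^n < real (Suc (nat \<lfloor>t * 2^n\<rfloor>))" using f by linarith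
 thus "t < rdyad n t" unfolding rdyad_def by (simp add: pos_less_divide_eq)
 have "real (Suc (nat \<lfloor>t * 2^n\<rfloor>)) <= t * 2^n + 1" using f by linarith
 hence "rdyad n t <= (t * 2^n + 1) / 2^n" unfolding rdyad_def by (intro divide_right_mono) auto
 thus "rdyad n t <= t + (1/2)^n" by (simp add: add_divide_distrib power_divide)
qed

lemma rdyad_tendsto: "t >= 0 ==> (%n. rdyad n t) ----> t"
proof -
 assume t: "t >= 0"
 have "(%n. t + (1/2)^n) ----> t + 0" by (intro tendsto_intros LIMSEQ_power_zero) auto
 hence "(%n. t + (1/2)^n) ----> t" by simp
 thus ?thesis
  by (rule tendsto_sandwich[OF _ _ tendsto_const, rotated 2]) (intro always_eventually allI less_imp_le rdyad t)+
qed

text \<open>\<open>fin_osc y\<close> bounds, for each eps, the number of oscillations of size eps along the dyadic times of the whole half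
 line. This is the property of martingale paths from which all their limits follow.\<close>

definition chain :: "real => (real => real) => real list => bool" where
 "chain eps y xs <-> set xs <= dyadics & successively (%p q. p < q & abs (y p - y q) > eps) xs"

definition fin_osc :: "(real => real) => bool" where
 "fin_osc y <-> (ALL eps>0. EX K. ALL xs. chain eps y xs --> length xs <= K)"

lemma dyadics_common_grid:
 assumes "finite S" "S <= dyadics"
 shows "EX n0. ALL n>=n0. ALL p:S. EX j<=4^n. p = real j / 2^n"
 using assms
proof (induction S rule: finite_induct)
 case (insert p S)
 then obtain n0 where n0: "ALL n>=n0. ALL p:S. EX j<=4^n. p = real j / 2^n" by auto
 obtain j m where p: "p = real j / 2^m" using insert.prems by (auto simp: dyadics_def)
 have "EX i<=4^n. p = real i / 2^n" if "n >= m + j" for n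
 proof (intro exI conjI)
  have "(2::real)^n = 2^(n - m) * 2^m" using that by (simp flip: power_add)
  thus "p = real (j * 2^(n - m)) / 2^n" by (simp add: p)
  have "j < 2^n" using that less_exp[of j] power_increasing[of j n "2::nat"] by linarith
  hence "j * 2^(n - m) <= 2^n * 2^n" by (intro mult_le_mono power_increasing) auto
  also have "(2::nat)^n * 2^n = 4^n" by (simp flip: power_mult_distrib)
  finally show "j * 2^(n - m) <= 4^n" .
 qed
 thus ?case using n0 by (intro exI[of _ "max n0 (m + j)"]) auto
qed auto

text \<open>Between consecutive members of a chain of oscillations larger than 2 eps the reference value must be replaced at
 least once, as it stays within eps of the sequence.\<close>

lemma chain_moves:
 assumes "chain (2 * eps) y xs" "xs ~= []" "eps > 0" "ALL p:set xs. EX j<=N. p = real j / 2^n"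
 shows "length xs <= Suc (moves eps (%j. y (real j / 2^n)) N)"
proof -
 let ?m = "moves eps (%j. y (real j / 2^n))"
 have "ALL i<=N. hd xs = real i / 2^n --> ?m i + length xs <= Suc (?m N)"
  using assms
 proof (induction xs rule: induct_list012)
  case (2 x)
  thus ?case using moves_incseq by auto
 next
  case (3 p q xs)
  have c: "chain (2 * eps) y (q # xs)" "p < q" "abs (y p - y q) > 2 * eps"
   using "3.prems" by (auto simp: chain_def)
  obtain k where k: "k <= N" "q = real k / 2^n" using "3.prems" by auto
  show ?case
  proof (intro allI impI)
   fix i assume i: "i <= N" "hd (p # q # xs) = real i / 2^n"
   hence "i <= k" using c(2) k by (simp add: divide_less_cancel)
   hence "?m i < ?m k" using moves_less[of eps i k "%j. y (real j / 2^n)"] c i k assms(3) by simp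
   moreover have "?m k + length (q # xs) <= Suc (?m N)"
    using "3.IH"(2)[OF c(1) _ assms(3)] "3.prems"(4) k by auto
   ultimately show "?m i + length (p # q # xs) <= Suc (?m N)" by simp
  qed
 qed auto
 thus ?thesis using assms(2,4) by (cases xs) auto
qed

text \<open>Without a limit from the left, from the right or at infinity, chains could be extended
 indefinitely at the corresponding end.\<close>

lemma fin_osc_append:
 assumes "fin_osc y" "eps > 0" "a : I" "!!a. a : I ==> EX p:dyadics Int I. p > a"
 shows "EX a:I. ALL p:dyadics Int I. ALL q:dyadics Int I. p > a --> q > a --> abs (y p - y q) <= eps"
proof (rule ccontr)
 assume "~ ?thesis"
 hence step: "EX p:dyadics Int I. EX q:dyadics Int I. p > a & q > a & abs (y p - y q) > eps" if "a : I" for a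
  using that unfolding not_le[symmetric] by blast
 have "EX xs. length xs = Suc k & chain (eps/2) y xs & last xs : I" for k
 proof (induction k)
  case 0
  obtain p where "p : dyadics Int I" using assms(3,4) by blast
  thus ?case by (intro exI[of _ "[p]"]) (auto simp: chain_def)
 next
  case (Suc k)
  then obtain xs where xs: "length xs = Suc k" "chain (eps/2) y xs" "last xs : I" by blast
  obtain p q where pq: "p : dyadics Int I" "q : dyadics Int I" "p > last xs" "q > last xs" "abs (y p - y q) > eps"
   using step[OF xs(3)] by blast
  hence "abs (y (last xs) - y p) > eps/2 | abs (y (last xs) - y q) > eps/2" by (smt (verit) field_sum_of_halves)
  then obtain r where "r : dyadics Int I" "r > last xs" "abs (y (last xs) - y r) > eps/2" using pq by blast
  thus ?case
   using xs by (intro exI[of _ "xs @ [r]"]) (auto simp: chain_def successively_append_iff)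
 qed
 moreover obtain K where "!!xs. chain (eps/2) y xs ==> length xs <= K"
  using assms(1,2) unfolding fin_osc_def by (meson half_gt_zero)
 ultimately show False by (metis Suc_n_not_le_n)
qed

lemma fin_osc_prepend:
 assumes "fin_osc y" "eps > 0" "t >= 0"
 shows "EX b>t. ALL p:dyadics. ALL q:dyadics. t < p --> p < b --> t < q --> q < b --> abs (y p - y q) <= eps"
proof (rule ccontr)
 assume "~ ?thesis"
 hence step: "EX p:dyadics. EX q:dyadics. t < p & p < b & t < q & q < b & abs (y p - y q) > eps" if "b > t" for b
  using that unfolding not_le[symmetric] by blast
 have "EX xs. length xs = Suc k & chain (eps/2) y xs & hd xs > t" for k
 proof (induction k)
  case 0
  thus ?case using rdyad[OF assms(3), of 0] by (intro exI[of _ "[rdyad 0 t]"]) (auto simp: chain_def)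
 next
  case (Suc k)
  then obtain xs where xs: "length xs = Suc k" "chain (eps/2) y xs" "hd xs > t" by blast
  obtain p q where pq: "p : dyadics" "q : dyadics" "t < p" "p < hd xs" "t < q" "q < hd xs" "abs (y p - y q) > eps"
   using step[OF xs(3)] by blast
  hence "abs (y p - y (hd xs)) > eps/2 | abs (y q - y (hd xs)) > eps/2" by (smt (verit) field_sum_of_halves)
  then obtain r where "r : dyadics" "r > t" "r < hd xs" "abs (y r - y (hd xs)) > eps/2" using pq by blast
  thus ?case
   using xs by (intro exI[of _ "r # xs"]) (cases xs, auto simp: chain_def)
 qed
 moreover obtain K where "!!xs. chain (eps/2) y xs ==> length xs <= K"
  using assms(1,2) unfolding fin_osc_def by (meson half_gt_zero)
 ultimately show False by (metis Suc_n_not_le_n)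
qed

lemma limit_of_oscillation:
 fixes f :: "'b => real"
 assumes "G ~= bot" "!!e. e > 0 ==> EX P. eventually P G & (ALL x y. P x & P y --> abs (f x - f y) <= e)"
 shows "EX l. (f ---> l) G"
proof -
 have "cauchy_filter (filtermap f G)"
  unfolding cauchy_filter_metric_filtermap
 proof (intro allI impI)
  fix e :: real assume e: "e > 0"
  then obtain P where "eventually P G" "ALL x y. P x & P y --> abs (f x - f y) <= e/2" using assms(2)[of "e/2"] by auto
  thus "EX P. eventually P G & (ALL x y. P x & P y --> dist (f x) (f y) < e)"
   using e by (intro exI[of _ P]) (auto simp: dist_real_def, smt (verit) field_sum_of_halves)
 qed
 then obtain l where "filtermap f G <= nhds l"
  using cauchy_filter_complete_converges[of "filtermap f G" UNIV] assms(1) complete_UNIV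
  by (auto simp: filtermap_bot_iff)
 thus ?thesis by (auto simp: filterlim_def)
qed

lemma rdyad_filterlim:
 assumes "t >= 0" shows "filterlim (%n. rdyad n t) (at t within (dyadics Int {t<..})) sequentially"
 using rdyad_tendsto[OF assms] rdyad[OF assms] unfolding filterlim_at
 by (auto intro!: always_eventually less_imp_neq[symmetric])

lemma rdyad_limit:
 assumes "!!s. s >= 0 ==> (x ---> x s) (at_right s)" "t >= 0"
 shows "(%n. x (rdyad n t)) ----> x t"
 using filterlim_compose[OF tendsto_within_subset[OF assms(1)[OF assms(2)]] rdyad_filterlim[OF assms(2)]] by blast

lemma fin_osc_right_limit:
 assumes y: "fin_osc y" and t: "t >= 0"
 shows "EX l. (y ---> l) (at t within (dyadics Int {t<..}))"
proof (rule limit_of_oscillation)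
 show "at t within (dyadics Int {t<..}) ~= bot"
  using rdyad_filterlim[OF t] unfolding filterlim_def by (metis filtermap_bot_iff le_bot sequentially_bot)
 fix e :: real assume "e > 0"
 then obtain b where b: "b > t" "ALL p:dyadics. ALL q:dyadics. t < p --> p < b --> t < q --> q < b --> abs (y p - y q) <= e"
  using fin_osc_prepend[OF y _ t, of e] by auto
 have "eventually (%p. p : dyadics & t < p & p < b) (at t within (dyadics Int {t<..}))"
  unfolding eventually_at using b(1) by (intro exI[of _ "b - t"]) (auto simp: dist_real_def)
 thus "EX P. eventually P (at t within (dyadics Int {t<..})) & (ALL x z. P x & P z --> abs (y x - y z) <= e)"
  using b(2) by blast
qed

text \<open>The right limit along dyadic times: the candidate for the cadlag version of a martingale.\<close>

definition reg :: "(real => real) => real => real" where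
 "reg y t = lim (%n. y (rdyad n t))"

lemma fin_osc_tendsto_reg:
 assumes "fin_osc y" "t >= 0"
 shows "(%n. y (rdyad n t)) ----> reg y t"
  and "eps > 0 ==> EX b>t. ALL p:dyadics. t < p --> p < b --> abs (y p - reg y t) <= eps"
proof -
 obtain l where l: "(y ---> l) (at t within (dyadics Int {t<..}))" using fin_osc_right_limit[OF assms] by blast
 from filterlim_compose[OF l rdyad_filterlim[OF assms(2)]]
 have *: "(%n. y (rdyad n t)) ----> l" .
 hence "reg y t = l" unfolding reg_def by (rule limI)
 thus "(%n. y (rdyad n t)) ----> reg y t" using * by simp
 assume "eps > 0"
 from tendstoD[OF l this] obtain d where "d > 0" "ALL p:dyadics Int {t<..}. p ~= t & dist p t < d --> dist (y p) l < eps"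
  unfolding eventually_at by blast
 thus "EX b>t. ALL p:dyadics. t < p --> p < b --> abs (y p - reg y t) <= eps"
  using \<open>reg y t = l\<close> by (intro exI[of _ "t + d"]) (auto simp: dist_real_def intro: less_imp_le)
qed

text \<open>Values of reg y are limits of values of y at dyadic times slightly later, so that one-sided limits of y
 along the dyadic times pass to reg y.\<close>

lemma cadlag_path_reg:
 assumes y: "fin_osc y"
 shows "cadlag_path (reg y)"
proof -
 have reg_in: "abs (reg y s - l) <= eps"
  if "s >= 0" "s < b" "!!p. p : dyadics ==> s < p ==> p < b ==> abs (y p - l) <= eps" for s b l eps
 proof (rule tendsto_upperbound)
  show "(%n. abs (y (rdyad n s) - l)) ----> abs (reg y s - l)" by (intro tendsto_intros fin_osc_tendsto_reg y that)
  show "eventually (%n. abs (y (rdyad n s) - l) <= eps) sequentially"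
   using order_tendstoD(2)[OF rdyad_tendsto[OF that(1)] that(2)] by eventually_elim (use that rdyad[OF that(1)] in auto)
 qed simp
 show ?thesis
  unfolding cadlag_path_def
 proof (intro conjI allI impI)
  fix t :: real assume t: "t >= 0"
  show "(reg y ---> reg y t) (at_right t)"
  proof (rule tendstoI)
   fix e :: real assume e: "e > 0"
   obtain b where b: "b > t" "!!p. p : dyadics ==> t < p ==> p < b ==> abs (y p - reg y t) <= e/2"
    using fin_osc_tendsto_reg(2)[OF y t, of "e/2"] e by auto
   have "eventually (%s. t < s & s < b) (at_right t)"
    using b(1) by (auto simp: eventually_at_right_field)
   thus "eventually (%s. dist (reg y s) (reg y t) < e) (at_right t)"
   proof eventually_elim
    case (elim s)
    hence "abs (reg y s - reg y t) <= e/2" using t b(2) by (intro reg_in[of s b]) auto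
    thus ?case using e by (simp add: dist_real_def)
   qed
  qed
 next
  fix t :: real assume t: "t > 0"
  have dense: "EX p:dyadics Int {0..<t}. p > a" if "a : {0..<t}" for a
  proof -
   have "eventually (%n. rdyad n a < t) sequentially"
    using that by (intro order_tendstoD(2)[OF rdyad_tendsto]) auto
   then obtain n where "rdyad n a < t" using eventually_happens' by force
   thus ?thesis using rdyad[of a n] that by auto
  qed
  have osc: "EX a:{0..<t}. ALL s:{a<..<t}. ALL u:{a<..<t}. abs (reg y s - reg y u) <= e" if e: "e > 0" for e
  proof -
   obtain a where a: "a : {0..<t}" "!!p q. p : dyadics Int {0..<t} ==> q : dyadics Int {0..<t} ==> p > a ==> q > a ==> abs (y p - y q) <= e"
    using fin_osc_append[OF y e, of 0 "{0..<t}"] t dense by auto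
   have "abs (reg y s - reg y u) <= e" if su: "s : {a<..<t}" "u : {a<..<t}" for s u
   proof (rule reg_in[of s t])
    fix p assume p: "p : dyadics" "s < p" "p < t"
    have "abs (reg y u - y p) <= e"
     using a p su by (intro reg_in[of u t]) auto
    thus "abs (y p - reg y u) <= e" by linarith
   qed (use su a in auto)
   with a(1) show ?thesis by (intro bexI[of _ a] ballI)
  qed
  show "EX l. (reg y ---> l) (at_left t)"
  proof (rule limit_of_oscillation)
   fix e :: real assume "e > 0"
   from osc[OF this] obtain a where a: "a < t" "ALL s:{a<..<t}. ALL u:{a<..<t}. abs (reg y s - reg y u) <= e" by auto
   have "eventually (%s. s : {a<..<t}) (at_left t)" using a(1) by (auto simp: eventually_at_left_field)
   thus "EX P. eventually P (at_left t) & (ALL x z. P x & P z --> abs (reg y x - reg y z) <= e)"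
    using a(2) by blast
  qed simp
 qed
qed

lemma fin_osc_converges:
 assumes y: "fin_osc y" and c: "continuous_on {0..} y"
 shows "EX l. (y ---> l) at_top"
proof -
 have osc: "EX a>=0. ALL s>a. ALL u>a. abs (y s - y u) <= e" if e: "e > 0" for e
 proof -
  have "EX p:dyadics Int {0..}. p > a" if "a : {0..}" for a
   using rdyad[of a 0] that by (intro bexI[of _ "rdyad 0 a"]) auto
  from fin_osc_append[OF y e _ this, of 0]
  obtain a where a: "a >= 0" "!!p q. p : dyadics ==> q : dyadics ==> p > a ==> q > a ==> abs (y p - y q) <= e"
   by (auto simp: dyadics_nonneg)
  have yl: "(%n. y (rdyad n s)) ----> y s" if "s >= 0" for s
   by (rule continuous_on_tendsto_compose[OF c rdyad_tendsto[OF that]])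
    (use that rdyad[OF that] in "auto intro!: always_eventually less_imp_le intro: order_le_less_trans")
  have "abs (y s - y u) <= e" if "s > a" "u > a" for s u
  proof (rule tendsto_upperbound)
   show "(%n. abs (y (rdyad n s) - y (rdyad n u))) ----> abs (y s - y u)" using that a by (intro tendsto_intros yl) auto
   have "s < rdyad n s" "u < rdyad n u" for n using rdyad that a by auto
   thus "eventually (%n. abs (y (rdyad n s) - y (rdyad n u)) <= e) sequentially"
    using a that rdyad by (intro always_eventually allI a(2)) (auto intro: less_trans)
  qed simp
  thus ?thesis using a(1) by blast
 qed
 show ?thesis
 proof (rule limit_of_oscillation)
  fix e :: real assume "e > 0"
  from osc[OF this] obtain a where a: "ALL s>a. ALL u>a. abs (y s - y u) <= e" by auto
  thus "EX P. eventually P at_top & (ALL x z. P x & P z --> abs (y x - y z) <= e)"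
   using eventually_gt_at_top[of a] by blast
 qed simp
qed

context usual_filtration begin

text \<open>On the grid of mesh \<open>1/2\<^sup>n\<close> the expected number of moves is at most \<open>(c / eps)\<^sup>2\<close>, because the sum of the squared moves
 differs from a squared end value by martingale increments of mean 0. The bound is uniform in n, so by Fatou's lemma
 the number of moves along almost every path stays bounded on a subsequence of grids, and any chain lies in one of them.\<close>

lemma fin_osc_bounded_martingale:
 assumes meas: "!!q. q >= 0 ==> R q : meas (F q)"
  and bnd: "!!q. q >= 0 ==> AE w in M. abs (R q w) <= c"
  and mart: "!!q r (k :: 'a => real) d. 0 <= q ==> q <= r ==> k : meas (F q) ==> AE w in M. abs (k w) <= d ==>
   (LINT w|M. k w * R r w) = (LINT w|M. k w * R q w)"
 shows "AE w in M. fin_osc (traj R w)"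
proof -
 have bnd': "AE w in M. ALL n j. abs (R (real j / 2^n) w) <= c"
  using bnd by (simp add: AE_all_countable)
 have one: "AE w in M. EX K. ALL xs. chain (2 * eps) (traj R w) xs --> length xs <= K" if eps: "eps > 0" for eps
 proof -
  define y where "y n w j = R (real j / 2^n) w" for n :: nat and w and j :: nat
  define mv where "mv n w = moves eps (y n w) (4^n)" for n w
  have y: "(%w. y n w j) : meas (F (real i / 2^n))" if "j <= i" for n i j
   unfolding y_def using that by (intro meas_F_mono[OF _ _ meas]) (auto intro: divide_right_mono)
  have r: "(%w. ref_val eps (y n w) j) : meas (F (real i / 2^n))" if "j <= i" for n i j
   using that
  proof (induction j)
   case (Suc j)
   have [measurable]: "(%w. ref_val eps (y n w) j) : meas (F (real i / 2^n))" using Suc by simp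
   have [measurable]: "(%w. y n w (Suc j)) : meas (F (real i / 2^n))" using y Suc.prems by blast
   show ?case by simp
  qed (use y in auto)
  have [measurable]: "(%w. y n w j) : meas M" for n j
   using meas_F_M[OF _ y[OF order_refl]] by simp
  have [measurable]: "(%w. ref_val eps (y n w) j) : meas M" for n j
   using meas_F_M[OF _ r[OF order_refl]] by simp
  have mvM: "(%w. real (moves eps (y n w) j)) : meas M" for n j
   by (induction j) (auto intro!: borel_measurable_add measurable_If)
  have mvE: "(%w. ennreal (real (mv n w))) : meas M" for n
   unfolding mv_def using mvM by simp
  have yb: "AE w in M. ALL n j. abs (y n w j) <= c & abs (ref_val eps (y n w) j) <= c"
   using bnd' by eventually_elim (auto simp: y_def intro!: ref_val_bound)
  have int_ry: "integrable M (%w. ref_val eps (y n w) i * y n w j)" for n i j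
   using yb by (intro integrable_const_bound[where B="c * c"])
    (auto simp: abs_mult intro!: mult_mono order_trans[OF abs_ge_zero] elim!: eventually_mono)
  have int_yy: "integrable M (%w. (y n w j)\<^sup>2)" "(LINT w|M. (y n w j)\<^sup>2) <= c\<^sup>2" for n j
  proof -
   have le: "AE w in M. (y n w j)\<^sup>2 <= c\<^sup>2"
    using yb by eventually_elim (metis abs_ge_zero power2_abs power_mono)
   thus 1: "integrable M (%w. (y n w j)\<^sup>2)" by (intro integrable_const_bound[where B="c\<^sup>2"]) auto
   show "(LINT w|M. (y n w j)\<^sup>2) <= c\<^sup>2"
    using integral_mono_AE[OF 1 _ le] prob_space by simp
  qed
  have rb: "AE w in M. abs (ref_val eps (y n w) i) <= c" for n i
   using yb by eventually_elim simp
  have zero: "(LINT w|M. ref_val eps (y n w) i * (y n w (Suc i) - y n w i)) = 0" for n i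
  proof -
   have "(LINT w|M. ref_val eps (y n w) i * y n w (Suc i)) = (LINT w|M. ref_val eps (y n w) i * y n w i)"
    unfolding y_def[of n _ "Suc i"] y_def[of n _ i]
    by (rule mart[OF _ _ r[OF order_refl] rb]) (auto intro: divide_right_mono)
   thus ?thesis using int_ry[of n i i] int_ry[of n i "Suc i"] by (simp add: right_diff_distrib)
  qed
  have Emv: "(\<integral>\<^sup>+w. ennreal (real (mv n w)) \<partial>M) <= ennreal (c\<^sup>2 / eps\<^sup>2)" for n
  proof -
   define G where "G w = (y n w (4^n))\<^sup>2 - (y n w 0)\<^sup>2 - 2 * (SUM i<4^n. ref_val eps (y n w) i * (y n w (Suc i) - y n w i))" for w
   have intS: "integrable M (%w. ref_val eps (y n w) i * (y n w (Suc i) - y n w i))" for i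
    using int_ry[of n i i] int_ry[of n i "Suc i"] by (simp add: right_diff_distrib)
   have G: "integrable M G" "(LINT w|M. G w) <= c\<^sup>2"
   proof -
    show "integrable M G" unfolding G_def using int_yy(1) intS by auto
    have "(LINT w|M. G w) = (LINT w|M. (y n w (4^n))\<^sup>2) - (LINT w|M. (y n w 0)\<^sup>2)"
     unfolding G_def using int_yy(1) intS by (simp add: Bochner_Integration.integral_sum zero)
    also have "... <= c\<^sup>2 - 0" by (intro diff_mono int_yy) simp
    finally show "(LINT w|M. G w) <= c\<^sup>2" by simp
   qed
   have le: "eps\<^sup>2 * real (mv n w) <= G w" for w
    unfolding G_def mv_def using moves_bound[OF eps, of "y n w" "4^n"] zero_le_power2[of "y n w (4^n) - ref_val eps (y n w) (4^n)"] by linarith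
   have le': "real (mv n w) <= G w / eps\<^sup>2" for w
    using le[of w] eps by (simp add: pos_le_divide_eq mult.commute)
   hence G0: "0 <= G w / eps\<^sup>2" for w by (meson of_nat_0_le_iff order_trans)
   have "(\<integral>\<^sup>+w. ennreal (real (mv n w)) \<partial>M) <= (\<integral>\<^sup>+w. ennreal (G w / eps\<^sup>2) \<partial>M)"
    using le' by (intro nn_integral_mono ennreal_leI)
   also have "... = ennreal (LINT w|M. G w / eps\<^sup>2)"
    using G(1) G0 by (intro nn_integral_eq_integral) auto
   also have "... <= ennreal (c\<^sup>2 / eps\<^sup>2)"
    using G(2) by (intro ennreal_leI) (simp add: divide_right_mono)
   finally show ?thesis .
  qed
  have "(\<integral>\<^sup>+w. liminf (%n. ennreal (real (mv n w))) \<partial>M) <= liminf (%n. \<integral>\<^sup>+w. ennreal (real (mv n w)) \<partial>M)"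
   using mvE by (rule nn_integral_liminf)
  also have "... <= limsup (%n. \<integral>\<^sup>+w. ennreal (real (mv n w)) \<partial>M)" by (intro Liminf_le_Limsup) simp
  also have "... <= ennreal (c\<^sup>2 / eps\<^sup>2)" using Emv by (intro Limsup_bounded always_eventually) auto
  finally have "(\<integral>\<^sup>+w. liminf (%n. ennreal (real (mv n w))) \<partial>M) ~= \<infinity>" by (auto simp: top_unique)
  hence "AE w in M. liminf (%n. ennreal (real (mv n w))) ~= \<infinity>"
   using mvE by (intro nn_integral_PInf_AE borel_measurable_liminf)
  thus ?thesis
  proof eventually_elim
   case (elim w)
   then obtain C where C: "C >= 0" "liminf (%n. ennreal (real (mv n w))) = ennreal C"
    by (cases "liminf (%n. ennreal (real (mv n w)))") auto
   have fr: "EX n>=n0. real (mv n w) < C + 1" for n0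
   proof (rule ccontr)
    assume "~ ?thesis"
    hence "eventually (%n. ennreal (C + 1) <= ennreal (real (mv n w))) sequentially"
     unfolding eventually_sequentially using C by (intro exI[of _ n0]) (auto intro!: ennreal_leI simp: not_less simp del: ennreal_plus)
    hence "ennreal (C + 1) <= ennreal C" using C(2) by (metis Liminf_bounded)
    thus False using C(1) by (simp add: ennreal_le_iff)
   qed
   have "length xs <= Suc (nat \<lceil>C + 1\<rceil>)" if xs: "chain (2 * eps) (traj R w) xs" for xs
   proof (cases "xs = []")
    case False
    obtain n0 where n0: "ALL n>=n0. ALL p:set xs. EX j<=4^n. p = real j / 2^n"
     using dyadics_common_grid[of "set xs"] xs by (auto simp: chain_def)
    obtain n where n: "n >= n0" "real (mv n w) < C + 1" using fr by blast
    have "length xs <= Suc (mv n w)"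
     unfolding mv_def y_def using chain_moves[OF xs False eps, of "4^n" n] n0 n by auto
    thus ?thesis using n(2) by linarith
   qed simp
   thus ?case by blast
  qed
 qed
 have "AE w in M. ALL k. EX K. ALL xs. chain (2 * (1 / real (Suc k))) (traj R w) xs --> length xs <= K"
  unfolding AE_all_countable by (intro allI one) simp
 thus ?thesis
 proof eventually_elim
  case (elim w)
  show ?case
   unfolding fin_osc_def
  proof (intro allI impI)
   fix e :: real assume "e > 0"
   then obtain k where k: "1 / real (Suc k) < e / 2" using nat_approx_posE[of "e/2"] by auto
   obtain K where K: "ALL xs. chain (2 * (1 / real (Suc k))) (traj R w) xs --> length xs <= K" using elim by blast
   have "chain (2 * (1 / real (Suc k))) (traj R w) xs" if "chain e (traj R w) xs" for xs
    unfolding chain_def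
    using that[unfolded chain_def] successively_mono[OF conjunct2[OF that[unfolded chain_def]]] k by auto
   thus "EX K. ALL xs. chain e (traj R w) xs --> length xs <= K" using K by blast
  qed
 qed
qed

lemma bm_converges:
 assumes "bm X"
 shows "AE w in M. EX l. (traj X w ---> l) at_top"
proof -
 obtain c where c: "c > 0" "cont_adapted X" "AE w in M. ALL t>=0. abs (X t w) <= c" using bmE[OF assms(1)] by blast
 have "AE w in M. fin_osc (traj X w)"
 proof (rule fin_osc_bounded_martingale[where c=c])
  show "AE w in M. abs (X q w) <= c" if "q >= 0" for q
   using c(3) by eventually_elim (use that in simp)
 qed (use cont_adaptedD[OF c(2)] bm_test[OF assms] in blast)+
 thus ?thesis
  using AE_cont[OF c(2)] by eventually_elim (rule fin_osc_converges)
qed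

text \<open>Conditional expectations at the dyadic times form a discrete martingale with finitely many oscillations; its right
 limits are a cadlag version, and right-continuity of the filtration keeps it adapted.\<close>

lemma martingale_of_bounded:
 fixes xi :: "'a => real"
 assumes [measurable]: "xi : meas M" and bnd: "AE w in M. abs (xi w) <= c"
 obtains N where "martingale M F N" "!!t. t >= 0 ==> AE w in M. real_cond_exp M (F t) xi w = N t w"
  "AE w in M. ALL t>=0. abs (N t w) <= c"
proof -
 define R where "R q = real_cond_exp M (F q) xi" for q
 have intxi: "integrable M xi" using bnd by (intro integrable_const_bound[where B=c]) auto
 have Rm: "R q : meas (F q)" for q unfolding R_def by simp
 have RM: "R q : meas M" for q unfolding R_def by simp
 have Rb: "AE w in M. abs (R q w) <= c" if "q >= 0" for q
 proof -
  interpret sigma_finite_subalgebra M "F q" by (rule sigma_finite_F[OF that])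
  have "AE w in M. R q w >= -c" unfolding R_def
   by (rule real_cond_exp_ge_c[OF intxi]) (use bnd in "auto elim: eventually_mono")
  moreover have "AE w in M. R q w <= c" unfolding R_def
   by (rule real_cond_exp_le_c[OF intxi]) (use bnd in "auto elim: eventually_mono")
  ultimately show ?thesis by eventually_elim auto
 qed
 have test: "(LINT w|M. k w * R q w) = (LINT w|M. k w * xi w)"
  if "q >= 0" "k : meas (F q)" "AE w in M. abs (k w) <= d" for q d and k :: "'a => real"
  by (rule test_of_cond_exp[symmetric, OF that(1) intxi that(2,3)]) (auto simp: R_def)
 have osc: "AE w in M. fin_osc (traj R w)"
 proof (rule fin_osc_bounded_martingale[OF Rm Rb])
  fix q r d :: real and k :: "'a => real" assume a: "0 <= q" "q <= r" "k : meas (F q)" "AE w in M. abs (k w) <= d"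
  hence "k : meas (F r)" using meas_F_mono by blast
  thus "(LINT w|M. k w * R r w) = (LINT w|M. k w * R q w)"
   using test[of r k d] test[of q k d] a by simp
 qed
 define N where "N t w = reg (traj R w) t" for t w
 have lim: "AE w in M. (%n. R (rdyad n t) w) ----> N t w" if "t >= 0" for t
  using osc by eventually_elim (auto simp: N_def intro: fin_osc_tendsto_reg that)
 have Nm: "N t : meas (F t)" if t: "t >= 0" for t
 proof (rule right_meas_F[OF _ t])
  fix s assume s: "s > t"
  obtain n0 where n0: "!!n. n >= n0 ==> rdyad n t < s"
   using order_tendstoD(2)[OF rdyad_tendsto[OF t] s] by (auto simp: eventually_sequentially)
  show "N t : meas (F s)"
  proof (rule AE_lim_meas_F)
   have "0 <= rdyad n t" for n using rdyad(2)[OF t, of n] t by linarith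
   thus "R (rdyad (n + n0) t) : meas (F s)" for n
    using n0[of "n + n0"] by (intro meas_F_mono[OF _ _ Rm]) auto
   show "AE w in M. (%n. R (rdyad (n + n0) t) w) ----> N t w"
    using lim[OF t] by eventually_elim (rule LIMSEQ_ignore_initial_segment)
  qed (use s t in auto)
 qed
 have Rb': "AE w in M. ALL q:dyadics. abs (R q w) <= c"
 proof -
  have "countable dyadics"
   unfolding dyadics_def by (rule countable_subset[of _ "range (%(j::nat, n::nat). real j / 2^n)"]) auto
  thus ?thesis using Rb dyadics_nonneg by (subst AE_ball_countable) auto
 qed
 have Nb: "AE w in M. ALL t>=0. abs (N t w) <= c"
  using osc Rb'
 proof eventually_elim
  case (elim w)
  show ?case
  proof (intro allI impI)
   fix t :: real assume t: "t >= 0"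
   show "abs (N t w) <= c"
   proof (rule tendsto_upperbound)
    show "(%n. abs (R (rdyad n t) w)) ----> abs (N t w)"
     unfolding N_def by (intro tendsto_intros fin_osc_tendsto_reg elim t)
   qed (use elim rdyad[OF t] in auto)
  qed
 qed
 have Ntest: "(LINT w|M. indicator A w * xi w) = expect_on A (N t)"
  if t: "t >= 0" and A: "A : sets (F t)" for t A
 proof (rule LIMSEQ_unique)
  have AM: "A : sets M" using sets_F[OF t A] .
  show "(%n. \<integral>w. indicator A w * R (rdyad n t) w \<partial>M) ----> expect_on A (N t)"
  proof (rule integral_dominated_convergence[where w="%_. c"])
   show "AE w in M. (%n. indicator A w * R (rdyad n t) w) ----> indicator A w * N t w"
    using lim[OF t] by eventually_elim (intro tendsto_intros)
   show "AE w in M. norm (indicator A w * R (rdyad n t) w) <= c" for n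
    using Rb' by eventually_elim (use rdyad[OF t] in "auto simp: indicator_def intro: order_trans[OF abs_ge_zero]")
  qed (use AM RM meas_F_M[OF t Nm[OF t]] in auto)
  have "(LINT w|M. indicator A w * R (rdyad n t) w) = (LINT w|M. indicator A w * xi w)" for n
  proof (rule test)
   show "AE w in M. abs (indicator A w) <= (1::real)" by (simp add: indicator_def)
   show "indicator A : meas (F (rdyad n t))"
    using sets_F_mono[OF t _ A, of "rdyad n t"] rdyad[OF t, of n] by simp
  qed (use rdyad(2)[OF t, of n] t in "auto simp: indicator_def")
  thus "(%n. \<integral>w. indicator A w * R (rdyad n t) w \<partial>M) ----> (LINT w|M. indicator A w * xi w)" by simp
 qed
 have intN: "integrable M (N t)" if "t >= 0" for t
  using Nb meas_F_M[OF that Nm[OF that]] that by (intro integrable_const_bound[where B=c]) (auto elim: eventually_mono)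
 show thesis
 proof (rule that[OF _ _ Nb])
  show "AE w in M. real_cond_exp M (F t) xi w = N t w" if "t >= 0" for t
   by (rule cond_exp_of_tests[OF that intxi intN[OF that] Nm[OF that] Ntest[OF that]])
  have "AE w in M. real_cond_exp M (F s) (N t) w = N s w" if st: "0 <= s" "s <= t" for s t
  proof (rule cond_exp_of_tests)
   fix A assume A: "A : sets (F s)"
   show "expect_on A (N t) = expect_on A (N s)"
    using Ntest[of t A] Ntest[of s A] sets_F_mono[OF st A] A st by simp
  qed (use st intN Nm in auto)
  moreover have "AE w in M. cadlag_path (traj N w)"
   using osc by eventually_elim (simp add: N_def cadlag_path_reg)
  ultimately show "martingale M F N"
   using Nm intN by (auto simp: martingale_def cadlag_adapted_def adapted_def)
 qed
qed

text \<open>The first time (among finitely many) at which a condition holds splits the event that it ever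
 holds into pieces known at that time. This gives the maximal inequalities below.\<close>

lemma first_passage_finite:
 fixes f g :: "'a => real"
 assumes "finite S" "S <= {0..}" "!!s. s : S ==> {w:space M. P s w} : sets (F s)"
  and "integrable M f" "integrable M g"
  and le: "!!s A. s : S ==> A : sets (F s) ==> A <= {w:space M. P s w} ==>
   (LINT w|M. indicator A w * f w) <= (LINT w|M. indicator A w * g w)"
 shows "(LINT w|M. indicator {w:space M. EX s:S. P s w} w * f w) <= (LINT w|M. indicator {w:space M. EX s:S. P s w} w * g w)"
 using assms(1,2,3,6)
proof (induction S rule: finite_linorder_max_induct)
 case (insert b S)
 define B where "B = {w:space M. EX s:S. P s w}"
 define C where "C = {w:space M. P b w} - B"
 have b: "b >= 0" using insert by auto
 have Beq: "B = (UN s:S. {w:space M. P s w})" by (auto simp: B_def)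
 have "{w:space M. P s w} : sets (F b)" if "s : S" for s
 proof (rule sets_F_mono[of s b])
  show "{w:space M. P s w} : sets (F s)" using insert.prems(2) that by blast
 qed (use insert that in "auto intro: less_imp_le")
 hence BF: "B : sets (F b)" unfolding Beq using insert.hyps by (intro sets.finite_UN) auto
 have CF: "C : sets (F b)" unfolding C_def using BF insert.prems(2)[of b] by auto
 have BC[measurable]: "B : sets M" "C : sets M" using sets_F[OF b] BF CF by auto
 have un: "{w:space M. EX s:insert b S. P s w} = B Un C" "B Int C = {}" by (auto simp: B_def C_def)
 have split: "(LINT w|M. indicator (B Un C) w * h w) = (LINT w|M. indicator B w * h w) + (LINT w|M. indicator C w * h w)"
  if "integrable M h" for h :: "'a => real"
 proof -
  have "integrable M (%w. indicator B w * h w)" "integrable M (%w. indicator C w * h w)"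
   using integrable_mult_indicator[OF BC(1) that] integrable_mult_indicator[OF BC(2) that] by auto
  thus ?thesis
   by (simp add: indicator_add[OF un(2), symmetric] distrib_right)
 qed
 have "(LINT w|M. indicator B w * f w) <= (LINT w|M. indicator B w * g w)"
  unfolding B_def using insert.prems by (intro insert.IH) auto
 moreover have "(LINT w|M. indicator C w * f w) <= (LINT w|M. indicator C w * g w)"
  using insert.prems(3)[of b C] CF by (auto simp: C_def)
 ultimately show ?case unfolding un using split assms(4,5) by simp
qed simp

lemma first_passage:
 fixes f g :: "'a => real"
 assumes P: "!!s. 0 <= s ==> s <= t ==> {w:space M. P s w} : sets (F s)"
  and fg: "integrable M f" "integrable M g"
  and le: "!!s A. 0 <= s ==> s <= t ==> A : sets (F s) ==> A <= {w:space M. P s w} ==>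
   (LINT w|M. indicator A w * f w) <= (LINT w|M. indicator A w * g w)"
 shows "{w:space M. EX s:dyadics Int {0..t}. P s w} : sets M"
  and "(LINT w|M. indicator {w:space M. EX s:dyadics Int {0..t}. P s w} w * f w) <=
    (LINT w|M. indicator {w:space M. EX s:dyadics Int {0..t}. P s w} w * g w)"
proof -
 define S where "S n = {real j / 2^n | j. j <= 4^n} Int {0..t}" for n :: nat
 define B where "B n = {w:space M. EX s:S n. P s w}" for n
 define Bi where "Bi = {w:space M. EX s:dyadics Int {0..t}. P s w}"
 have fin: "finite (S n)" for n unfolding S_def by (intro finite_Int disjI1) (auto simp: setcompr_eq_image)
 have Sd: "S n <= dyadics" for n by (auto simp: S_def dyadicsI)
 have B: "B n : sets M" for n
 proof -
  have "B n = (UN s:S n. {w:space M. P s w})" by (auto simp: B_def)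
  also have "... : sets M" by (intro sets.finite_UN fin sets_F[OF _ P]) (auto simp: S_def)
  finally show ?thesis .
 qed
 have ev: "eventually (%n. w : B n <-> w : Bi) sequentially" for w
 proof (cases "w : Bi")
  case True
  then obtain s where s: "s : dyadics" "s : {0..t}" "P s w" "w : space M" by (auto simp: Bi_def)
  obtain n0 where "ALL n>=n0. EX j<=4^n. s = real j / 2^n" using dyadics_common_grid[of "{s}"] s by auto
  hence "s : S n" if "n >= n0" for n using that s(2) by (auto simp: S_def)
  thus ?thesis using s True unfolding eventually_sequentially by (intro exI[of _ n0]) (auto simp: B_def)
 next
  case False
  hence "w ~: B n" for n using Sd by (auto simp: Bi_def B_def S_def)
  thus ?thesis using False by simp
 qed
 show Bi: "Bi : sets M"
 proof -
  have "Bi = (UN n. B n)"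
  proof (intro set_eqI iffI)
   fix w assume "w : Bi"
   hence "eventually (%n. w : B n) sequentially" using ev[of w] by simp
   thus "w : (UN n. B n)" using eventually_happens' by force
  qed (use Sd in "auto simp: B_def Bi_def S_def")
  thus ?thesis using B by auto
 qed
 have lim: "(%n. \<integral>w. indicator (B n) w * h w \<partial>M) ----> (LINT w|M. indicator Bi w * h w)" if h: "integrable M h" for h :: "'a => real"
 proof (rule integral_dominated_convergence[where w="%w. abs (h w)"])
  show "AE w in M. (%n. indicator (B n) w * h w) ----> indicator Bi w * h w"
  proof (rule AE_I2)
   fix w show "(%n. indicator (B n) w * h w) ----> indicator Bi w * h w"
    by (rule tendsto_eventually) (use ev[of w] in "auto elim!: eventually_mono simp: indicator_def")
  qed
 qed (use h B Bi in "auto simp: indicator_def")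
 show "(LINT w|M. indicator Bi w * f w) <= (LINT w|M. indicator Bi w * g w)"
 proof (rule LIMSEQ_le[OF lim[OF fg(1)] lim[OF fg(2)]])
  have "(LINT w|M. indicator (B n) w * f w) <= (LINT w|M. indicator (B n) w * g w)" for n
   unfolding B_def by (rule first_passage_finite[OF fin _ _ fg]) (use P le in "auto simp: S_def")
  thus "EX N. ALL n>=N. (LINT w|M. indicator (B n) w * f w) <= (LINT w|M. indicator (B n) w * g w)" by blast
 qed
qed

text \<open>A right-continuous path is determined by its values at the countably many dyadic times.\<close>

lemma AE_all_times:
 assumes X: "right_cont X" and C: "closed C" and t: "!!t. t >= 0 ==> AE w in M. X t w : C"
 shows "AE w in M. ALL t>=0. X t w : C"
proof -
 have "AE w in M. ALL s:dyadics. X s w : C"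
 proof (subst AE_ball_countable)
  show "countable dyadics" unfolding dyadics_def by (rule countable_subset[of _ "range (%(j::nat, n::nat). real j / 2^n)"]) auto
 qed (use t dyadics_nonneg in blast)
 thus ?thesis
  using X[unfolded right_cont_def, THEN conjunct2]
 proof eventually_elim
  case (elim w)
  show ?case
  proof (intro allI impI)
   fix s :: real assume s: "s >= 0"
   have "X (rdyad n s) w : C" for n using elim(1) rdyad(1)[OF s] by blast
   thus "X s w : C" by (rule closed_sequentially[OF C _ rdyad_limit[of "traj X w", OF _ s]]) (use elim(2) in blast)
  qed
 qed
qed

end

section \<open>Filtrations all of whose martingales are continuous\<close>

locale continuous_filtration = usual_filtration +
 assumes martingale_continuous: "martingale M F N ==> AE w in M. continuous_on {0..} (traj N w)"
begin

lemma bm_of_bounded: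
 fixes xi :: "'a => real"
 assumes "xi : meas M" "AE w in M. abs (xi w) <= c"
 obtains N where "bm N" "!!t. t >= 0 ==> AE w in M. real_cond_exp M (F t) xi w = N t w"
proof -
 obtain N where N: "martingale M F N" "!!t. t >= 0 ==> AE w in M. real_cond_exp M (F t) xi w = N t w"
  "AE w in M. ALL t>=0. abs (N t w) <= c" using martingale_of_bounded[OF assms] by blast
 have "expect_on A (N t) = expect_on A (N s)" if "0 <= s" "s <= t" "A : sets (F s)" for s t A
  by (rule test_of_cond_exp[of s, where c=1])
   (use that N(1) in "auto simp: martingale_def cadlag_adapted_def adapted_M")
 hence "bm N"
  using N martingale_continuous[OF N(1)]
  by (auto simp: bm_def cont_adapted_def martingale_def cadlag_adapted_def)
 thus thesis using that N(2) by blast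
qed

text \<open>A martingale is approximated by those with truncated terminal value, by Doob's maximal
 inequality.\<close>

lemma martingale_clm:
 assumes X: "martingale M F X"
 shows "clm X"
 unfolding clm_def
proof (intro conjI allI impI)
 have ad: "adapted F X" using X by (simp add: martingale_def cadlag_adapted_def)
 show cX: "cont_adapted X" using martingale_continuous[OF X] ad by (simp add: cont_adapted_def)
 fix T e :: real assume T: "T >= 0" and e: "e > 0"
 define xi where "xi = X (T + 1)"
 have intxi: "integrable M xi" using X T by (auto simp: martingale_def xi_def)
 define xin where "xin n w = (if \<bar>xi w\<bar> <= real n then xi w else 0)" for n w
 have mxin: "xin n : meas M" for n
  unfolding xin_def using intxi by measurable
 have "(%n. \<integral>w. abs (xi w - xin n w) \<partial>M) ----> (LINT w|M. 0)"
 proof (rule integral_dominated_convergence[where w="%w. abs (xi w)"])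
  show "AE w in M. (%n. abs (xi w - xin n w)) ----> 0"
  proof (rule AE_I2)
   fix w
   have "abs (xi w - xin n w) = 0" if "n >= nat \<lceil>abs (xi w)\<rceil>" for n
   proof -
    have "abs (xi w) <= real n" using that by linarith
    thus ?thesis by (simp add: xin_def)
   qed
   thus "(%n. abs (xi w - xin n w)) ----> 0"
    by (intro tendsto_eventually eventually_sequentiallyI)
  qed
 qed (use intxi mxin in "auto simp: xin_def")
 hence "eventually (%n. (LINT w|M. abs (xi w - xin n w)) < e * e) sequentially"
  using e by (intro order_tendstoD) auto
 then obtain n where n: "(LINT w|M. abs (xi w - xin n w)) < e * e" using eventually_happens' by force
 have bxin: "AE w in M. abs (xin n w) <= real n" by (auto simp: xin_def)
 obtain N where N: "bm N" "!!t. t >= 0 ==> AE w in M. real_cond_exp M (F t) (xin n) w = N t w"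
  using bm_of_bounded[OF mxin bxin] by blast
 have cN: "cont_adapted N" using N(1) by (simp add: bm_def)
 define D where "D s w = N s w - X s w" for s w
 have cD: "cont_adapted D" unfolding D_def[abs_def] by (intro cont_adapted_diff cN cX)
 define B where "B = {w:space M. EX s:dyadics Int {0..T+1}. abs (D s w) > e}"
 have intxin: "integrable M (xin n)" using bxin mxin by (intro integrable_const_bound[where B="real n"]) auto
 have test: "(LINT w|M. k w * D s w) = (LINT w|M. k w * (xin n w - xi w))"
  if s: "0 <= s" "s <= T + 1" and k: "k : meas (F s)" "AE w in M. abs (k w) <= 1" for s k
 proof -
  have kM: "k : meas M" using meas_F_M[OF s(1) k(1)] .
  have "(LINT w|M. k w * xin n w) = (LINT w|M. k w * N s w)"
   by (rule test_of_cond_exp[OF s(1) intxin k N(2)[OF s(1)] cont_adapted_M[OF cN s(1)]])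
  moreover have "(LINT w|M. k w * xi w) = (LINT w|M. k w * X s w)"
   by (rule test_of_cond_exp[OF s(1) intxi k _ cont_adapted_M[OF cX s(1)]]) (use X s in "auto simp: martingale_def xi_def")
  moreover have "integrable M (X s)" "integrable M (N s)" using X s N(1) bm_integrable by (auto simp: martingale_def)
  ultimately show ?thesis
   using integrable_bounded_mult[OF _ kM k(2)] intxi intxin by (simp add: D_def right_diff_distrib)
 qed
 have P: "{w:space M. abs (D s w) > e} : sets (F s)" if s: "0 <= s" "s <= T + 1" for s
 proof -
  have [measurable]: "D s : meas (F s)" using cont_adaptedD[OF cD s(1)] .
  have "{w:space (F s). abs (D s w) > e} : sets (F s)" by measurable
  thus ?thesis using space_F[OF s(1)] by simp
 qed
 have le: "(LINT w|M. indicator A w * e) <= (LINT w|M. indicator A w * abs (xi w - xin n w))"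
  if s: "0 <= s" "s <= T + 1" and A: "A : sets (F s)" "A <= {w:space M. abs (D s w) > e}" for s A
 proof -
  have [measurable]: "D s : meas (F s)" using cont_adaptedD[OF cD s(1)] .
  have AM[measurable]: "A : sets M" using sets_F[OF s(1) A(1)] .
  define k where "k w = indicator A w * sgn (D s w)" for w
  have k: "k : meas (F s)" "AE w in M. abs (k w) <= 1"
   unfolding k_def using A(1) by (auto simp: indicator_def sgn_if)
  have kM[measurable]: "k : meas M" using meas_F_M[OF s(1) k(1)] .
  have intD: "integrable M (D s)" using X s N(1) bm_integrable by (auto simp: martingale_def D_def[abs_def])
  have "(LINT w|M. indicator A w * e) <= (LINT w|M. k w * D s w)"
  proof (rule integral_mono_AE)
   show "integrable M (%w. k w * D s w)" by (rule integrable_bounded_mult[OF intD kM k(2)])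
   show "AE w in M. indicator A w * e <= k w * D s w"
    using A(2) by (intro AE_I2) (auto simp: k_def indicator_def sgn_if)
  qed (use AM in "auto simp: emeasure_eq_measure")
  also have "... = (LINT w|M. k w * (xin n w - xi w))" by (rule test[OF s k])
  also have "... <= (LINT w|M. indicator A w * abs (xi w - xin n w))"
   using integrable_mult_indicator[OF AM, of "%w. abs (xi w - xin n w)"] intxi intxin
   by (intro integral_mono_AE integrable_bounded_mult[OF _ kM k(2)]) (auto simp: k_def indicator_def sgn_if)
  finally show ?thesis .
 qed
 have intxixin: "integrable M (%w. abs (xi w - xin n w))" using intxi intxin by simp
 note fp = first_passage[OF P _ intxixin le, simplified]
 have BM: "B : sets M" and Be: "prob B * e <= (LINT w|M. indicator B w * abs (xi w - xin n w))"
  using fp by (simp_all add: B_def)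
 note Be
 also have "(LINT w|M. indicator B w * abs (xi w - xin n w)) <= (LINT w|M. abs (xi w - xin n w))"
  using integrable_mult_indicator[OF BM, of "%w. abs (xi w - xin n w)"] intxi intxin
  by (intro integral_mono) (auto simp: indicator_def)
 also note n
 finally have "prob B <= e" using e by simp
 moreover have "AE w in M. w ~: B --> (ALL s:{0..T}. abs (N s w - X s w) <= e)"
  using AE_cont[OF cD] AE_space
 proof eventually_elim
  case (elim w)
  show ?case
  proof (intro impI ballI)
   fix s assume nB: "w ~: B" and s: "s : {0..T}"
   hence s0: "s >= 0" by simp
   have pos: "0 <= rdyad n s" for n using rdyad(2)[OF s0, of n] s0 by linarith
   have "abs (D s w) <= e"
   proof (rule tendsto_upperbound)
    have "(%n. D (rdyad n s) w) ----> D s w"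
     by (rule continuous_on_tendsto_compose[OF elim(1) rdyad_tendsto[OF s0]]) (use s0 pos in auto)
    thus "(%n. abs (D (rdyad n s) w)) ----> abs (D s w)" by (rule tendsto_rabs)
    have "rdyad n s <= T + 1" for n
     using rdyad(3)[OF s0, of n] s power_le_one[of "1/2::real" n] by auto
    thus "eventually (%n. abs (D (rdyad n s) w) <= e) sequentially"
     using nB elim(2) rdyad(1)[OF s0] pos by (intro always_eventually) (auto simp: B_def not_less)
   qed simp
   thus "abs (N s w - X s w) <= e" by (simp add: D_def)
  qed
 qed
 ultimately show "EX Y. bm Y & near T e Y X"
  using N(1) BM unfolding near_def by blast
qed

lemma local_martingale_clm:
 assumes "local_martingale M F X"
 shows "clm X"
proof -
 obtain T where T: "AE w in M. incseq (traj T w) & traj T w ----> \<infinity>"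
  "!!n::nat. martingale M F (%t w. if T n w > 0 then stopped X (T n) t w else 0)"
  using assms unfolding local_martingale_def by blast
 show ?thesis
 proof (rule clm_limit[OF martingale_clm[OF T(2)]])
  show "AE w in M. loc_uniform (%n t. if T n w > 0 then stopped X (T n) t w else 0) (traj X w)"
   using T(1)
  proof (eventually_elim, intro allI impI uniform_limit_eventually_eq)
   fix w and K :: real
   assume "incseq (traj T w) & traj T w ----> \<infinity>" "K >= 0"
   hence "eventually (%n. ennreal K < T n w) sequentially"
    by (intro order_tendstoD(1)[of _ \<infinity>]) auto
   thus "eventually (%n. ALL t:{0..K}. (if T n w > 0 then stopped X (T n) t w else 0) = X t w) sequentially"
   proof eventually_elim
    case (elim n)
    have "ennreal t <= T n w" if "t <= K" for t using elim that by (meson ennreal_leI less_imp_le order_trans)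
    moreover have "T n w > 0" using elim by (rule le_less_trans[rotated]) simp
    ultimately show ?case by (auto simp: stopped_def min_time_id)
   qed
  qed
 qed
qed

end

section \<open>Stieltjes integrals along paths\<close>

definition sint :: "(real => real) => (real => real) => real => real => real" where
 "sint b f u v = (LINT s:{u<..v}|path_measure b. f s)"

text \<open>Integrands are only evaluated on (0,\<infinity>), and locally bounded ones suffice throughout.\<close>

definition lbm :: "(real => real) => bool" where
 "lbm f <-> (%s. indicator {0<..} s * f s) : borel_measurable borel & (ALL T. EX K. ALL s:{0<..T}. abs (f s) <= K)"

lemma lbm_meas: "lbm f ==> (%s. indicator {0<..} s * f s) : borel_measurable borel"
 by (simp add: lbm_def)

lemma lbm_bound:
 assumes "lbm f" obtains K where "K > 0" "!!s. s : {0<..T} ==> abs (f s) <= K"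
proof -
 obtain K where "ALL s:{0<..T}. abs (f s) <= K" using assms by (auto simp: lbm_def)
 thus thesis using that[of "max K 1"] by force
qed

lemma lbm_const [simp]: "lbm (%_. c)"
 by (auto simp: lbm_def)

lemma lbm_mult:
 assumes "lbm f" "lbm g" shows "lbm (%s. f s * g s)"
 unfolding lbm_def
proof (intro conjI allI)
 have "(%s. (indicator {0<..} s * f s) * (indicator {0<..} s * g s)) : borel_measurable borel"
  by (intro borel_measurable_times[OF lbm_meas lbm_meas] assms)
 moreover have "(indicator {0<..} s * f s) * (indicator {0<..} s * g s) = indicator {0<..} s * (f s * g s)" for s :: real
  by (auto simp: indicator_def)
 ultimately show "(%s. indicator {0<..} s * (f s * g s)) : borel_measurable borel" by simp
 fix T
 obtain K L where "K > 0" "!!s. s : {0<..T} ==> abs (f s) <= K" "L > 0" "!!s. s : {0<..T} ==> abs (g s) <= L"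
  using lbm_bound[OF assms(1), of T] lbm_bound[OF assms(2), of T] by metis
 thus "EX K. ALL s:{0<..T}. abs (f s * g s) <= K"
  by (intro exI[of _ "K * L"]) (auto simp: abs_mult intro!: mult_mono)
qed

lemma lbm_add:
 assumes "lbm f" "lbm g" shows "lbm (%s. f s + g s)"
 unfolding lbm_def
proof (intro conjI allI)
 show "(%s. indicator {0<..} s * (f s + g s)) : borel_measurable borel"
  unfolding distrib_left by (intro borel_measurable_add[OF lbm_meas lbm_meas] assms)
 fix T
 obtain K L where "!!s. s : {0<..T} ==> abs (f s) <= K" "!!s. s : {0<..T} ==> abs (g s) <= L"
  using lbm_bound[OF assms(1), of T] lbm_bound[OF assms(2), of T] by metis
 thus "EX K. ALL s:{0<..T}. abs (f s + g s) <= K"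
  by (intro exI[of _ "K + L"]) (smt (verit))
qed

lemma lbm_diff: "lbm f ==> lbm g ==> lbm (%s. f s - g s)"
 using lbm_add[OF _ lbm_mult[OF lbm_const[of "-1"]]] by fastforce

lemma lbm_power2: "lbm f ==> lbm (%s. (f s)\<^sup>2)"
 unfolding power2_eq_square by (rule lbm_mult)

lemma lbm_cong: "lbm f ==> (!!s. s > 0 ==> f s = g s) ==> lbm g"
proof -
 assume f: "lbm f" and eq: "!!s. s > 0 ==> f s = g s"
 have "(%s. indicator {0<..} s * f s) = (%s. indicator {0<..} s * g s)" using eq by (auto simp: fun_eq_iff indicator_def)
 thus "lbm g" using f eq unfolding lbm_def by auto
qed

lemma lbm_limit:
 assumes "!!n. lbm (f n)" "!!s. s > 0 ==> (%n. f n s) ----> g s" "!!T. EX K. ALL s:{0<..T}. abs (g s) <= K"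
 shows "lbm g"
 unfolding lbm_def
proof (intro conjI allI assms(3))
 show "(%s. indicator {0<..} s * g s) : borel_measurable borel"
 proof (rule borel_measurable_LIMSEQ_real)
  show "(%n. indicator {0<..} s * f n s) ----> indicator {0<..} s * g s" for s
   using assms(2)[of s] by (cases "s > 0") (auto intro: tendsto_mult_left)
  show "(%s. indicator {0<..} s * f n s) : borel_measurable borel" for n
   using assms(1) by (simp add: lbm_def)
 qed
qed

lemma lbm_of_continuous:
 assumes "continuous_on {0..} x" shows "lbm x"
 unfolding lbm_def
proof (intro conjI allI)
 have "(%s. indicator {0..} s *\<^sub>R x s) : borel_measurable borel"
  using assms by (intro borel_measurable_continuous_on_indicator) auto
 hence "(%s. indicator {0<..} s * (indicator {0..} s *\<^sub>R x s)) : borel_measurable borel"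
  by (intro borel_measurable_times) auto
 moreover have "(%s. indicator {0<..} s * (indicator {0..} s *\<^sub>R x s)) = (%s. indicator {0<..} s * x s)"
  by (auto simp: fun_eq_iff indicator_def)
 ultimately show "(%s. indicator {0<..} s * x s) : borel_measurable borel" by (simp only:)
 fix T :: real
 have "compact (x ` {0..T})" by (intro compact_continuous_image continuous_on_subset[OF assms]) auto
 then obtain K where "ALL s:{0..T}. abs (x s) <= K" unfolding compact_eq_bounded_closed bounded_iff by auto
 thus "EX K. ALL s:{0<..T}. abs (x s) <= K" by (intro exI[of _ K]) auto
qed

lemma increasing_path_ext:
 assumes "increasing_path b"
 shows "x <= y ==> (if x < 0 then 0 else b x) <= (if y < 0 then 0 else b y)"
  and "continuous (at_right a) (%t. if t < 0 then 0 else b t)"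
proof -
 have b: "0 <= b 0" "!!s t. 0 <= s ==> s <= t ==> b s <= b t" "!!t. t >= 0 ==> (b ---> b t) (at_right t)"
  using assms by (auto simp: increasing_path_def mono_on_def)
 show "x <= y ==> (if x < 0 then 0 else b x) <= (if y < 0 then 0 else b y)"
  using b(1) b(2)[of 0 y] b(2)[of x y] by auto
 show "continuous (at_right a) (%t. if t < 0 then 0 else b t)"
 proof (cases "a < 0")
  case True
  hence "eventually (%t. (if t < 0 then 0 else b t) = 0) (at_right a)"
   by (auto simp: eventually_at_right_field intro!: exI[of _ 0])
  thus ?thesis using True by (auto simp: continuous_within intro: tendsto_eventually)
 next
  case False
  hence "eventually (%t. b t = (if t < 0 then 0 else b t)) (at_right a)"
   by (auto simp: eventually_at_right_field intro!: exI[of _ "a+1"])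
  thus ?thesis using b(3)[of a] False by (auto simp: continuous_within intro: Lim_transform_eventually)
 qed
qed

lemma sets_path_measure [simp, measurable_cong]: "sets (path_measure b) = sets borel"
 by (simp add: path_measure_def)

lemma space_path_measure [simp]: "space (path_measure b) = UNIV"
 by (simp add: path_measure_def)

lemma emeasure_path_measure:
 assumes "increasing_path b" "0 <= u" "u <= v"
 shows "emeasure (path_measure b) {u<..v} = ennreal (b v - b u)"
 unfolding path_measure_def using assms
 by (subst emeasure_interval_measure_Ioc[OF _ increasing_path_ext(1)[OF assms(1)] increasing_path_ext(2)[OF assms(1)]]) auto

lemma incr_le: "increasing_path b ==> 0 <= u ==> u <= v ==> b u <= b v"
 by (auto simp: increasing_path_def mono_on_def)

lemma measure_path_measure:
 assumes "increasing_path b" "0 <= u" "u <= v"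
 shows "measure (path_measure b) {u<..v} = b v - b u"
 using emeasure_path_measure[OF assms] incr_le[OF assms] by (simp add: measure_def)

lemma set_integrable_bounded:
 fixes f :: "real => real"
 assumes "increasing_path b" "0 <= u" "(%s. indicator {u<..v} s * f s) : borel_measurable borel" "!!s. s : {u<..v} ==> abs (f s) <= K"
 shows "set_integrable (path_measure b) {u<..v} f"
proof (cases "u <= v")
 case True
 show ?thesis
  unfolding set_integrable_def
 proof (rule Bochner_Integration.integrable_bound)
  show "integrable (path_measure b) (%s. indicator {u<..v} s *\<^sub>R K)"
   using emeasure_path_measure[OF assms(1,2) True] by simp
  show "AE s in path_measure b. norm (indicator {u<..v} s *\<^sub>R f s) <= norm (indicator {u<..v} s *\<^sub>R K)"
   using assms(4) by (intro AE_I2) (fastforce simp: indicator_def)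
 qed (use assms(3) in simp)
qed (simp add: set_integrable_def)

lemma lbm_set_integrable:
 assumes "increasing_path b" "0 <= u" "lbm f"
 shows "set_integrable (path_measure b) {u<..v} f"
proof -
 obtain K where K: "!!s. s : {0<..v} ==> abs (f s) <= K" using lbm_bound[OF assms(3)] by metis
 have "(%s. indicator {u<..v} s * (indicator {0<..} s * f s)) : borel_measurable borel"
  by (intro borel_measurable_times[OF _ lbm_meas] assms) simp
 moreover have "indicator {u<..v} s * (indicator {0<..} s * f s) = indicator {u<..v} s * f s" for s
  using assms(2) by (auto simp: indicator_def)
 ultimately show ?thesis using K assms by (intro set_integrable_bounded[where K=K]) auto
qed

lemma sint_empty [simp]: "v <= u ==> sint b f u v = 0"
 by (simp add: sint_def set_lebesgue_integral_def)

lemma sint_cong: "(!!s. u < s ==> s <= v ==> f s = g s) ==> sint b f u v = sint b g u v"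
 unfolding sint_def by (rule set_lebesgue_integral_cong) auto

lemma sint_add:
 assumes "increasing_path b" "0 <= u" "lbm f" "lbm g"
 shows "sint b (%s. f s + g s) u v = sint b f u v + sint b g u v"
 unfolding sint_def using lbm_set_integrable[OF assms(1,2)] assms(3,4) by (intro set_integral_add)

lemma sint_diff:
 assumes "increasing_path b" "0 <= u" "lbm f" "lbm g"
 shows "sint b (%s. f s - g s) u v = sint b f u v - sint b g u v"
 unfolding sint_def using lbm_set_integrable[OF assms(1,2)] assms(3,4) by (intro set_integral_diff)

lemma sint_cmult: "sint b (%s. c * f s) u v = c * sint b f u v"
 unfolding sint_def by simp

lemma sint_split:
 assumes "set_integrable (path_measure b) {u<..v} f" "set_integrable (path_measure b) {v<..w} f" "u <= v" "v <= w"
 shows "sint b f u w = sint b f u v + sint b f v w"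
proof -
 have "{u<..w} = {u<..v} Un {v<..w}" using assms by auto
 thus ?thesis unfolding sint_def using assms by (simp add: set_integral_Un)
qed

lemma sint_split_lbm:
 assumes "increasing_path b" "lbm f" "0 <= u" "u <= v" "v <= w"
 shows "sint b f u w = sint b f u v + sint b f v w"
 using assms by (intro sint_split lbm_set_integrable) auto

lemma sint_abs_le:
 assumes b: "increasing_path b" "0 <= u" "u <= v" and f: "set_integrable (path_measure b) {u<..v} f" and K: "!!s. s : {u<..v} ==> abs (f s) <= K"
 shows "abs (sint b f u v) <= K * (b v - b u)"
proof -
 have "abs (sint b f u v) <= (LINT s:{u<..v}|path_measure b. abs (f s))"
  unfolding sint_def using set_integral_norm_bound[OF f] by simp
 also have "... <= (LINT s:{u<..v}|path_measure b. K)"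
  using f K emeasure_path_measure[OF b] by (intro set_integral_mono set_integrable_abs) (auto simp: set_integrable_def)
 also have "... = K * (b v - b u)"
  using measure_path_measure[OF b] by (simp add: set_lebesgue_integral_def)
 finally show ?thesis .
qed

lemma sint_one: "increasing_path b ==> 0 <= u ==> u <= v ==> sint b (%_. 1) u v = b v - b u"
 by (simp add: sint_def set_lebesgue_integral_def measure_path_measure)

lemma sint_mono:
 assumes "increasing_path b" "0 <= u" "lbm f" "lbm g" "!!s. s : {u<..v} ==> f s <= g s"
 shows "sint b f u v <= sint b g u v"
 unfolding sint_def using lbm_set_integrable[OF assms(1,2)] assms(3-5) by (intro set_integral_mono) auto

lemma sint_nonneg: "increasing_path b ==> 0 <= u ==> lbm f ==> (!!s. s : {u<..v} ==> 0 <= f s) ==> 0 <= sint b f u v"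
 using sint_mono[of b u "%_. 0" f v] by (simp add: sint_def)

lemma sint_le_T:
 assumes "increasing_path b" "0 <= t" "t <= T" "lbm f"
 shows "abs (sint b f 0 t) <= sint b (%s. abs (f s)) 0 T"
proof -
 have la: "lbm (%s. abs (f s))"
  using assms(4) borel_measurable_abs[of "%s. indicator {0<..} s * f s" borel] unfolding lbm_def by (auto simp: abs_mult)
 have "abs (sint b f 0 t) <= sint b (%s. abs (f s)) 0 t"
  unfolding sint_def using set_integral_norm_bound[OF lbm_set_integrable[OF assms(1) _ assms(4), of 0 t]] by simp
 also have "... <= sint b (%s. abs (f s)) 0 T"
  using sint_split_lbm[OF assms(1) la, of 0 t T] sint_nonneg[OF assms(1) _ la, of t T] assms by auto
 finally show ?thesis .
qed

lemma lbm_abs: "lbm f ==> lbm (%s. abs (f s))"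
 using borel_measurable_abs[of "%s. indicator {0<..} s * f s" borel] unfolding lbm_def by (auto simp: abs_mult)

lemma sint_dct:
 assumes "increasing_path b" "0 <= u" "!!n. set_integrable (path_measure b) {u<..v} (f n)"
  and "!!s. s : {u<..v} ==> (%n. f n s) ----> g s" "!!n s. s : {u<..v} ==> abs (f n s) <= K"
 shows "set_integrable (path_measure b) {u<..v} g" "(%n. sint b (f n) u v) ----> sint b g u v"
proof -
 let ?w = "%s. indicator {u<..v} s *\<^sub>R K"
 have w: "integrable (path_measure b) ?w"
  using emeasure_path_measure[OF assms(1,2), of v] by (cases "u <= v") auto
 have lim: "(%n. indicator {u<..v} s *\<^sub>R f n s) ----> indicator {u<..v} s *\<^sub>R g s" for s
  using assms(4)[of s] by (cases "s : {u<..v}") auto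
 have bd: "norm (indicator {u<..v} s *\<^sub>R f n s) <= ?w s" for n s using assms(5)[of s n] by (auto simp: indicator_def)
 have fm: "(%s. indicator {u<..v} s *\<^sub>R f n s) : meas (path_measure b)" for n
  using assms(3)[of n] unfolding set_integrable_def by auto
 have gm: "(%s. indicator {u<..v} s *\<^sub>R g s) : meas (path_measure b)"
  by (rule borel_measurable_LIMSEQ_real[OF lim fm])
 show "set_integrable (path_measure b) {u<..v} g"
  unfolding set_integrable_def by (rule integrable_dominated_convergence[where s="%n s. indicator {u<..v} s *\<^sub>R f n s" and w="?w"]; (rule gm fm w | intro AE_I2 lim bd))
 show "(%n. sint b (f n) u v) ----> sint b g u v"
  unfolding sint_def set_lebesgue_integral_def
  by (rule integral_dominated_convergence[where s="%n s. indicator {u<..v} s *\<^sub>R f n s" and w="?w"]; (rule gm fm w | intro AE_I2 lim bd))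
qed

lemma uniform_limit_sint:
 assumes "increasing_path b" "!!n. lbm (f n)" "lbm g"
  and "!!s. s : {0<..T} ==> (%n. f n s) ----> g s" "!!n s. s : {0<..T} ==> abs (f n s) <= K"
 shows "ulim T (%n t. sint b (f n) 0 t) (%t. sint b g 0 t)"
proof (rule uniform_limitI)
 fix e :: real assume e: "e > 0"
 obtain L where L: "!!s. s : {0<..T} ==> abs (g s) <= L" using lbm_bound[OF assms(3)] by metis
 have ld: "lbm (%s. f n s - g s)" for n using assms by (intro lbm_diff)
 have "(%n. sint b (%s. abs (f n s - g s)) 0 T) ----> sint b (%_. 0) 0 T"
 proof (rule sint_dct(2)[where K="K + L"])
  show "set_integrable (path_measure b) {0<..T} (%s. abs (f n s - g s))" for n
   by (intro lbm_set_integrable assms lbm_abs ld) auto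
  show "(%n. abs (f n s - g s)) ----> 0" if "s : {0<..T}" for s
   using tendsto_rabs[OF tendsto_diff[OF assms(4)[OF that] tendsto_const[of "g s"]]] by simp
  show "abs (abs (f n s - g s)) <= K + L" if "s : {0<..T}" for n s
   using assms(5)[OF that, of n] L[OF that] by linarith
 qed (use assms in auto)
 hence "eventually (%n. sint b (%s. abs (f n s - g s)) 0 T < e) sequentially"
  using e by (intro order_tendstoD) (auto simp: sint_def)
 thus "\<forall>\<^sub>F n in sequentially. ALL t:{0..T}. dist (sint b (f n) 0 t) (sint b g 0 t) < e"
 proof eventually_elim
  case (elim n)
  show ?case
  proof
   fix t assume t: "t : {0..T}"
   hence "abs (sint b (f n) 0 t - sint b g 0 t) <= sint b (%s. abs (f n s - g s)) 0 T"
    using sint_le_T[OF assms(1) _ _ ld, of t T n] sint_diff[OF assms(1) order_refl assms(2,3), of n t] by auto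
   thus "dist (sint b (f n) 0 t) (sint b g 0 t) < e" using elim by (simp add: dist_real_def)
  qed
 qed
qed

lemma continuous_on_sint:
 assumes b: "increasing_path b" and c: "continuous_on {0..} b" and f: "lbm f"
 shows "continuous_on {0..} (%t. sint b f 0 t)"
proof (rule continuous_on_halfline)
 fix T :: real assume "T >= 0"
 obtain K where K: "K > 0" "!!s. s : {0<..T} ==> abs (f s) <= K" using lbm_bound[OF f] by metis
 have "dist (sint b f 0 u) (sint b f 0 v) <= K * dist (b u) (b v)" if uv: "u : {0..T}" "v : {0..T}" for u v
 proof -
  have "abs (sint b f 0 v - sint b f 0 u) <= K * (b v - b u)" if "0 <= u" "u <= v" "v <= T" for u v
   using sint_split_lbm[OF b f, of 0 u v] sint_abs_le[OF b _ _ lbm_set_integrable[OF b _ f], of u v K] K that by auto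
  from this[of u v] this[of v u] incr_le[OF b, of u v] incr_le[OF b, of v u] uv show ?thesis
   unfolding dist_real_def by (cases "u <= v") (auto simp: abs_minus_commute)
 qed
 note lip = this
 show "continuous_on {0..T} (%t. sint b f 0 t)"
  unfolding continuous_on_iff
 proof (intro ballI allI impI)
  fix u e :: real assume u: "u : {0..T}" and e: "e > 0"
  hence "e / K > 0" using K by simp
  then obtain d where d: "d > 0" "ALL v:{0..T}. dist v u < d --> dist (b v) (b u) < e / K"
   using continuous_on_subset[OF c, of "{0..T}"] u unfolding continuous_on_iff by (auto, blast)
  have "dist (sint b f 0 v) (sint b f 0 u) < e" if "v : {0..T}" "dist v u < d" for v
   using lip[OF that(1) u] d(2) that K(1) by (auto simp: pos_less_divide_eq mult.commute intro: order_le_less_trans)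
  thus "EX d>0. ALL v:{0..T}. dist v u < d --> dist (sint b f 0 v) (sint b f 0 u) < e" using d(1) by blast
 qed
qed

lemma sint_right_continuous:
 assumes b: "increasing_path b" and f: "lbm f" and t: "t >= 0"
 shows "((%t. sint b f 0 t) ---> sint b f 0 t) (at_right t)"
proof -
 obtain K where K: "K > 0" "!!s. s : {0<..t+1} ==> abs (f s) <= K" using lbm_bound[OF f] by metis
 have "((%v. K * (b v - b t)) ---> K * (b t - b t)) (at_right t)"
  using b t unfolding increasing_path_def by (intro tendsto_intros) auto
 hence lim: "((%v. K * (b v - b t)) ---> 0) (at_right t)" by simp
 have "((%v. sint b f 0 v - sint b f 0 t) ---> 0) (at_right t)"
 proof (rule Lim_null_comparison[OF _ lim])
  have "eventually (%v. t < v & v < t + 1) (at_right t)" by (auto simp: eventually_at_right_field intro!: exI[of _ "t+1"])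
  thus "eventually (%v. norm (sint b f 0 v - sint b f 0 t) <= K * (b v - b t)) (at_right t)"
  proof eventually_elim
   case (elim v)
   thus ?case
    using sint_split_lbm[OF b f, of 0 t v] sint_abs_le[OF b _ _ lbm_set_integrable[OF b _ f], of t v K] K t by auto
  qed
 qed
 thus ?thesis by (rule LIM_zero_cancel)
qed

subsection \<open>Dyadic cells\<close>

text \<open>Left and right end points of the dyadic cell \<open>(j/2\<^sup>n, (j+1)/2\<^sup>n]\<close> that contains s.\<close>

definition lg :: "nat => real => real" where "lg n s = (of_int \<lceil>s * 2^n\<rceil> - 1) / 2^n"
definition rg :: "nat => real => real" where "rg n s = of_int \<lceil>s * 2^n\<rceil> / 2^n"

lemma cell_bounds: "lg n s < s" "s <= rg n s" "rg n s = lg n s + 1/2^n" "s > 0 ==> 0 <= lg n s"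
proof -
 show "lg n s < s" "s <= rg n s"
  unfolding lg_def rg_def by (simp_all add: pos_divide_less_eq pos_le_divide_eq) linarith
 show "rg n s = lg n s + 1/2^n" unfolding lg_def rg_def by (simp add: field_simps)
 assume "s > 0"
 hence "s * 2^n > 0" by simp
 hence "\<lceil>s * 2^n\<rceil> >= 1" by linarith
 thus "0 <= lg n s" unfolding lg_def by simp
qed

lemma cell_unique:
 assumes "real i / 2^n < s" "s <= real (Suc i) / 2^n"
 shows "lg n s = real i / 2^n" "rg n s = real (Suc i) / 2^n"
proof -
 have "real i < s * 2^n" "s * 2^n <= real (Suc i)" using assms by (auto simp: pos_divide_less_eq pos_le_divide_eq)
 hence "\<lceil>s * 2^n\<rceil> = int (Suc i)" by (intro ceiling_unique) auto
 thus "lg n s = real i / 2^n" "rg n s = real (Suc i) / 2^n" by (simp_all add: lg_def rg_def)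
qed

lemma inverse_pow2_tendsto: "(%n. 1/2^n) ----> (0::real)"
 using LIMSEQ_power_zero[of "1/2::real"] by (simp add: power_divide)

lemma lg_tendsto: "(%n. lg n s) ----> s" and rg_tendsto: "(%n. rg n s) ----> s"
proof -
 have 1: "(%n. s - 1/2^n) ----> s" "(%n. s + 1/2^n) ----> s"
  using tendsto_diff[OF tendsto_const[of s] inverse_pow2_tendsto] tendsto_add[OF tendsto_const[of s] inverse_pow2_tendsto] by auto
 have "s - 1/2^n <= lg n s" "lg n s <= s" "s <= rg n s" "rg n s <= s + 1/2^n" for n
  using cell_bounds[where n=n and s=s] by auto
 note bds = this
 show "(%n. lg n s) ----> s"
  by (rule tendsto_sandwich[OF _ _ 1(1) tendsto_const]; intro always_eventually allI bds)
 show "(%n. rg n s) ----> s"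
  by (rule tendsto_sandwich[OF _ _ tendsto_const 1(2)]; intro always_eventually allI bds)
qed

text \<open>dsum n f t adds up \<open>f (t \<and> i/2\<^sup>n) (t \<and> (i+1)/2\<^sup>n)\<close> over the dyadic cells; the first \<open>4\<^sup>n\<close> cells reach
 up to \<open>2\<^sup>n\<close>.\<close>

definition dsum :: "nat => (real => real => real) => real => real" where
 "dsum n f t = (SUM i<4^n. f (min t (real i / 2^n)) (min t (real (Suc i) / 2^n)))"

lemma dsum_add: "dsum n (%u v. f u v + g u v) t = dsum n f t + dsum n g t"
 by (simp add: dsum_def sum.distrib)

lemma dsum_diff: "dsum n (%u v. f u v - g u v) t = dsum n f t - dsum n g t"
 by (simp add: dsum_def sum_subtractf)

lemma dsum_cmult: "dsum n (%u v. c * f u v) t = c * dsum n f t"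
 by (simp add: dsum_def sum_distrib_left)

lemma pow2_grid: "real (4^n) / 2^n = 2^n"
 by (simp add: field_simps power_mult_distrib[symmetric])

lemma dsum_telescope: "0 <= t ==> t <= 2^n ==> dsum n (%u v. y v - y u) t = y t - y 0"
 unfolding dsum_def using sum_lessThan_telescope[of "%i. y (min t (real i / 2^n))" "4^n"] pow2_grid[of n]
 by (simp add: min_def)

lemma dsum_abs_le:
 assumes "!!u v. 0 <= u ==> u <= v ==> v <= t ==> v - u <= 1/2^n ==> abs (f u v) <= g u v" "t >= 0"
 shows "abs (dsum n f t) <= dsum n g t"
 unfolding dsum_def
proof (rule order_trans[OF sum_abs sum_mono])
 fix i
 have "real (Suc i) / 2^n - real i / 2^n = 1/2^n" by (simp add: field_simps)
 thus "abs (f (min t (real i / 2^n)) (min t (real (Suc i) / 2^n))) <= g (min t (real i / 2^n)) (min t (real (Suc i) / 2^n))"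
  using assms(2) dyadic_le[of i n] by (intro assms(1)) (auto simp: min_def)
qed

lemma dsum_sint:
 assumes b: "increasing_path b" and t: "0 <= t" "t <= 2^n"
  and int: "!!u v. 0 <= u ==> u <= v ==> v <= t ==> set_integrable (path_measure b) {u<..v} (psi u v)"
 shows "set_integrable (path_measure b) {0<..t} (%s. psi (lg n s) (min t (rg n s)) s)"
  and "dsum n (%u v. sint b (psi u v) u v) t = sint b (%s. psi (lg n s) (min t (rg n s)) s) 0 t"
proof -
 let ?\<Psi> = "%s. psi (lg n s) (min t (rg n s)) s"
 let ?g = "%i. min t (real i / 2^n)"
 have cell: "set_integrable (path_measure b) {?g i<..?g (Suc i)} ?\<Psi> & sint b ?\<Psi> (?g i) (?g (Suc i)) = sint b (psi (?g i) (?g (Suc i))) (?g i) (?g (Suc i))" for i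
 proof (cases "real i / 2^n < t")
  case True
  have eq: "?\<Psi> s = psi (?g i) (?g (Suc i)) s" if "s : {?g i<..?g (Suc i)}" for s
   using cell_unique[of i n s] that True by (auto simp: min_def split: if_splits)
  have "set_integrable (path_measure b) {?g i<..?g (Suc i)} (psi (?g i) (?g (Suc i)))"
   using t dyadic_le[of i n] by (intro int) (auto simp: min_def)
  hence "set_integrable (path_measure b) {?g i<..?g (Suc i)} ?\<Psi>"
   using eq by (subst set_integrable_cong) auto
  thus ?thesis using eq by (auto intro!: sint_cong)
 next
  case False
  hence "?g i = t" "?g (Suc i) = t" using dyadic_le[of i n] by auto
  thus ?thesis by (simp add: set_integrable_def)
 qed
 have "set_integrable (path_measure b) {0<..?g N} ?\<Psi> & (SUM i<N. sint b (psi (?g i) (?g (Suc i))) (?g i) (?g (Suc i))) = sint b ?\<Psi> 0 (?g N)" for N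
 proof (induction N)
  case 0
  thus ?case using t by (simp add: set_integrable_def)
 next
  case (Suc N)
  have le: "0 <= ?g N" "?g N <= ?g (Suc N)" using t dyadic_le[of N n] by (auto simp: min_def)
  hence "{0<..?g (Suc N)} = {0<..?g N} Un {?g N<..?g (Suc N)}"
   by (simp only: ivl_disj_un_two(6))
  hence "set_integrable (path_measure b) {0<..?g (Suc N)} ?\<Psi>"
   using Suc cell[of N] by (auto intro: set_integrable_Un)
  thus ?case using Suc cell[of N] sint_split[of b 0 "?g N" ?\<Psi> "?g (Suc N)"] le by simp
 qed
 from this[of "4^n"] show "set_integrable (path_measure b) {0<..t} ?\<Psi>"
  "dsum n (%u v. sint b (psi u v) u v) t = sint b ?\<Psi> 0 t"
  using t pow2_grid[of n] by (simp_all add: dsum_def min_absorb1)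
qed

text \<open>Identities between Stieltjes integrals of paths with jumps: it suffices to have them, with an
 integrand depending on the interval, over small intervals, and to find the limit of the integrands.\<close>

lemma sint_by_cells:
 assumes b: "increasing_path b" and t: "0 <= t"
  and y: "!!u v. 0 <= u ==> u <= v ==> v <= t ==> y v - y u = sint b (psi u v) u v"
  and int: "!!u v. 0 <= u ==> u <= v ==> v <= t ==> lbm (psi u v)"
  and bd: "!!u v s. 0 <= u ==> u < s ==> s <= v ==> v <= t ==> abs (psi u v s) <= K"
  and lim: "!!s. s : {0<..t} ==> (%n. psi (lg n s) (min t (rg n s)) s) ----> f s"
 shows "y t - y 0 = sint b f 0 t"
proof -
 obtain n0 where n0: "t < 2^n0" using real_arch_pow[of 2 t] by auto
 have tn: "t <= 2^(n + n0)" for n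
  using n0 power_increasing[of n0 "n + n0" "2::real"] by linarith
 note si = lbm_set_integrable[OF b _ int]
 have eq: "y t - y 0 = sint b (%s. psi (lg (n + n0) s) (min t (rg (n + n0) s)) s) 0 t" for n
 proof -
  have "y t - y 0 = dsum (n + n0) (%u v. y v - y u) t" using dsum_telescope[OF t tn] by simp
  also have "... = dsum (n + n0) (%u v. sint b (psi u v) u v) t"
   unfolding dsum_def using t by (intro sum.cong refl y min.mono dyadic_le) auto
  also have "... = sint b (%s. psi (lg (n + n0) s) (min t (rg (n + n0) s)) s) 0 t"
   by (rule dsum_sint(2)[OF b t tn]) (rule si)
  finally show ?thesis .
 qed
 have "(%n. sint b (%s. psi (lg (n + n0) s) (min t (rg (n + n0) s)) s) 0 t) ----> sint b f 0 t"
 proof (rule sint_dct(2)[OF b order_refl])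
  show "set_integrable (path_measure b) {0<..t} (%s. psi (lg (n + n0) s) (min t (rg (n + n0) s)) s)" for n
   by (rule dsum_sint(1)[OF b t tn]) (rule si)
  show "(%n. psi (lg (n + n0) s) (min t (rg (n + n0) s)) s) ----> f s" if "s : {0<..t}" for s
   using LIMSEQ_ignore_initial_segment[OF lim[OF that], of n0] .
  show "abs (psi (lg (n + n0) s) (min t (rg (n + n0) s)) s) <= K" if "s : {0<..t}" for n s
   using that cell_bounds[where n="n + n0" and s=s] by (intro bd) auto
 qed
 thus ?thesis unfolding eq[symmetric] by (simp add: LIMSEQ_const_iff)
qed

lemma min_rg_tendsto: "s <= t ==> (%n. min t (rg n s)) ----> s"
 using tendsto_min[OF tendsto_const[of t] rg_tendsto[of s]] by (simp add: min_absorb2)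

lemma right_tendsto:
 assumes "((x :: real => real) ---> x s) (at_right s)" "y ----> s" "!!n. s <= y n"
 shows "(%n. x (y n)) ----> x s"
proof -
 have "continuous (at s within {s..}) x"
 proof -
  have "{s..} - {s} = {s<..}" "{s<..} - {s} = {s<..}" by auto
  hence "at s within {s..} = at_right s" by (simp add: at_within_def)
  thus ?thesis using assms(1) by (simp add: continuous_within)
 qed
 thus ?thesis
  using assms(2,3) by (intro continuous_within_tendsto_compose'[of s "{s..}" x]) auto
qed

text \<open>Over a cell \<open>(u,v]\<close> the product changes by \<open>y\<^sub>u (x\<^sub>v - x\<^sub>u) + x\<^sub>v (y\<^sub>v - y\<^sub>u)\<close>. As the cells shrink to the point s they
 contain, \<open>y\<^sub>u\<close> tends to the left limit of y and \<open>x\<^sub>v\<close> to \<open>x\<^sub>s\<close>, which explains the asymmetry when both jump.\<close>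

lemma sint_product:
 assumes b: "increasing_path b" and t: "0 <= t" and f: "lbm f" and g: "lbm g"
  and x: "!!u. 0 <= u ==> x u = x 0 + sint b f 0 u" and y: "!!u. 0 <= u ==> y u = y 0 + sint b g 0 u"
  and yl: "!!s. s > 0 ==> (y ---> yl s) (at_left s)"
 shows "x t * y t - x 0 * y 0 = sint b (%s. yl s * f s + x s * g s) 0 t"
proof -
 have bnd: "EX K>0. ALL u:{0..t}. abs (z u) <= K" if h: "lbm h" and z: "!!u. 0 <= u ==> z u = z 0 + sint b h 0 u" for z h
 proof -
  obtain L where L: "L > 0" "!!s. s : {0<..t} ==> abs (h s) <= L" using lbm_bound[OF h] by metis
  have "abs (z u) <= abs (z 0) + L * (b t - b 0) + 1" if u: "u : {0..t}" for u
  proof -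
   have "abs (sint b h 0 u) <= L * (b u - b 0)"
    using u L by (intro sint_abs_le[OF b] lbm_set_integrable[OF b _ h]) auto
   also have "... <= L * (b t - b 0)" using incr_le[OF b, of u t] u L by (intro mult_left_mono) auto
   finally show ?thesis using z[of u] u by auto
  qed
  moreover have "abs (z 0) + L * (b t - b 0) + 1 > 0" using incr_le[OF b, of 0 t] t L by (simp add: add_nonneg_pos)
  ultimately show ?thesis by blast
 qed
 obtain X Y where XY: "X > 0" "!!u. u : {0..t} ==> abs (x u) <= X" "Y > 0" "!!u. u : {0..t} ==> abs (y u) <= Y"
  using bnd[OF f x] bnd[OF g y] by blast
 obtain Kf Kg where K: "Kf > 0" "!!s. s : {0<..t} ==> abs (f s) <= Kf" "Kg > 0" "!!s. s : {0<..t} ==> abs (g s) <= Kg"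
  using lbm_bound[OF f] lbm_bound[OF g] by metis
 have incr: "x v - x u = sint b f u v" "y v - y u = sint b g u v" if "0 <= u" "u <= v" for u v
  using x[of u] x[of v] y[of u] y[of v] sint_split_lbm[OF b _ order_refl that] f g that by auto
 have rc: "(x ---> x s) (at_right s)" if "s >= 0" for s
 proof -
  have "((%u. x 0 + sint b f 0 u) ---> x s) (at_right s)"
   using tendsto_add[OF tendsto_const sint_right_continuous[OF b f that]] x[OF that] by metis
  thus ?thesis
  proof (rule Lim_transform_eventually)
   show "eventually (%u. x 0 + sint b f 0 u = x u) (at_right s)"
    unfolding eventually_at_right_field using that by (intro exI[of _ "s+1"] conjI allI impI x[symmetric]) auto
  qed
 qed
 show ?thesis
 proof (rule sint_by_cells[OF b t, where psi="%u v s. y u * f s + x v * g s" and K="Y * Kf + X * Kg" and y="%t. x t * y t"])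
  fix u v assume uv: "0 <= u" "u <= v" "v <= t"
  have "x v * y v - x u * y u = y u * (x v - x u) + x v * (y v - y u)" by (simp add: algebra_simps)
  thus "x v * y v - x u * y u = sint b (%s. y u * f s + x v * g s) u v"
   using uv incr f g by (simp add: sint_add[OF b] lbm_mult sint_cmult)
  show "lbm (%s. y u * f s + x v * g s)" using f g by (intro lbm_add lbm_mult) auto
 next
  fix u v s assume "0 <= u" "u < s" "s <= v" "v <= t"
  hence "abs (y u) * abs (f s) <= Y * Kf" "abs (x v) * abs (g s) <= X * Kg" using XY K by (auto intro!: mult_mono)
  thus "abs (y u * f s + x v * g s) <= Y * Kf + X * Kg"
   using abs_triangle_ineq[of "y u * f s" "x v * g s"] by (simp add: abs_mult)
 next
  fix s assume s: "s : {0<..t}"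
  have "filterlim (%n. lg n s) (at_left s) sequentially"
   using lg_tendsto cell_bounds(1) unfolding filterlim_at by (auto intro!: always_eventually less_imp_neq)
  from filterlim_compose[OF yl this] s have "(%n. y (lg n s)) ----> yl s" by simp
  moreover have "(%n. x (min t (rg n s))) ----> x s"
  proof (rule right_tendsto[OF rc min_rg_tendsto])
   show "s <= min t (rg n s)" for n using s cell_bounds(2)[where n=n and s=s] by simp
  qed (use s in auto)
  ultimately show "(%n. y (lg n s) * f s + x (min t (rg n s)) * g s) ----> yl s * f s + x s * g s"
   by (intro tendsto_intros)
 qed
qed

text \<open>Riemann sums of a continuous path, with tags at the left (j = 0) or right (j = 1) end points of
 the cells, converge locally uniformly.\<close>

lemma riemann_uniform:
 assumes b: "increasing_path b" and g: "lbm g" and x: "continuous_on {0..} x" and T: "T >= 0"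
  and tag: "tag = (%u v. u) | tag = (%u v. v)"
 shows "ulim T (%n t. dsum n (%u v. x (tag u v) * sint b g u v) t) (%t. sint b (%s. x s * g s) 0 t)"
proof (rule uniform_limitI)
 fix e :: real assume e: "e > 0"
 obtain K where K: "K > 0" "!!s. s : {0<..T} ==> abs (g s) <= K" using lbm_bound[OF g] by metis
 define c where "c = K * (b T - b 0) + 1"
 have c: "c > 0" "K * (b T - b 0) < c" using K incr_le[OF b, of 0 T] T by (auto simp: c_def add_nonneg_pos)
 have "uniformly_continuous_on {0..T} x"
  by (intro compact_uniformly_continuous continuous_on_subset[OF x]) auto
 then obtain d where d: "d > 0" "!!s t. s : {0..T} ==> t : {0..T} ==> abs (s - t) < d ==> abs (x s - x t) < e / c"
  using e c unfolding uniformly_continuous_on_def dist_real_def by (metis divide_pos_pos)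
 have "eventually (%n. 1/2^n < d) sequentially" using inverse_pow2_tendsto d(1) by (rule order_tendstoD)
 thus "\<forall>\<^sub>F n in sequentially. ALL t:{0..T}. dist (dsum n (%u v. x (tag u v) * sint b g u v) t) (sint b (%s. x s * g s) 0 t) < e"
  using eventually_le_pow2[of T]
 proof eventually_elim
  case (elim n)
  show ?case
  proof
   fix t assume t: "t : {0..T}"
   hence tn: "0 <= t" "t <= 2^n" using elim by auto
   let ?x = "%s. x (tag (lg n s) (min t (rg n s)))"
   have si: "set_integrable (path_measure b) {u<..v} (%s. x (tag u v) * g s)" if "0 <= u" for u v
    using that g by (intro lbm_set_integrable[OF b] lbm_mult) auto
   have xg: "lbm (%s. x s * g s)" using g lbm_of_continuous[OF x] by (intro lbm_mult)
   note ds = dsum_sint[OF b tn, where psi="%u v s. x (tag u v) * g s", OF si, simplified]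
   have "abs ((?x s * g s) - x s * g s) <= (e / c) * K" if s: "s : {0<..t}" for s
   proof -
    have "tag (lg n s) (min t (rg n s)) : {0..T}" "abs (tag (lg n s) (min t (rg n s)) - s) < d"
     using tag cell_bounds[where n=n and s=s] s t elim(1) by auto
    hence "abs (?x s - x s) <= e / c" using d(2) s t by (simp add: less_imp_le)
    hence "abs (?x s - x s) * abs (g s) <= (e / c) * K" using K s t e c by (intro mult_mono) auto
    thus ?thesis by (simp add: abs_mult left_diff_distrib flip: abs_mult)
   qed
   hence "abs (sint b (%s. ?x s * g s - x s * g s) 0 t) <= (e / c) * K * (b t - b 0)"
    using tn by (intro sint_abs_le[OF b] set_integral_diff(1) ds(1) lbm_set_integrable[OF b _ xg]) auto
   also have "... <= (e / c) * (K * (b T - b 0))"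
    using incr_le[OF b, of t T] t e c K unfolding mult.assoc by (intro mult_left_mono) auto
   also have "... < (e / c) * c" using e c by (intro mult_strict_left_mono) auto
   finally have "abs (sint b (%s. ?x s * g s - x s * g s) 0 t) < e" using c by simp
   moreover have "sint b (%s. ?x s * g s - x s * g s) 0 t = sint b (%s. ?x s * g s) 0 t - sint b (%s. x s * g s) 0 t"
    unfolding sint_def by (intro set_integral_diff(2) ds(1) lbm_set_integrable[OF b _ xg]) auto
   moreover have "dsum n (%u v. x (tag u v) * sint b g u v) t = sint b (%s. ?x s * g s) 0 t"
    using ds(2) by (simp add: sint_cmult)
   ultimately show "dist (dsum n (%u v. x (tag u v) * sint b g u v) t) (sint b (%s. x s * g s) 0 t) < e"
    by (simp add: dist_real_def)
  qed
 qed
qed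

section \<open>Integration by parts and Ito's formula\<close>

definition Sint :: "(real => 'a => real) => (real => 'a => real) => real => 'a => real" where
 "Sint B g t w = sint (traj B w) (traj g w) 0 t"

abbreviation (input) stieltjes :: "(real => 'a => real) => (real => 'a => real) => 'a => bool" where
 "stieltjes V h w == increasing_path (traj V w) & lbm (traj h w)"

abbreviation (input) primitive :: "(real => 'a => real) => (real => 'a => real) => (real => 'a => real) => 'a => bool" where
 "primitive C B g w == increasing_path (traj B w) & lbm (traj g w) & (ALL t>=0. C t w = C 0 w + Sint B g t w)"

lemma Sint_zero [simp]: "Sint V (%_ _. 0) t w = 0"
 by (simp add: Sint_def sint_def)

lemma lbm_step:
 assumes "!!T. EX K. ALL s:{0..T}. abs (c s) <= K" shows "lbm (%s. c (lg n s))"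
 unfolding lbm_def
proof (intro conjI allI)
 have "(%s::real. \<lceil>s * 2^n\<rceil>) : borel \<rightarrow>\<^sub>M count_space UNIV" by measurable
 from measurable_compose[OF this, of "%i::int. c ((of_int i - 1) / 2^n)" borel]
 have "(%s::real. c ((of_int \<lceil>s * 2^n\<rceil> - 1) / 2^n)) : borel_measurable borel" by simp
 thus "(%s. indicator {0<..} s * c (lg n s)) : borel_measurable borel"
  unfolding lg_def by (intro borel_measurable_times) simp_all
 fix T
 obtain K where K: "ALL s:{0..T}. abs (c s) <= K" using assms by blast
 have "abs (c (lg n s)) <= K" if "s : {0<..T}" for s
  using K that cell_bounds[where n=n and s=s] by auto
 thus "EX K. ALL s:{0<..T}. abs (c (lg n s)) <= K" by blast
qed

lemma lg_tendsto_left: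
 assumes "(c ---> l) (at_left s)" shows "(%n. c (lg n s)) ----> l"
proof (rule filterlim_compose[OF assms])
 show "filterlim (%n. lg n s) (at_left s) sequentially"
  using lg_tendsto cell_bounds(1) unfolding filterlim_at by (auto intro!: always_eventually less_imp_neq)
qed

lemma bounded_of_sint:
 assumes b: "increasing_path b" and g: "lbm g" and c: "!!t. t >= 0 ==> c t = c 0 + sint b g 0 t"
 shows "EX K. ALL s:{0..T}. abs (c s) <= K"
proof -
 have "abs (c s) <= abs (c 0) + sint b (%s. abs (g s)) 0 T" if "s : {0..T}" for s
  using sint_le_T[OF b _ _ g, of s T] c[of s] that by auto
 thus ?thesis by blast
qed

lemma bounded_continuous:
 fixes x :: "real => real"
 assumes "continuous_on {0..} x" shows "bounded (x ` {0..T})"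
 by (intro compact_imp_bounded compact_continuous_image continuous_on_subset[OF assms]) auto

lemma parts_sum:
 assumes "0 <= t" "t <= 2^n"
 shows "dsum n (%u v. c u * (x v - x u)) t = x t * c t - x 0 * c 0 - dsum n (%u v. x v * (c v - c u)) t"
proof -
 have "x t * c t - x 0 * c 0 = dsum n (%u v. x v * c v - x u * c u) t"
  using dsum_telescope[OF assms, of "%t. x t * c t"] by simp
 also have "... = dsum n (%u v. c u * (x v - x u)) t + dsum n (%u v. x v * (c v - c u)) t"
  unfolding dsum_add[symmetric] by (simp add: algebra_simps)
 finally show ?thesis by simp
qed

lemma uniform_limit_eventually_cong:
 assumes "uniform_limit X f l G" "eventually (%n. ALL x:X. f n x = g n x) G"
 shows "uniform_limit X g l G"
 using uniform_limit_cong[OF assms(2), of l l] assms(1) by simp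

lemma dsum_cong:
 assumes "!!u v. 0 <= u ==> u <= v ==> v <= t ==> f u v = g u v" "t >= 0"
 shows "dsum n f t = dsum n g t"
 unfolding dsum_def using assms(2) dyadic_le by (intro sum.cong refl assms(1) min.mono) auto

text \<open>Summation by parts moves the increments from the continuous path x, which may have infinite variation, to the
 path c of finite variation; the remaining sums are Riemann sums of a Stieltjes integral.\<close>

lemma parts_uniform_limit:
 assumes b: "increasing_path b" and g: "lbm g" and x: "continuous_on {0..} x" and T: "T >= 0"
  and c: "!!t. t >= 0 ==> c t = c 0 + sint b g 0 t"
 shows "ulim T (%n t. dsum n (%u v. c u * (x v - x u)) t)
  (%t. x t * c t - x 0 * c 0 - sint b (%s. x s * g s) 0 t)" (is "ulim T ?f _")
proof (rule uniform_limit_eventually_cong)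
 have cc: "sint b g u v = c v - c u" if "0 <= u" "u <= v" for u v
  using c[of u] c[of v] sint_split_lbm[OF b g order_refl that] that by auto
 show "ulim T (%n t. (x t * c t - x 0 * c 0) - dsum n (%u v. x v * sint b g u v) t)
  (%t. (x t * c t - x 0 * c 0) - sint b (%s. x s * g s) 0 t)"
  by (intro uniform_limit_intros riemann_uniform[OF b g x T]) simp
 show "eventually (%n. ALL t:{0..T}. (x t * c t - x 0 * c 0) - dsum n (%u v. x v * sint b g u v) t = ?f n t) sequentially"
  using eventually_le_pow2[of T]
 proof eventually_elim
  case (elim n)
  show ?case
  proof (intro ballI, goal_cases)
   case (1 t)
   hence "dsum n (%u v. x v * sint b g u v) t = dsum n (%u v. x v * (c v - c u)) t"
    by (intro dsum_cong) (auto simp: cc)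
   thus ?case using 1 elim parts_sum[of t n c x] by auto
  qed
 qed
qed

lemma dsum_left_uniform:
 assumes b: "increasing_path b" and h: "lbm h" and c: "!!T. EX K. ALL s:{0..T}. abs (c s) <= K"
  and cl: "!!s. s > 0 ==> (c ---> cl s) (at_left s)"
 shows "lbm cl" "ulim T (%n t. dsum n (%u v. c u * (sint b h 0 v - sint b h 0 u)) t) (%t. sint b (%s. cl s * h s) 0 t)"
   (is "ulim T ?f ?g")
proof -
 have lim: "(%n. c (lg n s)) ----> cl s" if "s > 0" for s using lg_tendsto_left cl that by blast
 have cK: "abs (c (lg n s)) <= K" if "ALL s:{0..T}. abs (c s) <= K" "s : {0<..T}" for K T n s
  using that cell_bounds[where n=n and s=s] by auto
 have bl: "EX K. ALL s:{0<..T}. abs (cl s) <= K" for T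
 proof -
  obtain K where K: "ALL s:{0..T}. abs (c s) <= K" using c by blast
  have "abs (cl s) <= K" if "s : {0<..T}" for s
   by (rule tendsto_upperbound[OF tendsto_rabs[OF lim]]) (use cK[OF K that] that in auto)
  thus ?thesis by blast
 qed
 show cl': "lbm cl" by (rule lbm_limit[OF lbm_step[OF c] lim bl])
 obtain K where K: "ALL s:{0..T}. abs (c s) <= K" using c by blast
 obtain L where L: "!!s. s : {0<..T} ==> abs (h s) <= L" using lbm_bound[OF h] by metis
 show "ulim T ?f ?g"
 proof (rule uniform_limit_eventually_cong)
  show "ulim T (%n t. sint b (%s. c (lg n s) * h s) 0 t) ?g"
  proof (rule uniform_limit_sint[OF b])
   show "abs (c (lg n s) * h s) <= K * L" if "s : {0<..T}" for n s
    unfolding abs_mult using cK[OF K that, of n] L[OF that] by (intro mult_mono) auto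
  qed (use lim lbm_step[OF c] cl' h in "auto intro!: lbm_mult tendsto_intros")
  show "eventually (%n. ALL t:{0..T}. sint b (%s. c (lg n s) * h s) 0 t = ?f n t) sequentially"
   using eventually_le_pow2[of T]
  proof eventually_elim
   case (elim n)
   show ?case
   proof (intro ballI, goal_cases)
    case (1 t)
    have "sint b h 0 v - sint b h 0 u = sint b h u v" if "0 <= u" "u <= v" for u v
     using sint_split_lbm[OF b h order_refl that] by simp
    hence "?f n t = dsum n (%u v. sint b (%s. c u * h s) u v) t"
     using 1 by (intro dsum_cong) (auto simp: sint_cmult)
    also have "... = sint b (%s. c (lg n s) * h s) 0 t"
     using 1 elim by (intro dsum_sint(2)[OF b]) (auto intro!: lbm_set_integrable[OF b] lbm_mult h)
    finally show ?case by simp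
   qed
  qed
 qed
qed

context usual_filtration begin

abbreviation (input) bracket :: "(real => 'a => real) => (real => 'a => real) => (real => 'a => real) => (real => 'a => real) => bool" where
 "bracket X W V h == clm (%t w. X t w * W t w - Sint V h t w)"

lemma cont_adapted_ito_sum:
 assumes "cont_adapted X" "adapted F K"
 shows "cont_adapted (%t w. dsum n (%u v. K u w * (X v w - X u w)) t)"
proof -
 have "cont_adapted (%t w. K (min t a) w * (X (min t b) w - X (min t a) w))" if "0 <= a" "a <= b" for a b
  by (rule cont_adapted_cong[OF cont_adapted_increment[OF assms(1) that adaptedD[OF assms(2) that(1)]]])
   (use that in "auto simp: min_def")
 thus ?thesis unfolding dsum_def using dyadic_le by (intro cont_adapted_sum) auto
qed

lemma clm_ito_sum:
 assumes "clm X" "adapted F K"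
 shows "clm (%t w. dsum n (%u v. K u w * (X v w - X u w)) t)"
proof -
 have "clm (%t w. K (min t a) w * (X (min t b) w - X (min t a) w))" if "0 <= a" "a <= b" for a b
  by (rule clm_cong[OF clm_increment[OF assms(1) that adaptedD[OF assms(2) that(1)]]])
   (use that in "auto simp: min_def")
 thus ?thesis unfolding dsum_def using dyadic_le by (intro clm_sum) auto
qed

text \<open>U = X W - Gm says that Gm is the bracket of X and W; the increment \<open>k (X\<^sup>b - X\<^sup>a)\<close> then has the
 bracket \<open>k (Gm\<^sup>b - Gm\<^sup>a)\<close> with W.\<close>

lemma clm_piece:
 assumes U: "clm (%t w. X t w * W t w - Gm t w)" and W: "clm W" and X: "cont_adapted X"
  and ab: "0 <= a" "a <= b" and k: "k : meas (F a)"
 shows "clm (%t w. k w * (X (min t b) w - X (min t a) w) * W t w - k w * (Gm (min t b) w - Gm (min t a) w))"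
proof (rule clm_cong)
 let ?U = "%t w. X t w * W t w - Gm t w"
 have kX: "(%w. k w * X a w) : meas (F a)" "(%w. k w * X b w) : meas (F b)"
  using cont_adaptedD[OF X] ab k meas_F_mono[OF ab k] by (auto intro!: borel_measurable_times)
 show "clm (%t w. k w * (?U (min t b) w - ?U (min t a) w) +
   ((k w * X b w) * (W t w - W (min t b) w) - (k w * X a w) * (W t w - W (min t a) w)))"
  by (intro clm_add clm_diff clm_increment[OF U ab k] clm_tail[OF W _ kX(1)] clm_tail[OF W _ kX(2)]) (use ab in auto)
 show "AE w in M. ALL t>=0. k w * (?U (min t b) w - ?U (min t a) w) +
   ((k w * X b w) * (W t w - W (min t b) w) - (k w * X a w) * (W t w - W (min t a) w)) =
   k w * (X (min t b) w - X (min t a) w) * W t w - k w * (Gm (min t b) w - Gm (min t a) w)"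
  using ab by (auto simp: algebra_simps min_def)
qed

lemma clm_ito_sum_bracket:
 assumes U: "clm (%t w. X t w * W t w - Gm t w)" "clm W" "cont_adapted X" and C: "adapted F C"
 shows "clm (%t w. dsum n (%u v. C u w * (X v w - X u w)) t * W t w - dsum n (%u v. C u w * (Gm v w - Gm u w)) t)"
proof -
 have "clm (%t w. C (min t a) w * (X (min t b) w - X (min t a) w) * W t w - C (min t a) w * (Gm (min t b) w - Gm (min t a) w))"
  if "0 <= a" "a <= b" for a b
  by (rule clm_cong[OF clm_piece[OF U that adaptedD[OF C that(1)]]]) (use that in "auto simp: min_def")
 thus ?thesis
  unfolding dsum_def sum_distrib_right sum_subtractf[symmetric] using dyadic_le by (intro clm_sum) auto
qed

text \<open>The pathwise integral \<open>\<integral> C\<^sub>- dX = C X - C\<^sub>0 X\<^sub>0 - \<integral> X dC\<close> is the limit of elementary ones, uniformly on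
 compacts; neither X C nor \<integral> X dC need be continuous.\<close>

lemma ibp_limit:
 assumes "AE w in M. primitive C B g w" "cont_adapted X"
 shows "AE w in M. loc_uniform (%n t. dsum n (%u v. C u w * (X v w - X u w)) t)
  (%t. X t w * C t w - Sint B (%s w. X s w * g s w) t w - X 0 w * C 0 w)"
 using assms(1) AE_cont[OF assms(2)]
proof eventually_elim
 case (elim w)
 show ?case
 proof (intro allI impI, goal_cases)
  case (1 T)
  thus ?case
   unfolding Sint_def cancel_ab_semigroup_add_class.diff_right_commute[of _ "sint _ _ _ _"]
   by (intro parts_uniform_limit) (use elim in "unfold Sint_def, blast")+
 qed
qed

lemma clm_ibp:
 assumes X: "clm X" and C: "adapted F C" and path: "AE w in M. primitive C B g w"
 shows "clm (%t w. X t w * C t w - Sint B (%s w. X s w * g s w) t w)"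
proof (rule clm_limit)
 note cX = clm_cont[OF X]
 have XC: "(%w. X 0 w * C 0 w) : meas (F 0)"
  using cont_adaptedD[OF cX] adaptedD[OF C] by (auto intro!: borel_measurable_times)
 show "clm (%t w. dsum n (%u v. C u w * (X v w - X u w)) t + X 0 w * C 0 w)" for n
  by (intro clm_add clm_ito_sum[OF X C] clm_const XC)
 show "AE w in M. loc_uniform (%n t. dsum n (%u v. C u w * (X v w - X u w)) t + X 0 w * C 0 w)
  (%t. X t w * C t w - Sint B (%s w. X s w * g s w) t w)"
  using ibp_limit[OF path cX]
 proof eventually_elim
  case (elim w)
  show ?case
  proof (intro allI impI, goal_cases)
   case (1 T)
   show ?case using uniform_limit_add[OF elim[rule_format, OF 1] uniform_limit_const[where c="%_. X 0 w * C 0 w"]] by simp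
  qed
 qed
qed

text \<open>The bracket of \<open>\<integral> C\<^sub>- dX\<close> with W.\<close>

lemma clm_ibp_bracket:
 assumes U: "clm (%t w. X t w * W t w - Sint V h t w)" and W: "clm W" and X: "clm X" and C: "adapted F C"
  and path: "AE w in M. primitive C B g w"
  and left: "AE w in M. stieltjes V h w & (ALL s>0. (traj C w ---> Cl s w) (at_left s))"
 shows "clm (%t w. (X t w * C t w - Sint B (%s w. X s w * g s w) t w) * W t w - Sint V (%s w. Cl s w * h s w) t w)"
  (is "clm (%t w. ?I t w * W t w - ?J t w)")
proof (rule clm_limit)
 let ?P = "%n t w. dsum n (%u v. C u w * (X v w - X u w)) t"
 let ?Q = "%n t w. dsum n (%u v. C u w * (Sint V h v w - Sint V h u w)) t"
 note cX = clm_cont[OF X] and cW = clm_cont[OF W]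
 have XC: "(%w. X 0 w * C 0 w) : meas (F 0)"
  using cont_adaptedD[OF cX] adaptedD[OF C] by (auto intro!: borel_measurable_times)
 show "clm (%t w. (?P n t w * W t w - ?Q n t w) + (X 0 w * C 0 w) * W t w)" for n
  by (intro clm_add clm_ito_sum_bracket[OF U W cX C] clm_mult_F0[OF W XC])
 show "AE w in M. loc_uniform (%n t. (?P n t w * W t w - ?Q n t w) + (X 0 w * C 0 w) * W t w) (%t. ?I t w * W t w - ?J t w)"
  using path left ibp_limit[OF path cX] AE_cont[OF cW] AE_cont[OF clm_cont[OF clm_ibp[OF X C path]]]
 proof eventually_elim
  case (elim w)
  show ?case
  proof (intro allI impI, goal_cases)
   case (1 T)
   have "EX K. ALL s:{0..T}. abs (C s w) <= K" for T
    by (rule bounded_of_sint[of "traj B w" "traj g w"]) (use elim(1)[unfolded Sint_def] in blast)+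
   hence "ulim T (%n t. ?Q n t w) (%t. ?J t w)"
    unfolding Sint_def using elim(2) by (intro dsum_left_uniform(2)) auto
   moreover have "ulim T (%n t. ?P n t w * W t w) (%t. (?I t w - X 0 w * C 0 w) * W t w)"
    using elim(3) 1 by (intro uniform_lim_mult uniform_limit_const bounded_continuous continuous_on_diff elim(4,5)) auto
   ultimately have "ulim T (%n t. (?P n t w * W t w - ?Q n t w) + (X 0 w * C 0 w) * W t w)
    (%t. ((?I t w - X 0 w * C 0 w) * W t w - ?J t w) + (X 0 w * C 0 w) * W t w)"
    by (intro uniform_limit_add uniform_limit_minus uniform_limit_const)
   thus ?case by (simp add: algebra_simps)
  qed
 qed
qed

lemma exceed_prob_small:
 assumes "cont_adapted X" "T >= 0" "e > 0"
 shows "EX c>0. prob (exceeds X T c) < e"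
proof -
 have "AE w in M. eventually (%c. w ~: exceeds X T (real c)) sequentially"
  using AE_cont[OF assms(1)]
 proof eventually_elim
  case (elim w)
  obtain K where K: "!!s. s : {0..T} ==> abs (X s w) <= K"
   using bounded_continuous[OF elim, of T] unfolding bounded_iff by (metis image_eqI real_norm_def)
  have "w ~: exceeds X T (real c)" if "c >= nat \<lceil>K\<rceil>" for c
  proof -
   have "K <= real c" using that by linarith
   thus ?thesis using K by force
  qed
  thus ?case by (rule eventually_sequentiallyI)
 qed
 from order_tendstoD(2)[OF prob_tendsto_0[OF exceed_M[OF cont_right_cont[OF assms(1)] assms(2)] this] assms(3)]
 have "eventually (%c. prob (exceeds X T (real c)) < e & c > 0) sequentially"
  using eventually_gt_at_top[of 0] by eventually_elim simp
 thus ?thesis using eventually_happens'[OF sequentially_bot] of_nat_0_less_iff by blast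
qed

text \<open>Along dyadic partitions the sums of squared increments are bounded in probability: they are dominated by A
 in the sense of Lenglart's inequality.\<close>

lemma qv_tight:
 assumes X: "clm X" and XA: "clm (%t w. (X t w)\<^sup>2 - A t w)" and A: "cont_adapted A" "AE w in M. A 0 w = 0"
  and T: "T >= 0" and e: "e > 0"
 defines "Q == %n t w. sqrt (dsum n (%u v. (X v w - X u w)\<^sup>2) t)"
 shows "cont_adapted (Q n)" "EX K. ALL n. T <= 2^n --> prob (exceeds (Q n) T K) <= e"
proof -
 let ?q = "%n t w. dsum n (%u v. (X v w - X u w)\<^sup>2) t"
 let ?B = "%n t w. dsum n (%u v. 1 * (A v w - A u w)) t"
 have adX: "adapted F (%u w. 2 * X u w)"
  using clm_cont[OF X] by (auto simp: cont_adapted_def adapted_def)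
 have one: "adapted F (%u w. 1)" by (simp add: adapted_def)
 have eq: "?q n t w - ?B n t w = dsum n (%u v. 1 * (((X v w)\<^sup>2 - A v w) - ((X u w)\<^sup>2 - A u w))) t -
   dsum n (%u v. (2 * X u w) * (X v w - X u w)) t" for n t w
  unfolding dsum_diff[symmetric] by (rule arg_cong[where f="%h. dsum n h t"]) (simp add: fun_eq_iff power2_eq_square algebra_simps)
 have qB: "clm (%t w. ?q n t w - ?B n t w)" for n
  unfolding eq by (intro clm_diff clm_ito_sum X XA adX one)
 note cB = cont_adapted_ito_sum[OF A(1) one]
 have cq: "cont_adapted (?q n)" for n using cont_adapted_add[OF clm_cont[OF qB[of n]] cB[of n]] by simp
 show cQ: "cont_adapted (Q n)" for n
  using cq[of n] unfolding Q_def cont_adapted_def adapted_def by (auto elim!: eventually_mono intro!: borel_measurable_sqrt continuous_on_real_sqrt)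
 have QB: "clm (%t w. (Q n t w)\<^sup>2 - ?B n t w)" for n
  using qB[of n] unfolding Q_def by (simp add: dsum_def sum_nonneg)
 obtain c where c: "c > 0" "prob (exceeds A T c) < e/2" using exceed_prob_small[OF A(1) T, of "e/2"] e by auto
 define K where "K = sqrt (4 * c / e)"
 have K: "K > 0" "2 * c / K\<^sup>2 = e/2" using c e by (auto simp: K_def)
 have "prob (exceeds (Q n) T K) <= e" if n: "T <= 2^n" for n
 proof -
  have "prob (exceeds (Q n) T K) <= 2 * c / K\<^sup>2 + prob (exceeds (?B n) T (2 * c / 2))"
   by (rule lenglart[OF cQ _ cB _ QB]) (use K c T in "auto simp: Q_def dsum_def")
  also have "prob (exceeds (?B n) T (2 * c / 2)) = prob (exceeds A T c)"
  proof (rule finite_measure_eq_AE[OF _ exceed_M[OF cont_right_cont[OF cB] T] exceed_M[OF cont_right_cont[OF A(1)] T]])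
   show "AE w in M. (w : exceeds (?B n) T (2 * c / 2)) = (w : exceeds A T c)"
    using A(2) by eventually_elim (use n dsum_telescope[of _ n] in auto)
  qed
  finally show ?thesis using c K by simp
 qed
 thus "EX K. ALL n. T <= 2^n --> prob (exceeds (Q n) T K) <= e" by blast
qed

text \<open>Ito's formula, up to the identification of its martingale part. The cubic Taylor remainder only
 has to hold along the path, which admits functions such as 1/x on positive paths. Expanding over the
 dyadic cells leaves martingale sums, a Riemann sum, and a remainder that is small because the squared
 increments stay bounded in probability while the increments tend to 0.\<close>

lemma clm_ito:
 assumes X: "clm X" and XA: "clm (%t w. (X t w)\<^sup>2 - Sint V a t w)"
  and path: "AE w in M. increasing_path (traj V w) & continuous_on {0..} (traj V w) & lbm (traj a w)"
  and f: "f : borel_measurable borel" "f1 : borel_measurable borel" "f2 : borel_measurable borel"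
  and fX: "AE w in M. continuous_on {0..} (%t. f (X t w)) & continuous_on {0..} (%t. f2 (X t w)) &
   (ALL T>=0. EX ka. ALL u:{0..T}. ALL v:{0..T}. abs (f (X v w) - f (X u w) - f1 (X u w) * (X v w - X u w) -
     f2 (X u w) * (X v w - X u w)\<^sup>2 / 2) <= ka * abs (X v w - X u w)^3)"
 shows "clm (%t w. f (X t w) - Sint V (%s w. f2 (X s w) * a s w) t w / 2)"
proof -
 have cX: "cont_adapted X" by (rule clm_cont[OF X])
 have adX: "adapted F X" using cX by (simp add: cont_adapted_def)
 let ?A = "Sint V a"
 let ?S = "%t w. Sint V (%s w. f2 (X s w) * a s w) t w"
 let ?r = "%w u v. f (X v w) - f (X u w) - f1 (X u w) * (X v w - X u w) - f2 (X u w) * (X v w - X u w)\<^sup>2 / 2"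
 define R where "R n t w = dsum n (%u v. f2 (X u w) * (?A v w - ?A u w)) t" for n t w
 define P where "P n t w = f (X 0 w) + dsum n (%u v. f1 (X u w) * (X v w - X u w)) t +
  (1/2) * (dsum n (%u v. f2 (X u w) * (((X v w)\<^sup>2 - ?A v w) - ((X u w)\<^sup>2 - ?A u w))) t
   - dsum n (%u v. (2 * f2 (X u w) * X u w) * (X v w - X u w)) t)" for n t w
 define U where "U t w = f (X t w) - ?S t w / 2" for t w
 have ad: "adapted F (%t w. h (X t w))" if "h : borel_measurable borel" for h :: "real => real"
  unfolding adapted_def using adX that by (auto simp: adapted_def intro: measurable_compose)
 have ad2: "adapted F (%t w. 2 * f2 (X t w) * X t w)"
  using ad[of "%x. 2 * f2 x * x"] f by simp
 have P: "clm (P n)" for n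
  unfolding P_def[abs_def]
  by (intro clm_add clm_cmult clm_diff clm_ito_sum X XA ad ad2 f clm_const adaptedD[OF ad]) simp
 have cA: "cont_adapted ?A"
  using cont_adapted_diff[OF cont_adapted_mult[OF cX cX] clm_cont[OF XA]] by (simp add: power2_eq_square)
 have Rlim: "AE w in M. loc_uniform (%n t. R n t w) (traj ?S w)"
  using path fX
 proof eventually_elim
  case (elim w)
  show ?case
  proof (intro allI impI, goal_cases)
   case (1 T)
   have c: "continuous_on {0..} (%t. f2 (X t w))" using elim by blast
   show ?case
    unfolding R_def Sint_def
    by (rule dsum_left_uniform(2)) (use elim 1 bounded_continuous[OF c] cont_left_limit[OF c] in "auto simp: bounded_iff")
  qed
 qed
 have cU: "cont_adapted (%t w. f (X t w) - (1/2) * ?S t w)"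
 proof (intro cont_adapted_diff cont_adapted_mult[OF cont_adapted_const])
  show "cont_adapted (%t w. f (X t w))" using ad[OF f(1)] fX by (auto simp: cont_adapted_def elim: eventually_mono)
  show "cont_adapted ?S"
   by (rule cont_adapted_limit[OF _ Rlim]) (simp add: R_def[abs_def] cont_adapted_ito_sum cA ad f)
 qed simp
 hence cU: "cont_adapted U" by (simp add: U_def[abs_def])
 have UP: "U t w - P n t w = dsum n (?r w) t + (R n t w - ?S t w) / 2" if "0 <= t" "t <= 2^n" for t w n
 proof -
  have fd: "f (X t w) = f (X 0 w) + dsum n (%u v. f (X v w) - f (X u w)) t"
   using dsum_telescope[OF that, of "%t. f (X t w)"] by simp
  have "dsum n (%u v. f2 (X u w) * (((X v w)\<^sup>2 - ?A v w) - ((X u w)\<^sup>2 - ?A u w))) t - dsum n (%u v. (2 * f2 (X u w) * X u w) * (X v w - X u w)) t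
   = dsum n (%u v. 2 * (f2 (X u w) * (X v w - X u w)\<^sup>2 / 2)) t - R n t w"
   unfolding R_def dsum_diff[symmetric] by (rule arg_cong[where f="%h. dsum n h t"]) (simp add: fun_eq_iff power2_eq_square field_simps)
  thus ?thesis
   unfolding U_def P_def fd dsum_diff dsum_cmult by (simp add: field_simps)
 qed
 have "EX Y. clm Y & near T e Y U" if T: "T >= 0" and e: "e > 0" for T e
 proof -
  define Q where "Q n t w = sqrt (dsum n (%u v. (X v w - X u w)\<^sup>2) t)" for n t w
  have A0: "AE w in M. ?A 0 w = 0" by (simp add: Sint_def)
  have "e/2 > 0" using e by simp
  note qv = qv_tight[OF X XA cA A0 T this, folded Q_def]
  obtain K where K: "!!n. T <= 2^n ==> prob (exceeds (Q n) T K) <= e/2" using qv(2) by blast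
  let ?E = "%n. exceeds (%s w. U s w - P n s w) T e" and ?B = "%n. exceeds (Q n) T K"
  have M: "?E n : sets M" "?B n : sets M" for n
   by (intro exceed_M cont_right_cont cont_adapted_diff cU clm_cont P qv(1) T)+
  have "AE w in M. eventually (%n. w ~: ?E n - ?B n) sequentially"
   using Rlim fX AE_cont[OF cX]
  proof eventually_elim
   case (elim w)
   obtain ka where ka: "ka > 0" "!!u v. u : {0..T} ==> v : {0..T} ==> abs (?r w u v) <= ka * abs (X v w - X u w)^3"
   proof -
    obtain k where "ALL u:{0..T}. ALL v:{0..T}. abs (?r w u v) <= k * abs (X v w - X u w)^3" using elim(2) T by blast
    moreover have "k * abs x^3 <= max k 1 * abs x^3" for x :: real by (intro mult_right_mono) auto
    ultimately have "abs (?r w u v) <= max k 1 * abs (X v w - X u w)^3" if "u : {0..T}" "v : {0..T}" for u v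
     using that order_trans by blast
    thus thesis by (intro that[of "max k 1"]) auto
   qed
   define q where "q = K\<^sup>2 + 1"
   define d where "d = e / (2 * ka * q)"
   have "q > 0" using zero_le_power2[of K] unfolding q_def by linarith
   hence "d > 0" "ka * d * q = e / 2" using e ka(1) by (simp_all add: d_def)
   hence d: "d > 0" "ka * d * K\<^sup>2 <= e / 2" using ka(1) mult_pos_pos[of ka d] by (auto simp: q_def distrib_left)
   have "uniformly_continuous_on {0..T} (traj X w)"
    by (intro compact_uniformly_continuous continuous_on_subset[OF elim(3)]) auto
   then obtain \<eta> where \<eta>: "\<eta> > 0" "!!u v. u : {0..T} ==> v : {0..T} ==> abs (v - u) < \<eta> ==> abs (X v w - X u w) < d"
    using d(1) unfolding uniformly_continuous_on_def dist_real_def by metis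
   show ?case
    using order_tendstoD(2)[OF inverse_pow2_tendsto \<eta>(1)] uniform_limitD[OF elim(1)[rule_format, OF T] e] eventually_le_pow2[of T]
   proof eventually_elim
    case (elim n)
    have "abs (U t w - P n t w) <= e" if q: "abs (Q n t w) <= K" and t: "t : {0..T}" for t
    proof -
     have "abs (dsum n (?r w) t) <= dsum n (%u v. (ka * d) * (X v w - X u w)\<^sup>2) t"
     proof (rule dsum_abs_le)
      fix u v assume uv: "0 <= u" "u <= v" "v <= t" "v - u <= 1/2^n"
      hence i: "u : {0..T}" "v : {0..T}" using t by auto
      have "abs (X v w - X u w) <= d" using \<eta>(2)[OF i] uv elim by auto
      hence "abs (X v w - X u w) * (X v w - X u w)\<^sup>2 <= d * (X v w - X u w)\<^sup>2" by (intro mult_right_mono) auto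
      hence "ka * abs (X v w - X u w)^3 <= ka * (d * (X v w - X u w)\<^sup>2)"
       using ka(1) by (intro mult_left_mono) (auto simp: power3_eq_cube power2_eq_square abs_mult_self_eq mult.assoc)
      thus "abs (?r w u v) <= (ka * d) * (X v w - X u w)\<^sup>2" using ka(2)[OF i] by (simp add: mult.assoc)
     qed (use t in auto)
     also have "... = (ka * d) * dsum n (%u v. (X v w - X u w)\<^sup>2) t" by (rule dsum_cmult)
     also have "... <= (ka * d) * K\<^sup>2"
     proof (rule mult_left_mono)
      have "dsum n (%u v. (X v w - X u w)\<^sup>2) t = (Q n t w)\<^sup>2" by (simp add: Q_def dsum_def sum_nonneg)
      also have "... <= K\<^sup>2" using q by (intro abs_le_square_iff[THEN iffD1]) simp
      finally show "dsum n (%u v. (X v w - X u w)\<^sup>2) t <= K\<^sup>2" .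
     qed (use ka d in auto)
     finally have "abs (dsum n (?r w) t) <= e / 2" using d(2) by simp
     moreover have "abs (R n t w - ?S t w) <= e" using elim t by (force simp: dist_real_def)
     moreover have "abs q <= e / 2 ==> abs r <= e ==> abs (q + r / 2) <= e" for q r by linarith
     ultimately show ?thesis using UP[of t n w] t elim by simp
    qed
    thus ?case by (force simp: not_less)
   qed
  qed
  hence "(%n. prob (?E n - ?B n)) ----> 0" using M by (intro prob_tendsto_0) auto
  hence "eventually (%n. prob (?E n - ?B n) < e/2) sequentially" using e by (intro order_tendstoD) auto
  hence "eventually (%n. prob (?E n - ?B n) < e/2 & T <= 2^n) sequentially"
   using eventually_le_pow2[of T] by eventually_elim simp
  then obtain n where n: "prob (?E n - ?B n) < e/2" "T <= 2^n" using eventually_happens'[OF sequentially_bot] by blast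
  have "prob (?E n) <= prob (?E n - ?B n) + prob (?B n)"
   using measure_Un_le[of "?E n - ?B n" M "?B n"] finite_measure_mono[of "?E n" "(?E n - ?B n) Un ?B n"] M by auto
  hence "prob (?E n) <= e" using n K[of n] by simp
  hence "near T e (P n) U"
   unfolding near_def using M by (intro bexI[of _ "?E n"]) (auto simp: not_less abs_minus_commute)
  thus ?thesis using P by blast
 qed
 hence "clm U" by (intro clm_near cU)
 thus ?thesis by (simp add: U_def[abs_def])
qed

end

section \<open>Stieltjes exponentials\<close>

abbreviation (input) rc_path :: "(real => real) => bool" where
 "rc_path x == (ALL s>=0. (x ---> x s) (at_right s)) & (ALL T. EX K. ALL s:{0..T}. abs (x s) <= K)"

lemma rc_bounded_lbm:
 assumes rc: "!!s. s >= 0 ==> (x ---> x s) (at_right s)" and bd: "!!T. EX K. ALL s:{0..T}. abs (x s) <= K"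
 shows "lbm x"
proof (rule lbm_limit)
 show "lbm (%s. x (lg n s + 1/2^n))" for n
 proof (rule lbm_step[where c="%u. x (u + 1/2^n)"])
  fix T :: real
  obtain K where "ALL s:{0..T + 1/2^n}. abs (x s) <= K" using bd by blast
  thus "EX K. ALL s:{0..T}. abs (x (s + 1/2^n)) <= K" by (intro exI[of _ K]) auto
 qed
 show "(%n. x (lg n s + 1/2^n)) ----> x s" if "s > 0" for s
  using right_tendsto[OF rc rg_tendsto cell_bounds(2)] that unfolding cell_bounds(3) by simp
 fix T :: real
 obtain K where "ALL s:{0..T}. abs (x s) <= K" using bd by blast
 thus "EX K. ALL s:{0<..T}. abs (x s) <= K" by (intro exI[of _ K]) auto
qed

lemma riemann_right:
 assumes b: "increasing_path b" and g: "lbm g" and t: "t >= 0"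
  and rc: "!!s. s >= 0 ==> (x ---> x s) (at_right s)" and bd: "EX K. ALL s:{0..t}. abs (x s) <= K"
 shows "(%n. dsum n (%u v. x v * sint b g u v) t) ----> sint b (%s. x s * g s) 0 t"
proof -
 obtain n0 where n0: "t < 2^n0" using real_arch_pow[of 2 t] by auto
 have tn: "t <= 2^(n + n0)" for n
  using n0 power_increasing[of n0 "n + n0" "2::real"] by linarith
 obtain K L where K: "ALL s:{0..t}. abs (x s) <= K" and L: "L > 0" "!!s. s : {0<..t} ==> abs (g s) <= L" using bd lbm_bound[OF g] by metis
 have si: "set_integrable (path_measure b) {u<..v} (%s. x v * g s)" if "0 <= u" for u v
  using that g by (intro lbm_set_integrable[OF b] lbm_mult) auto
 have mr: "min t (rg n s) : {0..t}" "s <= min t (rg n s)" if "s : {0<..t}" for n s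
  using that cell_bounds(2)[where n=n and s=s] by auto
 have K0: "0 <= K" using K t by (meson abs_ge_zero atLeastAtMost_iff order_refl order_trans)
 note ds = dsum_sint[OF b t tn, where psi="%u v s. x v * g s", OF si]
 have "(%n. sint b (%s. x (min t (rg (n + n0) s)) * g s) 0 t) ----> sint b (%s. x s * g s) 0 t"
 proof (rule sint_dct(2)[OF b order_refl ds(1)])
  show "(%n. x (min t (rg (n + n0) s)) * g s) ----> x s * g s" if s: "s : {0<..t}" for s
  proof (rule tendsto_mult[OF right_tendsto[where x=x and s=s and y="%n. min t (rg (n + n0) s)"] tendsto_const])
   show "(x ---> x s) (at_right s)" using rc s by simp
   show "(%n. min t (rg (n + n0) s)) ----> s" using s by (intro LIMSEQ_ignore_initial_segment min_rg_tendsto) simp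
  qed (use mr s in blast)
  show "abs (x (min t (rg (n + n0) s)) * g s) <= K * L" if "s : {0<..t}" for n s
   unfolding abs_mult using K K0 mr[OF that, of "n + n0"] L that by (intro mult_mono) auto
 qed
 moreover have "sint b (%s. x (min t (rg (n + n0) s)) * g s) 0 t = dsum (n + n0) (%u v. x v * sint b g u v) t" for n
  using ds(2)[of n] by (simp add: sint_cmult)
 ultimately have "(%n. dsum (n + n0) (%u v. x v * sint b g u v) t) ----> sint b (%s. x s * g s) 0 t" by simp
 thus ?thesis by (rule LIMSEQ_offset)
qed

text \<open>The solution of \<open>dE = E\<^sub>- w db\<close> is the product integral of 1 + w db. It is constructed as the increasing limit of
 the products over the dyadic cells, which treats the continuous part and the jumps of b alike.\<close>

definition pexp_n :: "(real => real) => (real => real) => nat => real => real" where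
 "pexp_n b w n t = (PROD i<4^n. 1 + sint b w (min t (real i / 2^n)) (min t (real (Suc i) / 2^n)))"

definition pexp :: "(real => real) => (real => real) => real => real" where
 "pexp b w t = lim (%n. pexp_n b w n t)"

context
 fixes b w assumes b: "increasing_path b" and w: "lbm w" and w0: "!!s. s > 0 ==> w s >= 0"
begin

lemma sint_w_nonneg: "0 <= u ==> 0 <= sint b w u v"
 using w0 by (intro sint_nonneg[OF b _ w]) auto

lemma sint_w_split: "0 <= u ==> u <= v ==> v <= x ==> sint b w u x = sint b w u v + sint b w v x"
 by (rule sint_split_lbm[OF b w])

lemma pexp_n_mono_t:
 assumes "0 <= s" "s <= t" shows "pexp_n b w n s <= pexp_n b w n t"
 unfolding pexp_n_def
proof (intro prod_mono conjI)
 fix i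
 let ?a = "real i / 2^n" and ?c = "real (Suc i) / 2^n"
 have ac: "?a <= ?c" by (rule dyadic_le)
 show "0 <= 1 + sint b w (min s ?a) (min s ?c)" using sint_w_nonneg[of "min s ?a" "min s ?c"] assms by simp
 show "1 + sint b w (min s ?a) (min s ?c) <= 1 + sint b w (min t ?a) (min t ?c)"
 proof (cases "s <= ?a")
  case True
  thus ?thesis using ac assms sint_w_nonneg[of "min t ?a" "min t ?c"] by (simp add: min_absorb1)
 next
  case False
  thus ?thesis
   using assms sint_w_split[of ?a "min s ?c" "min t ?c"] sint_w_nonneg[of "min s ?c" "min t ?c"] ac by (simp add: min_absorb2)
 qed
qed

lemma pexp_n_mono_n:
 assumes "0 <= t" shows "pexp_n b w n t <= pexp_n b w (Suc n) t"
proof -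
 let ?x = "%j. min t (real j / 2^Suc n)"
 let ?f = "%j. 1 + sint b w (?x j) (?x (Suc j))"
 have f1: "1 <= ?f j" for j using sint_w_nonneg[of "?x j"] assms by simp
 have half: "real i / 2^n = real (i * 2) / 2^Suc n" for i by simp
 have "pexp_n b w n t <= (PROD i<4^n. prod ?f {i * 2..<i * 2 + 2})"
  unfolding pexp_n_def
 proof (intro prod_mono conjI)
  fix i
  have le: "?x (i * 2) <= ?x (Suc (i * 2))" "?x (Suc (i * 2)) <= ?x (Suc (Suc (i * 2)))"
   by (intro min.mono order_refl dyadic_le)+
  have eq: "sint b w (min t (real i / 2^n)) (min t (real (Suc i) / 2^n)) = sint b w (?x (i * 2)) (?x (Suc (i * 2))) + sint b w (?x (Suc (i * 2))) (?x (Suc (Suc (i * 2))))"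
   unfolding half using sint_w_split[OF _ le] assms by simp
  show "0 <= 1 + sint b w (min t (real i / 2^n)) (min t (real (Suc i) / 2^n))" using sint_w_nonneg assms by (simp add: add_nonneg_nonneg)
  have "1 + (p + q) <= (1 + p) * (1 + q)" if "0 <= p" "0 <= q" for p q :: real
   using mult_nonneg_nonneg[OF that] by (simp add: algebra_simps)
  hence "1 + sint b w (min t (real i / 2^n)) (min t (real (Suc i) / 2^n)) <= ?f (i * 2) * ?f (Suc (i * 2))"
   unfolding eq using sint_w_nonneg[of "?x (i * 2)"] sint_w_nonneg[of "?x (Suc (i * 2))"] assms by simp
  also have "... = prod ?f {i * 2..<i * 2 + 2}" by (simp add: numeral_2_eq_2 atLeastLessThanSuc)
  finally show "1 + sint b w (min t (real i / 2^n)) (min t (real (Suc i) / 2^n)) <= prod ?f {i * 2..<i * 2 + 2}" .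
 qed
 also have "... = prod ?f {..<4^n * 2}" by (rule prod.nat_group)
 also have "... <= prod ?f {..<4^Suc n}" using f1 by (intro prod_mono2) (auto intro: order_trans[OF zero_le_one])
 finally show ?thesis unfolding pexp_n_def .
qed

lemma pexp_n_bounds:
 assumes "0 <= t" shows "1 <= pexp_n b w n t" "pexp_n b w n t <= exp (sint b w 0 t)"
proof -
 let ?x = "%j. min t (real j / 2^n)"
 have x0: "0 <= ?x j" for j using assms by simp
 show "1 <= pexp_n b w n t" unfolding pexp_n_def using sint_w_nonneg[OF x0] by (intro prod_ge_1) simp
 have "(SUM i<N. sint b w (?x i) (?x (Suc i))) = sint b w 0 (?x N)" for N
 proof (induction N)
  case (Suc N)
  have "?x N <= ?x (Suc N)" by (intro min.mono order_refl dyadic_le)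
  from sint_w_split[OF order_refl x0[of N] this] Suc show ?case by (simp only: sum.lessThan_Suc)
 qed (use assms in simp)
 hence s: "(SUM i<4^n. sint b w (?x i) (?x (Suc i))) <= sint b w 0 t"
  using sint_w_split[OF order_refl x0[of "4^n"], of t] sint_w_nonneg[OF x0[of "4^n"], of t] by simp
 have "pexp_n b w n t <= (PROD i<4^n. exp (sint b w (?x i) (?x (Suc i))))"
  unfolding pexp_n_def using sint_w_nonneg[OF x0] by (intro prod_mono conjI exp_ge_add_one_self) (simp add: add_nonneg_nonneg)
 also have "... <= exp (sint b w 0 t)" using s by (simp flip: exp_sum)
 finally show "pexp_n b w n t <= exp (sint b w 0 t)" .
qed

lemma pexp_tendsto: "0 <= t ==> (%n. pexp_n b w n t) ----> pexp b w t"
 and pexp_n_le: "0 <= t ==> pexp_n b w n t <= pexp b w t"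
proof -
 assume t: "0 <= t"
 have "incseq (%n. pexp_n b w n t)" using pexp_n_mono_n[OF t] by (rule incseq_SucI)
 then obtain l where "(%n. pexp_n b w n t) ----> l"
  using incseq_convergent pexp_n_bounds(2)[OF t] by blast
 thus 1: "(%n. pexp_n b w n t) ----> pexp b w t" unfolding pexp_def by (simp add: limI)
 show "pexp_n b w n t <= pexp b w t" using \<open>incseq _\<close> 1 by (rule incseq_le)
qed

lemma pexp_ge_1: "0 <= t ==> 1 <= pexp b w t"
 using pexp_n_bounds(1) pexp_n_le order_trans by blast

lemma pexp_mono: "0 <= s ==> s <= t ==> pexp b w s <= pexp b w t"
 by (rule LIMSEQ_le[OF pexp_tendsto pexp_tendsto]) (auto intro: pexp_n_mono_t)

lemma pexp_0: "pexp b w 0 = 1"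
 unfolding pexp_def pexp_n_def by (simp add: min_absorb1)

lemma pexp_n_dsum:
 assumes "0 <= t" shows "pexp_n b w n t - 1 = dsum n (%u v. pexp_n b w n u * sint b w u v) t"
proof -
 let ?x = "%j. min t (real j / 2^n)"
 let ?p = "%k. PROD i<k. 1 + sint b w (?x i) (?x (Suc i))"
 have p: "pexp_n b w n (?x k) = ?p k" if "k <= 4^n" for k
 proof -
  have "pexp_n b w n (?x k) = (PROD i<4^n. if i < k then 1 + sint b w (?x i) (?x (Suc i)) else 1)"
   unfolding pexp_n_def
  proof (intro prod.cong refl)
   fix i
   have "i < k ==> real i / 2^n <= real k / 2^n & real (Suc i) / 2^n <= real k / 2^n"
    "~ i < k ==> real k / 2^n <= real i / 2^n & real k / 2^n <= real (Suc i) / 2^n"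
    by (auto simp del: of_nat_Suc intro!: divide_right_mono)
   thus "1 + sint b w (min (?x k) (real i / 2^n)) (min (?x k) (real (Suc i) / 2^n)) = (if i < k then 1 + sint b w (?x i) (?x (Suc i)) else 1)"
    by (cases "i < k") (simp_all add: min.assoc min_absorb1 min_absorb2)
  qed
  also have "... = (PROD i:{..<4^n} Int {i. i < k}. 1 + sint b w (?x i) (?x (Suc i)))" by (simp add: prod.inter_restrict del: of_nat_Suc)
  also have "{..<4^n} Int {i. i < k} = {..<k}" using that by auto
  finally show ?thesis .
 qed
 have "(SUM i<4^n. ?p (Suc i) - ?p i) = ?p (4^n) - ?p 0" by (rule sum_lessThan_telescope)
 moreover have "(SUM i<4^n. ?p (Suc i) - ?p i) = (SUM i<4^n. pexp_n b w n (?x i) * sint b w (?x i) (?x (Suc i)))"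
  by (intro sum.cong refl) (simp add: p algebra_simps)
 ultimately show ?thesis unfolding dsum_def by (simp add: pexp_n_def)
qed

definition pexp_left :: "real => real" where "pexp_left s = (SUP u\<in>{0..<s}. pexp b w u)"

lemma pexp_left_bounds:
 assumes "s > 0" shows "1 <= pexp_left s" "pexp_left s <= pexp b w s" "0 <= u ==> u < s ==> pexp b w u <= pexp_left s"
proof -
 have bdd: "bdd_above (pexp b w ` {0..<s})" using pexp_mono by (intro bdd_aboveI2[of _ _ "pexp b w s"]) auto
 show up: "0 <= u ==> u < s ==> pexp b w u <= pexp_left s" for u
  unfolding pexp_left_def by (intro cSUP_upper bdd) auto
 show "1 <= pexp_left s" using up[of 0] assms pexp_0 by simp
 show "pexp_left s <= pexp b w s" unfolding pexp_left_def using assms pexp_mono by (intro cSUP_least) auto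
qed

lemma pexp_left_approx:
 assumes "s > 0" "c < pexp_left s" obtains u where "0 <= u" "u < s" "c < pexp b w u"
proof -
 have "bdd_above (pexp b w ` {0..<s})" using pexp_mono by (intro bdd_aboveI2[of _ _ "pexp b w s"]) auto
 thus thesis using assms that unfolding pexp_left_def by (subst (asm) less_cSUP_iff) auto
qed

lemma pexp_left_tendsto:
 assumes "s > 0" shows "(pexp b w ---> pexp_left s) (at_left s)"
proof (rule order_tendstoI)
 fix c assume "c < pexp_left s"
 then obtain u where u: "0 <= u" "u < s" "c < pexp b w u" using pexp_left_approx[OF assms] by blast
 hence "c < pexp b w v" if "u < v" for v using pexp_mono[of u v] that by linarith
 thus "eventually (%v. c < pexp b w v) (at_left s)" using u(2) by (auto simp: eventually_at_left_field)
next
 fix c assume "pexp_left s < c"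
 hence "pexp b w v < c" if "0 < v" "v < s" for v using pexp_left_bounds(3)[OF assms, of v] that by linarith
 thus "eventually (%v. pexp b w v < c) (at_left s)" using assms by (auto simp: eventually_at_left_field)
qed

lemma lbm_pexp_left: "lbm pexp_left"
proof (rule lbm_limit)
 show "lbm (%s. pexp b w (lg n s))" for n
 proof (rule lbm_step)
  show "EX K. ALL s:{0..T}. abs (pexp b w s) <= K" for T
   using pexp_ge_1 pexp_mono by (intro exI[of _ "pexp b w T"]) (force simp: abs_of_nonneg)
 qed
 show "(%n. pexp b w (lg n s)) ----> pexp_left s" if "s > 0" for s
  by (rule lg_tendsto_left[OF pexp_left_tendsto[OF that]])
 fix T
 have "abs (pexp_left s) <= pexp b w T" if "s : {0<..T}" for s
  using pexp_left_bounds(1,2)[of s] pexp_mono[of s T] that by auto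
 thus "EX K. ALL s:{0<..T}. abs (pexp_left s) <= K" by blast
qed

text \<open>\<open>dE = E\<^sub>- w db\<close>.\<close>

lemma pexp_sint:
 assumes t: "0 <= t" shows "pexp b w t = 1 + sint b (%s. pexp_left s * w s) 0 t"
proof -
 obtain n0 where n0: "t < 2^n0" using real_arch_pow[of 2 t] by auto
 have tn: "t <= 2^(n + n0)" for n
  using n0 power_increasing[of n0 "n + n0" "2::real"] by linarith
 obtain L where L: "L > 0" "!!s. s : {0<..t} ==> abs (w s) <= L" using lbm_bound[OF w] by metis
 have si: "set_integrable (path_measure b) {u<..v} (%s. pexp_n b w n u * w s)" if "0 <= u" for u v n
  using that w by (intro lbm_set_integrable[OF b] lbm_mult) auto
 note ds = dsum_sint[OF b t tn, where psi="%u v s. pexp_n b w (n + n0) u * w s" for n, OF si]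
 have "(%n. sint b (%s. pexp_n b w (n + n0) (lg (n + n0) s) * w s) 0 t) ----> sint b (%s. pexp_left s * w s) 0 t"
 proof (rule sint_dct(2)[OF b order_refl ds(1)])
  fix s assume s: "s : {0<..t}"
  have lgs: "0 <= lg n s" "lg n s < s" for n using cell_bounds[where n=n and s=s] s by auto
  have "(%n. pexp_n b w n (lg n s)) ----> pexp_left s"
  proof (rule order_tendstoI)
   fix c assume "c < pexp_left s"
   then obtain u where u: "0 <= u" "u < s" "c < pexp b w u" using pexp_left_approx s by auto
   have "eventually (%n. c < pexp_n b w n u) sequentially" using pexp_tendsto[OF u(1)] u(3) by (rule order_tendstoD)
   moreover have "eventually (%n. u < lg n s) sequentially" using lg_tendsto u(2) by (rule order_tendstoD)
   ultimately show "eventually (%n. c < pexp_n b w n (lg n s)) sequentially"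
    by eventually_elim (use pexp_n_mono_t[OF u(1)] in "force intro: less_le_trans less_imp_le")
  next
   fix c assume "pexp_left s < c"
   thus "eventually (%n. pexp_n b w n (lg n s) < c) sequentially"
    using pexp_n_le[OF lgs(1)] pexp_left_bounds(3)[OF _ lgs] s by (intro always_eventually) (meson greaterThanAtMost_iff le_less_trans)
  qed
  thus "(%n. pexp_n b w (n + n0) (lg (n + n0) s) * w s) ----> pexp_left s * w s"
   by (intro tendsto_intros LIMSEQ_ignore_initial_segment)
  show "abs (pexp_n b w (n + n0) (lg (n + n0) s) * w s) <= pexp b w t * L" for n
   unfolding abs_mult
  proof (rule mult_mono)
   show "abs (pexp_n b w (n + n0) (lg (n + n0) s)) <= pexp b w t"
    using pexp_n_bounds(1)[OF lgs(1), of "n+n0" "n+n0"] pexp_n_le[OF lgs(1), of "n+n0" "n+n0"] pexp_mono[OF lgs(1), of "n+n0" t] lgs(2)[of "n+n0"] s by auto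
  qed (use L s pexp_ge_1[OF t] in auto)
 qed
 moreover have "sint b (%s. pexp_n b w (n + n0) (lg (n + n0) s) * w s) 0 t = pexp_n b w (n + n0) t - 1" for n
  using pexp_n_dsum[OF t, of "n + n0"] ds(2)[of n] by (simp add: sint_cmult)
 ultimately have "(%n. pexp_n b w (n + n0) t - 1) ----> sint b (%s. pexp_left s * w s) 0 t" by simp
 moreover have "(%n. pexp_n b w (n + n0) t - 1) ----> pexp b w t - 1"
  by (intro tendsto_intros LIMSEQ_ignore_initial_segment pexp_tendsto t)
 ultimately show ?thesis using LIMSEQ_unique by fastforce
qed

lemma pexp_right_continuous: "0 <= t ==> (pexp b w ---> pexp b w t) (at_right t)"
proof -
 assume t: "0 <= t"
 have "((%t. 1 + sint b (%s. pexp_left s * w s) 0 t) ---> pexp b w t) (at_right t)"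
  unfolding pexp_sint[OF t] by (intro tendsto_intros sint_right_continuous b lbm_mult lbm_pexp_left w t)
 thus ?thesis
  by (rule Lim_transform_eventually) (use t in \<open>auto simp: eventually_at_right_field pexp_sint intro!: exI[of _ "t+1"]\<close>)
qed

text \<open>d(1/E) = - (w/E) db: over an interval, 1/E changes by \<open>- \<Delta>E / (E\<^sub>u E\<^sub>v)\<close>.\<close>

lemma inverse_pexp_sint:
 assumes t: "0 <= t" shows "1 / pexp b w t = 1 + sint b (%s. - (w s / pexp b w s)) 0 t"
proof -
 obtain L where L: "L > 0" "!!s. s : {0<..t} ==> abs (w s) <= L" using lbm_bound[OF w] by metis
 note lw = lbm_mult[OF lbm_pexp_left w]
 have "1 / pexp b w t - 1 / pexp b w 0 = sint b (%s. - (w s / pexp b w s)) 0 t"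
 proof (rule sint_by_cells[OF b t, where psi="%u v s. - (1 / (pexp b w u * pexp b w v)) * (pexp_left s * w s)" and K="pexp b w t * L" and y="%t. 1 / pexp b w t"])
  fix u v :: real assume uv: "0 <= u" "u <= v" "v <= t"
  have p: "pexp b w u > 0" "pexp b w v > 0" using pexp_ge_1[of u] pexp_ge_1[of v] uv by auto
  have "pexp b w v - pexp b w u = sint b (%s. pexp_left s * w s) u v"
   using pexp_sint[of u] pexp_sint[of v] sint_split_lbm[OF b lw order_refl uv(1,2)] uv by auto
  thus "1 / pexp b w v - 1 / pexp b w u = sint b (%s. - (1 / (pexp b w u * pexp b w v)) * (pexp_left s * w s)) u v"
   unfolding sint_cmult using p by (simp add: field_simps)
  show "lbm (%s. - (1 / (pexp b w u * pexp b w v)) * (pexp_left s * w s))" by (intro lbm_mult lbm_const lw)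
 next
  fix u v s :: real assume uv: "0 <= u" "u < s" "s <= v" "v <= t"
  have p: "pexp b w u >= 1" "pexp b w v >= 1" using pexp_ge_1[of u] pexp_ge_1[of v] uv by auto
  hence "1 <= pexp b w u * pexp b w v" using mult_mono[of 1 "pexp b w u" 1 "pexp b w v"] by simp
  hence "abs (- (1 / (pexp b w u * pexp b w v))) <= 1" by simp
  moreover have "abs (pexp_left s) <= pexp b w t" using pexp_left_bounds[of s] pexp_mono[of s t] uv by auto
  moreover have "abs (w s) <= L" using L uv by auto
  ultimately have "abs (- (1 / (pexp b w u * pexp b w v))) * (abs (pexp_left s) * abs (w s)) <= 1 * (pexp b w t * L)"
   by (intro mult_mono) auto
  thus "abs (- (1 / (pexp b w u * pexp b w v)) * (pexp_left s * w s)) <= pexp b w t * L" by (simp only: abs_mult mult_1)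
 next
  fix s assume s: "s : {0<..t}"
  have p: "pexp_left s >= 1" "pexp b w s >= 1" using pexp_left_bounds[of s] s by auto
  have "(%n. pexp b w (lg n s)) ----> pexp_left s" using s by (intro lg_tendsto_left pexp_left_tendsto) auto
  moreover have "(%n. pexp b w (min t (rg n s))) ----> pexp b w s"
  proof (rule right_tendsto[OF pexp_right_continuous min_rg_tendsto])
   show "s <= min t (rg n s)" for n using s cell_bounds(2)[where n=n and s=s] by simp
  qed (use s in auto)
  ultimately have "(%n. - (1 / (pexp b w (lg n s) * pexp b w (min t (rg n s)))) * (pexp_left s * w s)) ----> - (1 / (pexp_left s * pexp b w s)) * (pexp_left s * w s)"
   using p by (intro tendsto_intros) auto
  moreover have "- (1 / (pexp_left s * pexp b w s)) * (pexp_left s * w s) = - (w s / pexp b w s)"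
   using p by (simp add: field_simps)
  ultimately show "(%n. - (1 / (pexp b w (lg n s) * pexp b w (min t (rg n s)))) * (pexp_left s * w s)) ----> - (w s / pexp b w s)" by simp
 qed
 thus ?thesis by (simp add: pexp_0)
qed

end

text \<open>The Stieltjes measure of the path that jumps from 0 to 1 at time u.\<close>

lemma nn_integral_jump:
 "(\<integral>\<^sup>+s\<in>{0..}. U s \<partial>path_measure (%t. if u <= ennreal t then 1 else 0)) = (if u < top then U (enn2real u) else 0)"
proof (cases u)
 case top
 define mu where "mu = path_measure (%t. if u <= ennreal t then 1 else (0::real))"
 have i: "increasing_path (%t. if u <= ennreal t then 1 else (0::real))" using top by (auto simp: increasing_path_def mono_on_def top_unique)
 have "emeasure mu {- real n<..real n} = 0" for n
  unfolding mu_def path_measure_def using increasing_path_ext[OF i] by (subst emeasure_interval_measure_Ioc) (auto simp: top top_unique)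
 moreover have "(UN n. {- real n<..real n}) = UNIV"
 proof (intro set_eqI iffI UNIV_I)
  fix x :: real
  obtain n where "abs x < real n" using reals_Archimedean2 by blast
  thus "x : (UN n. {- real n<..real n})" by (intro UN_I[of n]) auto
 qed
 ultimately have "UNIV : null_sets mu" using null_sets_UN[of "%n. {- real n<..real n}" mu] by (auto simp: null_sets_def mu_def)
 hence "AE s in mu. s ~: UNIV" by (rule AE_not_in)
 hence "(\<integral>\<^sup>+s\<in>{0..}. U s \<partial>mu) = (\<integral>\<^sup>+s. 0 \<partial>mu)" by (intro nn_integral_cong_AE) auto
 thus ?thesis using top by (simp add: mu_def)
next
 case (real r)
 define x where "x = (%t. if u <= ennreal t then 1 else (0::real))"
 define mu where "mu = path_measure x"
 have x: "x t = (if r <= t then 1 else 0)" if "t >= 0" for t using that real by (auto simp: x_def ennreal_le_iff)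
 have i: "increasing_path x"
  unfolding increasing_path_def
 proof (intro conjI allI impI)
  show "mono_on {0..} x" by (auto simp: mono_on_def x)
  fix t :: real assume t: "t >= 0"
  have "eventually (%s. x s = x t) (at_right t)"
   unfolding eventually_at_right_field using t x by (intro exI[of _ "if r <= t then t + 1 else r"]) auto
  thus "(x ---> x t) (at_right t)" by (rule tendsto_eventually)
 qed (simp add: x_def)
 have em: "emeasure mu {a<..c} = ennreal ((if c < 0 then 0 else x c) - (if a < 0 then 0 else x a))" if "a <= c" for a c
  unfolding mu_def path_measure_def using increasing_path_ext[OF i] by (subst emeasure_interval_measure_Ioc[OF that]) auto
 have r0: "r >= 0" by fact
 have null: "{s. s ~= r} : null_sets mu"
 proof -
  have "{s. s ~= r} = (UN n. {- real n<..r - 1 / real (Suc n)} Un {r<..r + real n})"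
  proof (intro set_eqI iffI)
   fix s assume s: "s : {s. s ~= r}"
   show "s : (UN n. {- real n<..r - 1 / real (Suc n)} Un {r<..r + real n})"
   proof (cases "s > r")
    case True
    obtain n where "s - r < real n" using reals_Archimedean2 by blast
    thus ?thesis using True by (intro UN_I[of n]) auto
   next
    case False
    hence "r - s > 0" using s by auto
    then obtain n1 where n1: "1 / real (Suc n1) < r - s" using nat_approx_posE by blast
    obtain n2 where n2: "- s < real n2" using reals_Archimedean2 by blast
    have "1 / real (Suc (max n1 n2)) <= 1 / real (Suc n1)" by (intro divide_left_mono) auto
    hence "s : {- real (max n1 n2)<..r - 1 / real (Suc (max n1 n2))}" using n1 n2 by auto
    thus ?thesis by blast
   qed
  next
   fix s assume "s : (UN n. {- real n<..r - 1 / real (Suc n)} Un {r<..r + real n})"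
   then obtain n where "s <= r - 1 / real (Suc n) | r < s" by auto
   moreover have "1 / real (Suc n) > 0" by simp
   ultimately have "s ~= r" by linarith
   thus "s : {s. s ~= r}" by simp
  qed
  moreover have "{- real n<..r - 1 / real (Suc n)} : null_sets mu" for n
  proof (cases "- real n <= r - 1 / real (Suc n)")
   case True
   have "1 / real (Suc n) > 0" by simp
   hence "~ r <= r - 1 / real (Suc n)" by linarith
   thus ?thesis using em[OF True] x by (auto simp: null_sets_def mu_def not_less)
  qed (auto simp: mu_def)
  moreover have "{r<..r + real n} : null_sets mu" for n
   using em[of r "r + real n"] x[of r] x[of "r + real n"] r0 by (auto simp: null_sets_def mu_def)
  ultimately show ?thesis by (auto intro!: null_sets_UN)
 qed
 have "emeasure mu {r - 1<..r} = emeasure mu {r}"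
  using AE_not_in[OF null] by (intro emeasure_eq_AE) (auto simp: mu_def elim!: eventually_mono)
 hence one: "emeasure mu {r} = 1" using em[of "r - 1" r] x[of r] x[of "r - 1"] r0 by (cases "r < 1") auto
 have "(\<integral>\<^sup>+s\<in>{0..}. U s \<partial>mu) = (\<integral>\<^sup>+s. U r * indicator {r} s \<partial>mu)"
  using AE_not_in[OF null] r0 by (intro nn_integral_cong_AE) (auto elim!: eventually_mono)
 also have "... = U r" using one by (simp add: mu_def nn_integral_cmult_indicator)
 finally show ?thesis using real by (simp add: mu_def x_def)
qed

section \<open>Azema's supermartingale and its multiplicative decomposition\<close>

context usual_filtration begin

text \<open>Optional processes are generated by the cadlag adapted ones, for which this holds by definition.\<close>

lemma optional_adapted:
 fixes X :: "real => 'a => real"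
 assumes "optional M F X" shows "adapted F X"
 unfolding adapted_def
proof (intro allI impI)
 fix t :: real assume t: "t >= 0"
 have "(%w. (t, w)) : F t \<rightarrow>\<^sub>M optional_sigma M F"
  unfolding optional_sigma_def
 proof (rule measurable_measure_of)
  show "(%w. (t, w)) : space (F t) \<rightarrow> {0..} \<times> space M" using t space_F[OF t] by auto
  fix y assume "y : {{(t, w) : {0..} \<times> space M. X t w : B} | X B. adapted F X & (ALL w:space M. cadlag_path (traj X w)) & B : sets (borel :: real measure)}"
  then obtain X B where y: "y = {(t, w) : {0..} \<times> space M. X t w : B}" "adapted F X" "B : sets (borel :: real measure)" by blast
  have "(%w. (t, w)) -` y Int space (F t) = X t -` B Int space (F t)" using t space_F[OF t] y(1) by auto
  thus "(%w. (t, w)) -` y Int space (F t) : sets (F t)"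
   using measurable_sets[OF adaptedD[OF y(2) t] y(3)] by simp
 qed auto
 from measurable_compose[OF this assms[unfolded optional_def]] show "X t : meas (F t)" by simp
qed

lemma optional_of_cadlag:
 assumes "adapted F X" "!!w. w : space M ==> cadlag_path (traj X w)"
 shows "(%(t, w). X t w) : meas (optional_sigma M F)"
proof (rule measurableI)
 have sp: "space (optional_sigma M F) = {0..} \<times> space M" unfolding optional_sigma_def by (intro space_measure_of) auto
 fix B :: "real set" assume B: "B : sets borel"
 have "(%(t, w). X t w) -` B Int space (optional_sigma M F) = {(t, w) : {0..} \<times> space M. X t w : B}" by (auto simp: sp)
 also have "... : sets (optional_sigma M F)"
  unfolding optional_sigma_def using assms B by (intro in_measure_of) auto
 finally show "(%(t, w). X t w) -` B Int space (optional_sigma M F) : sets (optional_sigma M F)" .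
qed simp

text \<open>Indicators of (a,\<infinity>) are limits of continuous functions that vanish up to a.\<close>

lemma optional_after:
 assumes "0 <= s" "s <= a" "A : sets (F s)"
 shows "(%(u, w). of_bool (a < u) * indicator A w :: real) : meas (optional_sigma M F)"
proof (rule borel_measurable_LIMSEQ_real)
 let ?f = "%n u w. min 1 (real n * max 0 (u - a)) * indicator A w"
 show "(%(u, w). ?f n u w) : meas (optional_sigma M F)" for n
 proof (rule optional_of_cadlag)
  have "?f n u : meas (F u)" if "u >= 0" for u
  proof (cases "a < u")
   case True
   thus ?thesis using sets_F_mono[OF assms(1) _ assms(3), of u] assms(2) by simp
  qed simp
  thus "adapted F (?f n)" by (simp add: adapted_def)
  show "cadlag_path (traj (?f n) w)" for w by (intro continuous_on_imp_cadlag_path continuous_intros)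
 qed
 fix x :: "real \<times> 'a"
 obtain u w where x: "x = (u, w)" by (cases x)
 have "1 <= real n * (u - a)" if "a < u" "1 / (u - a) <= real n" for n
  using that by (simp add: pos_divide_le_eq)
 hence "eventually (%n. ?f n u w = of_bool (a < u) * indicator A w) sequentially"
  by (intro eventually_mono[OF eventually_real_ge[of "1 / (u - a)"]]) (auto simp: min_def not_less)
 thus "(%n. (%(u, w). ?f n u w) x) ----> (%(u, w). of_bool (a < u) * indicator A w) x"
  unfolding x by (simp add: tendsto_eventually)
qed

lemma stopped_measurable:
 assumes "cont_adapted Y" "\<tau> : meas M" "t >= 0"
 shows "stopped Y \<tau> t : meas M"
proof (rule AE_eq_meas_M)
 have "stop_sum Y \<tau> n t : meas M" for n
 proof -
  have "Y (min t (real j / 2^n)) : meas M" for j using assms by (intro cont_adapted_M) auto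
  moreover have "(%w. of_bool (ennreal (real j / 2^n) < \<tau> w) :: real) : meas M" for j using assms(2) by measurable
  ultimately show ?thesis
   unfolding stop_sum_def[abs_def] using cont_adapted_M[OF assms(1), of 0]
   by (intro borel_measurable_add borel_measurable_sum borel_measurable_times borel_measurable_diff) (auto simp del: of_nat_Suc)
 qed
 thus "(%w. lim (%n. stop_sum Y \<tau> n t w)) : meas M" by (rule borel_measurable_lim_metric)
 show "AE w in M. lim (%n. stop_sum Y \<tau> n t w) = stopped Y \<tau> t w"
  using AE_stop_sum[OF assms(1), of \<tau>]
  by eventually_elim (use assms(3) in "auto intro!: limI intro: tendsto_uniform_limitI")
qed

lemma adapted_Sint:
 assumes Y: "adapted F Y" and C: "adapted F C"
  and path: "AE w in M. primitive C B g w & rc_path (traj Y w)"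
 shows "adapted F (Sint B (%s w. Y s w * g s w))"
 unfolding adapted_def
proof (intro allI impI)
 fix t :: real assume t: "t >= 0"
 show "Sint B (%s w. Y s w * g s w) t : meas (F t)"
 proof (rule AE_lim_meas_F[OF _ _ t])
  have m: "Y (min t (real i / 2^n)) : meas (F t)" "C (min t (real i / 2^n)) : meas (F t)" for i n
   by (rule meas_F_mono[OF _ _ adaptedD[OF Y]] meas_F_mono[OF _ _ adaptedD[OF C]]; use t in simp)+
  show "(%w. dsum n (%u v. Y v w * (C v w - C u w)) t) : meas (F t)" for n
   unfolding dsum_def by (intro borel_measurable_sum borel_measurable_times borel_measurable_diff m)
  show "AE w in M. (%n. dsum n (%u v. Y v w * (C v w - C u w)) t) ----> Sint B (%s w. Y s w * g s w) t w"
   using path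
  proof eventually_elim
   case (elim w)
   have cc: "C v w - C u w = sint (traj B w) (traj g w) u v" if "0 <= u" "u <= v" for u v
    using sint_split_lbm[of "traj B w" "traj g w" 0 u v] elim that unfolding Sint_def by (smt (verit))
   have "dsum n (%u v. Y v w * (C v w - C u w)) t = dsum n (%u v. Y v w * sint (traj B w) (traj g w) u v) t" for n
    using t by (intro dsum_cong) (auto simp: cc)
   thus ?case
    unfolding Sint_def using riemann_right[of "traj B w" "traj g w" t "traj Y w"] elim t by auto
  qed
 qed
qed

lemma adapted_pexp:
 assumes W: "adapted F (Sint B wt)"
  and path: "AE w in M. increasing_path (traj B w) & lbm (traj wt w) & (ALL s>0. wt s w >= 0)"
 shows "adapted F (%t w. pexp (traj B w) (traj wt w) t)"
 unfolding adapted_def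
proof (intro allI impI)
 fix t :: real assume t: "t >= 0"
 let ?W = "Sint B wt"
 show "(%w. pexp (traj B w) (traj wt w) t) : meas (F t)"
 proof (rule AE_lim_meas_F[OF _ _ t])
  have "?W (min t (real i / 2^n)) : meas (F t)" for i n
   by (rule meas_F_mono[OF _ _ adaptedD[OF W]]) (use t in auto)
  thus "(%w. PROD i<4^n. 1 + (?W (min t (real (Suc i) / 2^n)) w - ?W (min t (real i / 2^n)) w)) : meas (F t)" for n
   by (intro borel_measurable_prod borel_measurable_add borel_measurable_diff borel_measurable_const)
  show "AE w in M. (%n. PROD i<4^n. 1 + (?W (min t (real (Suc i) / 2^n)) w - ?W (min t (real i / 2^n)) w)) ----> pexp (traj B w) (traj wt w) t"
   using path
  proof eventually_elim
   case (elim w)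
   have cc: "?W v w - ?W u w = sint (traj B w) (traj wt w) u v" if "0 <= u" "u <= v" for u v
    using sint_split_lbm[of "traj B w" "traj wt w" 0 u v] elim that by (simp add: Sint_def)
   have "(PROD i<4^n. 1 + (?W (min t (real (Suc i) / 2^n)) w - ?W (min t (real i / 2^n)) w)) = pexp_n (traj B w) (traj wt w) n t" for n
    unfolding pexp_n_def using t by (intro prod.cong refl arg_cong2[where f="(+)"] cc min.mono dyadic_le) auto
   thus ?case using pexp_tendsto[of "traj B w" "traj wt w", OF _ _ _ t] elim by simp
  qed
 qed
qed

end

locale random_time = continuous_filtration M F for M :: "'a measure" and F +
 fixes \<tau> :: "'a => ennreal" and Z Ao V :: "real => 'a => real"
 assumes \<tau>_meas: "\<tau> : meas M"
  and azema: "azema_supermartingale M F \<tau> Z"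
  and Z_pos: "AE w in M. ALL t>=0. Z t w > 0"
  and dual: "dual_optional_projection M F (%t w. if \<tau> w <= ennreal t then 1 else 0) Ao"
  and bracket: "predictable_bracket M F (%t w. Z t w + Ao t w) V"
begin

definition m :: "real => 'a => real" where "m t w = Z t w + Ao t w"

lemma adapted_Z: "adapted F Z" and adapted_Ao: "adapted F Ao"
 using azema dual by (auto simp: azema_supermartingale_def dual_optional_projection_def intro: optional_adapted)

lemma Ao_incr: "AE w in M. increasing_path (traj Ao w)"
 using dual by (simp add: dual_optional_projection_def)

lemma Z_cadlag: "AE w in M. cadlag_path (traj Z w)"
 using azema by (simp add: azema_supermartingale_def)

lemma Z_test:
 assumes "t >= 0" "k : meas (F t)" "AE w in M. abs (k w) <= c"
 shows "(LINT w|M. k w * of_bool (\<tau> w > ennreal t)) = (LINT w|M. k w * Z t w)"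
proof -
 have ev[measurable]: "{w : space M. \<tau> w > ennreal t} : sets M" using \<tau>_meas by measurable
 have "(LINT w|M. k w * of_bool (\<tau> w > ennreal t)) = (LINT w|M. k w * indicator {w : space M. \<tau> w > ennreal t} w)"
  by (intro Bochner_Integration.integral_cong) (auto simp: indicator_def)
 also have "... = (LINT w|M. k w * Z t w)"
 proof (rule test_of_cond_exp[OF assms(1) _ assms(2,3)])
  show "AE w in M. real_cond_exp M (F t) (indicator {w : space M. \<tau> w > ennreal t}) w = Z t w"
  proof -
   have "AE w in M. Z t w = real_cond_exp M (F t) (indicator {w : space M. \<tau> w > ennreal t}) w"
    using azema assms(1) by (simp add: azema_supermartingale_def)
   thus ?thesis by eventually_elim simp
  qed
 qed (use adapted_M[OF adapted_Z assms(1)] in "auto simp: emeasure_eq_measure")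
 finally show ?thesis .
qed

lemma Z_le_1: "AE w in M. ALL t>=0. Z t w <= 1"
proof -
 have "AE w in M. Z t w <= 1" if t: "t >= 0" for t
 proof -
  interpret sigma_finite_subalgebra M "F t" by (rule sigma_finite_F[OF t])
  have [measurable]: "{w : space M. \<tau> w > ennreal t} : sets M" using \<tau>_meas by measurable
  have "AE w in M. real_cond_exp M (F t) (indicator {w : space M. \<tau> w > ennreal t}) w <= 1"
   by (rule real_cond_exp_le_c) (auto simp: emeasure_eq_measure indicator_def)
  moreover have "AE w in M. Z t w = real_cond_exp M (F t) (indicator {w : space M. \<tau> w > ennreal t}) w"
   using azema t by (auto simp: azema_supermartingale_def)
  ultimately show ?thesis by eventually_elim auto
 qed
 hence "AE w in M. Z t w : {..1}" if "t >= 0" for t using that by simp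
 from AE_all_times[OF _ closed_atMost this] show ?thesis
  using cadlag_right_cont adapted_Z Z_cadlag by (simp add: cadlag_adapted_def)
qed

lemma Z_integrable: "t >= 0 ==> integrable M (Z t)"
 using adapted_M[OF adapted_Z]
 by (intro integrable_const_bound[where B=1] eventually_mono[OF eventually_conj[OF Z_pos Z_le_1]]) (auto simp: abs_le_iff)

text \<open>Z and its left limits are bounded away from 0 on compacts: as Z is a supermartingale, after a
 passage below 1/k its terminal value has expectation at most 1/k.\<close>

lemma Z_lower: "AE w in M. ALL T. EX eps>0. ALL t:{0..T}. Z t w >= eps"
proof -
 note Zi = Z_integrable
 have one: "AE w in M. EX k. ALL s:dyadics Int {0..real N}. ~ Z s w < 1 / real (Suc k)" for N
 proof -
  define B where "B k = {w:space M. EX s:dyadics Int {0..real N}. Z s w < 1 / real (Suc k)}" for k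
  have P: "{w:space M. Z s w < 1 / real (Suc k)} : sets (F s)" if "0 <= s" for s k
  proof -
   have [measurable]: "Z s : meas (F s)" using adaptedD[OF adapted_Z that] .
   have "{w:space (F s). Z s w < 1 / real (Suc k)} : sets (F s)" by measurable
   thus ?thesis using space_F[OF that] by simp
  qed
  have le: "expect_on A (Z (real N)) <= expect_on A (%_. 1 / real (Suc k))"
   if s: "0 <= s" "s <= real N" and A: "A : sets (F s)" "A <= {w:space M. Z s w < 1 / real (Suc k)}" for s A k
  proof -
   have AM[measurable]: "A : sets M" using sets_F[OF s(1) A(1)] .
   have [measurable]: "(%w. of_bool (\<tau> w > ennreal u) :: real) : meas M" for u using \<tau>_meas by measurable
   have "expect_on A (Z (real N)) = (LINT w|M. indicator A w * of_bool (\<tau> w > ennreal (real N)))"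
    using sets_F_mono[OF s A(1)] s by (intro Z_test[where c=1, symmetric]) (auto simp: indicator_def)
   also have "... <= (LINT w|M. indicator A w * of_bool (\<tau> w > ennreal s))"
    using le_less_trans[OF ennreal_leI[OF s(2)]] by (intro integral_mono integrable_const_bound[where B=1]) (auto simp: indicator_def)
   also have "... = expect_on A (Z s)" using A s by (intro Z_test[where c=1]) (auto simp: indicator_def)
   also have "... <= expect_on A (%_. 1 / real (Suc k))"
    proof (intro integral_mono)
     show "indicator A w * Z s w <= indicator A w * (1 / real (Suc k))" for w
      using A(2) by (force simp: indicator_def)
    qed (use integrable_mult_indicator[OF AM Zi[OF s(1)]] in "auto simp: emeasure_eq_measure")
   finally show ?thesis .
  qed
  have fp: "B k : sets M" "expect_on (B k) (Z (real N)) <= expect_on (B k) (%_. 1 / real (Suc k))" for k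
   using first_passage[where t="real N" and P="%s w. Z s w < 1 / real (Suc k)" and f="Z (real N)" and g="%_. 1 / real (Suc k)", OF P Zi _ le]
   unfolding B_def by auto
  let ?B = "INT k. B k"
  have i: "integrable M (%w. indicator B w * Z (real N) w)" if "B : sets M" for B
   using integrable_mult_indicator[OF that Zi[of "real N"]] by simp
  have BM: "?B : sets M" using fp(1) by auto
  have up: "expect_on ?B (Z (real N)) <= 1 / real (Suc k)" for k
  proof -
   have "AE w in M. indicator ?B w * Z (real N) w <= indicator (B k) w * Z (real N) w"
    using Z_pos by eventually_elim (force simp: indicator_def less_imp_le)
   from integral_mono_AE[OF i[OF BM] i[OF fp(1)] this] fp[of k]
   have "expect_on ?B (Z (real N)) <= prob (B k) * (1 / real (Suc k))" by simp
   also have "... <= 1 * (1 / real (Suc k))" by (intro mult_right_mono) auto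
   finally show ?thesis by simp
  qed
  have "(%k. 1 / real (Suc k)) ----> 0" by (intro LIMSEQ_Suc lim_1_over_n)
  from LIMSEQ_le_const[OF this] have "expect_on ?B (Z (real N)) <= 0" using up by blast
  moreover have nn: "AE w in M. 0 <= indicator ?B w * Z (real N) w"
   using Z_pos by eventually_elim (auto simp: indicator_def less_imp_le)
  ultimately have "AE w in M. indicator ?B w * Z (real N) w = 0"
   using integral_nonneg_eq_0_iff_AE[OF i[OF BM] nn] integral_nonneg_AE[OF nn] by auto
  thus ?thesis
   using Z_pos AE_space
  proof eventually_elim
   case (elim w)
   have "Z (real N) w > 0" using elim(2) by simp
   hence "w ~: ?B" using elim(1) by (auto simp: indicator_def split: if_splits)
   thus ?case using elim(3) by (auto simp: B_def)
  qed
 qed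
 hence "AE w in M. ALL N. EX k. ALL s:dyadics Int {0..real N}. ~ Z s w < 1 / real (Suc k)" by (simp add: AE_all_countable)
 thus ?thesis
  using Z_cadlag
 proof eventually_elim
  case (elim w)
  have "EX eps>0. ALL t:{0..T}. Z t w >= eps" for T
  proof -
   obtain N where N: "T + 1 <= real N" using real_arch_simple by blast
   obtain k where k: "ALL s:dyadics Int {0..real N}. 1 / real (Suc k) <= Z s w" using elim(1) by (auto simp: not_less)
   have "1 / real (Suc k) <= Z t w" if t: "t : {0..T}" for t
   proof -
    have t0: "t >= 0" using t by simp
    have "(%n. Z (rdyad n t) w) ----> Z t w"
     by (rule rdyad_limit[of "traj Z w"]) (use elim(2) t0 in "auto simp: cadlag_path_def")
    moreover have "rdyad n t : dyadics Int {0..real N}" for n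
     using rdyad[OF t0, of n] t N power_le_one[of "1/2::real" n] by auto
    ultimately show ?thesis using k by (intro LIMSEQ_le_const) auto
   qed
   thus ?thesis by (intro exI[of _ "1 / real (Suc k)"]) auto
  qed
  thus ?case by blast
 qed
qed

text \<open>The dominating variable is the limit at infinity, which is integrable as the total mass of \<open>dA\<^sup>o\<close> is.\<close>

lemma Ao_dominated:
 obtains ze where "integrable M ze" "AE w in M. ALL t>=0. 0 <= Ao t w - Ao 0 w & Ao t w - Ao 0 w <= ze w"
proof -
 define ze where "ze w = (SUP n. ennreal (Ao (real n) w - Ao 0 w))" for w
 have [measurable]: "(%w. ennreal (Ao (real n) w - Ao 0 w)) : meas M" for n
  using adapted_M[OF adapted_Ao, of "real n"] adapted_M[OF adapted_Ao, of 0] by measurable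
 have zeM[measurable]: "ze : meas M" unfolding ze_def by measurable
 have "(\<integral>\<^sup>+w. ze w \<partial>M) <= (\<integral>\<^sup>+w. emeasure (path_measure (traj Ao w)) {0..} \<partial>M)"
 proof (rule nn_integral_mono_AE)
  show "AE w in M. ze w <= emeasure (path_measure (traj Ao w)) {0..}"
   using Ao_incr
  proof eventually_elim
   case (elim w)
   show ?case
    unfolding ze_def by (intro SUP_least) (subst emeasure_path_measure[OF elim, symmetric], auto intro!: emeasure_mono)
  qed
 qed
 hence fin: "(\<integral>\<^sup>+w. ze w \<partial>M) < \<infinity>" using dual by (auto simp: dual_optional_projection_def)
 have AEze: "AE w in M. ze w ~= \<infinity>" using fin by (intro nn_integral_PInf_AE) auto
 show thesis
 proof (rule that)
  have "(\<integral>\<^sup>+w. ennreal (norm (enn2real (ze w))) \<partial>M) <= (\<integral>\<^sup>+w. ze w \<partial>M)"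
   by (rule nn_integral_mono_AE) (use AEze in "eventually_elim, simp add: less_top")
  thus "integrable M (%w. enn2real (ze w))" using fin by (intro integrableI_bounded) auto
  show "AE w in M. ALL t>=0. 0 <= Ao t w - Ao 0 w & Ao t w - Ao 0 w <= enn2real (ze w)"
   using AEze Ao_incr
  proof eventually_elim
   case (elim w)
   have "Ao t w - Ao 0 w <= enn2real (ze w)" if t: "t >= 0" for t
   proof -
    obtain n where n: "t <= real n" using real_arch_simple by blast
    have "ennreal (Ao t w - Ao 0 w) <= ennreal (Ao (real n) w - Ao 0 w)" using incr_le[OF elim(2) t n] by (intro ennreal_leI) simp
    also have "... <= ze w" unfolding ze_def by (rule SUP_upper) simp
    finally have "ennreal (Ao t w - Ao 0 w) <= ennreal (enn2real (ze w))" using elim(1) by (simp add: less_top)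
    thus ?thesis by (simp add: ennreal_le_iff)
   qed
   thus ?case using incr_le[OF elim(2) order_refl] by simp
  qed
 qed
qed

text \<open>The defining property of the dual optional projection, for bounded continuous integrands.\<close>

lemma dual_projection_nonneg:
 assumes Y: "adapted F Y" "!!w. w : space M ==> continuous_on {0..} (traj Y w)"
  and bd: "!!t w. t >= 0 ==> w : space M ==> 0 <= Y t w & Y t w <= c"
  and st: "0 <= s" "s <= t" and A: "A : sets (F s)"
 defines "f == %w. indicator A w * (of_bool (ennreal s < \<tau> w & \<tau> w <= ennreal t) * stopped Y \<tau> t w)"
  and "g == %w. indicator A w * sint (traj Ao w) (traj Y w) s t"
 shows "integrable M f" "integrable M g" "(LINT w|M. f w) = (LINT w|M. g w)"
proof -
 (* Y on the interval (s, t] and the event A *)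
 define U where "U u w = Y u w * (of_bool (s < u) * indicator A w - of_bool (t < u) * indicator A w)" for u w
 have cY: "cont_adapted Y" using Y by (simp add: cont_adapted_def)
 have t0: "0 <= t" using st by simp
 have "(%(u, w). Y u w) : meas (optional_sigma M F)"
  by (rule optional_of_cadlag[OF Y(1) continuous_on_imp_cadlag_path[OF Y(2)]])
 hence "(%x. (%(u, w). Y u w) x * ((%(u, w). of_bool (s < u) * indicator A w) x - (%(u, w). of_bool (t < u) * indicator A w) x)) : meas (optional_sigma M F)"
  by (intro borel_measurable_times borel_measurable_diff optional_after[OF st(1) order_refl A] optional_after[OF st A])
 hence "optional M F (%u w. ennreal (U u w))"
  unfolding optional_def U_def by (simp add: case_prod_unfold)
 hence D: "(\<integral>\<^sup>+w. (\<integral>\<^sup>+s\<in>{0..}. ennreal (U s w) \<partial>path_measure (%t. if \<tau> w <= ennreal t then 1 else 0)) \<partial>M) =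
  (\<integral>\<^sup>+w. (\<integral>\<^sup>+s\<in>{0..}. ennreal (U s w) \<partial>path_measure (traj Ao w)) \<partial>M)"
  using dual by (simp add: dual_optional_projection_def)
 have As: "A <= space M" using sets.sets_into_space[OF A] space_F[OF st(1)] by simp
 have "(if \<tau> w < top then ennreal (U (enn2real (\<tau> w)) w) else 0) = ennreal (f w)" for w
 proof (cases "\<tau> w")
  case (real r)
  hence "stopped Y \<tau> t w = Y r w" if "r <= t" using that t0 by (simp add: stopped_def min_time_ennreal)
  thus ?thesis using real st by (auto simp: U_def f_def ennreal_less_iff ennreal_le_iff mult.commute)
 qed (auto simp: f_def top_unique)
 hence L: "(\<integral>\<^sup>+w. (\<integral>\<^sup>+s\<in>{0..}. ennreal (U s w) \<partial>path_measure (%t. if \<tau> w <= ennreal t then 1 else 0)) \<partial>M) = (\<integral>\<^sup>+w. ennreal (f w) \<partial>M)"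
  unfolding nn_integral_jump by simp
 have R: "(\<integral>\<^sup>+w. (\<integral>\<^sup>+s\<in>{0..}. ennreal (U s w) \<partial>path_measure (traj Ao w)) \<partial>M) = (\<integral>\<^sup>+w. ennreal (g w) \<partial>M)"
 proof (rule nn_integral_cong_AE)
  show "AE w in M. (\<integral>\<^sup>+s\<in>{0..}. ennreal (U s w) \<partial>path_measure (traj Ao w)) = ennreal (g w)"
   using Ao_incr AE_space
  proof eventually_elim
   case (elim w)
   let ?mu = "path_measure (traj Ao w)"
   have i: "set_integrable ?mu {s<..t} (traj Y w)"
    by (intro lbm_set_integrable elim lbm_of_continuous Y st)
   have "(\<integral>\<^sup>+u\<in>{0..}. ennreal (U u w) \<partial>?mu) = (\<integral>\<^sup>+u. ennreal (indicator {s<..t} u *\<^sub>R (indicator A w * Y u w)) \<partial>?mu)"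
    using st by (intro nn_integral_cong) (auto simp: U_def indicator_def)
   also have "... = ennreal (LINT u:{s<..t}|?mu. indicator A w * Y u w)"
    unfolding set_lebesgue_integral_def
    using i bd elim(2) st set_integrable_mult_right[OF i, of "indicator A w"]
    by (intro nn_integral_eq_integral) (auto simp: set_integrable_def indicator_def)
   finally show ?case by (simp add: g_def sint_def)
  qed
 qed
 have [measurable]: "A : sets M" using sets_F[OF st(1) A] .
 have fM: "f : meas M"
  unfolding f_def using stopped_measurable[OF cY \<tau>_meas t0] \<tau>_meas by measurable
 have f0: "0 <= f w" "f w <= c" if "w : space M" for w
  using bd[OF min_time_bounds(1)[OF t0] that, of "\<tau> w"] by (auto simp: f_def stopped_def indicator_def)
 show fi: "integrable M f" using f0 fM by (intro integrable_const_bound[where B=c]) auto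
 have "adapted F (Sint Ao (%s w. Y s w * 1))"
 proof (rule adapted_Sint[OF Y(1) adapted_Ao])
  show "AE w in M. primitive Ao Ao (%s w. 1) w & rc_path (traj Y w)"
   using Ao_incr AE_space
  proof eventually_elim
   case (elim w)
   have "ALL s:{0..T}. abs (Y s w) <= c" for T using bd elim(2) by auto
   thus ?case using elim cont_right_limit[OF Y(2)] by (auto simp: Sint_def sint_one)
  qed
 qed
 hence SM: "Sint Ao Y u : meas M" if "u >= 0" for u using adapted_M that by fastforce
 have gM: "g : meas M"
 proof (rule AE_eq_meas_M)
  show "(%w. indicator A w * (Sint Ao Y t w - Sint Ao Y s w)) : meas M" using SM[OF t0] SM[OF st(1)] by measurable
  show "AE w in M. indicator A w * (Sint Ao Y t w - Sint Ao Y s w) = g w"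
   using Ao_incr AE_space
   by eventually_elim (use sint_split_lbm[OF _ lbm_of_continuous[OF Y(2)] order_refl st] in "auto simp: Sint_def g_def")
 qed
 have g0: "AE w in M. 0 <= g w"
  using Ao_incr AE_space
 proof eventually_elim
  case (elim w)
  have "0 <= sint (traj Ao w) (traj Y w) s t"
   using bd[OF _ elim(2)] st by (intro sint_nonneg elim lbm_of_continuous Y) auto
  thus ?case by (simp add: g_def)
 qed
 have nn: "(\<integral>\<^sup>+w. ennreal (f w) \<partial>M) = (\<integral>\<^sup>+w. ennreal (g w) \<partial>M)" using D L R by simp
 have ff: "(\<integral>\<^sup>+w. ennreal (f w) \<partial>M) = ennreal (LINT w|M. f w)" using fi f0 by (intro nn_integral_eq_integral) auto
 show gi: "integrable M g"
 proof (rule integrableI_bounded[OF gM])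
  have "(\<integral>\<^sup>+w. ennreal (norm (g w)) \<partial>M) = (\<integral>\<^sup>+w. ennreal (g w) \<partial>M)" using g0 by (intro nn_integral_cong_AE) auto
  thus "(\<integral>\<^sup>+w. ennreal (norm (g w)) \<partial>M) < \<infinity>" unfolding nn[symmetric] ff by simp
 qed
 have "ennreal (LINT w|M. f w) = ennreal (LINT w|M. g w)" using nn ff nn_integral_eq_integral[OF gi g0] by simp
 moreover have "0 <= (LINT w|M. f w)" "0 <= (LINT w|M. g w)" using f0 g0 by (auto intro!: integral_nonneg_AE)
 ultimately show "(LINT w|M. f w) = (LINT w|M. g w)" by simp
qed

text \<open>Almost sure continuity and boundedness suffice: off a null event, which by completeness is known at time 0, the
 process is replaced by 0, and a constant is added to make it nonnegative.\<close>

lemma dual_projection: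
 assumes Y: "cont_adapted Y" and bd: "AE w in M. ALL t>=0. abs (Y t w) <= c" and c: "c >= 0"
  and st: "0 <= s" "s <= t" and A: "A : sets (F s)"
 defines "f == %Y w. indicator A w * (of_bool (ennreal s < \<tau> w & \<tau> w <= ennreal t) * stopped Y \<tau> t w)"
  and "g == %Y w. indicator A w * sint (traj Ao w) (traj Y w) s t"
 shows "integrable M (f Y)" "integrable M (g Y)" "(LINT w|M. f Y w) = (LINT w|M. g Y w)"
proof -
 define Gm where "Gm = {w:space M. continuous_on {0..} (traj Y w) & (ALL t>=0. abs (Y t w) <= c)}"
 have AEGm: "AE w in M. w : Gm" using AE_cont[OF Y] bd AE_space by eventually_elim (simp add: Gm_def)
 have GmF: "Gm : sets (F u)" if "u >= 0" for u
 proof -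
  have "AE w in M. continuous_on {0..} (traj Y w) & (ALL t>=0. abs (Y t w) <= c)" using AE_cont[OF Y] bd by eventually_elim simp
  from AE_set_F[OF this that] show ?thesis by (simp add: Gm_def)
 qed
 define Y' where "Y' t w = indicator Gm w * (Y t w + c)" for t w
 have Y'1: "adapted F Y'"
  unfolding adapted_def Y'_def using GmF cont_adaptedD[OF Y] by (auto intro!: borel_measurable_times borel_measurable_add)
 have Y'2: "continuous_on {0..} (traj Y' w)" for w
  unfolding Y'_def by (cases "w : Gm") (auto simp: Gm_def intro!: continuous_intros)
 have Y'3: "0 <= Y' t w & Y' t w <= 2 * c" if "t >= 0" for t w
 proof (cases "w : Gm")
  case True
  hence "abs (Y t w) <= c" using that by (simp add: Gm_def)
  thus ?thesis using True by (simp add: Y'_def abs_le_iff)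
 qed (use c in "simp add: Y'_def")
 have 1: "integrable M (f Y')" "integrable M (g Y')" "(LINT w|M. f Y' w) = (LINT w|M. g Y' w)"
  unfolding f_def g_def by (rule dual_projection_nonneg[OF Y'1 Y'2 Y'3 st A]; simp)+
 have 2: "integrable M (f (%_ _. c))" "integrable M (g (%_ _. c))" "(LINT w|M. f (%_ _. c) w) = (LINT w|M. g (%_ _. c) w)"
  unfolding f_def g_def using c by (intro dual_projection_nonneg[where c=c] st A; simp add: adapted_def)+
 have fe: "AE w in M. f Y' w - f (%_ _. c) w = f Y w"
  using AEGm by eventually_elim (simp add: f_def Y'_def stopped_def algebra_simps)
 have ge: "AE w in M. g Y' w - g (%_ _. c) w = g Y w"
  using AEGm Ao_incr
 proof eventually_elim
  case (elim w)
  have "sint (traj Ao w) (%t. Y t w + c) s t = sint (traj Ao w) (traj Y w) s t + sint (traj Ao w) (%t. c) s t"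
   using elim st by (intro sint_add lbm_of_continuous) (auto simp: Gm_def)
  thus ?case using elim(1) by (simp add: g_def Y'_def algebra_simps)
 qed
 have [measurable]: "A : sets M" using sets_F[OF st(1) A] .
 have t0: "0 <= t" using st by simp
 have fM: "f Y : meas M"
  by (rule AE_eq_meas_M[OF _ fe]) (use 1 2 in auto)
 have gM: "g Y : meas M"
  by (rule AE_eq_meas_M[OF _ ge]) (use 1 2 in auto)
 show "integrable M (f Y)" "integrable M (g Y)"
  using 1 2 Bochner_Integration.integrable_diff[of M "f Y'" "f (%_ _. c)"] Bochner_Integration.integrable_diff[of M "g Y'" "g (%_ _. c)"]
   integrable_cong_AE[OF _ fM fe] integrable_cong_AE[OF _ gM ge] by auto
 have "(LINT w|M. f Y w) = (LINT w|M. f Y' w - f (%_ _. c) w)"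
  using fe fM 1 2 by (intro integral_cong_AE) (auto elim!: eventually_mono)
 also have "... = (LINT w|M. g Y' w - g (%_ _. c) w)" using 1 2 by simp
 also have "... = (LINT w|M. g Y w)"
  using ge gM 1 2 by (intro integral_cong_AE) (auto elim!: eventually_mono)
 finally show "(LINT w|M. f Y w) = (LINT w|M. g Y w)" .
qed

lemma increasing_left_limit:
 assumes i: "increasing_path x" and t: "t > 0" shows "EX l. (x ---> l) (at_left t)"
proof
 let ?S = "SUP u\<in>{0..<t}. x u"
 have bdd: "bdd_above (x ` {0..<t})" using incr_le[OF i] by (intro bdd_aboveI2[of _ _ "x t"]) auto
 show "(x ---> ?S) (at_left t)"
 proof (rule increasing_tendsto)
  show "eventually (%v. x v <= ?S) (at_left t)"
   using t by (auto simp: eventually_at_left_field intro!: exI[of _ 0] cSUP_upper bdd)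
  fix c assume "c < ?S"
  then obtain u where u: "0 <= u" "u < t" "c < x u" using t bdd by (subst (asm) less_cSUP_iff) auto
  hence "c < x v" if "u < v" for v using incr_le[OF i, of u v] that by linarith
  thus "eventually (%v. c < x v) (at_left t)" using u(2) by (auto simp: eventually_at_left_field)
 qed
qed

text \<open>On events A of \<open>F\<^sub>s\<close>, both - Z and \<open>A\<^sup>o\<close> have over \<open>(s,t]\<close> the expected increment P(A, s < \<tau> \<le> t). The initial value
 of \<open>A\<^sup>o\<close> is split off because \<open>martingale_clm\<close> is applied to \<open>Z + A\<^sup>o - A\<^sup>o\<^sub>0\<close>.\<close>

lemma clm_m: "clm m"
proof -
 obtain ze where ze: "integrable M ze" "AE w in M. ALL t>=0. 0 <= Ao t w - Ao 0 w & Ao t w - Ao 0 w <= ze w" by (rule Ao_dominated)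
 define a where "a t w = Ao t w - Ao 0 w" for t w
 have A0: "Ao 0 : meas (F t)" if "t >= 0" for t using meas_F_mono[OF order_refl that adaptedD[OF adapted_Ao order_refl]] .
 have ada: "adapted F a"
  using adapted_Ao A0 unfolding adapted_def a_def[abs_def] by (auto intro: borel_measurable_diff)
 have Ai: "integrable M (a t)" if "t >= 0" for t
 proof (rule Bochner_Integration.integrable_bound[OF ze(1) adapted_M[OF ada that]])
  show "AE w in M. norm (a t w) <= norm (ze w)" using ze(2) by eventually_elim (use that in "force simp: a_def")
 qed
 have ad: "adapted F (%t w. Z t w + a t w)" using adapted_Z ada unfolding adapted_def by (auto intro: borel_measurable_add)
 have mi: "integrable M (%w. Z t w + a t w)" if "t >= 0" for t using Ai Z_integrable that by simp
 have "AE w in M. real_cond_exp M (F s) (%w. Z t w + a t w) w = Z s w + a s w" if st: "0 <= s" "s <= t" for s t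
 proof (rule cond_exp_of_tests)
  fix A assume A: "A : sets (F s)"
  have [measurable]: "A : sets M" using sets_F[OF st(1) A] .
  have t0: "0 <= t" using st by simp
  have iM: "integrable M (%w. indicator A w * h w)" if "integrable M h" for h :: "'a => real"
   using integrable_mult_indicator[OF _ that, of A] by simp
  note iM' = iM[OF Ai[OF t0]] iM[OF Ai[OF st(1)]] iM[OF Z_integrable[OF t0]] iM[OF Z_integrable[OF st(1)]]
  have [measurable]: "(%w. of_bool (\<tau> w > ennreal u) :: real) : meas M" for u using \<tau>_meas by measurable
  have iB: "integrable M (%w. indicator A w * of_bool (\<tau> w > ennreal u) :: real)" for u
   by (intro iM integrable_const_bound[where B=1]) auto
  have z: "expect_on A (Z u) = expect_on A (%w. of_bool (\<tau> w > ennreal u))" if "s <= u" for u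
   using sets_F_mono[OF st(1) that A] st that by (intro Z_test[where c=1, symmetric]) (auto simp: indicator_def)
  note dp = dual_projection[where Y="%_ _. 1" and c=1, OF cont_adapted_const _ _ st A, simplified]
  have "expect_on A (a t) - expect_on A (a s) = (LINT w|M. indicator A w * a t w - indicator A w * a s w)" using iM' by simp
  also have "... = (LINT w|M. indicator A w * sint (traj Ao w) (%_. 1) s t)"
  proof (rule integral_cong_AE)
   show "AE w in M. indicator A w * a t w - indicator A w * a s w = indicator A w * sint (traj Ao w) (%_. 1) s t"
    using Ao_incr by eventually_elim (use st in "simp add: a_def sint_one algebra_simps")
  qed (use dp(2) iM' in auto)
  also have "... = (LINT w|M. indicator A w * of_bool (\<tau> w > ennreal s) - indicator A w * of_bool (\<tau> w > ennreal t))"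
   unfolding dp(3)[symmetric] using ennreal_leI[OF st(2)]
   by (intro Bochner_Integration.integral_cong refl) (auto simp: indicator_def stopped_def not_le)
  also have "... = expect_on A (Z s) - expect_on A (Z t)"
   using iB by (simp add: z[OF order_refl] z[OF st(2)])
  finally show "expect_on A (%w. Z t w + a t w) = expect_on A (%w. Z s w + a s w)"
   using iM' by (simp add: distrib_left)
 qed (use st mi ad in "auto simp: adapted_def")
 moreover have "AE w in M. cadlag_path (%t. Z t w + a t w)"
  using Z_cadlag Ao_incr
 proof eventually_elim
  case (elim w)
  have "EX l. ((%t. Z t w + a t w) ---> l) (at_left t)" if t: "t > 0" for t
  proof -
   obtain l l' where "(traj Ao w ---> l) (at_left t)" "(traj Z w ---> l') (at_left t)"
    using increasing_left_limit[OF elim(2) t] elim(1) t unfolding cadlag_path_def by blast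
   thus ?thesis unfolding a_def by (intro exI[of _ "l' + (l - Ao 0 w)"]) (intro tendsto_intros)
  qed
  thus ?case using elim unfolding cadlag_path_def increasing_path_def a_def by (auto intro!: tendsto_intros)
 qed
 ultimately have "martingale M F (%t w. Z t w + a t w)" using ad mi by (auto simp: martingale_def cadlag_adapted_def)
 from clm_add[OF martingale_clm[OF this] clm_const[OF A0[OF order_refl]]]
 show ?thesis by (simp add: a_def m_def[abs_def])
qed

lemma clm_m2: "clm (%t w. (m t w)\<^sup>2 - V t w)"
 using bracket unfolding predictable_bracket_def m_def by (auto intro: local_martingale_clm)

lemma V_path: "AE w in M. V 0 w = 0 & increasing_path (traj V w) & continuous_on {0..} (traj V w)"
proof -
 have "AE w in M. V 0 w = 0 & increasing_path (traj V w)" using bracket by (simp add: predictable_bracket_def)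
 thus ?thesis
  using AE_cont[OF clm_cont[OF clm_m]] AE_cont[OF clm_cont[OF clm_m2]]
 proof eventually_elim
  case (elim w)
  from continuous_on_diff[OF continuous_on_power[OF elim(2), of 2] elim(3)] elim(1) show ?case by simp
 qed
qed

lemma cont_adapted_V: "cont_adapted V"
 using cont_adapted_diff[OF cont_adapted_mult clm_cont[OF clm_m2], of m m] clm_cont[OF clm_m]
 by (simp add: power2_eq_square)

lemma clm_m2': "clm (%t w. m t w * m t w - Sint V (%_ _. 1) t w)"
proof (rule clm_cong[OF clm_m2])
 show "AE w in M. ALL t>=0. (m t w)\<^sup>2 - V t w = m t w * m t w - Sint V (%_ _. 1) t w"
  using V_path by eventually_elim (simp add: Sint_def sint_one power2_eq_square)
qed

text \<open>The exponential E of \<open>\<integral> dA\<^sup>o / Z\<close> makes N = Z E a continuous local martingale with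
 \<open>dN = E\<^sub>- dm\<close>, and D = 1/E = Z/N decreases with \<open>dD = - dA\<^sup>o / N\<close>.\<close>

definition E :: "real => 'a => real" where "E t w = pexp (traj Ao w) (%t. 1 / Z t w) t"
definition El :: "real => 'a => real" where "El t w = pexp_left (traj Ao w) (%t. 1 / Z t w) t"
definition N :: "real => 'a => real" where "N t w = Z t w * E t w"

definition regular :: "'a => bool" where
 "regular w <-> increasing_path (traj Ao w) & cadlag_path (traj Z w) & (ALL t>=0. 0 < Z t w & Z t w <= 1) &
  (ALL T. EX eps>0. ALL t:{0..T}. Z t w >= eps) & continuous_on {0..} (traj m w) &
  V 0 w = 0 & increasing_path (traj V w) & continuous_on {0..} (traj V w)"

lemma AE_regular: "AE w in M. regular w"
 using Ao_incr Z_cadlag Z_pos Z_le_1 Z_lower V_path AE_cont[OF clm_cont[OF clm_m]]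
 by eventually_elim (simp add: regular_def)

lemma lbm_Z:
 assumes "regular w" shows "lbm (traj Z w)" "lbm (%t. 1 / Z t w)"
  and "!!T. EX K. ALL s:{0..T}. abs (1 / Z s w) <= K" and "!!s. s >= 0 ==> ((%t. 1 / Z t w) ---> 1 / Z s w) (at_right s)"
proof -
 have rc: "(traj Z w ---> Z s w) (at_right s)" if "s >= 0" for s using assms that by (auto simp: regular_def cadlag_path_def)
 have "ALL s:{0..T}. abs (Z s w) <= 1" for T using assms by (auto simp: regular_def abs_of_pos)
 thus "lbm (traj Z w)" using rc by (intro rc_bounded_lbm) blast+
 show rc': "((%t. 1 / Z t w) ---> 1 / Z s w) (at_right s)" if "s >= 0" for s
  using assms that by (intro tendsto_intros rc) (auto simp: regular_def)
 show bd: "EX K. ALL s:{0..T}. abs (1 / Z s w) <= K" for T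
 proof -
  obtain eps where e: "eps > 0" "ALL t:{0..T}. Z t w >= eps" using assms unfolding regular_def by meson
  have "abs (1 / Z s w) <= 1 / eps" if "s : {0..T}" for s
  proof -
   have "Z s w >= eps" using e that by blast
   thus ?thesis using e(1) by (simp add: frac_le)
  qed
  thus ?thesis by blast
 qed
 show "lbm (%t. 1 / Z t w)" using rc' bd by (intro rc_bounded_lbm) auto
qed

lemma regular_pos: "regular w ==> t >= 0 ==> 0 < Z t w"
 by (simp add: regular_def)

lemma pexp_assms:
 assumes "regular w" shows "increasing_path (traj Ao w)" "lbm (%t. 1 / Z t w)" "!!s. s > 0 ==> 1 / Z s w >= 0"
 using assms lbm_Z by (auto simp: regular_def less_imp_le)

lemma E_facts:
 assumes "regular w"
 shows "t >= 0 ==> E t w >= 1" "E 0 w = 1" "lbm (traj El w)"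
  and "t >= 0 ==> E t w = E 0 w + Sint Ao (%s w. El s w * (1 / Z s w)) t w"
  and "s > 0 ==> (traj E w ---> El s w) (at_left s)"
  and "t >= 0 ==> 1 / E t w = 1 / E 0 w + Sint Ao (%s w. - (1 / N s w)) t w"
  and "0 <= s ==> s <= t ==> E s w <= E t w"
 using pexp_ge_1[OF pexp_assms[OF assms]] pexp_0[OF pexp_assms[OF assms]] lbm_pexp_left[OF pexp_assms[OF assms]]
  pexp_sint[OF pexp_assms[OF assms]] pexp_left_tendsto[OF pexp_assms[OF assms]] inverse_pexp_sint[OF pexp_assms[OF assms]]
  pexp_mono[OF pexp_assms[OF assms]]
 by (simp_all add: E_def El_def Sint_def N_def)

lemma adapted_int_Z: "adapted F (Sint Ao (%s w. 1 / Z s w))"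
proof -
 have "adapted F (Sint Ao (%s w. 1 / Z s w * 1))"
 proof (rule adapted_Sint[OF _ adapted_Ao])
  show "adapted F (%s w. 1 / Z s w)" using adapted_Z unfolding adapted_def by (auto intro: borel_measurable_divide)
  show "AE w in M. primitive Ao Ao (%s w. 1) w & rc_path (%t. 1 / Z t w)"
   using AE_regular
  proof eventually_elim
   case (elim w)
   thus ?case using lbm_Z(3,4)[OF elim] pexp_assms(1)[OF elim] by (auto simp: Sint_def sint_one)
  qed
 qed
 thus ?thesis by simp
qed

lemma adapted_E: "adapted F E"
 unfolding E_def[abs_def]
proof (rule adapted_pexp[OF adapted_int_Z])
 show "AE w in M. increasing_path (traj Ao w) & lbm (%s. 1 / Z s w) & (ALL s>0. 1 / Z s w >= 0)"
  using AE_regular by eventually_elim (intro conjI allI impI pexp_assms)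
qed

text \<open>The left hand side is \<open>Z\<^sub>0 + \<integral> E\<^sub>- dm\<close> after integration by parts, as \<open>dE = E\<^sub>- dA\<^sup>o / Z\<close>.\<close>

lemma N_parts: "AE w in M. ALL t>=0. m t w * E t w - Sint Ao (%s w. m s w * (El s w * (1 / Z s w))) t w - Ao 0 w = N t w"
 using AE_regular
proof eventually_elim
 case r: (elim w)
 show ?case
 proof (intro allI impI)
 fix t :: real assume t: "t >= 0"
 note pa = pexp_assms[OF r] and Ef = E_facts[OF r]
 have "Ao t w * E t w - Ao 0 w * E 0 w = sint (traj Ao w) (%s. El s w * 1 + Ao s w * (El s w * (1 / Z s w))) 0 t"
 proof (rule sint_product[where x="traj Ao w" and y="traj E w" and yl="traj El w", OF pa(1) t lbm_const lbm_mult[OF Ef(3) pa(2)]])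
  show "Ao u w = Ao 0 w + sint (traj Ao w) (%_. 1) 0 u" if "0 <= u" for u using that pa(1) by (simp add: sint_one)
  show "E u w = E 0 w + sint (traj Ao w) (%s. El s w * (1 / Z s w)) 0 u" if "0 <= u" for u using Ef(4)[OF that] by (simp add: Sint_def)
 qed (rule Ef(5))
 also have "... = sint (traj Ao w) (%s. m s w * (El s w * (1 / Z s w))) 0 t"
 proof (rule sint_cong)
  fix s :: real assume "0 < s"
  hence "Z s w ~= 0" using regular_pos[OF r, of s] by simp
  thus "El s w * 1 + Ao s w * (El s w * (1 / Z s w)) = m s w * (El s w * (1 / Z s w))"
   by (simp add: m_def field_simps)
 qed
 finally show "m t w * E t w - Sint Ao (%s w. m s w * (El s w * (1 / Z s w))) t w - Ao 0 w = N t w"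
  using Ef(2) by (simp add: N_def m_def Sint_def algebra_simps)
 qed
qed

lemma E_path: "AE w in M. primitive E Ao (%s w. El s w * (1 / Z s w)) w"
 using AE_regular
proof eventually_elim
 case (elim w)
 show ?case using pexp_assms[OF elim] E_facts(3,4)[OF elim] lbm_mult by blast
qed

lemma clm_N: "clm N"
 by (rule clm_cong[OF clm_diff[OF clm_ibp[OF clm_m adapted_E E_path] clm_const] N_parts]) (rule adaptedD[OF adapted_Ao order_refl])

lemma clm_N_bracket:
 assumes W: "clm W" and mW: "clm (%t w. m t w * W t w - Sint V h t w)" and h: "AE w in M. lbm (traj h w)"
 shows "clm (%t w. N t w * W t w - Sint V (%s w. El s w * h s w) t w)"
proof (rule clm_cong[OF clm_diff[OF clm_ibp_bracket[OF mW W clm_m adapted_E E_path] clm_mult_F0[OF W]]])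
 show "AE w in M. stieltjes V h w & (ALL s>0. (traj E w ---> El s w) (at_left s))"
  using AE_regular h by eventually_elim (use E_facts(5) in "auto simp: regular_def")
 show "Ao 0 : meas (F 0)" by (rule adaptedD[OF adapted_Ao order_refl])
 show "AE w in M. ALL t>=0. (m t w * E t w - Sint Ao (%s w. m s w * (El s w * (1 / Z s w))) t w) * W t w - Sint V (%s w. El s w * h s w) t w - Ao 0 w * W t w =
   N t w * W t w - Sint V (%s w. El s w * h s w) t w"
  using N_parts by eventually_elim (simp add: algebra_simps flip: distrib_left)
qed

lemma clm_N2: "clm (%t w. (N t w)\<^sup>2 - Sint V (%s w. (El s w)\<^sup>2) t w)"
proof -
 have "clm (%t w. N t w * m t w - Sint V (%s w. El s w * 1) t w)"
  by (rule clm_N_bracket[OF clm_m clm_m2']) simp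
 hence "clm (%t w. m t w * N t w - Sint V El t w)" by (simp add: mult.commute)
 from clm_N_bracket[OF clm_N this] have "clm (%t w. N t w * N t w - Sint V (%s w. El s w * El s w) t w)"
  using eventually_mono[OF AE_regular E_facts(3)[of _]] by simp
 thus ?thesis by (simp add: power2_eq_square)
qed

end

section \<open>The enlarged filtration\<close>

context random_time begin

definition G :: "real => 'a measure" where "G = progressive_enlargement M F \<tau>"

text \<open>The right-continuous regularisation of these \<sigma>-algebras is the enlarged filtration.\<close>

definition presets :: "real => 'a set set" where
 "presets u = sigma_sets (space M) (sets (F u) Un {(%w. min (\<tau> w) (ennreal u)) -` B Int space M | B. B : sets borel})"

lemma presets_M: "u >= 0 ==> A : presets u ==> A : sets M"
proof (rule subsetD[OF sets.sigma_sets_subset])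
 assume u: "u >= 0"
 have "(%w. min (\<tau> w) (ennreal u)) : meas M" using \<tau>_meas by measurable
 thus "sets (F u) Un {(%w. min (\<tau> w) (ennreal u)) -` B Int space M | B. B : sets borel} <= sets M"
  using sets_F[OF u] by (auto intro: measurable_sets)
qed (simp add: presets_def)

lemma sets_G: "t >= 0 ==> sets (G t) = (INT u:{t<..}. presets u)"
proof -
 assume "t >= 0"
 hence "sets (G t) = (INT eps:{0<..}. presets (t + eps))" by (simp add: G_def sets_progressive_enlargement[OF filtered] presets_def)
 also have "... = (INT u:(%eps. t + eps) ` {0<..}. presets u)" by simp
 also have "(%eps. t + eps) ` {0<..} = {t<..}"
  using image_eqI[of _ "%eps. t + eps" "_ - t" "{0<..}"] by fastforce
 finally show ?thesis .
qed

lemma space_G: "space (G t) = space M"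
 unfolding G_def progressive_enlargement_def by (simp add: space_measure_of_conv)

lemma F_sub_G: "t >= 0 ==> A : sets (F t) ==> A : sets (G t)"
 unfolding sets_G presets_def by (rule INT_I, rule sigma_sets.Basic, rule UnI1, rule sets_F_mono[of t]) simp_all

lemma G_mono: "0 <= s ==> s <= t ==> A : sets (G s) ==> A : sets (G t)"
 by (auto simp: sets_G)

lemma G_M: "t >= 0 ==> A : sets (G t) ==> A : sets M"
 using presets_M[of "t + 1" A] by (auto simp: sets_G)

sublocale EG: usual_filtration M G
proof (standard, unfold usual_hypotheses_def filtered_def subalgebra_def, intro conjI allI impI ballI)
 fix t :: real assume t: "0 <= t"
 show "sets (G t) = (INT s:{t<..}. sets (G s))"
 proof (intro equalityI subsetI)
  fix A assume A: "A : sets (G t)"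
  show "A : (INT s:{t<..}. sets (G s))" by (rule INT_I, rule G_mono[OF t _ A]) simp
 next
  fix A assume A: "A : (INT s:{t<..}. sets (G s))"
  have "A : presets u" if "u > t" for u
  proof -
   have "A : sets (G ((t + u) / 2))" using A that by simp
   thus ?thesis using that t by (simp add: sets_G)
  qed
  thus "A : sets (G t)" using t by (simp add: sets_G)
 qed
next
 fix t :: real assume t: "0 <= t"
 show "sets (G t) <= sets M" using G_M[OF t] by blast
next
 fix s t :: real assume "0 <= s & s <= t"
 thus "sets (G s) <= sets (G t)" using G_mono by blast
next
 fix N A assume "N : null_sets M" "A <= N"
 thus "A : sets (G 0)" using null_F[of N A 0] F_sub_G by blast
qed (simp_all add: space_G)

lemma \<tau>_stopping: "ext_stopping_time G \<tau>"
 unfolding ext_stopping_time_def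
proof (intro allI impI)
 fix t :: real assume t: "0 <= t"
 have "{w:space M. \<tau> w <= ennreal t} : presets u" if u: "t < u" for u
 proof -
  have "min (\<tau> w) (ennreal u) <= ennreal t <-> \<tau> w <= ennreal t" for w
   using u t ennreal_less_iff[of t u] by (auto simp: min_le_iff_disj not_le)
  hence "{w:space M. \<tau> w <= ennreal t} = (%w. min (\<tau> w) (ennreal u)) -` {..ennreal t} Int space M" by auto
  thus ?thesis unfolding presets_def by (intro sigma_sets.Basic UnI2 CollectI exI[of _ "{..ennreal t}"]) auto
 qed
 thus "Measurable.pred (G t) (%w. \<tau> w <= ennreal t)" using t by (simp add: pred_def space_G sets_G)
qed

text \<open>Before \<tau> the enlarged filtration carries no more events than F.\<close>

lemma presets_trace:
 assumes u: "u >= 0" and A: "A : presets u"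
 shows "EX A':sets (F u). ALL w:space M. ennreal u <= \<tau> w --> (w : A <-> w : A')"
 using A unfolding presets_def
proof induction
 case (Basic A)
 then consider "A : sets (F u)" | B where "A = (%w. min (\<tau> w) (ennreal u)) -` B Int space M" by auto
 thus ?case
 proof cases
  case (2 B)
  thus ?thesis using sets.top[of "F u"] space_F[OF u]
   by (intro bexI[of _ "if ennreal u : B then space M else {}"]) (auto simp: min_def)
 qed auto
next
 case (Compl A)
 then obtain A' where "A' : sets (F u)" "ALL w:space M. ennreal u <= \<tau> w --> (w : A <-> w : A')" by auto
 thus ?case using sets.compl_sets[of A' "F u"] space_F[OF u] by (intro bexI[of _ "space M - A'"]) auto
next
 case (Union A)
 then obtain A' where "!!i. A' i : sets (F u)" "!!i. ALL w:space M. ennreal u <= \<tau> w --> (w : A i <-> w : A' i)" by metis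
 hence "(UN i. A' i) : sets (F u)" "ALL w:space M. ennreal u <= \<tau> w --> (w : (UN i. A i) <-> w : (UN i. A' i))" by blast+
 thus ?case by blast
qed auto

lemma adapted_FG: "adapted F X ==> adapted G X"
 unfolding adapted_def
proof (intro allI impI)
 fix t :: real assume "ALL t>=0. X t : meas (F t)" and t: "t >= 0"
 moreover have "subalgebra (G t) (F t)" unfolding subalgebra_def using F_sub_G[OF t] space_F[OF t] by (auto simp: space_G)
 ultimately show "X t : meas (G t)" by (blast intro: measurable_from_subalg)
qed

lemma cont_adapted_FG: "cont_adapted X ==> EG.cont_adapted X"
 by (simp add: cont_adapted_def EG.cont_adapted_def adapted_FG)

text \<open>The process that has to be a martingale in F for the stopped process \<open>Y\<^sup>\<tau>\<close> to be one in the
 enlarged filtration.\<close>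

definition Lam :: "(real => 'a => real) => real => 'a => real" where
 "Lam Y t w = Y t w * Z t w + Sint Ao Y t w"

text \<open>On \<open>{\<tau> \<le> s}\<close> both sides agree path by path. On \<open>{s < \<tau>}\<close> the event A may be replaced by one in \<open>F\<^sub>s\<close>; the value at
 \<tau> on \<open>{s < \<tau> \<le> t}\<close> then has the expectation of \<open>\<integral> Y dA\<^sup>o\<close> over \<open>(s,t]\<close>, that on \<open>{t < \<tau>}\<close> the expectation of \<open>Y\<^sub>t Z\<^sub>t\<close>,
 and their sum is constant in t because Lam Y is dominated by an integrable
 variable and hence a martingale.\<close>

lemma Lam_test:
 assumes Y: "cont_adapted Y" and bd: "AE w in M. ALL t>=0. abs (Y t w) <= c" and c: "c >= 0" and L: "clm (Lam Y)"
  and st: "0 <= s" "s <= t" and A: "A : presets s"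
 shows "expect_on A (stopped Y \<tau> t) = expect_on A (stopped Y \<tau> s)"
proof -
 have t0: "0 <= t" using st by simp
 obtain A' where A': "A' : sets (F s)" "!!w. w : space M ==> ennreal s < \<tau> w ==> w : A <-> w : A'"
  using presets_trace[OF st(1) A] less_imp_le by meson
 have [measurable]: "A : sets M" "A' : sets M" "{w:space M. ennreal u < \<tau> w} : sets M" for u
  using presets_M[OF st(1) A] sets_F[OF st(1) A'(1)] \<tau>_meas by auto
 have YM: "Y u : meas M" "stopped Y \<tau> u : meas M" if "u >= 0" for u
  using cont_adapted_M[OF Y that] stopped_measurable[OF Y \<tau>_meas that] .
 have i: "integrable M (%w. k w * U w)"
  if "k : meas M" "!!w. abs (k w) <= 1" "U : meas M" "AE w in M. abs (U w) <= c" for k U :: "'a => real"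
 proof (rule integrable_const_bound[where B=c])
  show "AE w in M. norm (k w * U w) <= c" using that(4)
   by eventually_elim (use mult_mono[OF that(2), of "abs (U _)" c] in "simp add: abs_mult")
 qed (use that in measurable)
 have b: "AE w in M. abs (Y u w) <= c" "AE w in M. abs (stopped Y \<tau> u w) <= c" if "u >= 0" for u
  using bd by (eventually_elim; use that in "simp add: stopped_def min_time_bounds")+
 let ?k = "%u w. indicator A' w * of_bool (ennreal u < \<tau> w) :: real"
 let ?J = "%w. indicator A' w * (of_bool (ennreal s < \<tau> w & \<tau> w <= ennreal t) * stopped Y \<tau> t w)"
 let ?S = "%w. indicator A' w * sint (traj Ao w) (traj Y w) s t"
 have iA: "integrable M (%w. indicator A w * stopped Y \<tau> u w)" and ik: "integrable M (%w. ?k u w * Y u w)" if "u >= 0" for u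
  using that YM b \<tau>_meas by (auto intro!: i simp: indicator_def)
 obtain ze where ze: "integrable M ze" "AE w in M. ALL t>=0. 0 <= Ao t w - Ao 0 w & Ao t w - Ao 0 w <= ze w" by (rule Ao_dominated)
 have lb: "AE w in M. lbm (traj Y w)" using AE_cont[OF Y] by eventually_elim (rule lbm_of_continuous)
 have bYZ: "AE w in M. ALL u>=0. abs (Y u w * Z u w) <= c"
  using bd Z_pos Z_le_1
 proof eventually_elim
  case (elim w)
  have "abs (Y u w * Z u w) <= c * 1" if "u >= 0" for u unfolding abs_mult using elim that c by (intro mult_mono) (auto simp: abs_of_pos)
  thus ?case by simp
 qed
 have dom: "AE w in M. ALL u>=0. abs (Lam Y u w) <= c + c * ze w"
  using ze(2) bd bYZ Ao_incr lb
 proof eventually_elim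
  case (elim w)
  have "abs (Sint Ao Y u w) <= c * ze w" if u: "u >= 0" for u
  proof -
   have "abs (Sint Ao Y u w) <= c * (Ao u w - Ao 0 w)"
    unfolding Sint_def using elim u by (intro sint_abs_le lbm_set_integrable) auto
   also have "... <= c * ze w" using elim(1) u c by (intro mult_left_mono) auto
   finally show ?thesis .
  qed
  thus ?case unfolding Lam_def using elim(3) by (auto intro!: order_trans[OF abs_triangle_ineq] add_mono)
 qed
 have LE: "expect_on A' (Lam Y t) = expect_on A' (Lam Y s)"
  by (rule clm_dominated[OF L _ dom st A'(1)]) (use ze(1) in simp)
 have iL: "integrable M (%w. indicator A' w * Lam Y u w)" if u: "u >= 0" for u
 proof (rule Bochner_Integration.integrable_bound[where f="%w. c + c * ze w"])
  show "AE w in M. norm (indicator A' w * Lam Y u w) <= norm (c + c * ze w)"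
   using dom by eventually_elim (use u in "force simp: indicator_def")
 qed (use ze(1) cont_adapted_M[OF clm_cont[OF L] u] in auto)
 note dp = dual_projection[OF Y bd c st A'(1)]
 have zt: "(LINT w|M. ?k u w * Y u w) = expect_on A' (%w. Y u w * Z u w)" if u: "s <= u" for u
 proof -
  have u0: "u >= 0" using st u by simp
  have "AE w in M. abs (indicator A' w * Y u w) <= c" using b(1)[OF u0] by eventually_elim (use c in "auto simp: indicator_def")
  from Z_test[OF u0 _ this] show ?thesis
   using cont_adaptedD[OF Y u0] sets_F_mono[OF st(1) u A'(1)] by (simp add: ac_simps)
 qed
 have iZ: "integrable M (%w. indicator A' w * (Y u w * Z u w))" if u: "0 <= u" for u
  by (rule i) (use bYZ YM(1)[OF u] adapted_M[OF adapted_Z u] u in "auto simp: indicator_def elim!: eventually_mono")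
 have "indicator A w * stopped Y \<tau> t w - indicator A w * stopped Y \<tau> s w = ?k t w * Y t w + ?J w - ?k s w * Y s w" if wt: "w : space M" for w
 proof -
  have le: "ennreal s <= ennreal t" using st by (simp add: ennreal_leI)
  show ?thesis
  proof (cases "ennreal s < \<tau> w")
   case True
   hence "stopped Y \<tau> s w = Y s w" "ennreal t < \<tau> w ==> stopped Y \<tau> t w = Y t w"
    using st t0 by (simp_all add: stopped_def min_time_id)
   thus ?thesis using True A'(2)[OF wt] by (auto simp: indicator_def not_less)
  next
   case False
   hence "\<tau> w <= ennreal s" "~ ennreal t < \<tau> w" using le by (auto simp: not_less)
   hence "stopped Y \<tau> s w = stopped Y \<tau> t w" using le by (simp add: stopped_def min_time_def min.absorb2)
   thus ?thesis using False \<open>~ ennreal t < \<tau> w\<close> by simp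
  qed
 qed
 hence "expect_on A (stopped Y \<tau> t) - expect_on A (stopped Y \<tau> s) = (LINT w|M. ?k t w * Y t w + ?J w - ?k s w * Y s w)"
  by (simp add: iA st(1) t0 flip: Bochner_Integration.integral_diff cong: Bochner_Integration.integral_cong)
 also have "... = expect_on A' (%w. Y t w * Z t w) + (LINT w|M. ?S w) - expect_on A' (%w. Y s w * Z s w)"
  unfolding zt[OF st(2), symmetric] zt[OF order_refl, symmetric] dp(3)[symmetric] using ik[OF t0] ik[OF st(1)] dp(1) by simp
 also have "... = (LINT w|M. indicator A' w * (Y t w * Z t w) + ?S w - indicator A' w * (Y s w * Z s w))"
  using iZ[OF t0] iZ[OF st(1)] dp(2) by simp
 also have "... = (LINT w|M. indicator A' w * Lam Y t w - indicator A' w * Lam Y s w)"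
 proof (rule integral_cong_AE)
  show "AE w in M. indicator A' w * (Y t w * Z t w) + ?S w - indicator A' w * (Y s w * Z s w) = indicator A' w * Lam Y t w - indicator A' w * Lam Y s w"
   using Ao_incr lb by eventually_elim (use sint_split_lbm[OF _ _ order_refl st] in "simp add: Lam_def Sint_def algebra_simps")
 qed (use iZ[OF t0] iZ[OF st(1)] dp(2) iL[OF t0] iL[OF st(1)] in auto)
 also have "... = 0" using LE iL[OF t0] iL[OF st(1)] by simp
 finally show ?thesis by simp
qed

text \<open>\<open>Lam_test\<close> applies at all u > s, whose \<sigma>-algebras presets u contain \<open>G\<^sub>s\<close>; then u decreases to s.\<close>

lemma bounded_Lam_stopped:
 assumes Y: "cont_adapted Y" and bd: "AE w in M. ALL t>=0. abs (Y t w) <= c" and c: "c >= 0" and L: "clm (Lam Y)"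
 shows "EG.bm (stopped Y \<tau>)"
 unfolding EG.bm_def
proof (intro conjI allI impI; (elim conjE)?)
 show "EG.cont_adapted (stopped Y \<tau>)" by (rule EG.cont_adapted_stopped[OF cont_adapted_FG[OF Y] \<tau>_stopping])
 show "EX c. AE w in M. ALL t>=0. abs (stopped Y \<tau> t w) <= c"
  using bd by (intro exI[of _ c]) (auto elim!: eventually_mono simp: stopped_def min_time_bounds)
 fix s t A assume st: "0 <= s" "s <= t" and A: "A : sets (G s)"
 show "expect_on A (stopped Y \<tau> t) = expect_on A (stopped Y \<tau> s)"
 proof (cases "s = t")
  case False
  define u where "u n = s + (t - s) * (1 / real (Suc n))" for n
  have u: "s < u n" "u n <= t" for n using False st mult_left_le[of "1 / real (Suc n)" "t - s"] unfolding u_def by auto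
  have "u ----> s + (t - s) * 0" unfolding u_def by (intro tendsto_intros LIMSEQ_Suc lim_1_over_n)
  hence ul: "filterlim u (at_right s) sequentially" using less_imp_neq[OF u(1)] u(1) unfolding filterlim_at by (auto intro!: always_eventually simp: eq_commute[of "u _"])
  have mb: "(%w. indicator A w * stopped Y \<tau> r w) : meas M" if "r >= s" for r
   using G_M[OF st(1) A] stopped_measurable[OF Y \<tau>_meas, of r] st(1) that by (intro borel_measurable_times) auto
  have "(%n. expect_on A (stopped Y \<tau> (u n))) ----> expect_on A (stopped Y \<tau> s)"
  proof (rule integral_dominated_convergence[where w="%_. c"])
   show "AE w in M. (%n. indicator A w * stopped Y \<tau> (u n) w) ----> indicator A w * stopped Y \<tau> s w"
    using AE_cont[OF Y]
    by eventually_elim (intro tendsto_mult_left filterlim_compose[OF cont_right_limit[OF continuous_on_stopped st(1)] ul])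
   show "AE w in M. norm (indicator A w * stopped Y \<tau> (u n) w) <= c" for n
    using bd by eventually_elim (use u(1)[of n] st(1) c in "auto simp: indicator_def stopped_def min_time_bounds")
  qed (use mb less_imp_le[OF u(1)] in auto)
  moreover have "expect_on A (stopped Y \<tau> (u n)) = expect_on A (stopped Y \<tau> t)" for n
   using Lam_test[OF Y bd c L _ u(2)[of n], of A] u(1)[of n] A st(1) by (simp add: sets_G)
  ultimately show ?thesis by (simp add: LIMSEQ_const_iff)
 qed simp
qed

lemma lbm_path: "cont_adapted Y ==> AE w in M. lbm (traj Y w)"
 by (drule AE_cont, erule eventually_mono) (rule lbm_of_continuous)

lemma Lam_F0:
 assumes "k : meas (F 0)" "clm (Lam Y)"
 shows "clm (Lam (%t w. k w * Y t w))"
 by (rule clm_cong[OF clm_mult_F0[OF assms(2,1)]]) (simp add: Lam_def Sint_def sint_cmult distrib_left mult.assoc)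

text \<open>Freezing Y at a stopping time changes Lam Y into a martingale driven by m from then on.\<close>

lemma clm_tail_stopping:
 assumes X: "clm X" and Y: "cont_adapted Y" and T: "ext_stopping_time F T"
 shows "clm (%t w. stopped Y T t w * (X t w - stopped X T t w))"
proof (rule clm_limit)
 let ?k = "%a w. (1 - of_bool (ennreal a < T w)) * stopped Y T a w"
 let ?S = "%n t w. SUM j<4^n. ?k (real j / 2^n) w * (X (min t (real (Suc j) / 2^n)) w - X (min t (real j / 2^n)) w)"
 note cX = clm_cont[OF X] and cYT = cont_adapted_stopped[OF Y T]
 show "clm (?S n)" for n
  using dyadic_le by (intro clm_sum clm_increment[OF X] borel_measurable_times borel_measurable_diff stopping_coeff[OF T] cont_adaptedD[OF cYT]) auto
 have S: "?S n t w = stopped Y T t w * (X t w - stop_sum X T n t w)" if t: "0 <= t" "t <= 2^n" for n t w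
 proof -
  have "?k a w * (X (min t b) w - X (min t a) w) = stopped Y T t w * ((X (min t b) w - X (min t a) w) - of_bool (ennreal a < T w) * (X (min t b) w - X (min t a) w))"
   if ab: "0 <= a" "a <= b" for a b
  proof (cases "ennreal a < T w | t <= a")
   case False
   hence "T w <= ennreal a" "ennreal a <= ennreal t" by (auto simp: not_less intro: ennreal_leI)
   hence "T w <= ennreal a" "T w <= ennreal t" by auto
   thus ?thesis by (simp add: stopped_def min_time_def min.absorb2 not_less)
  qed (use ab in "auto simp: min_def")
  hence "?S n t w = stopped Y T t w * (dsum n (%u v. X v w - X u w) t - (stop_sum X T n t w - X 0 w))"
   unfolding dsum_def stop_sum_def add_diff_cancel_left' sum_subtractf[symmetric] sum_distrib_left using dyadic_le by (intro sum.cong refl) auto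
  thus ?thesis using dsum_telescope[OF t, of "traj X w"] by simp
 qed
 show "AE w in M. loc_uniform (%n t. ?S n t w) (%t. stopped Y T t w * (X t w - stopped X T t w))"
  using AE_cont[OF cX] AE_cont[OF cYT] AE_cont[OF cont_adapted_stopped[OF cX T]]
 proof eventually_elim
  case (elim w)
  show ?case
  proof (intro allI impI, rule uniform_limit_eventually_cong)
   fix K :: real assume K: "0 <= K"
   show "ulim K (%n t. stopped Y T t w * (X t w - stop_sum X T n t w)) (%t. stopped Y T t w * (X t w - stopped X T t w))"
    by (intro uniform_lim_mult uniform_limit_minus uniform_limit_const uniform_limit_stop_sum bounded_continuous continuous_on_diff elim K)
   show "eventually (%n. ALL t:{0..K}. stopped Y T t w * (X t w - stop_sum X T n t w) = ?S n t w) sequentially"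
    using eventually_le_pow2[of K] by eventually_elim (use S in auto)
  qed
 qed
qed

lemma Lam_stopped:
 assumes Y: "cont_adapted Y" and L: "clm (Lam Y)" and T: "ext_stopping_time F T"
 shows "clm (Lam (stopped Y T))"
proof (rule clm_cong[OF clm_add[OF clm_stopped[OF L T] clm_tail_stopping[OF clm_m Y T]]])
 show "AE w in M. ALL t>=0. stopped (Lam Y) T t w + stopped Y T t w * (m t w - stopped m T t w) = Lam (stopped Y T) t w"
  using Ao_incr AE_cont[OF Y]
 proof eventually_elim
  case (elim w)
  show ?case
  proof (intro allI impI)
   fix t :: real assume t: "t >= 0"
   obtain r where r: "r >= 0" "!!x. 0 <= x ==> x <= t ==> min_time x (T w) = min x r"
    using min_time_eq[OF t, of "T w" t] by metis
   let ?s = "sint (traj Ao w)"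
   have e: "?s (traj (stopped Y T) w) 0 (min t r) = ?s (traj Y w) 0 (min t r)" by (rule sint_cong) (simp add: stopped_def r)
   show "stopped (Lam Y) T t w + stopped Y T t w * (m t w - stopped m T t w) = Lam (stopped Y T) t w"
   proof (cases "t <= r")
    case True
    thus ?thesis using e t by (simp add: Lam_def Sint_def stopped_def r)
   next
    case False
    have mr: "min_time s (T w) = r" if "r < s" "s <= t" for s using r(2)[of s] r(1) that by simp
    have "?s (traj (stopped Y T) w) 0 t = ?s (traj (stopped Y T) w) 0 r + ?s (traj (stopped Y T) w) r t"
     using False r(1) by (intro sint_split_lbm elim lbm_of_continuous continuous_on_stopped) auto
    also have "?s (traj (stopped Y T) w) r t = ?s (%s. Y r w * 1) r t" by (rule sint_cong) (simp add: stopped_def mr r)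
    also have "... = Y r w * (Ao t w - Ao r w)" unfolding sint_cmult using False r(1) elim by (simp add: sint_one)
    finally show ?thesis using e False t by (simp add: Lam_def Sint_def m_def stopped_def r algebra_simps)
   qed
  qed
 qed
qed

text \<open>Localization by the hitting times of the levels n reduces the claim to bounded processes. The factor that removes
 the paths starting above the level is known at time 0.\<close>

lemma Lam_imp_clm:
 assumes Y: "cont_adapted Y" and L: "clm (Lam Y)"
 shows "EG.clm (stopped Y \<tau>)"
proof -
 define Yn where "Yn n t w = of_bool (ennreal 0 < hit Y (real n) w) * stopped Y (hit Y (real n)) t w" for n t w
 have k: "(%w. of_bool (ennreal 0 < hit Y (real n) w) :: real) : meas (F 0)" for n
  by (rule stopping_coeff[OF hit_stopping_time[OF Y]]) simp
 show ?thesis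
 proof (rule EG.clm_limit[of "%n. stopped (Yn n) \<tau>"])
  fix n
  have "EG.bm (stopped (Yn n) \<tau>)"
  proof (rule bounded_Lam_stopped)
   show "cont_adapted (Yn n)" unfolding Yn_def[abs_def]
    by (intro cont_adapted_mult cont_adapted_const k cont_adapted_stopped[OF Y hit_stopping_time[OF Y]])
   show "clm (Lam (Yn n))" unfolding Yn_def[abs_def]
    by (intro Lam_F0 k Lam_stopped[OF Y L hit_stopping_time[OF Y]])
   show "AE w in M. ALL t>=0. abs (Yn n t w) <= real n"
    using AE_cont[OF Y]
   proof eventually_elim
    case (elim w)
    have "abs (Y 0 w) < real n" if "0 < hit Y (real n) w" using that hit_le_iff[OF elim, of 0 "real n"] by (auto simp: not_le[symmetric])
    thus ?case using before_hit[OF elim] by (auto simp: Yn_def stopped_def min_time_bounds min_time_le)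
   qed
  qed simp
  thus "EG.clm (stopped (Yn n) \<tau>)" by (rule EG.bm_clm)
 next
  show "AE w in M. loc_uniform (%n s. stopped (Yn n) \<tau> s w) (%s. stopped Y \<tau> s w)"
   using AE_cont[OF Y]
  proof eventually_elim
   case (elim w)
   show ?case
   proof (intro allI impI)
    fix T :: real assume T: "0 <= T"
    obtain K where K: "!!c. c > K ==> hit Y c w > ennreal T" using hit_gt[OF elim T] by blast
    have "stopped (Yn n) \<tau> s w = stopped Y \<tau> s w" if n: "K + 1 <= real n" and s: "s : {0..T}" for n s
    proof -
     let ?u = "min_time s (\<tau> w)"
     have u: "0 <= ?u" "?u <= T" using min_time_bounds[of s "\<tau> w"] s by auto
     have h: "ennreal T < hit Y (real n) w" using K n by simp
     hence "ennreal ?u <= hit Y (real n) w" using ennreal_leI[OF u(2)] by (meson le_less_trans less_imp_le)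
     moreover have "0 < hit Y (real n) w" using h by (rule le_less_trans[rotated]) simp
     ultimately show ?thesis using u by (simp add: stopped_def Yn_def min_time_id)
    qed
    thus "ulim T (%n s. stopped (Yn n) \<tau> s w) (%s. stopped Y \<tau> s w)"
     by (intro uniform_limit_eventually_eq eventually_mono[OF eventually_real_ge[of "K + 1"]]) auto
   qed
  qed
 qed
qed

end

section \<open>Martingales of the enlarged filtration\<close>

text \<open>A continuous integrator does not charge countable sets, in particular the jump times of another path.\<close>

lemma sint_cong_countable:
 assumes b: "increasing_path b" "continuous_on {0..} b" and f: "lbm f" "lbm g"
  and e: "countable {s. s > 0 & f s ~= g s}"
 shows "sint b f 0 t = sint b g 0 t"
proof -
 have sing: "{s} : null_sets (path_measure b)" if s: "s > 0" for s
 proof -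
  have "emeasure (path_measure b) {s} <= ennreal (b s - b u)" if u: "0 <= u" "u < s" for u
   using emeasure_mono[of "{s}" "{u<..s}" "path_measure b"] emeasure_path_measure[OF b(1) u(1) less_imp_le[OF u(2)]] u by simp
  hence "eventually (%u. emeasure (path_measure b) {s} <= ennreal (b s - b u)) (at_left s)"
   using s by (auto simp: eventually_at_left_field)
  moreover have "((%u. ennreal (b s - b u)) ---> ennreal (b s - b s)) (at_left s)"
   by (intro tendsto_ennrealI tendsto_diff tendsto_const cont_left_limit[OF b(2) s])
  ultimately have "emeasure (path_measure b) {s} <= ennreal (b s - b s)" by (intro tendsto_lowerbound) auto
  thus ?thesis by (simp add: null_sets_def)
 qed
 have "(UN s:{s. s > 0 & f s ~= g s}. {s}) : null_sets (path_measure b)"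
  using e sing by (intro null_sets_UN') auto
 hence ae: "AE s in path_measure b. s ~: {s. s > 0 & f s ~= g s}" by (intro AE_not_in) simp
 show ?thesis
  unfolding sint_def set_lebesgue_integral_def
 proof (rule integral_cong_AE)
  show "AE s in path_measure b. indicator {0<..t} s *\<^sub>R f s = indicator {0<..t} s *\<^sub>R g s"
   using ae by eventually_elim (auto simp: indicator_def)
 qed (use lbm_set_integrable[OF b(1) order_refl f(1)] lbm_set_integrable[OF b(1) order_refl f(2)] in "auto simp: set_integrable_def")
qed

text \<open>Fubini for a continuous and an arbitrary integrator, by summation by parts.\<close>

lemma product_mixed:
 assumes b: "increasing_path b" "continuous_on {0..} b" and g: "lbm g" and y: "increasing_path y" and t: "t >= 0"
 shows "sint b g 0 t * y t - sint y (%s. sint b g 0 s) 0 t = sint b (%s. y s * g s) 0 t"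
proof -
 let ?x = "%s. sint b g 0 s"
 have cx: "continuous_on {0..} ?x" by (rule continuous_on_sint[OF b g])
 have rc: "(y ---> y s) (at_right s)" if "s >= 0" for s using y that by (simp add: increasing_path_def)
 have bd: "ALL s:{0..t}. abs (y s) <= y t" using incr_le[OF y] y by (auto simp: increasing_path_def) (metis abs_of_nonneg incr_le[OF y] order_refl order_trans)
 have 1: "(%n. dsum n (%u v. y v * sint b g u v) t) ----> sint b (%s. y s * g s) 0 t"
  by (rule riemann_right[OF b(1) g t rc]) (use bd in blast)+
 have "(%n. dsum n (%u v. ?x u * sint y (%_. 1) u v) t) ----> sint y (%s. ?x s * 1) 0 t"
  by (rule tendsto_uniform_limitI[OF riemann_uniform[OF y lbm_const cx t disjI1[OF refl]]]) (use t in simp)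
 from tendsto_add[OF this 1] have "(%n. dsum n (%u v. ?x u * sint y (%_. 1) u v) t + dsum n (%u v. y v * sint b g u v) t)
  ----> sint y ?x 0 t + sint b (%s. y s * g s) 0 t" by simp
 moreover have "eventually (%n. dsum n (%u v. ?x u * sint y (%_. 1) u v) t + dsum n (%u v. y v * sint b g u v) t = ?x t * y t) sequentially"
  using eventually_le_pow2[of t]
 proof eventually_elim
  case (elim n)
  have s: "sint b g u v = ?x v - ?x u" if "0 <= u" "u <= v" for u v using sint_split_lbm[OF b(1) g order_refl that] by simp
  have "dsum n (%u v. y v * sint b g u v) t = dsum n (%u v. y v * (?x v - ?x u)) t" by (rule dsum_cong[OF _ t]) (subst s, auto)
  moreover have "dsum n (%u v. ?x u * sint y (%_. 1) u v) t = dsum n (%u v. ?x u * (y v - y u)) t"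
   using t by (intro dsum_cong) (auto simp: sint_one[OF y])
  ultimately show ?case using parts_sum[of t n ?x y] t elim by (simp add: mult.commute)
 qed
 ultimately have "(%n. ?x t * y t) ----> sint y ?x 0 t + sint b (%s. y s * g s) 0 t"
  by (rule Lim_transform_eventually)
 thus ?thesis by (simp add: LIMSEQ_const_iff)
qed

lemma min_time_ge_iff: "t >= 0 ==> s > 0 ==> s <= min_time t u <-> s <= t & ennreal s <= u"
 by (cases u) (auto simp: min_time_ennreal min_time_top ennreal_le_iff)

context random_time begin

definition ka :: "real => 'a => real" where "ka s w = of_bool (ennreal s <= \<tau> w)"

lemma lbm_ka: "lbm (traj ka w)"
proof -
 have "{s. 0 < s & ennreal s <= \<tau> w} : sets borel" by measurable
 moreover have "(%s. indicator {0<..} s * of_bool (ennreal s <= \<tau> w)) = (indicator {s. 0 < s & ennreal s <= \<tau> w} :: real => real)"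
  by (auto simp: indicator_def fun_eq_iff)
 ultimately show ?thesis unfolding lbm_def ka_def by (auto intro!: exI[of _ 1])
qed

lemma stopped_Sint: "t >= 0 ==> stopped (Sint V g) \<tau> t w = Sint V (%s w. ka s w * g s w) t w"
 unfolding stopped_def Sint_def sint_def set_lebesgue_integral_def
 by (intro Bochner_Integration.integral_cong refl) (auto simp: indicator_def ka_def min_time_ge_iff)

lemma E_right_continuous: "regular w ==> s >= 0 ==> (traj E w ---> E s w) (at_right s)"
 unfolding E_def by (rule pexp_right_continuous[OF pexp_assms])

lemma lbm_E:
 assumes "regular w" shows "lbm (traj E w)"
proof (rule rc_bounded_lbm)
 have "abs (E s w) <= E T w" if "s : {0..T}" for s T using E_facts(1,7)[OF assms, of s] E_facts(7)[OF assms, of s T] that by force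
 thus "EX K. ALL s:{0..T}. abs (E s w) <= K" for T by blast
qed (rule E_right_continuous[OF assms])

lemma sint_El:
 assumes r: "regular w" and h: "lbm h"
 shows "sint (traj V w) (%s. El s w * h s) 0 t = sint (traj V w) (%s. E s w * h s) 0 t"
proof (rule sint_cong_countable)
 have "mono (%s. E (max 0 s) w)" using E_facts(7)[OF r] by (intro monoI) auto
 hence "countable {s. ~ isCont (%s. E (max 0 s) w) s}" by (rule mono_ctble_discont)
 moreover have "El s w = E s w" if s: "s > 0" and c: "isCont (%s. E (max 0 s) w) s" for s
 proof -
  have "((%s. E (max 0 s) w) ---> E s w) (at_left s)" using c s unfolding isCont_def by (auto intro: tendsto_within_subset)
  moreover have "eventually (%u. E (max 0 u) w = E u w) (at_left s)" using s by (auto simp: eventually_at_left_field intro!: exI[of _ 0])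
  ultimately have "(traj E w ---> E s w) (at_left s)" by (rule Lim_transform_eventually)
  from tendsto_unique[OF _ E_facts(5)[OF r s] this] show ?thesis by simp
 qed
 ultimately show "countable {s. s > 0 & El s w * h s ~= E s w * h s}" by (elim countable_subset[rotated]) auto
qed (use r E_facts(3)[OF r] lbm_E[OF r] h in "auto simp: regular_def intro: lbm_mult")

lemma clm_N_squared: "clm (%t w. (N t w)\<^sup>2 - Sint V (%s w. (E s w)\<^sup>2) t w)"
 by (rule clm_cong[OF clm_N2])
  (use AE_regular in \<open>eventually_elim, use sint_El E_facts(3) lbm_E in "simp add: Sint_def power2_eq_square mult.commute"\<close>)

definition right_cont_bounded :: "(real => 'a => real) => bool" where
 "right_cont_bounded g <-> adapted F g & (AE w in M. rc_path (traj g w))"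

lemma right_cont_bounded_mult:
 assumes "right_cont_bounded f" "right_cont_bounded g" shows "right_cont_bounded (%s w. f s w * g s w)"
proof -
 have "AE w in M. rc_path (%s. f s w * g s w)"
  using assms[unfolded right_cont_bounded_def, THEN conjunct2]
 proof eventually_elim
  case (elim w)
  have "EX K. ALL s:{0..T}. abs (f s w * g s w) <= K" for T
  proof -
   obtain K K' where "ALL s:{0..T}. abs (f s w) <= K" "ALL s:{0..T}. abs (g s w) <= K'" using elim by meson
   hence "ALL s:{0..T}. abs (f s w * g s w) <= K * K'" unfolding abs_mult by (meson abs_ge_zero mult_mono order_trans)
   thus ?thesis by blast
  qed
  thus ?case using elim by (auto intro: tendsto_mult)
 qed
 thus ?thesis using assms unfolding right_cont_bounded_def adapted_def by (auto intro: borel_measurable_times)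
qed

lemma right_cont_bounded_cont: "cont_adapted X ==> right_cont_bounded X"
 unfolding right_cont_bounded_def cont_adapted_def
 by (auto elim!: eventually_mono intro: cont_right_limit dest: bounded_continuous simp: bounded_iff)

lemma right_cont_bounded_inverse_Z: "right_cont_bounded (%s w. 1 / Z s w)"
 unfolding right_cont_bounded_def
proof
 show "adapted F (%s w. 1 / Z s w)" using adapted_Z unfolding adapted_def by (auto intro: borel_measurable_divide)
 show "AE w in M. rc_path (%s. 1 / Z s w)" using AE_regular by eventually_elim (use lbm_Z(3,4) in blast)
qed

lemma N_ge_Z: "regular w ==> t >= 0 ==> Z t w <= N t w"
 using mult_left_mono[OF E_facts(1), of w t "Z t w"] by (simp add: N_def regular_def less_imp_le)

lemma N_pos: "regular w ==> t >= 0 ==> 0 < N t w"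
 using N_ge_Z[of w t] regular_pos[of w t] by linarith

lemma cont_adapted_inverse_N: "cont_adapted (%s w. 1 / N s w)"
 unfolding cont_adapted_def
proof (intro conjI)
 show "adapted F (%s w. 1 / N s w)" using clm_cont[OF clm_N] unfolding cont_adapted_def adapted_def by (auto intro: borel_measurable_divide)
 show "AE w in M. continuous_on {0..} (%t. 1 / N t w)"
  using AE_cont[OF clm_cont[OF clm_N]] AE_regular
 proof eventually_elim
  case (elim w)
  have "ALL t:{0..}. N t w ~= 0" using N_pos[OF elim(2)] by (metis atLeast_iff less_irrefl)
  thus ?case by (intro continuous_intros elim(1)) auto
 qed
qed

lemma right_cont_bounded_lbm: "right_cont_bounded g ==> AE w in M. lbm (traj g w)"
 unfolding right_cont_bounded_def by (elim conjE eventually_mono) (auto intro: rc_bounded_lbm)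

lemma Sint_V_adapted:
 assumes g: "right_cont_bounded g" and C: "adapted F (Sint V gam)" and gam: "AE w in M. lbm (traj gam w)"
 shows "cont_adapted (Sint V (%s w. g s w * gam s w))"
 unfolding cont_adapted_def
proof (intro conjI)
 show "adapted F (Sint V (%s w. g s w * gam s w))"
 proof (rule adapted_Sint[OF _ C])
  show "AE w in M. primitive (Sint V gam) V gam w & rc_path (traj g w)"
   using V_path gam g[unfolded right_cont_bounded_def, THEN conjunct2] by eventually_elim (simp add: Sint_def)
 qed (use g in "simp add: right_cont_bounded_def")
 show "AE w in M. continuous_on {0..} (%t. Sint V (%s w. g s w * gam s w) t w)"
  using V_path right_cont_bounded_lbm[OF g] gam by eventually_elim (auto simp: Sint_def intro!: continuous_on_sint lbm_mult)
qed

lemma cont_adapted_Sint_V: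
 assumes "right_cont_bounded g" shows "cont_adapted (Sint V g)"
proof -
 have "adapted F (Sint V (%_ _. 1))"
  unfolding adapted_def
 proof (intro allI impI)
  fix t :: real assume t: "t >= 0"
  have "AE w in M. V t w = Sint V (%_ _. 1) t w" using V_path by eventually_elim (use t in "simp add: Sint_def sint_one")
  from AE_eq_meas_F[OF cont_adaptedD[OF cont_adapted_V t] this t] show "Sint V (%_ _. 1) t : meas (F t)" .
 qed
 from Sint_V_adapted[OF assms this] show ?thesis by simp
qed

lemma ibp_V:
 assumes X: "clm X" and g: "AE w in M. lbm (traj g w)" and a: "cont_adapted (Sint V g)"
 shows "clm (%t w. X t w * Sint V g t w - Sint V (%s w. X s w * g s w) t w)"
proof (rule clm_ibp[OF X])
 show "AE w in M. primitive (Sint V g) V g w"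
  using V_path g by eventually_elim (simp add: Sint_def)
qed (use a in "simp add: cont_adapted_def")

text \<open>The Jeulin-Yor formula: in the enlarged filtration \<open>X\<^sup>\<tau>\<close> has the drift d\<langle>X,m\<rangle> / Z. For
 Y = X - \<integral> d\<langle>X,m\<rangle> / Z the drift of \<open>Y Z + \<integral> Y dA\<^sup>o\<close> is d\<langle>X,m\<rangle> - Z d\<langle>X,m\<rangle> / Z = 0.\<close>

lemma jeulin_yor:
 assumes X: "clm X" and Xm: "bracket X m V gam" and gam: "AE w in M. lbm (traj gam w)"
 shows "EG.clm (stopped (%t w. X t w - Sint V (%s w. 1 / Z s w * gam s w) t w) \<tau>)"
proof (rule Lam_imp_clm)
 let ?g = "%s w. 1 / Z s w * gam s w"
 let ?B = "Sint V ?g"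
 note cX = clm_cont[OF X] and cm = clm_cont[OF clm_m]
 have "adapted F (%t w. X t w * m t w - (X t w * m t w - Sint V gam t w))"
  using cont_adapted_diff[OF cont_adapted_mult[OF cX cm] clm_cont[OF Xm]] by (simp add: cont_adapted_def)
 hence "adapted F (Sint V gam)" by simp
 from Sint_V_adapted[OF right_cont_bounded_inverse_Z this gam] have B: "cont_adapted ?B" .
 show "cont_adapted (%t w. X t w - ?B t w)" by (rule cont_adapted_diff[OF cX B])
 have lg: "AE w in M. lbm (traj ?g w)" using right_cont_bounded_lbm[OF right_cont_bounded_inverse_Z] gam by eventually_elim (rule lbm_mult)
 have ibp: "clm (%t w. X t w * Ao t w - Sint Ao (%s w. X s w * 1) t w)"
  by (rule clm_ibp[OF X adapted_Ao]) (use Ao_incr in "eventually_elim, simp add: Sint_def sint_one")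
 show "clm (Lam (%t w. X t w - ?B t w))"
 proof (rule clm_cong[OF clm_diff[OF clm_diff[OF Xm ibp] ibp_V[OF clm_m lg B]]])
  show "AE w in M. ALL t>=0. X t w * m t w - Sint V gam t w - (X t w * Ao t w - Sint Ao (%s w. X s w * 1) t w) -
    (m t w * ?B t w - Sint V (%s w. m s w * ?g s w) t w) = Lam (%t w. X t w - ?B t w) t w"
   using AE_regular lbm_path[OF cX] lbm_path[OF B] lg lbm_path[OF cm]
  proof eventually_elim
   case (elim w)
   note r = elim(1) and l = elim(2-5)
   have i: "increasing_path (traj Ao w)" and v: "increasing_path (traj V w)" "continuous_on {0..} (traj V w)" using r by (auto simp: regular_def)
   have lA: "lbm (traj Ao w)" using lbm_diff[OF l(4) lbm_Z(1)[OF r]] by (simp add: m_def)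
   show ?case
   proof (intro allI impI)
    fix t :: real assume t: "t >= 0"
    let ?s = "%f. sint (traj V w) f 0 t"
    have "?s (%s. m s w * ?g s w) - ?s (%s. Ao s w * ?g s w) = ?s (%s. m s w * ?g s w - Ao s w * ?g s w)"
     by (rule sint_diff[OF v(1) order_refl, symmetric]) (intro lbm_mult l lA)+
    also have "... = ?s (traj gam w)"
    proof (rule sint_cong)
     fix s :: real assume "0 < s"
     hence "Z s w ~= 0" using regular_pos[OF r, of s] by simp
     thus "m s w * ?g s w - Ao s w * ?g s w = gam s w" by (simp add: m_def field_simps)
    qed
    finally have 1: "Sint V (%s w. m s w * ?g s w) t w - ?s (%s. Ao s w * ?g s w) = Sint V gam t w" by (simp add: Sint_def)
    have 2: "?B t w * Ao t w - Sint Ao ?B t w = ?s (%s. Ao s w * ?g s w)"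
     using product_mixed[OF v l(3) i t] by (simp add: Sint_def)
    have 3: "Sint Ao (%s w. X s w - ?B s w) t w = Sint Ao X t w - Sint Ao ?B t w"
     using sint_diff[OF i order_refl l(1,2)] by (simp add: Sint_def)
    have gen: "x * (z + a) - (sm - (b * a - sb)) - (x * a - sx) - ((z + a) * b - sm) = (x - b) * z + (sx - sb)" for x z a sx b sm sb :: real
     by (simp add: left_diff_distrib right_diff_distrib distrib_left distrib_right mult.commute)
    show "X t w * m t w - Sint V gam t w - (X t w * Ao t w - Sint Ao (%s w. X s w * 1) t w) -
     (m t w * ?B t w - Sint V (%s w. m s w * ?g s w) t w) = Lam (%t w. X t w - ?B t w) t w"
     unfolding Lam_def 3 mult_1_right m_def[of t] 1[symmetric] 2[symmetric] by (rule gen)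
   qed
  qed
 qed
qed

text \<open>\<open>Lam (X / N) = X / E + \<integral> X dA\<^sup>o / N\<close> is a local martingale by integration by parts, as \<open>d(1/E) = - dA\<^sup>o / N\<close>.\<close>

lemma clm_div_N:
 assumes X: "clm X" shows "EG.clm (stopped (%t w. X t w * (1 / N t w)) \<tau>)"
proof (rule Lam_imp_clm)
 show "cont_adapted (%t w. X t w * (1 / N t w))" by (rule cont_adapted_mult[OF clm_cont[OF X] cont_adapted_inverse_N])
 have "clm (%t w. X t w * (1 / E t w) - Sint Ao (%s w. X s w * - (1 / N s w)) t w)"
 proof (rule clm_ibp[OF X])
  show "adapted F (%t w. 1 / E t w)" using adapted_E unfolding adapted_def by (auto intro: borel_measurable_divide)
  show "AE w in M. primitive (%t w. 1 / E t w) Ao (%s w. - (1 / N s w)) w"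
   using AE_regular lbm_path[OF cont_adapted_inverse_N]
  proof eventually_elim
   case (elim w)
   have "lbm (%s. - (1 / N s w))" using lbm_mult[OF lbm_const[of "-1"] elim(2)] by simp
   thus ?case by (intro conjI allI impI pexp_assms(1)[OF elim(1)] E_facts(6)[OF elim(1)])
  qed
 qed
 thus "clm (Lam (%t w. X t w * (1 / N t w)))"
 proof (rule clm_cong)
  have "Sint Ao (%s w. X s w * - (1 / N s w)) t w = - Sint Ao (%s w. X s w * (1 / N s w)) t w" for t w
   using sint_cmult[of _ "-1" "%s. X s w * (1 / N s w)" 0 t] by (simp add: Sint_def)
  moreover have "X t w * (1 / E t w) = X t w * (1 / N t w) * Z t w" if "regular w" "t >= 0" for t w
   using regular_pos[OF that] by (simp add: N_def)
  ultimately show "AE w in M. ALL t>=0. X t w * (1 / E t w) - Sint Ao (%s w. X s w * - (1 / N s w)) t w = Lam (%t w. X t w * (1 / N t w)) t w"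
   using AE_regular by (auto simp: Lam_def Sint_def elim!: eventually_mono)
 qed
qed

text \<open>The martingale part U = m - \<integral> dV / Z of m in the enlarged filtration.\<close>

definition U :: "real => 'a => real" where "U t w = m t w - Sint V (%s w. 1 / Z s w) t w"

lemma hat_process_U: "hat_process \<tau> Z m V t w = stopped U \<tau> t w"
 by (simp add: hat_process_def stopped_def U_def Sint_def sint_def)

lemma clm_U: "EG.clm (stopped U \<tau>)"
 using jeulin_yor[OF clm_m clm_m2'] by (simp add: U_def[abs_def])

text \<open>The bracket of \<open>U\<^sup>\<tau>\<close> is that of m up to \<tau>. The Jeulin-Yor formula is applied to \<open>m\<^sup>2 - V\<close>, whose bracket with m is
 \<integral> 2 m dV by Ito's formula for \<open>m\<^sup>3\<close>; the resulting drift is what integration by parts subtracts when m is replaced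
 by U.\<close>

lemma clm_U_squared: "EG.bracket (stopped U \<tau>) (stopped U \<tau>) V ka"
proof -
 let ?g = "%s w. 1 / Z s w"
 let ?B = "Sint V ?g" and ?V = "Sint V (%_ _. 1)"
 note cm = clm_cont[OF clm_m]
 have B: "cont_adapted ?B" by (rule cont_adapted_Sint_V[OF right_cont_bounded_inverse_Z])
 have lg: "AE w in M. lbm (traj ?g w)" by (rule right_cont_bounded_lbm[OF right_cont_bounded_inverse_Z])
 have cube: "clm (%t w. (m t w)^3 - Sint V (%s w. 6 * m s w * 1) t w / 2)"
 proof (rule clm_ito[OF clm_m, where f="%x. x^3" and ?f1.0="%x. 3 * x\<^sup>2"])
  show "clm (%t w. (m t w)\<^sup>2 - Sint V (%s w. 1) t w)" using clm_m2' by (simp add: power2_eq_square)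
  show "AE w in M. increasing_path (traj V w) & continuous_on {0..} (traj V w) & lbm (%s. 1)" using V_path by eventually_elim simp
  have rem: "v^3 - u^3 - 3 * u\<^sup>2 * (v - u) - 6 * u * (v - u)\<^sup>2 / 2 = (v - u)^3" for u v :: real
   by (simp add: power2_eq_square power3_eq_cube field_simps)
  show "AE w in M. continuous_on {0..} (%t. (m t w)^3) & continuous_on {0..} (%t. 6 * m t w) & (ALL T>=0. EX K. ALL u:{0..T}. ALL v:{0..T}.
    abs ((m v w)^3 - (m u w)^3 - 3 * (m u w)\<^sup>2 * (m v w - m u w) - 6 * m u w * (m v w - m u w)\<^sup>2 / 2) <= K * abs (m v w - m u w)^3)"
   using AE_cont[OF cm]
  proof eventually_elim
   case (elim w)
   show ?case unfolding rem by (intro conjI allI impI exI[of _ 1] continuous_intros elim) (simp add: power_abs)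
  qed
 qed measurable
 have V1: "cont_adapted ?V" by (rule cont_adapted_Sint_V[OF right_cont_bounded_cont[OF cont_adapted_const]]) simp
 have ibpV: "clm (%t w. m t w * ?V t w - Sint V (%s w. m s w * 1) t w)" by (rule ibp_V[OF clm_m _ V1]) simp
 have "bracket (%t w. m t w * m t w - ?V t w) m V (%s w. 2 * m s w)"
  using clm_diff[OF cube ibpV] by (simp add: Sint_def sint_cmult power3_eq_cube algebra_simps)
 moreover have "AE w in M. lbm (%t. 2 * m t w)" using lbm_path[OF cm] by eventually_elim (intro lbm_mult lbm_const)
 ultimately have 1: "EG.clm (stopped (%t w. (m t w * m t w - ?V t w) - Sint V (%s w. ?g s w * (2 * m s w)) t w) \<tau>)"
  by (rule jeulin_yor[OF clm_m2'])
 have 2: "EG.clm (%t w. stopped U \<tau> t w * Sint V (%s w. ka s w * ?g s w) t w - Sint V (%s w. stopped U \<tau> s w * (ka s w * ?g s w)) t w)"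
 proof (rule EG.clm_ibp[OF clm_U])
  have "adapted G (stopped ?B \<tau>)"
   using EG.cont_adapted_stopped[OF cont_adapted_FG[OF B] \<tau>_stopping] by (simp add: EG.cont_adapted_def)
  moreover have "stopped ?B \<tau> t = Sint V (%s w. ka s w * ?g s w) t" if "t >= 0" for t by (intro ext stopped_Sint that)
  ultimately show "adapted G (Sint V (%s w. ka s w * ?g s w))" by (simp only: adapted_def) metis
  show "AE w in M. primitive (Sint V (%s w. ka s w * ?g s w)) V (%s w. ka s w * ?g s w) w"
   using V_path lg by eventually_elim (auto simp: Sint_def simp del: times_divide_eq_right intro: lbm_mult lbm_ka)
 qed
 show ?thesis
 proof (rule EG.clm_cong[OF EG.clm_diff[OF 1 EG.clm_cmult[OF 2, of 2]]])
  show "AE w in M. ALL t>=0. stopped (%t w. (m t w * m t w - ?V t w) - Sint V (%s w. ?g s w * (2 * m s w)) t w) \<tau> t w -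
    2 * (stopped U \<tau> t w * Sint V (%s w. ka s w * ?g s w) t w - Sint V (%s w. stopped U \<tau> s w * (ka s w * ?g s w)) t w) =
    stopped U \<tau> t w * stopped U \<tau> t w - Sint V ka t w"
   using V_path lbm_path[OF cm] lbm_path[OF B] lg AE_cont[OF B]
  proof eventually_elim
   case (elim w)
   show ?case
   proof (intro allI impI)
    fix t :: real assume t: "t >= 0"
    define r where "r = min_time t (\<tau> w)"
    have r: "r >= 0" unfolding r_def by (rule min_time_bounds(1)[OF t])
    note l = elim(2-4) and i = conjunct1[OF conjunct2[OF elim(1)]]
    let ?s = "%f. sint (traj V w) f 0 r"
    have k: "Sint V (%s w. ka s w * f s w) t w = ?s (traj f w)" for f
     using stopped_Sint[OF t, of f w] by (simp add: Sint_def stopped_def r_def)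
    have "Sint V (%s w. stopped U \<tau> s w * (ka s w * ?g s w)) t w = Sint V (%s w. ka s w * (U s w * ?g s w)) t w"
     unfolding Sint_def by (rule sint_cong) (auto simp: ka_def stopped_def min_time_id)
    hence 3: "Sint V (%s w. stopped U \<tau> s w * (ka s w * ?g s w)) t w = ?s (%s. m s w * ?g s w) - ?s (%s. ?B s w * ?g s w)"
     using sint_diff[OF i order_refl lbm_mult[OF l(1,3)] lbm_mult[OF l(2,3)]] by (simp add: k U_def diff_divide_distrib)
    have 4: "Sint V (%s w. ?g s w * (2 * m s w)) r w = 2 * ?s (%s. m s w * ?g s w)"
     unfolding Sint_def sint_cmult[symmetric] by (simp add: mult.commute mult.left_commute)
    have "?B r w * ?B r w - ?B 0 w * ?B 0 w = ?s (%s. ?B s w * ?g s w + ?B s w * ?g s w)"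
     by (rule sint_product[where yl="traj ?B w", OF i r l(3) l(3)]) (simp_all add: Sint_def cont_left_limit[OF elim(5), unfolded Sint_def])
    hence 5: "?B r w * ?B r w = ?s (%s. ?B s w * ?g s w) + ?s (%s. ?B s w * ?g s w)"
     using sint_add[OF i order_refl lbm_mult[OF l(2,3)] lbm_mult[OF l(2,3)]] by (simp add: Sint_def)
    have gen: "(x * x - v - 2 * p) - 2 * ((x - b) * b - (p - q)) = (x - b) * (x - b) - v" if "b * b = q + q" for x v b p q :: real
     using that by (simp add: algebra_simps)
    show "stopped (%t w. (m t w * m t w - ?V t w) - Sint V (%s w. ?g s w * (2 * m s w)) t w) \<tau> t w -
     2 * (stopped U \<tau> t w * Sint V (%s w. ka s w * ?g s w) t w - Sint V (%s w. stopped U \<tau> s w * (ka s w * ?g s w)) t w) =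
     stopped U \<tau> t w * stopped U \<tau> t w - Sint V ka t w"
     using gen[OF 5, of "m r w"] k[of "%_ _. 1"] k[of ?g] unfolding 3 unfolding stopped_def r_def[symmetric] 4 by (simp add: U_def Sint_def)
   qed
  qed
 qed
qed

text \<open>The deflator: L solves dL = - (L / Z) dU on \<open>[0, \<tau>]\<close>. The next lemmas are the brackets that
 identify this equation.\<close>

definition Ls :: "real => 'a => real" where "Ls t w = N 0 w * stopped (%t w. 1 / N t w) \<tau> t w"

lemma N0: "N 0 : meas (F 0)"
 by (rule cont_adaptedD[OF clm_cont[OF clm_N] order_refl])

lemma clm_Ls_mult:
 assumes "clm X" shows "EG.clm (%t w. Ls t w * stopped X \<tau> t w)"
proof -
 have "EG.clm (stopped (%t w. (N 0 w * X t w) * (1 / N t w)) \<tau>)" by (rule clm_div_N[OF clm_mult_F0[OF assms N0]])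
 thus ?thesis by (simp add: Ls_def stopped_def[abs_def] ac_simps)
qed

lemma clm_Ls: "EG.clm Ls"
 using clm_Ls_mult[OF clm_const[of "%_. 1"]] by (simp add: stopped_def)

lemma Ls_before: "s >= 0 ==> ka s w = 0 | Ls s w = N 0 w * (1 / N s w)"
 by (simp add: ka_def Ls_def stopped_def min_time_id)

text \<open>Since N \<integral> g dV - \<integral> N g dV is a local martingale, N (R + \<integral> g dV) is one, and the division by N applies to it.\<close>

lemma stopped_compensated:
 assumes Y: "clm Y" and g: "right_cont_bounded g" and k: "k : meas (F 0)"
  and Yg: "AE w in M. ALL t>=0. Y t w = N t w * R t w + Sint V (%s w. N s w * g s w) t w"
  and h: "AE w in M. ALL s>0. ka s w * (k w * g s w) = - h s w"
 shows "EG.clm (%t w. k w * stopped R \<tau> t w - Sint V h t w)"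
proof -
 note X = clm_mult_F0[OF clm_add[OF Y ibp_V[OF clm_N right_cont_bounded_lbm[OF g] cont_adapted_Sint_V[OF g]]] k]
 show ?thesis
 proof (rule EG.clm_cong[OF clm_div_N[OF X]])
  show "AE w in M. ALL t>=0. stopped (%t w. k w * (Y t w + (N t w * Sint V g t w - Sint V (%s w. N s w * g s w) t w)) * (1 / N t w)) \<tau> t w =
    k w * stopped R \<tau> t w - Sint V h t w"
   using Yg h AE_regular
  proof eventually_elim
   case (elim w)
   show ?case
   proof (intro allI impI)
    fix t :: real assume t: "t >= 0"
    define u where "u = min_time t (\<tau> w)"
    have u: "u >= 0" unfolding u_def by (rule min_time_bounds(1)[OF t])
    have "sint (traj V w) (traj h w) 0 t = sint (traj V w) (%s. - k w * (ka s w * g s w)) 0 t"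
     using elim(2) by (intro sint_cong) (simp add: mult.left_commute)
    also have "... = - k w * stopped (Sint V g) \<tau> t w" unfolding sint_cmult stopped_Sint[OF t] by (simp add: Sint_def)
    finally have "Sint V h t w = - k w * Sint V g u w" by (simp add: Sint_def stopped_def u_def)
    moreover have "k w * (N u w * R u w + a + (N u w * b - a)) * (1 / N u w) = k w * R u w - (- k w * b)" for a b
     using N_pos[OF elim(3) u] by (simp add: field_simps)
    ultimately show "stopped (%t w. k w * (Y t w + (N t w * Sint V g t w - Sint V (%s w. N s w * g s w) t w)) * (1 / N t w)) \<tau> t w =
     k w * stopped R \<tau> t w - Sint V h t w"
     using elim(1) u by (simp add: stopped_def u_def[symmetric])
   qed
  qed
 qed
qed

text \<open>N (U / N) = U differs from the martingale m by \<integral> dV / Z.\<close>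

lemma clm_Ls_U: "EG.bracket (stopped U \<tau>) Ls V (%s w. - (Ls s w / Z s w) * ka s w)"
proof -
 have "EG.clm (%t w. N 0 w * stopped (%t w. U t w * (1 / N t w)) \<tau> t w - Sint V (%s w. - (Ls s w / Z s w) * ka s w) t w)"
 proof (rule stopped_compensated[OF clm_m right_cont_bounded_mult[OF right_cont_bounded_cont[OF cont_adapted_inverse_N] right_cont_bounded_inverse_Z] N0])
  show "AE w in M. ALL s>0. ka s w * (N 0 w * (1 / N s w * (1 / Z s w))) = - (- (Ls s w / Z s w) * ka s w)"
  proof (intro AE_I2 allI impI)
   show "ka s w * (N 0 w * (1 / N s w * (1 / Z s w))) = - (- (Ls s w / Z s w) * ka s w)" if "s > 0" for w s
    using Ls_before[of s w] that by auto
  qed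
  have *: "Sint V (%s w. N s w * (1 / N s w * (1 / Z s w))) t w = Sint V (%s w. 1 / Z s w) t w" if "regular w" for t w
   unfolding Sint_def using N_pos[OF that] by (intro sint_cong) (simp add: less_imp_neq[symmetric])
  show "AE w in M. ALL t>=0. m t w = N t w * (U t w * (1 / N t w)) + Sint V (%s w. N s w * (1 / N s w * (1 / Z s w))) t w"
   using AE_regular by eventually_elim (simp only: *, use N_pos in "auto simp: U_def less_imp_neq[symmetric]")
 qed
 thus ?thesis by (simp add: Ls_def stopped_def[abs_def] ac_simps)
qed

text \<open>\<open>N (1 / N\<^sup>2) = 1 / N\<close>, whose drift is given by Ito's formula.\<close>

lemma clm_Ls_squared: "EG.clm (%t w. (Ls t w)\<^sup>2 - Sint V (%s w. (- (Ls s w / Z s w))\<^sup>2 * ka s w) t w)"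
proof -
 let ?iN = "%s w. 1 / N s w" and ?iZ = "%s w. 1 / Z s w"
 note gN = right_cont_bounded_cont[OF cont_adapted_inverse_N] and gZ = right_cont_bounded_inverse_Z
 have g: "right_cont_bounded (%s w. ?iN s w * ?iN s w * (?iZ s w * ?iZ s w) * (-1))"
  by (intro right_cont_bounded_mult gN gZ right_cont_bounded_cont[OF cont_adapted_const]) simp
 have cN: "cont_adapted N" by (rule clm_cont[OF clm_N])
 have ito: "clm (%t w. 1 / N t w - Sint V (%s w. 2 / (N s w)^3 * (E s w)\<^sup>2) t w / 2)"
 proof (rule clm_ito[OF clm_N clm_N_squared, where f="%x. 1 / x" and ?f1.0="%x. - 1 / x\<^sup>2"])
  show "AE w in M. increasing_path (traj V w) & continuous_on {0..} (traj V w) & lbm (%s. (E s w)\<^sup>2)"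
   using AE_regular by eventually_elim (auto simp: regular_def[symmetric] intro: lbm_power2 lbm_E, auto simp: regular_def)
  show "AE w in M. continuous_on {0..} (%t. 1 / N t w) & continuous_on {0..} (%t. 2 / (N t w)^3) & (ALL T>=0. EX K. ALL u:{0..T}. ALL v:{0..T}.
    abs (1 / N v w - 1 / N u w - - 1 / (N u w)\<^sup>2 * (N v w - N u w) - 2 / (N u w)^3 * (N v w - N u w)\<^sup>2 / 2) <= K * abs (N v w - N u w)^3)"
   using AE_cont[OF cN] AE_regular
  proof eventually_elim
   case (elim w)
   note r = elim(2)
   have nz: "ALL t:{0..}. N t w ~= 0" using N_pos[OF r] by (metis atLeast_iff less_irrefl)
   have "EX K. ALL u:{0..T}. ALL v:{0..T}. abs (1 / N v w - 1 / N u w - - 1 / (N u w)\<^sup>2 * (N v w - N u w) - 2 / (N u w)^3 * (N v w - N u w)\<^sup>2 / 2) <= K * abs (N v w - N u w)^3" for T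
   proof -
    obtain eps where e: "eps > 0" "ALL t:{0..T}. Z t w >= eps" using r unfolding regular_def by meson
    have Ne: "N t w >= eps" if "t : {0..T}" for t using e(2) that N_ge_Z[OF r, of t] by force
    (* The remainder equals - (y - x)^3 / (x^3 y), and N is at least eps. *)
    show ?thesis
    proof (intro exI[of _ "1 / eps^4"] ballI)
    fix u v assume uv: "u : {0..T}" "v : {0..T}"
    let ?x = "N u w" and ?y = "N v w"
    have p: "eps <= ?x" "eps <= ?y" "?x > 0" "?y > 0" using Ne[OF uv(1)] Ne[OF uv(2)] e(1) by auto
    have "1 / ?y - 1 / ?x - - 1 / ?x\<^sup>2 * (?y - ?x) - 2 / ?x^3 * (?y - ?x)\<^sup>2 / 2 = - ((?y - ?x)^3 / (?x^3 * ?y))"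
     using p(3,4) by (simp add: field_simps power2_eq_square power3_eq_cube)
    hence "abs (1 / ?y - 1 / ?x - - 1 / ?x\<^sup>2 * (?y - ?x) - 2 / ?x^3 * (?y - ?x)\<^sup>2 / 2) = abs (?y - ?x)^3 / (?x^3 * ?y)"
     using p(3,4) by (simp add: abs_mult power_abs)
    also have "eps^4 <= ?x^3 * ?y" using p(1,2) e(1) mult_mono[OF power_mono[of eps ?x 3] p(2)] by (simp add: eval_nat_numeral ac_simps)
    hence "abs (?y - ?x)^3 / (?x^3 * ?y) <= abs (?y - ?x)^3 / eps^4" using e(1) using p by (intro divide_left_mono mult_pos_pos) auto
    finally show "abs (1 / ?y - 1 / ?x - - 1 / ?x\<^sup>2 * (?y - ?x) - 2 / ?x^3 * (?y - ?x)\<^sup>2 / 2) <= 1 / eps^4 * abs (?y - ?x)^3" by simp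
    qed
   qed
   thus ?case using nz elim(1) by (intro conjI allI impI continuous_intros) auto
  qed
 qed measurable
 have k: "(%w. N 0 w * N 0 w) : meas (F 0)" using N0 by measurable
 have "EG.clm (%t w. N 0 w * N 0 w * stopped (%t w. ?iN t w * ?iN t w) \<tau> t w - Sint V (%s w. (- (Ls s w / Z s w))\<^sup>2 * ka s w) t w)"
 proof (rule stopped_compensated[OF ito g k])
  show "AE w in M. ALL s>0. ka s w * (N 0 w * N 0 w * (?iN s w * ?iN s w * (?iZ s w * ?iZ s w) * (-1))) = - ((- (Ls s w / Z s w))\<^sup>2 * ka s w)"
  proof (intro AE_I2 allI impI)
   show "ka s w * (N 0 w * N 0 w * (?iN s w * ?iN s w * (?iZ s w * ?iZ s w) * (-1))) = - ((- (Ls s w / Z s w))\<^sup>2 * ka s w)" if "s > 0" for w s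
    using Ls_before[of s w] that by (auto simp: power2_eq_square)
  qed
  show "AE w in M. ALL t>=0. 1 / N t w - Sint V (%s w. 2 / (N s w)^3 * (E s w)\<^sup>2) t w / 2 =
    N t w * (?iN t w * ?iN t w) + Sint V (%s w. N s w * (?iN s w * ?iN s w * (?iZ s w * ?iZ s w) * (-1))) t w"
   using AE_regular
  proof eventually_elim
   case (elim w)
   have "sint (traj V w) (%s. 2 / (N s w)^3 * (E s w)\<^sup>2) 0 t = sint (traj V w) (%s. (-2) * (N s w * (?iN s w * ?iN s w * (?iZ s w * ?iZ s w) * (-1)))) 0 t" for t
   proof (rule sint_cong)
    fix s :: real assume "0 < s"
    hence "Z s w ~= 0" "E s w ~= 0" using regular_pos[OF elim, of s] E_facts(1)[OF elim, of s] by auto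
    thus "2 / (N s w)^3 * (E s w)\<^sup>2 = (-2) * (N s w * (?iN s w * ?iN s w * (?iZ s w * ?iZ s w) * (-1)))"
     by (simp add: N_def power2_eq_square power3_eq_cube)
   qed
   thus ?case unfolding Sint_def sint_cmult using N_pos[OF elim] by (simp add: less_imp_neq[symmetric])
  qed
 qed
 thus ?thesis by (simp add: Ls_def stopped_def[abs_def] power2_eq_square ac_simps)
qed

end

section \<open>Stochastic integrals against continuous processes\<close>

lemma sint_interval:
 assumes b: "increasing_path b" and h: "lbm h" and uv: "0 <= a" "a <= c" and t: "t >= 0"
 shows "sint b (%s. (if a < s & s <= c then k else 0) * h s) 0 t = k * (sint b h 0 (min t c) - sint b h 0 (min t a))"
proof -
 have "sint b (%s. (if a < s & s <= c then k else 0) * h s) 0 t = sint b (%s. k * h s) (min t a) (min t c)"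
  unfolding sint_def set_lebesgue_integral_def using uv t
  by (intro Bochner_Integration.integral_cong refl) (auto simp: indicator_def)
 also have "... = k * (sint b h 0 (min t c) - sint b h 0 (min t a))"
  unfolding sint_cmult using sint_split_lbm[OF b h order_refl, of "min t a" "min t c"] uv t by simp
 finally show ?thesis .
qed

context usual_filtration begin

lemma near_prob:
 assumes "near t e X Y" "e <= eps"
 shows "prob (exceeds (%s w. X s w - Y s w) t eps) <= e"
proof -
 obtain B where B: "B : sets M" "prob B <= e" "AE w in M. w ~: B --> (ALL s:{0..t}. abs (X s w - Y s w) <= e)"
  using assms(1) unfolding near_def by blast
 have "prob (exceeds (%s w. X s w - Y s w) t eps) <= prob B"
  using B(3) by (intro finite_measure_mono_AE[OF _ B(1)], eventually_elim) (use assms(2) in force)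
 thus ?thesis using B(2) by simp
qed

lemma ucp_of_uniform:
 assumes "!!n. right_cont (Yn n)" "right_cont Y"
  and lim: "AE w in M. loc_uniform (%n s. Yn n s w) (traj Y w)"
 shows "ucp_tendsto M Yn Y"
 unfolding ucp_tendsto_def
proof (intro allI impI, rule tendstoI)
 fix t eps e :: real assume t: "0 <= t" and p: "0 < eps" "0 < e"
 have "AE w in M. ulim t (%n s. Yn n s w) (traj Y w)" using lim by eventually_elim (use t in simp)
 from near_of_tendsto[OF assms(1,2) t _ this, of "min eps (e/2)"] p
 have "eventually (%n. near t (min eps (e/2)) (Yn n) Y) sequentially" by simp
 thus "\<forall>\<^sub>F n in sequentially. dist (prob (exceeds (%s w. Yn n s w - Y s w) t eps)) 0 < e"
 proof eventually_elim
  case (elim n)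
  from near_prob[OF elim, of eps] p show ?case by (simp add: measure_nonneg)
 qed
qed

lemma ucp_borel_cantelli:
 assumes D: "!!k. right_cont (D k)"
  and p: "!!k::nat. prob (exceeds (D k) (real k) ((1/2)^k)) <= (1/2)^k"
 shows "AE w in M. ALL T. eventually (%k. ALL s:{0..T}. abs (D k s w) <= (1/2)^k) sequentially"
proof -
 let ?A = "%k. exceeds (D k) (real k) ((1/2)^k)"
 have "summable (%k. (1/2)^k :: real)" by (rule summable_geometric) simp
 hence "summable (%k. prob (?A k))" by (rule summable_comparison_test_ev[rotated]) (use p in simp)
 hence "AE w in M. eventually (%k. w : space M - ?A k) sequentially"
  by (intro borel_cantelli_AE1 exceed_M D) (simp_all add: emeasure_eq_measure)
 thus ?thesis
 proof eventually_elim
  case (elim w)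
  show ?case
  proof
   fix T
   from eventually_real_ge[of T] elim show "eventually (%k. ALL s:{0..T}. abs (D k s w) <= (1/2)^k) sequentially"
    by eventually_elim (force simp: not_less)
  qed
 qed
qed

lemma filterlim_ge_id: "(!!k. k <= r k) ==> filterlim (r :: nat => nat) at_top sequentially"
 by (rule filterlim_at_top_mono[OF filterlim_ident]) simp

lemma ucp_subsequence:
 assumes u: "ucp_tendsto M Yn Y" and r: "!!n. right_cont (Yn n)" "right_cont Y"
 obtains r :: "nat => nat" where "filterlim r at_top sequentially" "AE w in M. loc_uniform (%k s. Yn (r k) s w) (traj Y w)"
proof -
 let ?P = "%k n. prob (exceeds (%s w. Yn n s w - Y s w) (real k) ((1/2)^k))"
 have "ALL k. EX n. k <= n & ?P k n <= (1/2)^k"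
 proof
  fix k
  have "?P k ----> 0" using u by (simp add: ucp_tendsto_def)
  hence "eventually (%n. ?P k n < (1/2)^k) sequentially" by (rule order_tendstoD) simp
  hence "eventually (%n. k <= n & ?P k n <= (1/2)^k) sequentially"
   using eventually_ge_at_top[of k] by eventually_elim simp
  thus "EX n. k <= n & ?P k n <= (1/2)^k" by (auto simp: eventually_sequentially)
 qed
 from choice[OF this] obtain r where rk: "!!k. k <= r k" "!!k. ?P k (r k) <= (1/2)^k" by blast
 have "AE w in M. loc_uniform (%k s. Yn (r k) s w) (traj Y w)"
  using ucp_borel_cantelli[OF right_cont_diff[OF r] rk(2)]
 proof eventually_elim
  case (elim w)
  show ?case
  proof (intro allI impI uniform_limitI)
   fix T e :: real assume e: "0 < e"
   have "(%k. (1/2)^k :: real) ----> 0" by (rule LIMSEQ_power_zero) simp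
   from order_tendstoD(2)[OF this e] elim[rule_format, of T]
   show "\<forall>\<^sub>F k in sequentially. ALL s:{0..T}. dist (Yn (r k) s w) (Y s w) < e"
    by eventually_elim (force simp: dist_real_def)
  qed
 qed
 with filterlim_ge_id[OF rk(1)] show thesis by (rule that)
qed

lemma ucp_complete:
 assumes Y: "!!n. cont_adapted (Yn n)"
  and cauchy: "!!t eps. t >= 0 ==> eps > 0 ==> EX n0. ALL n>=n0. ALL k>=n0. prob (exceeds (%s w. Yn n s w - Yn k s w) t eps) <= eps"
 obtains r :: "nat => nat" and Y where "filterlim r at_top sequentially" "AE w in M. loc_uniform (%k s. Yn (r k) s w) (traj Y w)"
proof -
 let ?P = "%k n m. prob (exceeds (%s w. Yn n s w - Yn m s w) (real k) ((1/2)^k)) <= (1/2)^k"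
 have "ALL k. EX n0. ALL n>=n0. ALL m>=n0. ?P k n m" by (rule allI, rule cauchy) simp_all
 from choice[OF this] obtain q where q: "!!k n m. n >= q k ==> m >= q k ==> ?P k n m" by blast
 define r where "r k = (SUM j<=k. Suc (q j))" for k
 have r: "k <= r k" "q k <= r k" "q k <= r (Suc k)" for k
 proof -
  have "(SUM j<=k. 1) <= r k" unfolding r_def by (rule sum_mono) simp
  thus "k <= r k" by simp
  show "q k <= r k" unfolding r_def by (cases k) auto
  thus "q k <= r (Suc k)" by (simp add: r_def)
 qed
 define f where "f k s w = Yn (r (Suc k)) s w - Yn (r k) s w" for k s w
 define Y' where "Y' s w = Yn (r 0) s w + suminf (%k. f k s w)" for s w
 have "AE w in M. ALL T. eventually (%k. ALL s:{0..T}. abs (f k s w) <= (1/2)^k) sequentially"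
  unfolding f_def by (intro ucp_borel_cantelli right_cont_diff cont_right_cont Y q r)
 hence "AE w in M. loc_uniform (%k s. Yn (r k) s w) (traj Y' w)"
 proof eventually_elim
  case (elim w)
  have "ulim T (%n s. SUM k<n. f k s w) (%s. suminf (%k. f k s w))" for T
   by (rule Weierstrass_m_test_ev[where M="%k. (1/2)^k"]) (use elim in "auto intro: summable_geometric")
  hence "ulim T (%n s. Yn (r 0) s w + (SUM k<n. f k s w)) (traj Y' w)" for T
   unfolding Y'_def by (intro uniform_limit_add uniform_limit_const)
  moreover have "(SUM k<n. f k s w) = Yn (r n) s w - Yn (r 0) s w" for n s
   unfolding f_def by (rule sum_lessThan_telescope[of "%k. Yn (r k) s w"])
  ultimately show ?case by simp
 qed
 with filterlim_ge_id[OF r(1)] show thesis by (rule that)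
qed

lemma cont_adapted_cadlag: "cont_adapted X ==> cadlag_adapted M F X"
 unfolding cont_adapted_def cadlag_adapted_def by (auto elim!: eventually_mono intro: continuous_on_imp_cadlag_path)

lemma cont_adapted_of_clm:
 assumes "clm (%t w. Y t w - A t w)" "cont_adapted Y" shows "cont_adapted A"
 using cont_adapted_diff[OF assms(2) clm_cont[OF assms(1)]] by simp

text \<open>Lenglart's inequality turns the convergence of brackets into convergence of the processes, uniformly in all
 processes whose brackets are dominated.\<close>

lemma lenglart_vanishing:
 assumes A: "!!n. cont_adapted (A n)" and lim: "AE w in M. ulim t (%n s. A n s w) (%s. 0)" and t: "t >= 0" and e: "eps > 0"
 shows "EX n0. ALL n>=n0. ALL Y B. cont_adapted Y --> (AE w in M. Y 0 w = 0) --> (AE w in M. B 0 w = 0) -->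
   clm (%t w. Y t w * Y t w - B t w) --> (AE w in M. ALL s:{0..t}. abs (B s w) <= abs (A n s w)) --> prob (exceeds Y t eps) <= eps"
proof -
 have c0: "cont_adapted (%_ _. 0)" by (rule cont_adapted_const) simp
 define dl where "dl = eps^3 / 2"
 have d: "dl > 0" "dl / eps\<^sup>2 = eps / 2" using e by (simp_all add: dl_def power2_eq_square power3_eq_cube)
 from near_of_tendsto[OF cont_right_cont[OF A] cont_right_cont[OF c0] t _ lim, of "min (dl / 2) (eps / 4)"] e d
 obtain n0 where n0: "!!n. n >= n0 ==> near t (min (dl / 2) (eps / 4)) (A n) (%_ _. 0)" by (auto simp: eventually_sequentially)
 show ?thesis
 proof (intro exI[of _ n0] allI impI)
  fix n Y B assume n: "n >= n0" and Y: "cont_adapted Y" "AE w in M. Y 0 w = 0" and B: "AE w in M. B 0 w = 0"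
   "clm (%t w. Y t w * Y t w - B t w)" "AE w in M. ALL s:{0..t}. abs (B s w) <= abs (A n s w)"
  have "prob (exceeds Y t eps) <= dl / eps\<^sup>2 + prob (exceeds B t (dl / 2))"
   by (rule lenglart[OF Y cont_adapted_of_clm[OF B(2) cont_adapted_mult[OF Y(1) Y(1)]] B(1) _ e d(1) t])
    (use B(2) in "simp add: power2_eq_square")
  also have "prob (exceeds B t (dl / 2)) <= prob (exceeds (A n) t (dl / 2))"
   by (rule finite_measure_mono_AE[OF _ exceed_M[OF cont_right_cont[OF A] t]])
    (use B(3) in "eventually_elim, force")
  also have "... <= eps / 4" using near_prob[OF n0[OF n], of "dl / 2"] by simp
  finally show "prob (exceeds Y t eps) <= eps" using d(2) e by simp
 qed
qed

lemma elementary_facts: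
 assumes "elementary_integral M F X H Y" and X: "cont_adapted X"
 shows "cont_adapted Y & (ALL w. Y 0 w = 0) & (ALL w. lbm (traj H w)) & (EX c. ALL s. ALL w:space M. abs (H s w) <= c)"
 using assms(1)
proof induction
 case (at_zero k c)
 have "lbm (%s. if s = 0 then k w else 0)" for w using lbm_cong[OF lbm_const[of 0]] by simp
 moreover have "abs (if s = 0 then k w else 0) <= abs c" if "w : space M" for s w using at_zero(2) that by force
 ultimately show ?case using cont_adapted_const[of "%_. 0", OF borel_measurable_const] by (intro conjI; (blast | simp))
next
 case (on_interval a b k c)
 have "(%s. indicator {0<..} s * (if a < s & s <= b then k w else 0)) : borel_measurable borel" for w by measurable
 hence "lbm (%s. if a < s & s <= b then k w else 0)" for w unfolding lbm_def by (auto intro!: exI[of _ "abs (k w)"])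
 moreover have "abs (if a < s & s <= b then k w else 0) <= abs c" if "w : space M" for s w using on_interval(4) that by force
 ultimately show ?case using cont_adapted_increment[OF X on_interval(1-3)] on_interval(1,2) by (intro conjI; (blast | simp))
next
 case (add H Y H' Y')
 then obtain c c' where "ALL s. ALL w:space M. abs (H s w) <= c" "ALL s. ALL w:space M. abs (H' s w) <= c'" by blast
 hence "ALL s. ALL w:space M. abs (H s w + H' s w) <= c + c'" by (meson abs_triangle_ineq add_mono order_trans)
 thus ?case using add by (auto intro: cont_adapted_add lbm_add)
qed

text \<open>Integration commutes with brackets: d\<langle>H \<bullet> X, W\<rangle> = H d\<langle>X, W\<rangle>. This determines the bounded
 integrals, as their graph is the closure of the elementary ones.\<close>

lemma elementary_bracket:
 assumes "elementary_integral M F X H Y" and X: "cont_adapted X" and W: "clm W"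
  and XW: "bracket X W V h" and path: "AE w in M. stieltjes V h w"
 shows "bracket Y W V (%s w. H s w * h s w)"
 using assms(1)
proof induction
 case (at_zero k c)
 have "Sint V (%s w. (if s = 0 then k w else 0) * h s w) t w = sint (traj V w) (%s. 0) 0 t" for t w
  unfolding Sint_def by (rule sint_cong) simp
 thus ?case using clm_const[of "%_. 0"] by (simp add: sint_def)
next
 case (on_interval a b k c)
 show ?case
  by (rule clm_cong[OF clm_piece[OF XW W X on_interval(1-3)]])
   (use path in "eventually_elim, simp add: Sint_def sint_interval[OF _ _ on_interval(1,2)]")
next
 case (add H Y H' Y')
 have l: "lbm (traj H w)" "lbm (traj H' w)" for w
  using elementary_facts[OF add.hyps(1) X] elementary_facts[OF add.hyps(2) X] by auto
 show ?case
  by (rule clm_cong[OF clm_add[OF add.IH]])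
   (use path in "eventually_elim, simp add: Sint_def distrib_right sint_add lbm_mult l")
qed

lemma bounded_facts:
 assumes "bounded_integral M F X H Y" and X: "cont_adapted X"
 shows "cont_adapted Y & (AE w in M. Y 0 w = 0) & (ALL w:space M. lbm (traj H w)) & (EX c. ALL s>=0. ALL w:space M. abs (H s w) <= c)"
 using assms(1)
proof induction
 case (elementary H Y)
 thus ?case using elementary_facts[OF elementary X] by (auto 0 3)
next
 case (bounded_limit Hn Yn c H Y)
 obtain r where r: "AE w in M. loc_uniform (%k s. Yn (r k) s w) (traj Y w)"
  by (rule ucp_subsequence[OF bounded_limit.hyps(5)]) (use bounded_limit.IH bounded_limit.hyps(4) in "auto intro: cont_right_cont cadlag_right_cont")
 have 1: "cont_adapted Y" by (rule cont_adapted_limit[OF _ r]) (use bounded_limit.IH in simp)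
 have "AE w in M. ALL n. Yn n 0 w = 0" using bounded_limit.IH by (simp add: AE_all_countable)
 hence 2: "AE w in M. Y 0 w = 0"
  using r
 proof eventually_elim
  case (elim w)
  have "(%k. Yn (r k) 0 w) ----> Y 0 w" by (rule tendsto_uniform_limitI[where S="{0..0}"]) (use elim(2) in auto)
  thus ?case using elim(1) by (simp add: LIMSEQ_const_iff)
 qed
 have bd: "abs (H s w) <= c" if "s >= 0" "w : space M" for s w
  by (rule LIMSEQ_le_const2[OF tendsto_rabs[OF bounded_limit.hyps(3)[rule_format, OF that]]]) (use bounded_limit.hyps(2) that in blast)
 have 3: "lbm (traj H w)" if wt: "w : space M" for w
  by (rule lbm_limit[of "%n s. Hn n s w"]) (use bounded_limit.IH bounded_limit.hyps(3) bd[OF _ wt] wt in "auto simp: less_imp_le intro!: exI[of _ c]")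
 show ?case using 1 2 3 bd by blast
qed

text \<open>Brackets pass to limits that are uniform on compacts in probability: along a subsequence the products converge
 locally uniformly, and so do the integrals of the densities by dominated convergence.\<close>

lemma bracket_limit:
 assumes Yn: "!!n. bracket (Yn n) W V (hn n)" "!!n. cont_adapted (Yn n)" and W: "clm W"
  and Y: "ucp_tendsto M Yn Y" "right_cont Y"
  and path: "AE w in M. stieltjes V h w & (ALL n. lbm (traj (hn n) w)) & (ALL s>0. (%n. hn n s w) ----> h s w) &
   (ALL T. EX K. ALL n. ALL s:{0<..T}. abs (hn n s w) <= K)"
 shows "cont_adapted Y" "bracket Y W V h"
proof -
 obtain r where r: "filterlim r at_top sequentially" "AE w in M. loc_uniform (%k s. Yn (r k) s w) (traj Y w)"
  using ucp_subsequence[OF Y(1) cont_right_cont[OF Yn(2)] Y(2)] by blast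
 show cY: "cont_adapted Y" by (rule cont_adapted_limit[OF Yn(2) r(2)])
 show "bracket Y W V h"
 proof (rule clm_limit[OF Yn(1)[of "r _"]])
  show "AE w in M. loc_uniform (%k t. Yn (r k) t w * W t w - Sint V (hn (r k)) t w) (%t. Y t w * W t w - Sint V h t w)"
   using r(2) path AE_cont[OF clm_cont[OF W]] AE_cont[OF cY]
  proof eventually_elim
   case (elim w)
   show ?case
   proof (intro allI impI uniform_limit_minus)
    fix T :: real assume T: "0 <= T"
    show "ulim T (%k t. Yn (r k) t w * W t w) (%t. Y t w * W t w)"
     using elim(1) T by (intro uniform_lim_mult uniform_limit_const bounded_continuous elim(3,4)) auto
    obtain K where "ALL n. ALL s:{0<..T}. abs (hn n s w) <= K" using elim(2) by blast
    thus "ulim T (%k t. Sint V (hn (r k)) t w) (%t. Sint V h t w)"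
     unfolding Sint_def using elim(2) by (intro uniform_limit_sint[where K=K] filterlim_compose[OF _ r(1)]) auto
   qed
  qed
 qed
qed

lemma bounded_bracket:
 assumes "bounded_integral M F X H Y" and X: "cont_adapted X" and W: "clm W"
  and XW: "bracket X W V h" and path: "AE w in M. stieltjes V h w"
 shows "bracket Y W V (%s w. H s w * h s w)"
 using assms(1)
proof induction
 case (elementary H Y)
 thus ?case by (rule elementary_bracket[OF _ X W XW path])
next
 case (bounded_limit Hn Yn c H Y)
 have bi: "bounded_integral M F X H Y" by (rule bounded_integral.bounded_limit[OF bounded_limit.hyps])
 note fY = bounded_facts[OF bi X] and fn = bounded_facts[OF bounded_limit.hyps(1) X]
 show ?case
 proof (rule bracket_limit(2)[OF bounded_limit.IH _ W bounded_limit.hyps(5)])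
  show "AE w in M. stieltjes V (%s w. H s w * h s w) w & (ALL n. lbm (%s. Hn n s w * h s w)) &
   (ALL s>0. (%n. Hn n s w * h s w) ----> H s w * h s w) & (ALL T. EX K. ALL n. ALL s:{0<..T}. abs (Hn n s w * h s w) <= K)"
   using path AE_space
  proof eventually_elim
   case (elim w)
   have "EX K. ALL n. ALL s:{0<..T}. abs (Hn n s w * h s w) <= K" for T
   proof -
    obtain K where K: "K > 0" "!!s. s : {0<..T} ==> abs (h s w) <= K" using lbm_bound[OF conjunct2[OF elim(1)]] by metis
    have "abs (Hn n s w * h s w) <= abs c * K" if "s : {0<..T}" for n s
     unfolding abs_mult using K(2)[OF that] that elim(2) bounded_limit.hyps(2) by (intro mult_mono) (auto intro: order_trans[OF _ abs_ge_self])
    thus ?thesis by blast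
   qed
   thus ?case using elim fY fn bounded_limit.hyps(3) by (auto intro: lbm_mult tendsto_mult_right)
  qed
 qed (use fn fY in "auto intro: cont_right_cont")
qed

lemma bounded_cong:
 assumes H: "bounded_integral M F X H Y" and X: "cont_adapted X" and e: "!!t w. t >= 0 ==> w : space M ==> H' t w = H t w"
 shows "bounded_integral M F X H' Y"
proof -
 obtain c where c: "ALL s>=0. ALL w:space M. abs (H s w) <= c" and Y: "cont_adapted Y" using bounded_facts[OF H X] by blast
 show ?thesis
  by (rule bounded_integral.bounded_limit[where Hn="%_. H" and Yn="%_. Y"])
   (use H c e cont_adapted_cadlag[OF Y] in "auto simp: ucp_tendsto_def")
qed

lemma elementary_cmult:
 assumes "elementary_integral M F X H Y"
 shows "elementary_integral M F X (%t w. a * H t w) (%t w. a * Y t w)"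
 using assms
proof induction
 case (at_zero k c)
 have "elementary_integral M F X (%t w. if t = 0 then a * k w else 0) (%t w. 0)"
  using at_zero by (intro elementary_integral.at_zero[where c="abs a * c"]) (auto simp: abs_mult mult_left_mono)
 thus ?case by (simp add: if_distrib[of "(*) a"] cong: if_cong)
next
 case (on_interval b d k c)
 have "elementary_integral M F X (%t w. if b < t & t <= d then a * k w else 0) (%t w. a * k w * (X (min t d) w - X (min t b) w))"
  using on_interval by (intro elementary_integral.on_interval[where c="abs a * c"]) (auto simp: abs_mult mult_left_mono)
 thus ?case by (simp add: if_distrib[of "(*) a"] mult.assoc cong: if_cong)
next
 case (add H Y H' Y')
 from elementary_integral.add[OF add.IH] show ?case by (simp add: distrib_left)
qed

lemma bounded_linear:
 assumes H: "bounded_integral M F X H Y" and H': "bounded_integral M F X H' Y'" and X: "cont_adapted X"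
 shows "bounded_integral M F X (%t w. a * H t w + H' t w) (%t w. a * Y t w + Y' t w)"
proof -
 have step: "bounded_integral M F X (%t w. b * H t w + K t w) (%t w. b * Y t w + J t w)"
  if n: "!!n. bounded_integral M F X (%t w. b * Hn n t w + K t w) (%t w. b * Yn n t w + J t w)"
   and h: "!!n. bounded_integral M F X (Hn n) (Yn n)" "ALL n::nat. ALL t>=0. ALL w:space M. abs (Hn n t w) <= c"
    "ALL t>=0. ALL w:space M. (%n. Hn n t w) ----> H t w" "cadlag_adapted M F Y" "ucp_tendsto M Yn Y"
   and K: "bounded_integral M F X K J" for b Hn Yn c H Y K J
 proof -
  obtain d where d: "ALL s>=0. ALL w:space M. abs (K s w) <= d" using bounded_facts[OF K X] by blast
  show ?thesis
  proof (rule bounded_integral.bounded_limit[OF n])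
   show "ALL n t. 0 <= t --> (ALL w:space M. abs (b * Hn n t w + K t w) <= abs b * c + d)"
    using h(2) d by (auto simp: abs_mult intro!: order_trans[OF abs_triangle_ineq] add_mono mult_left_mono)
   show "ALL t>=0. ALL w:space M. (%n. b * Hn n t w + K t w) ----> b * H t w + K t w" using h(3) by (auto intro!: tendsto_intros)
   show "cadlag_adapted M F (%t w. b * Y t w + J t w)"
    using bounded_facts[OF bounded_integral.bounded_limit[OF h] X] bounded_facts[OF K X]
    by (intro cont_adapted_cadlag cont_adapted_add cont_adapted_mult cont_adapted_const) auto
   have "prob (exceeds (%s w. b * Yn n s w + J s w - (b * Y s w + J s w)) t eps) = prob (exceeds (%s w. Yn n s w - Y s w) t (eps / abs b))"
    if "b ~= 0" for n t eps
   proof -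
    have "eps < abs (b * y + j - (b * z + j)) <-> eps / abs b < abs (y - z)" for y z j
     using that by (simp add: right_diff_distrib[symmetric] abs_mult divide_less_eq mult.commute)
    thus ?thesis by simp
   qed
   thus "ucp_tendsto M (%n t w. b * Yn n t w + J t w) (%t w. b * Y t w + J t w)"
    using h(5) unfolding ucp_tendsto_def by (cases "b = 0") auto
  qed
 qed
 have el: "bounded_integral M F X (%t w. a * K t w + H' t w) (%t w. a * J t w + Y' t w)" if K: "elementary_integral M F X K J" for K J
  using H'
 proof induction
  case (elementary H Y)
  thus ?case by (intro bounded_integral.elementary elementary_integral.add elementary_cmult K)
 next
  case (bounded_limit Hn Yn c H Y)
  show ?case
   using step[of 1, OF _ bounded_limit.hyps bounded_integral.elementary[OF elementary_cmult[OF K, of a]]] bounded_limit.IH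
   by (simp add: add.commute)
 qed
 show ?thesis
  using H
 proof induction
  case (elementary H Y)
  thus ?case by (rule el)
 next
  case (bounded_limit Hn Yn c H Y)
  show ?case by (rule step[OF bounded_limit.IH bounded_limit.hyps H'])
 qed
qed

text \<open>Polarization of brackets.\<close>

lemma clm_diff_squared:
 assumes Y: "bracket Y Y V (%s w. H s w * (H s w * a s w))" "bracket Y' Y' V (%s w. H' s w * (H' s w * a s w))"
   "bracket Y Y' V (%s w. H s w * (H' s w * a s w))"
  and path: "AE w in M. stieltjes V a w & lbm (traj H w) & lbm (traj H' w)"
 shows "bracket (%t w. Y t w - Y' t w) (%t w. Y t w - Y' t w) V (%s w. (H s w - H' s w)\<^sup>2 * a s w)"
proof (rule clm_cong[OF clm_add[OF clm_diff[OF Y(1) clm_cmult[OF Y(3), of 2]] Y(2)]])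
 show "AE w in M. ALL t>=0. Y t w * Y t w - Sint V (%s w. H s w * (H s w * a s w)) t w -
   2 * (Y t w * Y' t w - Sint V (%s w. H s w * (H' s w * a s w)) t w) + (Y' t w * Y' t w - Sint V (%s w. H' s w * (H' s w * a s w)) t w) =
   (Y t w - Y' t w) * (Y t w - Y' t w) - Sint V (%s w. (H s w - H' s w)\<^sup>2 * a s w) t w"
  using path
 proof eventually_elim
  case (elim w)
  let ?f = "%s. H s w * (H s w * a s w)" and ?g = "%s. H s w * (H' s w * a s w)" and ?k = "%s. H' s w * (H' s w * a s w)"
  have l: "lbm ?f" "lbm (%s. 2 * ?g s)" "lbm ?k" using elim by (auto intro!: lbm_mult)
  have "(%s. (H s w - H' s w)\<^sup>2 * a s w) = (%s. (?f s - 2 * ?g s) + ?k s)"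
   by (simp add: fun_eq_iff power2_eq_square algebra_simps)
  hence "Sint V (%s w. (H s w - H' s w)\<^sup>2 * a s w) t w = sint (traj V w) ?f 0 t - 2 * sint (traj V w) ?g 0 t + sint (traj V w) ?k 0 t" for t
   unfolding Sint_def using elim by (simp only: sint_add[OF _ order_refl lbm_diff[OF l(1,2)] l(3)] sint_diff[OF _ order_refl l(1,2)] sint_cmult)
  thus ?case by (simp add: Sint_def algebra_simps)
 qed
qed

lemma predictable_gen_Pow:
 "{{0} \<times> A | A. A : sets (F 0)} Un {{s<..t} \<times> A | s t A. 0 <= s & s <= t & A : sets (F s)} <= Pow ({0..} \<times> space M)"
proof -
 have "A <= space M" if "A : sets (F s)" "0 <= s" for A s using sets.sets_into_space[OF that(1)] space_F[OF that(2)] by simp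
 thus ?thesis by fastforce
qed

lemma space_predictable: "space (predictable_sigma M F) = {0..} \<times> space M"
 unfolding predictable_sigma_def by (simp add: space_measure_of_conv)

lemma sets_predictable: "sets (predictable_sigma M F) = sigma_sets ({0..} \<times> space M)
  ({{0} \<times> A | A. A : sets (F 0)} Un {{s<..t} \<times> A | s t A. 0 <= s & s <= t & A : sets (F s)})"
 unfolding predictable_sigma_def by (rule sets_measure_of[OF predictable_gen_Pow])

end

text \<open>Existence of the bounded integrals, by the isometry in the form of Lenglart's inequality.\<close>

locale bracketed = usual_filtration M F for M :: "'a measure" and F +
 fixes X V a :: "real => 'a => real"
 assumes clm_X: "clm X" and clm_X2: "bracket X X V a"
  and Va: "AE w in M. stieltjes V a w & (ALL s>0. a s w >= 0)"
begin

abbreviation (input) integ :: "(real => 'a => real) => bool" where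
 "integ H == EX Y. bounded_integral M F X H Y"

lemma cX: "cont_adapted X" by (rule clm_cont[OF clm_X])

lemma a_path: "AE w in M. stieltjes V a w"
 using Va by eventually_elim simp

lemma integ_linear:
 assumes "integ H" "integ H'" "!!t w. t >= 0 ==> w : space M ==> K t w = b * H t w + H' t w"
 shows "integ K"
proof -
 obtain Y Y' where "bounded_integral M F X H Y" "bounded_integral M F X H' Y'" using assms(1,2) by blast
 hence "bounded_integral M F X K (%t w. b * Y t w + Y' t w)"
  using assms(3) by (intro bounded_cong[OF bounded_linear[OF _ _ cX, where a=b] cX])
 thus ?thesis by blast
qed

lemma bounded_clm:
 assumes H: "bounded_integral M F X H Y" shows "clm Y"
 using bounded_bracket[OF H cX clm_const[of "%_. 1"], of V "%_ _. 0"] clm_X a_path by simp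

lemma bounded_cross:
 assumes H: "bounded_integral M F X H Y" and H': "bounded_integral M F X H' Y'"
 shows "bracket Y Y' V (%s w. H s w * (H' s w * a s w))"
proof (rule bounded_bracket[OF H cX bounded_clm[OF H']])
 from bounded_bracket[OF H' cX clm_X clm_X2 a_path]
 show "bracket X Y' V (%s w. H' s w * a s w)" by (simp add: mult.commute)
 show "AE w in M. stieltjes V (%s w. H' s w * a s w) w"
  using a_path AE_space by eventually_elim (use bounded_facts[OF H' cX] in "auto intro: lbm_mult")
qed

text \<open>The integrals of Hn form a Cauchy sequence, because the brackets of their differences tend to 0.\<close>

lemma bounded_limit_exists:
 assumes n: "!!n. integ (Hn n)"
  and bd: "!!n t w. t >= 0 ==> w : space M ==> abs (Hn n t w) <= c"
  and lim: "!!t w. t >= 0 ==> w : space M ==> (%n. Hn n t w) ----> H t w"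
 shows "integ H"
proof -
 obtain Yn where Yn: "!!n. bounded_integral M F X (Hn n) (Yn n)" using n by metis
 note fn = bounded_facts[OF Yn cX]
 have cY: "cont_adapted (Yn n)" for n using fn by blast
 let ?D = "%n k t w. Yn n t w - Yn k t w"
 define A where "A n k = Sint V (%s w. (Hn n s w - Hn k s w)\<^sup>2 * a s w)" for n k
 have cl: "clm (%t w. ?D n k t w * ?D n k t w - A n k t w)" for n k
  unfolding A_def by (rule clm_diff_squared[OF bounded_cross[OF Yn Yn] bounded_cross[OF Yn Yn] bounded_cross[OF Yn Yn]])
   (use a_path AE_space in "eventually_elim, use fn in blast")
 have cD: "cont_adapted (?D n k)" for n k by (intro cont_adapted_diff cY)
 have cauchy: "EX n0. ALL n>=n0. ALL k>=n0. prob (exceeds (?D n k) t eps) <= eps" if t: "t >= 0" and e: "eps > 0" for t eps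
 proof (rule ccontr)
  assume "~ ?thesis"
  hence "ALL n0. EX p. n0 <= fst p & n0 <= snd p & eps < prob (exceeds (?D (fst p) (snd p)) t eps)" by (auto simp: not_le)
  from choice[OF this] obtain p where p: "!!j. j <= fst (p j)" "!!j. j <= snd (p j)" "!!j. eps < prob (exceeds (?D (fst (p j)) (snd (p j))) t eps)" by blast
  define u v where "u j = fst (p j)" and "v j = snd (p j)" for j
  have uv: "filterlim u at_top sequentially" "filterlim v at_top sequentially"
   unfolding u_def v_def by (rule filterlim_ge_id; rule p)+
  have "AE w in M. ulim t (%j s. A (u j) (v j) s w) (%s. 0)"
   using a_path AE_space
  proof eventually_elim
   case (elim w)
   obtain K where K: "!!s. s : {0<..t} ==> abs (a s w) <= K" using lbm_bound[of "traj a w"] elim by metis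
   have "ulim t (%j s. sint (traj V w) (%s. (Hn (u j) s w - Hn (v j) s w)\<^sup>2 * a s w) 0 s) (%s. sint (traj V w) (%_. 0) 0 s)"
   proof (rule uniform_limit_sint[where K="(c + c)\<^sup>2 * K"])
    fix s assume s: "s : {0<..t}"
    have l: "(%n. Hn n s w) ----> H s w" using lim[of s w] s elim(2) by simp
    have "(%j. (Hn (u j) s w - Hn (v j) s w)\<^sup>2 * a s w) ----> (H s w - H s w)\<^sup>2 * a s w"
     by (intro tendsto_intros filterlim_compose[OF l uv(1)] filterlim_compose[OF l uv(2)])
    thus "(%j. (Hn (u j) s w - Hn (v j) s w)\<^sup>2 * a s w) ----> 0" by simp
    fix j
    have "abs (Hn (u j) s w) <= c" "abs (Hn (v j) s w) <= c" using bd[of s w] s elim(2) by auto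
    hence "abs (Hn (u j) s w - Hn (v j) s w) <= c + c" by linarith
    from power_mono[OF this, of 2] show "abs ((Hn (u j) s w - Hn (v j) s w)\<^sup>2 * a s w) <= (c + c)\<^sup>2 * K"
     unfolding abs_mult using K[OF s] by (intro mult_mono) auto
   next
    show "lbm (%s. (Hn (u j) s w - Hn (v j) s w)\<^sup>2 * a s w)" for j
     using elim fn by (intro lbm_mult[OF lbm_power2[OF lbm_diff]]) blast+
   qed (use elim in auto)
   thus ?case by (simp add: A_def Sint_def sint_def)
  qed
  from lenglart_vanishing[OF cont_adapted_of_clm[OF cl cont_adapted_mult[OF cD cD]] this t e]
  obtain j where j: "!!Y B. cont_adapted Y ==> AE w in M. Y 0 w = 0 ==> AE w in M. B 0 w = 0 ==> clm (%t w. Y t w * Y t w - B t w) ==>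
    AE w in M. ALL s:{0..t}. abs (B s w) <= abs (A (u j) (v j) s w) ==> prob (exceeds Y t eps) <= eps" by blast
  have "AE w in M. Yn n 0 w = 0" for n using fn by blast
  from this[of "u j"] this[of "v j"] have D0: "AE w in M. ?D (u j) (v j) 0 w = 0" by eventually_elim simp
  have "prob (exceeds (?D (u j) (v j)) t eps) <= eps" by (rule j[OF cD D0 _ cl]) (simp_all add: A_def Sint_def)
  thus False using p(3)[of j] unfolding u_def v_def by simp
 qed
 obtain r Y where r: "filterlim r at_top sequentially" "AE w in M. loc_uniform (%k s. Yn (r k) s w) (traj Y w)"
  using ucp_complete[of Yn, OF cY cauchy] by blast
 have Y: "cont_adapted Y" by (rule cont_adapted_limit[OF cY r(2)])
 have "bounded_integral M F X H Y"
  by (rule bounded_integral.bounded_limit[where Hn="%k. Hn (r k)" and Yn="%k. Yn (r k)" and c=c])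
   (use Yn bd filterlim_compose[OF lim r(1)] cont_adapted_cadlag[OF Y] ucp_of_uniform[OF _ _ r(2)] cont_right_cont cY Y in auto)
 thus ?thesis by blast
qed

lemma Int_stable_predictable:
 "Int_stable ({{0} \<times> A | A. A : sets (F 0)} Un {{s<..t} \<times> A | s t A. 0 <= s & s <= t & A : sets (F s)})" (is "Int_stable (?Z Un ?I)")
proof (rule Int_stableI)
 have emp: "{} : ?Z Un ?I" by (intro UnI1 CollectI exI[of _ "{}"]) auto
 have ZI: "z Int i = {}" if "z : ?Z" "i : ?I" for z i using that by auto
 fix a b assume "a : ?Z Un ?I" "b : ?Z Un ?I"
 then consider "a : ?Z & b : ?Z" | "a : ?Z & b : ?I | b : ?Z & a : ?I" | "a : ?I & b : ?I" unfolding Un_iff by argo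
 thus "a Int b : ?Z Un ?I"
 proof cases
  case 1
  then obtain A B where "a = {0} \<times> A" "b = {0} \<times> B" "A : sets (F 0)" "B : sets (F 0)" by blast
  thus ?thesis by (intro UnI1 CollectI exI[of _ "A Int B"]) auto
 next
  case 3
  then obtain s t A s' t' B where e: "a = {s<..t} \<times> A" "0 <= s" "A : sets (F s)" "b = {s'<..t'} \<times> B" "0 <= s'" "B : sets (F s')" by blast
  have "A Int B : sets (F (max s s'))" using sets_F_mono[OF e(2) _ e(3)] sets_F_mono[OF e(5) _ e(6)] by auto
  moreover have "a Int b = {max s s'<..max (max s s') (min t t')} \<times> (A Int B)" using e by auto
  ultimately have "a Int b : ?I" using e(2) by (intro CollectI exI[of _ "max s s'"] exI[of _ "max (max s s') (min t t')"] exI[of _ "A Int B"]) auto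
  thus ?thesis by (rule UnI2)
 next
  case 2
  hence "a Int b = {}" by (elim disjE conjE) (simp only: ZI, simp only: ZI inf_commute[of a b])
  thus ?thesis using emp by simp
 qed
qed

text \<open>A Dynkin system argument: the sets with an integral include the predictable rectangles and are closed under
 complements and countable disjoint unions.\<close>

lemma set_integral_exists:
 assumes A: "A : sets (predictable_sigma M F)"
 shows "integ (%t w. indicator A (t, w))"
proof -
 let ?I = "%A. integ (%t w. indicator A (t, w))"
 have iv: "?I ({s<..t'} \<times> A)" if "0 <= s" "s <= t'" "A : sets (F s)" for s t' A
 proof -
  have "bounded_integral M F X (%t w. if s < t & t <= t' then indicator A w else 0) (%t w. indicator A w * (X (min t t') w - X (min t s) w))"
   using that by (intro bounded_integral.elementary elementary_integral.on_interval[where c=1]) (auto simp: indicator_def)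
  thus ?thesis by (intro exI, rule bounded_cong[OF _ cX]) (auto simp: indicator_def)
 qed
 have zr: "?I ({0} \<times> A)" if "A : sets (F 0)" for A
 proof -
  have "bounded_integral M F X (%t w. if t = 0 then indicator A w else 0) (%t w. 0)"
   using that by (intro bounded_integral.elementary elementary_integral.at_zero[where c=1]) (auto simp: indicator_def)
  thus ?thesis by (intro exI, rule bounded_cong[OF _ cX]) (auto simp: indicator_def)
 qed
 have sp: "space M : sets (F 0)" using sets.top[of "F 0"] space_F[of 0] by simp
 have one: "integ (%t w. 1)"
 proof (rule bounded_limit_exists[where c=1])
  show "?I ({0..real n} \<times> space M)" for n
   by (rule integ_linear[OF zr[OF sp] iv[OF order_refl _ sp, of "real n"], of _ 1]) (auto simp: indicator_def)
  show "(%n. indicator ({0..real n} \<times> space M) (t, w) :: real) ----> 1" if "t >= 0" "w : space M" for t w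
   using that by (intro tendsto_eventually eventually_mono[OF eventually_real_ge[of t]]) auto
 qed (auto simp: indicator_def)
 have empty: "?I {}" using zr[of "{}"] by simp
 show ?thesis
  using A unfolding sets_predictable
 proof (rule sigma_sets_induct_disjoint[OF Int_stable_predictable predictable_gen_Pow])
  show "?I A" if "A : {{0} \<times> A | A. A : sets (F 0)} Un {{s<..t} \<times> A | s t A. 0 <= s & s <= t & A : sets (F s)}" for A
   using that iv zr by blast
  show "?I ({0..} \<times> space M - A)" if "?I A" for A
   by (rule integ_linear[OF that one, of _ "-1"]) (auto simp: indicator_def)
  fix A :: "nat => (real \<times> 'a) set" assume d: "disjoint_family A" and A: "!!i. ?I (A i)"
  have U: "?I (\<Union>i<n. A i)" for n
  proof (induction n)
   case (Suc n)
   have "A i Int A n = {}" if "i < n" for i using d that by (simp add: disjoint_family_on_def)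
   thus ?case by (intro integ_linear[OF Suc.IH A[of n], of _ 1]) (auto simp: indicator_def lessThan_Suc)
  qed (use empty in simp)
  show "?I (UN i. A i)"
  proof (rule bounded_limit_exists[where c=1, OF U])
   show "(%n. indicator (\<Union>i<n. A i) (t, w) :: real) ----> indicator (UN i. A i) (t, w)" for t w by (rule LIMSEQ_indicator_UN)
  qed (auto simp: indicator_def)
 qed (rule empty)
qed

lemma bounded_integral_exists:
 assumes H: "predictable M F H" and bd: "!!t w. t >= 0 ==> w : space M ==> abs (H t w) <= c"
 shows "integ H"
proof (rule bounded_limit_exists[where Hn="%n t w. lg n (H t w)" and c="c + 1"])
 fix n
 define A where "A k = {x : space (predictable_sigma M F). \<lceil>case_prod H x * 2^n\<rceil> = k}" for k
 have [measurable]: "case_prod H : meas (predictable_sigma M F)" using H by (simp add: predictable_def)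
 have A: "A k : sets (predictable_sigma M F)" for k unfolding A_def by measurable
 have sum: "integ (%t w. SUM k:S. f k * indicator (A k) (t, w))" if "finite S" for S and f :: "int => real"
  using that
 proof induction
  case empty
  thus ?case using set_integral_exists[of "{}"] by simp
 next
  case (insert k S)
  show ?case by (rule integ_linear[OF set_integral_exists[OF A[of k]] insert.IH, of _ "f k"]) (simp only: sum.insert[OF insert.hyps])
 qed
 define N where "N = \<lceil>c * 2^n\<rceil>"
 obtain Y where Y: "bounded_integral M F X (%t w. SUM k:{-N..N}. (of_int k - 1) / 2^n * indicator (A k) (t, w)) Y"
  using sum[of "{-N..N}" "%k. (of_int k - 1) / 2^n"] by auto
 show "integ (%t w. lg n (H t w))"
 proof (rule exI, rule bounded_cong[OF Y cX])
  fix t :: real and w assume tw: "0 <= t" "w : space M"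
  have "abs (H t w * 2^n) <= c * 2^n" using bd[OF tw] by (simp add: abs_mult)
  hence "- (c * 2^n) <= H t w * 2^n" "H t w * 2^n <= c * 2^n" by linarith+
  hence "\<lceil>H t w * 2^n\<rceil> : {-N..N}" using ceiling_mono[of "H t w * 2^n" "c * 2^n"] unfolding N_def by (auto, linarith)
  moreover have "(of_int k - 1) / 2^n * indicator (A k) (t, w) = (if \<lceil>H t w * 2^n\<rceil> = k then (of_int k - 1) / 2^n else (0::real))" for k
   using tw by (auto simp: A_def space_predictable indicator_def)
  ultimately show "lg n (H t w) = (SUM k:{-N..N}. (of_int k - 1) / 2^n * indicator (A k) (t, w))"
   by (simp add: lg_def sum.delta')
 qed
next
 fix n and t :: real and w assume tw: "0 <= t" "w : space M"
 have "1/2^n <= (1::real)" by (simp add: divide_le_eq)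
 thus "abs (lg n (H t w)) <= c + 1" using bd[OF tw] cell_bounds(1-3)[where n=n and s="H t w"] by linarith
qed (rule lg_tendsto)

text \<open>A process with the brackets that \<integral> H dX must have is this integral.\<close>

lemma stochastic_integral_of_brackets:
 assumes H: "predictable M F H" and lH: "AE w in M. lbm (traj H w)" and Y: "clm Y" and Y0: "AE w in M. Y 0 w = 0"
  and XY: "bracket X Y V (%s w. H s w * a s w)" and YY: "bracket Y Y V (%s w. H s w * (H s w * a s w))"
 shows "stochastic_integral M F X H Y"
proof -
 define Hn where "Hn n t w = (if \<bar>H t w\<bar> <= real n then H t w else 0)" for n t w
 have "integ (Hn n)" for n
 proof (rule bounded_integral_exists)
  have [measurable]: "(%x. H (fst x) (snd x)) : meas (predictable_sigma M F)"
   using H by (simp add: predictable_def case_prod_unfold)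
  show "predictable M F (Hn n)" unfolding predictable_def Hn_def case_prod_unfold by measurable
 qed (auto simp: Hn_def)
 then obtain Yn where Yn: "!!n. bounded_integral M F X (Hn n) (Yn n)" by metis
 note fn = bounded_facts[OF Yn cX]
 define D where "D n t w = Yn n t w - Y t w" for n t w
 define h where "h n s w = (Hn n s w - H s w)\<^sup>2 * a s w" for n s w
 have clD: "clm (D n)" for n unfolding D_def using clm_diff[OF bounded_clm[OF Yn] Y] .
 note cD = clm_cont[OF clD]
 have lHn: "AE w in M. stieltjes V a w & (ALL s>0. a s w >= 0) & lbm (traj (Hn n) w) & lbm (traj H w)" for n
  using Va lH AE_space by eventually_elim (use fn in blast)
 have hp: "AE w in M. stieltjes V (h n) w & (ALL s>0. h n s w >= 0)" for n
  using lHn[of n] unfolding h_def by eventually_elim (auto intro!: lbm_mult[OF lbm_power2[OF lbm_diff]])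
 have hp': "AE w in M. stieltjes V (h n) w" for n using hp[of n] by eventually_elim blast
 have DD: "bracket (D n) (D n) V (h n)" for n
  unfolding D_def h_def
 proof (rule clm_diff_squared[OF bounded_cross[OF Yn Yn] YY bounded_bracket[OF Yn cX Y XY]])
  show "AE w in M. stieltjes V (%s w. H s w * a s w) w" using lHn[of 0] by eventually_elim (auto intro: lbm_mult)
  show "AE w in M. stieltjes V a w & lbm (traj (Hn n) w) & lbm (traj H w)" using lHn[of n] by eventually_elim blast
 qed
 have lim: "AE w in M. ulim t (%n s. Sint V (h n) s w) (%s. 0)" for t
  using lH
 proof eventually_elim
  case (elim w)
  obtain K where K: "!!s. s : {0<..t} ==> abs (H s w) <= K" using lbm_bound[OF elim, of t] by metis
  have "Sint V (h n) s w = 0" if "K <= real n" "s : {0..t}" for n s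
  proof -
   have "Sint V (h n) s w = sint (traj V w) (%s. 0) 0 s"
    unfolding Sint_def using K that by (intro sint_cong) (force simp: h_def Hn_def)
   thus ?thesis by (simp add: sint_def)
  qed
  thus ?case by (intro uniform_limit_eventually_eq eventually_mono[OF eventually_real_ge[of K]]) auto
 qed
 have "emery_tendsto M F Yn Y"
  unfolding emery_tendsto_def
 proof (intro allI impI)
  fix t eps :: real assume t: "0 <= t" and e: "0 < eps"
  from lenglart_vanishing[OF cont_adapted_of_clm[OF DD cont_adapted_mult[OF cD cD]] lim t e] obtain n0
   where n0: "!!n Y B. n >= n0 ==> cont_adapted Y ==> AE w in M. Y 0 w = 0 ==> AE w in M. B 0 w = 0 ==> clm (%t w. Y t w * Y t w - B t w) ==>
    AE w in M. ALL s:{0..t}. abs (B s w) <= abs (Sint V (h n) s w) ==> prob (exceeds Y t eps) <= eps" by blast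
  show "EX N. ALL n>=N. ALL K J. elementary_integral M F (%s w. Yn n s w - Y s w) K J & (ALL s>=0. ALL w:space M. abs (K s w) <= 1) -->
    prob (exceeds J t eps) <= eps"
  proof (intro exI[of _ n0] allI impI, elim conjE)
   fix n K J assume n: "n >= n0" and J: "elementary_integral M F (%s w. Yn n s w - Y s w) K J" and K: "ALL s>=0. ALL w:space M. abs (K s w) <= 1"
   have J: "elementary_integral M F (D n) K J" using J by (simp add: D_def[abs_def])
   note fJ = elementary_facts[OF J cD]
   have clJ: "clm J" using elementary_bracket[OF J cD clm_const[of "%_. 1"], of V "%_ _. 0"] clD a_path by simp
   have DJ: "bracket (D n) J V (%s w. K s w * h n s w)"
    using elementary_bracket[OF J cD clD DD hp'] by (simp add: mult.commute)
   have "bracket J J V (%s w. K s w * (K s w * h n s w))"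
    by (rule elementary_bracket[OF J cD clJ DJ]) (use hp'[of n] in \<open>eventually_elim, use fJ in "auto intro: lbm_mult"\<close>)
   moreover have "AE w in M. ALL s:{0..t}. abs (Sint V (%s w. K s w * (K s w * h n s w)) s w) <= abs (Sint V (h n) s w)"
    using hp[of n] AE_space
   proof eventually_elim
    case (elim w)
    have k: "0 <= K s w * (K s w * h n s w)" "K s w * (K s w * h n s w) <= h n s w" if "s : {0<..u}" for s u
    proof -
     have "abs (K s w) <= 1" and h: "h n s w >= 0" using K elim that by auto
     hence "(K s w)\<^sup>2 * h n s w <= 1 * h n s w" by (intro mult_right_mono) (auto simp: abs_square_le_1)
     moreover have "0 <= (K s w)\<^sup>2 * h n s w" using h by simp
     ultimately show "0 <= K s w * (K s w * h n s w)" "K s w * (K s w * h n s w) <= h n s w" by (simp_all add: power2_eq_square mult.assoc)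
    qed
    have lK: "lbm (traj K w)" using fJ by blast
    show ?case
    proof
     fix s assume "s : {0..t}"
     have "0 <= Sint V (%s w. K s w * (K s w * h n s w)) s w" "Sint V (%s w. K s w * (K s w * h n s w)) s w <= Sint V (h n) s w"
      unfolding Sint_def using elim lK k by (intro sint_nonneg sint_mono lbm_mult; auto)+
     thus "abs (Sint V (%s w. K s w * (K s w * h n s w)) s w) <= abs (Sint V (h n) s w)" by simp
    qed
   qed
   ultimately show "prob (exceeds J t eps) <= eps"
    by (intro n0[OF n, of J "Sint V (%s w. K s w * (K s w * h n s w))"]) (use fJ in "auto simp: Sint_def")
  qed
 qed
 thus ?thesis
  unfolding stochastic_integral_def using H Y0 cont_adapted_cadlag[OF clm_cont[OF Y]] Yn unfolding Hn_def by blast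
qed

end

context usual_filtration begin

lemma AE_eq_prob:
 assumes "A : sets M" "B <= space M" "AE w in M. w : A <-> w : B" shows "prob B = prob A"
proof -
 have "(%w. indicator B w :: real) : meas M"
  by (rule AE_eq_meas_M[of "indicator A"]) (use assms in "auto simp: indicator_def")
 hence "B Int space M : sets M" by (simp only: borel_measurable_indicator_iff)
 hence "B : sets M" using assms(2) by (simp add: Int_absorb2)
 with assms show ?thesis by (intro finite_measure_eq_AE) auto
qed

text \<open>Conversely every stochastic integral inherits the brackets of the truncated ones.\<close>

lemma stochastic_integral_limit:
 assumes I: "stochastic_integral M F X H Y" and X: "cont_adapted X"
 obtains Yn where "!!n. bounded_integral M F X (%t w. if \<bar>H t w\<bar> <= real (n::nat) then H t w else 0) (Yn n)" "ucp_tendsto M Yn Y"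
proof -
 obtain Yn where Yn: "!!n. bounded_integral M F X (%t w. if \<bar>H t w\<bar> <= real (n::nat) then H t w else 0) (Yn n)" "emery_tendsto M F Yn Y"
  and Y: "cadlag_adapted M F Y" "AE w in M. Y 0 w = 0" using I unfolding stochastic_integral_def by blast
 note f = bounded_facts[OF Yn(1) X]
 let ?D = "%n s w. Yn n s w - Y s w"
 have "ucp_tendsto M Yn Y"
  unfolding ucp_tendsto_def
 proof (intro allI impI, rule tendstoI)
  fix t eps e :: real assume t: "0 <= t" and p: "0 < eps" "0 < e"
  define d where "d = min eps (e / 2)"
  have d: "0 < d" "d <= eps" "d < e" using p by (auto simp: d_def)
  obtain N where N: "!!n K J. n >= N ==> elementary_integral M F (?D n) K J ==> (ALL s>=0. ALL w:space M. abs (K s w) <= 1) ==> prob (exceeds J t d) <= d"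
   using Yn(2) t d(1) unfolding emery_tendsto_def by meson
  show "\<forall>\<^sub>F n in sequentially. dist (prob (exceeds (?D n) t eps)) 0 < e"
   unfolding eventually_sequentially
  proof (intro exI[of _ N] allI impI)
   fix n assume n: "n >= N"
   define J where "J s w = 1 * (?D n (min s t) w - ?D n (min s 0) w)" for s w
   have "elementary_integral M F (?D n) (%s w. if 0 < s & s <= t then 1 else 0) J"
    unfolding J_def by (rule elementary_integral.on_interval[where c=1]) (use t in auto)
   from N[OF n this] have "prob (exceeds J t d) <= d" by simp
   have rc: "right_cont (?D n)" using f Y(1) by (intro right_cont_diff cont_right_cont cadlag_right_cont) auto
   have "AE w in M. Yn n 0 w = 0" using f by blast
   hence "AE w in M. w : exceeds (?D n) t d <-> w : exceeds J t d"
    using Y(2) by eventually_elim (auto simp: J_def)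
   from AE_eq_prob[OF exceed_M[OF rc t] _ this] N[OF n \<open>elementary_integral M F (?D n) _ J\<close>] have "prob (exceeds (?D n) t d) <= d" by auto
   moreover have "prob (exceeds (?D n) t eps) <= prob (exceeds (?D n) t d)"
    by (intro finite_measure_mono exceed_M rc t) (use d(2) in force)
   ultimately show "dist (prob (exceeds (?D n) t eps)) 0 < e" using d(3) by (simp add: measure_nonneg)
  qed
 qed
 with Yn(1) show thesis by (rule that)
qed

lemma stochastic_integral_bracket:
 assumes I: "stochastic_integral M F X H Y" and X: "cont_adapted X" and W: "clm W" and XW: "bracket X W V h"
  and path: "AE w in M. stieltjes V h w & (ALL T. EX K. ALL s:{0<..T}. h s w = 0 | abs (H s w) <= K)"
 shows "cont_adapted Y" "bracket Y W V (%s w. H s w * h s w)"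
proof -
 let ?H = "%n s w. if \<bar>H s w\<bar> <= real n then H s w else 0"
 obtain Yn where Yn: "!!n. bounded_integral M F X (?H n) (Yn n)" "ucp_tendsto M Yn Y"
  using stochastic_integral_limit[OF I X] by blast
 note fn = bounded_facts[OF Yn(1) X]
 have cY: "cont_adapted (Yn n)" for n using fn by blast
 have rY: "right_cont Y" using I by (auto simp: stochastic_integral_def intro: cadlag_right_cont)
 have p': "AE w in M. stieltjes V h w" using path by eventually_elim simp
 have "AE w in M. stieltjes V (%s w. H s w * h s w) w & (ALL n. lbm (%s. ?H n s w * h s w)) &
   (ALL s>0. (%n. ?H n s w * h s w) ----> H s w * h s w) & (ALL T. EX K. ALL n. ALL s:{0<..T}. abs (?H n s w * h s w) <= K)"
  using path AE_space
 proof eventually_elim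
  case (elim w)
  have bd: "EX K. ALL n. ALL s:{0<..T}. abs (?H n s w * h s w) <= K & abs (H s w * h s w) <= K" for T
  proof -
   obtain K L where K: "!!s. s : {0<..T} ==> h s w = 0 | abs (H s w) <= K" "L > 0" "!!s. s : {0<..T} ==> abs (h s w) <= L"
    using elim(1) lbm_bound[of "traj h w" T] by metis
   have "abs (H s w * h s w) <= abs K * L" if "s : {0<..T}" for s
    using K(1)[OF that] K(2) K(3)[OF that] unfolding abs_mult by (cases "h s w = 0") (auto intro!: mult_mono)
   moreover have "abs (?H n s w * h s w) <= abs (H s w * h s w)" for n s by simp
   ultimately show ?thesis by (meson order_trans)
  qed
  have lim: "(%n. ?H n s w * h s w) ----> H s w * h s w" for s
   by (intro tendsto_eventually eventually_mono[OF eventually_ge_at_top[of "nat \<lceil>abs (H s w)\<rceil>"]]) (auto simp: nat_le_iff ceiling_le_iff)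
  have lb: "lbm (%s. ?H n s w * h s w)" for n using fn[of n] elim by (auto intro: lbm_mult)
  have "lbm (%s. H s w * h s w)" by (rule lbm_limit[OF lb lim]) (use bd in meson)
  thus ?case using elim lb lim bd by meson
 qed
 from bracket_limit[OF bounded_bracket[OF Yn(1) X W XW p'] cY W Yn(2) rY this]
 show "cont_adapted Y" "bracket Y W V (%s w. H s w * h s w)" .
qed

text \<open>Gronwall's lemma for brackets: dividing by the exponential of \<integral> wt dV makes \<open>\<Delta>\<^sup>2\<close> a nonnegative
 local martingale starting at 0.\<close>

lemma clm_gronwall:
 assumes D: "cont_adapted \<Delta>" and D0: "AE w in M. \<Delta> 0 w = 0"
  and cl: "clm (%t w. (\<Delta> t w)\<^sup>2 - Sint V (%s w. (\<Delta> s w)\<^sup>2 * wt s w) t w)"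
  and W: "adapted F (Sint V wt)"
  and path: "AE w in M. increasing_path (traj V w) & lbm (traj wt w) & (ALL s>0. wt s w >= 0)"
  and V: "AE w in M. continuous_on {0..} (traj V w)"
 shows "AE w in M. ALL t>=0. \<Delta> t w = 0"
proof -
 define e where "e t w = pexp (traj V w) (traj wt w) t" for t w
 have ae: "adapted F e" unfolding e_def[abs_def] by (rule adapted_pexp[OF W path])
 let ?g = "%s w. - (wt s w / e s w)"
 let ?A = "Sint V (%s w. (\<Delta> s w)\<^sup>2 * wt s w)"
 have ep: "AE w in M. increasing_path (traj V w) & lbm (traj wt w) & (ALL t>=0. e t w >= 1) & e 0 w = 1 & lbm (traj ?g w) & (ALL t>=0. 1 / e t w = 1 / e 0 w + Sint V ?g t w)"
  using path
 proof eventually_elim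
  case (elim w)
  hence p: "increasing_path (traj V w)" "lbm (traj wt w)" "!!s. s > 0 ==> wt s w >= 0" by auto
  have q: "t >= 0 ==> 1 <= e t w" "e 0 w = 1" "t >= 0 ==> 1 / e t w = 1 + Sint V ?g t w" "t >= 0 ==> (traj e w ---> e t w) (at_right t)" for t
   using pexp_ge_1[OF p] pexp_0[OF p] inverse_pexp_sint[OF p] pexp_right_continuous[OF p] by (simp_all add: e_def Sint_def)
  have "lbm (%t. - 1 / e t w)"
  proof (rule rc_bounded_lbm)
   show "((%t. - 1 / e t w) ---> - 1 / e s w) (at_right s)" if "s >= 0" for s
    using q(1)[OF that] q(4)[OF that] by (intro tendsto_intros) auto
   show "EX K. ALL s:{0..T}. abs (- 1 / e s w) <= K" for T
   proof (intro exI[of _ 1] ballI)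
    fix s assume "s : {0..T}"
    hence "1 <= e s w" using q(1) by simp
    thus "abs (- 1 / e s w) <= 1" by (simp add: divide_le_eq)
   qed
  qed
  from lbm_mult[OF this p(2)] have "lbm (traj ?g w)" by simp
  thus ?case by (intro conjI allI impI p q(1,2)) (simp_all add: q(2,3))
 qed
 have cl2: "clm (%t w. ((\<Delta> t w)\<^sup>2 - ?A t w) * (1 / e t w) - Sint V (%s w. ((\<Delta> s w)\<^sup>2 - ?A s w) * ?g s w) t w)"
 proof (rule clm_ibp[OF cl])
  show "adapted F (%t w. 1 / e t w)" using ae unfolding adapted_def by (auto intro: borel_measurable_divide)
  show "AE w in M. primitive (%t w. 1 / e t w) V ?g w"
   using ep by eventually_elim blast
 qed
 have cA: "cont_adapted ?A"
  using cont_adapted_diff[OF cont_adapted_mult[OF D D] clm_cont[OF cl]] by (simp add: power2_eq_square)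
 have U: "clm (%t w. (\<Delta> t w)\<^sup>2 * (1 / e t w))"
 proof (rule clm_cong[OF cl2])
  show "AE w in M. ALL t>=0. ((\<Delta> t w)\<^sup>2 - ?A t w) * (1 / e t w) - Sint V (%s w. ((\<Delta> s w)\<^sup>2 - ?A s w) * ?g s w) t w = (\<Delta> t w)\<^sup>2 * (1 / e t w)"
   using ep AE_cont[OF D] V AE_cont[OF cA]
  proof (eventually_elim, intro allI impI)
   fix w and t :: real
   assume "increasing_path (traj V w) & lbm (traj wt w) & (ALL t>=0. e t w >= 1) & e 0 w = 1 & lbm (traj ?g w) & (ALL t>=0. 1 / e t w = 1 / e 0 w + Sint V ?g t w)"
   hence i: "increasing_path (traj V w)" and lw: "lbm (traj wt w)" and lg: "lbm (traj ?g w)" and e0: "e 0 w = 1"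
    and ie: "!!t. t >= 0 ==> 1 / e t w = 1 / e 0 w + Sint V ?g t w" by blast+
   assume c: "continuous_on {0..} (%t. \<Delta> t w)" "continuous_on {0..} (traj V w)" "continuous_on {0..} (traj ?A w)" and t: "t >= 0"
   let ?s = "%f. sint (traj V w) f 0 t"
   have lD: "lbm (%s. (\<Delta> s w)\<^sup>2)" "lbm (traj ?A w)" using lbm_of_continuous[OF c(3)] lbm_power2[OF lbm_of_continuous[OF c(1)]] by auto
   have "continuous_on {0..} (%t. 1 / e t w) <-> continuous_on {0..} (%t. 1 / e 0 w + Sint V ?g t w)"
    by (intro continuous_on_cong refl ie) simp
   moreover have "continuous_on {0..} (%t. 1 / e 0 w + Sint V ?g t w)"
    unfolding Sint_def by (intro continuous_on_add continuous_on_const continuous_on_sint[OF i c(2) lg])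
   ultimately have "continuous_on {0..} (%t. 1 / e t w)" by blast
   note left = cont_left_limit[OF this]
   have 1: "?A t w * (1 / e t w) - ?A 0 w * (1 / e 0 w) = ?s (%s. 1 / e s w * ((\<Delta> s w)\<^sup>2 * wt s w) + ?A s w * ?g s w)"
    by (rule sint_product[where x="traj ?A w" and y="%s. 1 / e s w", OF i t lbm_mult[OF lD(1) lw] lg _ _ left])
     (simp add: Sint_def, rule ie[unfolded Sint_def])
   have "?s (%s. ((\<Delta> s w)\<^sup>2 - ?A s w) * ?g s w) = ?s (%s. - 1 * (1 / e s w * ((\<Delta> s w)\<^sup>2 * wt s w) + ?A s w * ?g s w))"
    by (rule sint_cong) (simp add: left_diff_distrib diff_divide_distrib)
   also have "... = - (?A t w * (1 / e t w))" unfolding sint_cmult 1[symmetric] by (simp add: Sint_def)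
   finally show "((\<Delta> t w)\<^sup>2 - ?A t w) * (1 / e t w) - Sint V (%s w. ((\<Delta> s w)\<^sup>2 - ?A s w) * ?g s w) t w = (\<Delta> t w)\<^sup>2 * (1 / e t w)"
    by (simp add: Sint_def diff_divide_distrib)
  qed
 qed
 have "AE w in M. (\<Delta> t w) : {0}" if t: "t >= 0" for t
 proof -
  have "(\<integral>\<^sup>+w. ennreal ((\<Delta> t w)\<^sup>2 * (1 / e t w)) \<partial>M) <= ennreal 0"
  proof (rule clm_nonneg_expectation[OF U _ _ t])
   show "AE w in M. (\<Delta> 0 w)\<^sup>2 * (1 / e 0 w) = 0" using D0 by eventually_elim simp
   show "AE w in M. ALL t>=0. 0 <= (\<Delta> t w)\<^sup>2 * (1 / e t w)" using ep
   proof eventually_elim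
    case (elim w)
    hence "ALL t>=0. 0 <= e t w" using order_trans[OF zero_le_one] by blast
    thus ?case by simp
   qed
  qed
  hence "AE w in M. ennreal ((\<Delta> t w)\<^sup>2 * (1 / e t w)) = 0"
   using cont_adapted_M[OF clm_cont[OF U] t] by (subst nn_integral_0_iff_AE[symmetric]) simp_all
  thus ?thesis using ep
  proof eventually_elim
   case (elim w)
   hence "e t w > 0" using t by (meson less_le_trans zero_less_one)
   moreover have "(\<Delta> t w)\<^sup>2 * (1 / e t w) <= 0" using elim(1) by (simp add: ennreal_eq_0_iff)
   ultimately have "(\<Delta> t w)\<^sup>2 <= 0" by (simp add: divide_le_eq)
   thus ?case by simp
  qed
 qed
 from AE_all_times[OF cont_right_cont[OF D] _ this] show ?thesis by simp
qed

end

section \<open>Predictability\<close>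

context usual_filtration begin

lemma predictable_zero: "A : sets (F 0) ==> {0} \<times> A : sets (predictable_sigma M F)"
 unfolding sets_predictable by blast

lemma predictable_Ioc: "0 <= s ==> A : sets (F s) ==> {s<..t} \<times> A : sets (predictable_sigma M F)"
proof (cases "s <= t")
 case True
 assume "0 <= s" "A : sets (F s)"
 thus ?thesis unfolding sets_predictable using True by blast
qed simp

lemma predictable_Ioi:
 assumes "0 <= s" "A : sets (F s)" shows "{s<..} \<times> A : sets (predictable_sigma M F)"
proof -
 have "{s<..} \<times> A = (UN n. {s<..real n} \<times> A)" using real_arch_simple by fastforce
 thus ?thesis using predictable_Ioc[OF assms] by auto
qed

lemma predictable_cont:
 assumes Y: "adapted F Y" and c: "!!w. w : space M ==> continuous_on {0..} (traj Y w)"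
 shows "(%x. Y (fst x) (snd x)) : meas (predictable_sigma M F)"
proof (rule borel_measurable_LIMSEQ_real)
 fix n :: nat
 let ?f = "%x. Y (max 0 (lg n (fst x))) (snd x)"
 have lg0: "max 0 (lg n 0) = 0" using cell_bounds(1)[where n=n and s=0] by simp
 show "?f : meas (predictable_sigma M F)"
 proof (rule measurableI)
  fix B :: "real set" assume B: "B : sets borel"
  let ?A = "%s. {w:space M. Y s w : B}"
  have A: "?A s : sets (F s)" if "s >= 0" for s
   using measurable_sets[OF adaptedD[OF Y that] B] space_F[OF that] by (simp add: vimage_def Int_def conj_commute)
  have "?f -` B Int space (predictable_sigma M F) = {0} \<times> ?A 0 Un (UN i::nat. {real i / 2^n<..real (Suc i) / 2^n} \<times> ?A (real i / 2^n))" (is "?L = ?R")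
  proof (intro set_eqI iffI)
   fix x assume x: "x : ?L"
   obtain s w where [simp]: "x = (s, w)" by (cases x)
   show "x : ?R"
   proof (cases "s = 0")
    case False
    hence s: "s > 0" using x by (simp add: space_predictable)
    define i where "i = nat (\<lceil>s * 2^n\<rceil> - 1)"
    have "\<lceil>s * 2^n\<rceil> >= 1" using s by simp
    hence i: "real i / 2^n = lg n s" "real (Suc i) / 2^n = rg n s" by (simp_all add: i_def lg_def rg_def)
    have "max 0 (lg n s) = lg n s" unfolding i(1)[symmetric] by simp
    thus ?thesis using x s cell_bounds(1,2)[where n=n and s=s]
     by (intro UnI2 UN_I[of i]) (auto simp: space_predictable i simp del: of_nat_Suc)
   qed (use x lg0 in "auto simp: space_predictable")
  next
   fix x assume "x : ?R"
   then consider w where "x = (0, w)" "w : ?A 0" | i s w where "x = (s, w)" "real i / 2^n < s" "s <= real (Suc i) / 2^n" "w : ?A (real i / 2^n)" by auto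
   thus "x : ?L"
   proof cases
    case (2 i s w)
    have "0 <= real i / 2^n" by simp
    hence "0 <= s" using 2(2) by linarith
    thus ?thesis using 2 cell_unique(1)[OF 2(2,3)] by (simp add: space_predictable)
   qed (simp add: lg0 space_predictable)
  qed
  thus "?f -` B Int space (predictable_sigma M F) : sets (predictable_sigma M F)"
   using predictable_zero[OF A] predictable_Ioc[OF _ A] by auto
 qed simp
next
 fix x assume "x : space (predictable_sigma M F)"
 then obtain s w where x: "x = (s, w)" "s >= 0" "w : space M" by (auto simp: space_predictable)
 have "(%n. max 0 (lg n s)) ----> max 0 s" by (intro tendsto_max tendsto_const lg_tendsto)
 hence "(%n. max 0 (lg n s)) ----> s" using x by simp
 from continuous_on_tendsto_compose[OF c[OF x(3)] this] x
 show "(%n. Y (max 0 (lg n (fst x))) (snd x)) ----> Y (fst x) (snd x)" by simp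
qed

lemma hit_incr:
 assumes i: "increasing_path x" and t: "t >= 0" shows "hit_time x a <= ennreal t <-> a <= x t"
proof
 have x0: "abs (x s) = x s" if "s >= 0" for s using incr_le[OF i order_refl that] i by (simp add: increasing_path_def)
 assume "a <= x t"
 thus "hit_time x a <= ennreal t" unfolding hit_time_def using t x0[OF t] by (intro Inf_lower) auto
next
 have x0: "abs (x s) = x s" if "s >= 0" for s using incr_le[OF i order_refl that] i by (simp add: increasing_path_def)
 assume h: "hit_time x a <= ennreal t"
 have "a <= x s" if s: "s > t" for s
 proof -
  have "hit_time x a < ennreal s" using h s t by (auto intro: le_less_trans simp: ennreal_less_iff)
  then obtain u where "u >= 0" "a <= abs (x u)" "ennreal u < ennreal s" unfolding hit_time_def by (auto simp: Inf_less_iff)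
  thus ?thesis using incr_le[OF i, of u s] x0 by (auto simp: ennreal_less_iff)
 qed
 hence "eventually (%s. a <= x s) (at_right t)" by (auto simp: eventually_at_right_field intro: exI[of _ "t + 1"])
 moreover have "(x ---> x t) (at_right t)" using i t by (simp add: increasing_path_def)
 ultimately show "a <= x t" by (intro tendsto_lowerbound) auto
qed

end

context continuous_filtration begin

text \<open>A bounded stopping time S is the first zero of the continuous process \<open>E[S - t \<and> S | F\<^sub>t]\<close>, and is
 therefore announced by the times at which this process is small.\<close>

lemma bounded_stopping_predictable:
 assumes T: "ext_stopping_time F T"
 shows "EX Q:sets (predictable_sigma M F). AE w in M. ALL t>=0. (t, w) : Q <-> min_time (real (Suc n)) (T w) <= t"
proof -
 let ?n = "real (Suc n)"
 define S where "S w = min_time ?n (T w)" for w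
 have n0: "0 <= ?n" by simp
 have S: "0 <= S w" "S w <= ?n" for w unfolding S_def using min_time_bounds[OF n0] by auto
 define C where "C t w = stopped (%t _. t) T (min t ?n) w" for t w
 have C_eq: "C t w = min t (S w)" if "t >= 0" for t w
  using that by (cases "T w") (auto simp: C_def S_def stopped_def min_time_ennreal min_time_top simp del: of_nat_Suc)
 have id: "cont_adapted (%t _. t)" by (auto simp: cont_adapted_def adapted_def intro: continuous_intros)
 have C: "cont_adapted C"
  unfolding C_def[abs_def] using cont_adapted_stop_const[OF cont_adapted_stopped[OF id T] n0] by simp
 have "(%w. C ?n w) = S" using C_eq[OF n0] min.absorb2[OF S(2)] by simp
 hence SM: "S : meas M" using cont_adapted_M[OF C n0] by simp
 have Si: "integrable M S" using S by (intro integrable_const_bound[OF _ SM, of ?n]) auto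
 obtain X where X: "bm X" "!!t. t >= 0 ==> AE w in M. real_cond_exp M (F t) S w = X t w"
  by (rule bm_of_bounded[OF SM, of ?n]) (use S in auto)
 have cX: "cont_adapted X" using X(1) by (simp add: bm_def)
 define D where "D t w = X t w - C t w" for t w
 have D: "cont_adapted D" unfolding D_def by (rule cont_adapted_diff[OF cX C])
 have "AE w in M. D t w : {0..}" if t: "t >= 0" for t
 proof -
  interpret sigma_finite_subalgebra M "F t" by (rule sigma_finite_F[OF t])
  have "0 <= C t w" "C t w <= ?n" for w unfolding C_eq[OF t] using t S[of w] by (auto intro: min.coboundedI2)
  hence Ci: "integrable M (C t)" by (intro integrable_const_bound[OF _ cont_adapted_M[OF C t], of ?n]) auto
  have "AE w in M. real_cond_exp M (F t) (C t) w <= real_cond_exp M (F t) S w"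
   using C_eq[OF t] Ci Si by (intro real_cond_exp_mono) auto
  thus ?thesis using X(2)[OF t] real_cond_exp_F_meas[OF Ci cont_adaptedD[OF C t]] by eventually_elim (simp add: D_def)
 qed
 from AE_all_times[OF cont_right_cont[OF D] _ this] have D0: "AE w in M. ALL t>=0. D t w >= 0" by auto
 have EX0: "expectation (X 0) = expectation S"
 proof -
  interpret sigma_finite_subalgebra M "F 0" by (rule sigma_finite_F) simp
  have "expectation (X 0) = expectation (real_cond_exp M (F 0) S)"
   by (rule integral_cong_AE) (use X(2)[of 0] cont_adapted_M[OF cX] in "auto elim: eventually_mono")
  thus ?thesis using real_cond_exp_int(2)[OF Si] by simp
 qed
 have EX: "expectation (stopped X T' ?n) = expectation S" "integrable M (stopped X T' ?n)" if "ext_stopping_time F T'" for T'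
  using bm_test[OF bm_stopped[OF X(1) that] order_refl n0, of "%_. 1" 1] EX0 bm_integrable[OF bm_stopped[OF X(1) that] n0]
  by (simp_all add: stopped_def[abs_def])
 have DS: "AE w in M. D (S w) w = 0"
 proof -
  have e: "stopped X T ?n w - S w = D (S w) w" for w using C_eq[OF S(1)] by (simp add: stopped_def D_def S_def)
  have "AE w in M. stopped X T ?n w - S w = 0"
  proof (subst integral_nonneg_eq_0_iff_AE[symmetric])
   show "AE w in M. 0 <= stopped X T ?n w - S w" unfolding e using D0 by eventually_elim (use S in blast)
  qed (simp_all add: EX[OF T] Si del: of_nat_Suc)
  thus ?thesis unfolding e .
 qed
 (* The first zero of D becomes the time at which a level is reached. *)
 define x where "x t w = 1 - min (D t w) 1" for t w
 have x: "cont_adapted x"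
  using D unfolding cont_adapted_def adapted_def x_def by (auto elim!: eventually_mono intro!: continuous_intros)
 define R where "R = hit x 1"
 have Rs: "ext_stopping_time F R" unfolding R_def by (rule hit_stopping_time[OF x])
 have R: "AE w in M. ALL t>=0. R w <= ennreal t <-> (EX s:{0..t}. D s w = 0)"
  using AE_cont[OF x] D0
 proof (eventually_elim, intro allI impI)
  fix w and t :: real assume c: "continuous_on {0..} (traj x w)" and d: "ALL t>=0. D t w >= 0" and t: "t >= 0"
  have "abs (x s w) >= 1 <-> D s w = 0" if "s >= 0" for s
  proof -
   have "D s w >= 0" using d that by blast
   thus ?thesis by (auto simp: x_def min_def abs_real_def)
  qed
  thus "R w <= ennreal t <-> (EX s:{0..t}. D s w = 0)" unfolding R_def hit_le_iff[OF c t] by auto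
 qed
 (* R is at most S, and X stopped at R has the expectation of S. *)
 have RS: "AE w in M. R w = ennreal (S w)"
 proof -
  have 1: "AE w in M. EX r. R w = ennreal r & 0 <= r & r <= S w & D r w = 0"
   using R DS
  proof eventually_elim
   case (elim w)
   have le: "R w <= ennreal (S w)"
    unfolding elim(1)[rule_format, OF S(1)] by (rule bexI[of _ "S w"]) (simp_all add: elim(2) S)
   then obtain r where r: "R w = ennreal r" "0 <= r" by (cases "R w") (auto simp: top_unique)
   have "EX s:{0..r}. D s w = 0" using elim(1)[rule_format, OF r(2)] r(1) by simp
   then obtain s where s: "0 <= s" "s <= r" "D s w = 0" by auto
   have "R w <= ennreal s" unfolding elim(1)[rule_format, OF s(1)] by (rule bexI[of _ s]) (simp_all add: s)
   hence "D r w = 0" using r s by (simp add: ennreal_le_iff)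
   thus ?case using r le S by (auto simp: ennreal_le_iff)
  qed
  hence 2: "AE w in M. stopped X R ?n w <= S w & R w = ennreal (stopped X R ?n w)"
  proof eventually_elim
   case (elim w)
   then obtain r where r: "R w = ennreal r" "0 <= r" "r <= S w" "D r w = 0" by blast
   hence "r <= ?n" using S(2)[of w] by linarith
   hence "stopped X R ?n w = r" using r C_eq[OF r(2)] by (simp add: stopped_def min_time_ennreal D_def)
   thus ?case using r by simp
  qed
  have "AE w in M. S w - stopped X R ?n w = 0"
  proof (subst integral_nonneg_eq_0_iff_AE[symmetric])
   show "AE w in M. 0 <= S w - stopped X R ?n w" using 2 by eventually_elim simp
  qed (simp_all add: EX[OF Rs] Si del: of_nat_Suc)
  thus ?thesis using 2 by eventually_elim simp
 qed
 (* By continuity D gets close to 0 strictly before S, so that the half lines may be open on the left. *)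
 define Q where "Q = {0} \<times> {w:space M. T w <= ennreal 0} Un (INT k. UN q:\<rat> Int {0..}. {q<..} \<times> {w:space M. D q w < 1 / real (Suc k)})"
 have "Measurable.pred (F 0) (%w. T w <= ennreal 0)" using T unfolding ext_stopping_time_def by blast
 hence T0: "{w:space M. T w <= ennreal 0} : sets (F 0)" using space_F[of 0] by (simp add: pred_def)
 have Dq: "{q<..} \<times> {w:space M. D q w < 1 / real (Suc k)} : sets (predictable_sigma M F)" if q: "q : \<rat> Int {0..}" for q k
 proof -
  have q: "q >= 0" using q by simp
  have [measurable]: "D q : meas (F q)" by (rule cont_adaptedD[OF D q])
  have "{w:space (F q). D q w < 1 / real (Suc k)} : sets (F q)" by measurable
  thus ?thesis using predictable_Ioi[OF q] space_F[OF q] by simp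
 qed
 have "(UN q:\<rat> Int {0..}. {q<..} \<times> {w:space M. D q w < 1 / real (Suc k)}) : sets (predictable_sigma M F)" for k
  by (intro sets.countable_UN' countable_Int1 countable_rat) (use Dq in blast)
 hence "Q : sets (predictable_sigma M F)" unfolding Q_def by (intro sets.Un predictable_zero T0 sets.countable_INT) auto
 moreover have "AE w in M. ALL t>=0. (t, w) : Q <-> S w <= t"
  using AE_cont[OF D] D0 R RS DS AE_space
 proof (eventually_elim, intro allI impI)
  fix w and t :: real
  assume c: "continuous_on {0..} (traj D w)" and d: "ALL t>=0. D t w >= 0" and r: "ALL t>=0. R w <= ennreal t <-> (EX s:{0..t}. D s w = 0)"
   and rs: "R w = ennreal (S w)" and ds: "D (S w) w = 0" and wt: "w : space M" and t: "0 <= t"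
  show "(t, w) : Q <-> S w <= t"
  proof (cases "t = 0")
   case True
   have "S w <= 0 <-> T w <= 0" by (cases "T w") (auto simp: S_def min_time_ennreal min_time_top)
   thus ?thesis using True wt by (auto simp: Q_def)
  next
   case False
   have "(t, w) : Q <-> (ALL k. EX q:\<rat>. 0 <= q & q < t & D q w < 1 / real (Suc k))" using False wt by (auto simp: Q_def)
   also have "... <-> S w <= t"
   proof
    assume s: "S w <= t"
    show "ALL k. EX q:\<rat>. 0 <= q & q < t & D q w < 1 / real (Suc k)"
    proof
     fix k
     show "EX q:\<rat>. 0 <= q & q < t & D q w < 1 / real (Suc k)"
     proof (cases "S w = 0")
      case True
      thus ?thesis using ds t False by (intro bexI[of _ 0]) auto
     next
      case nz: False
      hence p: "S w > 0" using S(1)[of w] by simp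
      have "eventually (%u. D u w < 1 / real (Suc k)) (at_left (S w))"
       using cont_left_limit[OF c p] ds by (intro order_tendstoD(2)) auto
      then obtain b where b: "b < S w" "!!u. b < u ==> u < S w ==> D u w < 1 / real (Suc k)" by (auto simp: eventually_at_left_field)
      obtain q where "q : \<rat>" "max b 0 < q" "q < S w" using Rats_dense_in_real[of "max b 0" "S w"] b p by auto
      thus ?thesis using b s by (intro bexI[of _ q]) auto
     qed
    qed
   next
    assume q: "ALL k. EX q:\<rat>. 0 <= q & q < t & D q w < 1 / real (Suc k)"
    have "continuous_on {0..t} (traj D w)" by (rule continuous_on_subset[OF c]) auto
    then obtain s where s: "s : {0..t}" "!!u. u : {0..t} ==> D s w <= D u w"
     using continuous_attains_inf[of "{0..t}" "traj D w"] t by auto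
    have "D s w <= 1 / real (Suc k)" for k using q s(2) by (meson atLeastAtMost_iff less_imp_le order_trans)
    hence "D s w <= 0" using nat_approx_posE[of "D s w"] by (meson not_le)
    hence "D s w = 0" using d s(1) by (simp add: order_antisym)
    hence "R w <= ennreal t" using r t s(1) by blast
    thus "S w <= t" using rs t by (simp add: ennreal_le_iff)
   qed
   finally show ?thesis .
  qed
 qed
 ultimately show ?thesis unfolding S_def by blast
qed

text \<open>T is the limit of the bounded stopping times T \<and> n.\<close>

lemma stopping_predictable:
 assumes T: "ext_stopping_time F T"
 shows "EX Q:sets (predictable_sigma M F). AE w in M. ALL t>=0. (t, w) : Q <-> T w <= ennreal t"
proof -
 have "ALL n. EX Q. Q : sets (predictable_sigma M F) & (AE w in M. ALL t>=0. (t, w) : Q <-> min_time (real (Suc n)) (T w) <= t)"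
  using bounded_stopping_predictable[OF T] by blast
 from choice[OF this] obtain Q where Q: "!!n. Q n : sets (predictable_sigma M F)" "!!n. AE w in M. ALL t>=0. (t, w) : Q n <-> min_time (real (Suc n)) (T w) <= t"
  by blast
 let ?Q = "UN n. Q n Int ({0} \<times> space M Un {0<..real n} \<times> space M)"
 have "space M : sets (F 0)" using sets.top[of "F 0"] space_F[of 0] by simp
 hence "{0} \<times> space M Un {0<..real n} \<times> space M : sets (predictable_sigma M F)" for n
  by (intro sets.Un predictable_zero predictable_Ioc) auto
 hence "?Q : sets (predictable_sigma M F)" using Q(1) by (intro sets.countable_UN' sets.Int) auto
 moreover have "AE w in M. ALL n. ALL t>=0. (t, w) : Q n <-> min_time (real (Suc n)) (T w) <= t" using Q(2) by (simp add: AE_all_countable)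
 hence "AE w in M. ALL t>=0. (t, w) : ?Q <-> T w <= ennreal t"
  using AE_space
 proof (eventually_elim, intro allI impI)
  fix w and t :: real assume q: "ALL n. ALL t>=0. (t, w) : Q n <-> min_time (real (Suc n)) (T w) <= t" and wt: "w : space M" and t: "t >= 0"
  have e: "min_time (real (Suc n)) (T w) <= t <-> T w <= ennreal t" if "t <= real n" for n
   using that t by (cases "T w") (auto simp: min_time_ennreal min_time_top ennreal_le_iff top_unique min_le_iff_disj)
  obtain n where "t <= real n" using real_arch_simple by blast
  thus "(t, w) : ?Q <-> T w <= ennreal t" using q e t wt by (auto simp: less_le)
 qed
 ultimately show ?thesis by blast
qed

text \<open>The sets where the process is at least a are the intervals from the stopping times at which the level a is
 reached, which are predictable for all rational a simultaneously off a null event.\<close>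

lemma increasing_predictable:
 assumes A: "adapted F A" and i: "AE w in M. increasing_path (traj A w)"
 obtains Gm where "Gm : sets (F 0)" "AE w in M. w : Gm" "(%x. indicator Gm (snd x) * A (fst x) (snd x) :: real) : meas (predictable_sigma M F)"
proof -
 have "ALL a. EX Q. Q : sets (predictable_sigma M F) & (AE w in M. ALL t>=0. (t, w) : Q <-> a <= A t w)"
 proof
  fix a
  have "ext_stopping_time F (hit A a)"
   unfolding ext_stopping_time_def
  proof (intro allI impI)
   fix t :: real assume t: "0 <= t"
   have [measurable]: "A t : meas (F t)" by (rule adaptedD[OF A t])
   have "{w:space (F t). a <= A t w} : sets (F t)" by measurable
   hence 1: "{w:space M. a <= A t w} : sets (F t)" using space_F[OF t] by simp
   have 2: "AE w in M. w : {w:space M. a <= A t w} <-> w : {w:space M. hit A a w <= ennreal t}"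
    using i by eventually_elim (simp add: hit_incr[OF _ t])
   have "{w:space M. hit A a w <= ennreal t} : sets (F t)" by (rule AE_eq_set_F[OF 1 _ 2 t]) auto
   thus "Measurable.pred (F t) (%w. hit A a w <= ennreal t)" by (simp add: pred_def space_F[OF t])
  qed
  from stopping_predictable[OF this] obtain Q where Q: "Q : sets (predictable_sigma M F)" "AE w in M. ALL t>=0. (t, w) : Q <-> hit A a w <= ennreal t" by blast
  from Q(2) i have "AE w in M. ALL t>=0. (t, w) : Q <-> a <= A t w" by eventually_elim (simp add: hit_incr)
  thus "EX Q. Q : sets (predictable_sigma M F) & (AE w in M. ALL t>=0. (t, w) : Q <-> a <= A t w)" using Q(1) by blast
 qed
 from choice[OF this] obtain Q where Q: "!!a. Q a : sets (predictable_sigma M F)" "!!a. AE w in M. ALL t>=0. (t, w) : Q a <-> a <= A t w" by blast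
 define Gm where "Gm = {w:space M. ALL a:\<rat>. ALL t>=0. (t, w) : Q a <-> a <= A t w}"
 have AEGm: "AE w in M. ALL a:\<rat>. ALL t>=0. (t, w) : Q a <-> a <= A t w" using Q(2) by (subst AE_ball_countable) (auto intro: countable_rat)
 have GmF: "Gm : sets (F 0)" unfolding Gm_def by (rule AE_set_F[OF AEGm]) simp
 have AEGm': "AE w in M. w : Gm" using AEGm AE_space by eventually_elim (simp add: Gm_def)
 let ?P = "predictable_sigma M F"
 have cyl: "{0..} \<times> B : sets ?P" if "B : sets (F 0)" for B
 proof -
  have "{0..} \<times> B = {0} \<times> B Un {0::real<..} \<times> B" by auto
  thus ?thesis using predictable_zero[OF that] predictable_Ioi[OF order_refl that] by auto
 qed
 have "(%x. indicator Gm (snd x) * A (fst x) (snd x) :: real) : meas ?P"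
 proof (rule borel_measurableI_ge)
  fix y :: real
  let ?S = "%a. Q a Int {0..} \<times> Gm Un (if a <= 0 then {0..} \<times> (space M - Gm) else {})"
  have "{x : space ?P. y <= indicator Gm (snd x) * A (fst x) (snd x)} = space ?P Int (INT a:\<rat> Int {..<y}. ?S a)" (is "?L = _ Int ?R")
  proof (intro set_eqI)
   fix x :: "real \<times> 'a"
   obtain s w where x: "x = (s, w)" by (cases x)
   have in_S: "x : ?S a <-> a <= indicator Gm w * A s w" if "a : \<rat>" "s >= 0" "w : space M" for a
    using that by (auto simp: x Gm_def indicator_def)
   have "y <= z <-> (ALL a:\<rat> Int {..<y}. a <= z)" for z
   proof (intro iffI ballI)
    assume "ALL a:\<rat> Int {..<y}. a <= z"
    thus "y <= z" using Rats_dense_in_real[of z y] by (meson IntI lessThan_iff not_le)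
   qed auto
   from this[of "indicator Gm w * A s w"] in_S show "x : ?L <-> x : space ?P Int ?R"
    by (auto simp: x space_predictable simp del: Un_iff Int_iff)
  qed
  also have "... : sets ?P"
  proof (cases "\<rat> Int {..<y} = {}")
   case False
   have "space M - Gm : sets (F 0)" using sets.compl_sets[OF GmF] space_F[of 0] by simp
   hence "?S a : sets ?P" for a using sets.Int[OF Q(1) cyl[OF GmF]] cyl by (intro sets.Un) auto
   thus ?thesis using False by (intro sets.Int sets.top sets.countable_INT') (auto intro: countable_rat)
  qed simp
  finally show "{x : space ?P. y <= indicator Gm (snd x) * A (fst x) (snd x)} : sets ?P" .
 qed
 with GmF AEGm' show thesis by (rule that)
qed

end

section \<open>The deflator\<close>

context usual_filtration begin

text \<open>Almost every path stays below some level n. There it agrees with the process stopped at n, which converges as a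
 bounded martingale.\<close>

lemma nonneg_clm_converges:
 assumes U: "clm U" and U0: "AE w in M. U 0 w = x" and nn: "AE w in M. ALL t>=0. U t w >= 0"
 shows "AE w in M. EX l. (traj U w ---> l) at_top"
proof -
 have cU: "cont_adapted U" by (rule clm_cont[OF U])
 have conv: "AE w in M. EX l. ((%t. stopped U (hit U (real n)) t w) ---> l) at_top" if n: "abs x < real n" for n
 proof (rule bm_converges, rule clm_bounded_bm)
  show "clm (stopped U (hit U (real n)))" by (rule clm_stopped[OF U hit_stopping_time[OF cU]])
  show "AE w in M. ALL t>=0. abs (stopped U (hit U (real n)) t w) <= real n"
   using AE_cont[OF cU] U0
  proof (eventually_elim, intro allI impI)
   fix w and t :: real assume "continuous_on {0..} (traj U w)" "U 0 w = x" "0 <= t"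
   thus "abs (stopped U (hit U (real n)) t w) <= real n"
    unfolding stopped_def by (intro before_hit[where x="traj U w"] min_time_bounds min_time_le) (use n in auto)
  qed
 qed
 have "AE w in M. ALL n. abs x < real n --> (EX l. ((%t. stopped U (hit U (real n)) t w) ---> l) at_top)"
  using conv by (simp add: AE_all_countable)
 thus ?thesis
  using clm_nonneg_bounded_paths[OF U U0 nn] nn
 proof eventually_elim
  case (elim w)
  then obtain K where K: "!!t. t >= 0 ==> U t w <= K" by blast
  obtain n where n: "max K \<bar>x\<bar> < real n" using reals_Archimedean2 by blast
  have "~ real n <= abs (U t w)" if "t >= 0" for t using K[OF that] elim(3) that n by simp
  hence "hit U (real n) w = top" by (auto simp: hit_time_def)
  moreover obtain l where "((%t. stopped U (hit U (real n)) t w) ---> l) at_top" using elim(1) n by auto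
  moreover have "eventually (%t. U (min_time t top) w = U t w) at_top"
   using eventually_ge_at_top[of 0] by eventually_elim (simp add: min_time_top)
  ultimately show ?case by (auto simp: stopped_def intro: Lim_transform_eventually)
 qed
qed

end

context random_time begin

lemma predictable_FG:
 fixes f :: "real \<times> 'a => real"
 assumes "f : meas (predictable_sigma M F)" shows "f : meas (predictable_sigma M G)"
proof (rule measurable_from_subalg[OF _ assms])
 have "{{0} \<times> A | A. A : sets (F 0)} Un {{s<..t} \<times> A | s t A. 0 <= s & s <= t & A : sets (F s)} <=
   {{0} \<times> A | A. A : sets (G 0)} Un {{s<..t} \<times> A | s t A. 0 <= s & s <= t & A : sets (G s)}"
  using F_sub_G by blast
 thus "subalgebra (predictable_sigma M G) (predictable_sigma M F)"
  unfolding subalgebra_def sets_predictable EG.sets_predictable by (simp add: space_predictable EG.space_predictable sigma_sets_mono')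
qed

lemma G_bracketed: "bracketed M G (stopped U \<tau>) V ka"
proof
 show "EG.clm (stopped U \<tau>)" by (rule clm_U)
 show "EG.bracket (stopped U \<tau>) (stopped U \<tau>) V ka" by (rule clm_U_squared)
 show "AE w in M. stieltjes V ka w & (ALL s>0. 0 <= ka s w)"
  using V_path by eventually_elim (simp add: lbm_ka, simp add: ka_def)
qed

lemma Ls_path: "AE w in M. Ls 0 w = 1 & (ALL t>=0. Ls t w > 0) & continuous_on {0..} (traj Ls w) & lbm (%s. Ls s w / Z s w)"
 using AE_regular EG.AE_cont[OF EG.clm_cont[OF clm_Ls]]
proof eventually_elim
 case (elim w)
 have "Ls t w > 0" if "t >= 0" for t
  using N_pos[OF elim(1)] min_time_bounds(1)[OF that] by (simp add: Ls_def stopped_def)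
 moreover have "Ls 0 w = 1" using N_pos[OF elim(1), of 0] by (simp add: Ls_def stopped_def)
 ultimately show ?case using elim(2) lbm_mult[OF lbm_of_continuous[OF elim(2)] lbm_Z(2)[OF elim(1)]] by simp
qed

lemma Ls_brackets:
 shows "EG.clm (%t w. Ls t w - 1)"
  and "EG.bracket (stopped U \<tau>) (%t w. Ls t w - 1) V (%s w. - (Ls s w / Z s w) * ka s w)"
  and "EG.bracket (%t w. Ls t w - 1) (%t w. Ls t w - 1) V (%s w. - (Ls s w / Z s w) * (- (Ls s w / Z s w) * ka s w))"
proof -
 have one: "EG.clm (%t w. 1)" by (rule EG.clm_const) simp
 show "EG.clm (%t w. Ls t w - 1)" by (rule EG.clm_diff[OF clm_Ls one])
 show "EG.bracket (stopped U \<tau>) (%t w. Ls t w - 1) V (%s w. - (Ls s w / Z s w) * ka s w)"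
  using EG.clm_diff[OF clm_Ls_U clm_U] by (simp add: algebra_simps)
 show "EG.bracket (%t w. Ls t w - 1) (%t w. Ls t w - 1) V (%s w. - (Ls s w / Z s w) * (- (Ls s w / Z s w) * ka s w))"
  using EG.clm_add[OF EG.clm_diff[OF clm_Ls_squared EG.clm_cmult[OF clm_Ls, of 2]] one]
  by (simp add: power2_eq_square algebra_simps)
qed

text \<open>The integrand has to be predictable. This holds for \<open>Z = m - A\<^sup>o\<close> after replacing the paths in a null event that is
 known at time 0.\<close>

lemma deflator_exists: "EX L. stochastic_integral M G (stopped U \<tau>) (%t w. - (L t w / Z t w)) (%t w. L t w - 1)"
proof -
 interpret B: bracketed M G "stopped U \<tau>" V ka by (rule G_bracketed)
 obtain Gm1 where Gm1: "Gm1 : sets (F 0)" "AE w in M. w : Gm1" "(%x. indicator Gm1 (snd x) * Ao (fst x) (snd x) :: real) : meas (predictable_sigma M F)"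
  by (rule increasing_predictable[OF adapted_Ao Ao_incr])
 let ?P = "%w. regular w & continuous_on {0..} (traj Ls w)"
 have AEGm: "AE w in M. ?P w" using AE_regular Ls_path by eventually_elim simp
 define Gm where "Gm = Gm1 Int {w:space M. ?P w}"
 have GmF: "Gm : sets (F t)" if "t >= 0" for t
  unfolding Gm_def using AE_set_F[OF AEGm that] sets_F_mono[OF _ that Gm1(1)] by (intro sets.Int) auto
 have AEGm': "AE w in M. w : Gm" using AEGm Gm1(2) AE_space by eventually_elim (simp add: Gm_def)
 have ind: "adapted F (%t w. indicator Gm w :: real)" using GmF by (simp add: adapted_def)
 define L where "L t w = indicator Gm w * Ls t w" for t w
 have LL: "AE w in M. ALL t. L t w = Ls t w" using AEGm' by eventually_elim (simp add: L_def)
 have [measurable]: "(%x. L (fst x) (snd x)) : meas (predictable_sigma M G)"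
 proof (rule EG.predictable_cont)
  show "adapted G L" using adapted_FG[OF ind] EG.clm_cont[OF clm_Ls]
   unfolding EG.cont_adapted_def adapted_def L_def[abs_def] by (auto intro: borel_measurable_times)
  show "continuous_on {0..} (traj L w)" for w
   unfolding L_def by (cases "w : Gm") (auto simp: Gm_def)
 qed
 have [measurable]: "(%x. indicator Gm (snd x) * m (fst x) (snd x) :: real) : meas (predictable_sigma M G)"
 proof (rule predictable_FG, rule predictable_cont)
  show "adapted F (%t w. indicator Gm w * m t w)" using ind clm_cont[OF clm_m]
   unfolding cont_adapted_def adapted_def by (auto intro: borel_measurable_times)
  show "continuous_on {0..} (%t. indicator Gm w * m t w)" for w
   by (cases "w : Gm") (auto simp: Gm_def regular_def)
 qed
 have [measurable]: "(%x. indicator Gm (snd x) :: real) : meas (predictable_sigma M G)"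
  by (rule predictable_FG, rule predictable_cont[OF ind]) simp
 note [measurable] = predictable_FG[OF Gm1(3)]
 have "(%x. - (L (fst x) (snd x) / (indicator Gm (snd x) * m (fst x) (snd x) - indicator Gm (snd x) * (indicator Gm1 (snd x) * Ao (fst x) (snd x)))))
  : meas (predictable_sigma M G)" by measurable
 also have "(%x. - (L (fst x) (snd x) / (indicator Gm (snd x) * m (fst x) (snd x) - indicator Gm (snd x) * (indicator Gm1 (snd x) * Ao (fst x) (snd x))))) =
  (%x. - (L (fst x) (snd x) / Z (fst x) (snd x)))"
  by (auto simp: fun_eq_iff L_def Gm_def m_def indicator_def)
 finally have H: "predictable M G (%t w. - (L t w / Z t w))" by (simp add: predictable_def case_prod_unfold)
 have "stochastic_integral M G (stopped U \<tau>) (%t w. - (L t w / Z t w)) (%t w. L t w - 1)"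
 proof (rule B.stochastic_integral_of_brackets[OF H])
  show "AE w in M. lbm (%s. - (L s w / Z s w))"
   using LL Ls_path by eventually_elim (use lbm_mult[OF lbm_const[of "-1"]] in fastforce)
  show "AE w in M. L 0 w - 1 = 0" using LL Ls_path by eventually_elim simp
 qed (rule EG.clm_cong, rule Ls_brackets, use LL in "eventually_elim, simp add: Sint_def")+
 thus ?thesis by blast
qed

text \<open>The equation determines L: the difference of two solutions satisfies a linear equation.\<close>

lemma deflator_unique:
 assumes I: "stochastic_integral M G (stopped U \<tau>) (%t w. - (L t w / Z t w)) (%t w. L t w - 1)"
 shows "AE w in M. ALL t>=0. Ls t w = L t w"
proof -
 let ?X = "stopped U \<tau>" and ?H = "%t w. - (L t w / Z t w)" and ?Y = "%t w. L t w - 1"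
 interpret B: bracketed M G ?X V ka by (rule G_bracketed)
 note br = EG.stochastic_integral_bracket[OF I B.cX]
 have p0: "AE w in M. stieltjes V (%_ _. 0) w & (ALL T. EX K. ALL s:{0<..T}. (0::real) = 0 | abs (?H s w) <= K)"
  using V_path by eventually_elim simp
 have "EG.bracket ?X (%_ _. 1) V (%_ _. 0)" using clm_U by simp
 from br[OF EG.clm_const this p0] have cY: "EG.cont_adapted ?Y" and clY: "EG.clm ?Y" by simp_all
 have lH: "AE w in M. regular w & lbm (traj ?H w) & lbm (%s. - (Ls s w / Z s w))"
  using AE_regular EG.AE_cont[OF cY] Ls_path
 proof eventually_elim
  case (elim w)
  have "continuous_on {0..} (%t. -1 * (?Y t w + 1))" by (intro continuous_intros elim)
  from lbm_mult[OF lbm_of_continuous[OF this] lbm_Z(2)[OF elim(1)]] show ?case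
   using elim lbm_mult[OF lbm_const[of "-1"], of "%s. Ls s w / Z s w"] by simp
 qed
 have p: "AE w in M. stieltjes V (%s w. h s w * ka s w) w & (ALL T. EX K. ALL s:{0<..T}. h s w * ka s w = 0 | abs (?H s w) <= K)"
  if "AE w in M. lbm (traj h w)" for h
  using that lH by eventually_elim (use lbm_ka lbm_mult lbm_bound in "unfold regular_def, meson")
 have 1: "EG.bracket ?X ?Y V (%s w. ?H s w * ka s w)"
  using br(2)[OF clm_U _ p[of "%_ _. 1"]] B.clm_X2 by (simp add: mult.commute)
 have 2: "EG.bracket ?Y ?Y V (%s w. ?H s w * (?H s w * ka s w))"
  by (rule br(2)[OF clY 1 p]) (use lH in "eventually_elim, blast")
 have 3: "EG.bracket ?Y (%t w. Ls t w - 1) V (%s w. ?H s w * (- (Ls s w / Z s w) * ka s w))"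
  by (rule br(2)[OF Ls_brackets(1,2) p]) (use lH in "eventually_elim, blast")
 have path: "AE w in M. stieltjes V ka w & lbm (traj ?H w) & lbm (%s. - (Ls s w / Z s w))"
  using lH by eventually_elim (use lbm_ka in "unfold regular_def, blast")
 define \<Delta> where "\<Delta> t w = ?Y t w - (Ls t w - 1)" for t w
 define wt where "wt s w = ka s w * (1 / Z s w * (1 / Z s w))" for s w
 have "(?H s w - - (Ls s w / Z s w))\<^sup>2 * ka s w = (\<Delta> s w)\<^sup>2 * wt s w" for s w
 proof -
  have "?H s w - - (Ls s w / Z s w) = - (\<Delta> s w * (1 / Z s w))" by (simp add: \<Delta>_def diff_divide_distrib)
  thus ?thesis by (simp add: wt_def power2_eq_square)
 qed
 with EG.clm_diff_squared[OF 2 Ls_brackets(3) 3 path]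
 have D: "EG.clm (%t w. (\<Delta> t w)\<^sup>2 - Sint V (%s w. (\<Delta> s w)\<^sup>2 * wt s w) t w)"
  by (simp add: \<Delta>_def power2_eq_square)
 have cD: "EG.cont_adapted \<Delta>"
  using EG.clm_cont[OF EG.clm_diff[OF clY Ls_brackets(1)]] by (simp add: \<Delta>_def[abs_def])
 have "AE w in M. ALL t>=0. \<Delta> t w = 0"
 proof (rule EG.clm_gronwall[OF cD _ D])
  have "AE w in M. ?Y 0 w = 0" using I by (simp add: stochastic_integral_def)
  thus "AE w in M. \<Delta> 0 w = 0" using Ls_path by eventually_elim (simp add: \<Delta>_def)
  let ?q = "%s w. 1 / Z s w * (1 / Z s w)"
  have "EG.cont_adapted (stopped (Sint V ?q) \<tau>)"
   by (intro EG.cont_adapted_stopped[OF cont_adapted_FG \<tau>_stopping] cont_adapted_Sint_V right_cont_bounded_mult right_cont_bounded_inverse_Z)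
  moreover have "stopped (Sint V ?q) \<tau> t = Sint V wt t" if "t >= 0" for t
   using stopped_Sint[OF that, of ?q] unfolding wt_def[abs_def] by (simp add: fun_eq_iff)
  ultimately show "adapted G (Sint V wt)" by (simp add: EG.cont_adapted_def adapted_def)
  show "AE w in M. increasing_path (traj V w) & lbm (traj wt w) & (ALL s>0. 0 <= wt s w)"
   using AE_regular
  proof eventually_elim
   case (elim w)
   have "lbm (traj wt w)" unfolding wt_def by (intro lbm_mult lbm_ka lbm_Z(2)[OF elim])
   thus ?case using elim by (simp add: regular_def wt_def ka_def)
  qed
  show "AE w in M. continuous_on {0..} (traj V w)" using V_path by eventually_elim simp
 qed
 thus ?thesis by eventually_elim (simp add: \<Delta>_def)
qed

text \<open>L converges as a nonnegative local martingale. Its inverse \<open>N\<^sup>\<tau> / N\<^sub>0\<close> has bounded paths because \<open>N / N\<^sub>0\<close> is a nonnegative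
 local martingale of F, so that the limit is positive.\<close>

lemma Ls_limit: "AE w in M. EX l>0. (traj Ls w ---> l) at_top"
proof -
 have k: "(%w. 1 / N 0 w) : meas (F 0)" using N0 by measurable
 have N0': "AE w in M. 1 / N 0 w * N 0 w = 1" using AE_regular
 proof eventually_elim
  case (elim w)
  thus ?case using N_pos[OF elim, of 0] by simp
 qed
 have Nn: "AE w in M. ALL t>=0. 1 / N 0 w * N t w >= 0" using AE_regular by eventually_elim (simp add: N_pos less_imp_le)
 have Ls0: "AE w in M. Ls 0 w = 1" "AE w in M. ALL t>=0. Ls t w >= 0" using Ls_path by (eventually_elim; simp add: less_imp_le)+
 from clm_nonneg_bounded_paths[OF clm_mult_F0[OF clm_N k] N0' Nn] EG.nonneg_clm_converges[OF clm_Ls Ls0] AE_regular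
 show ?thesis
 proof eventually_elim
  case (elim w)
  obtain K where K: "!!t. t >= 0 ==> 1 / N 0 w * N t w <= K" using elim(1) by blast
  have K1: "K >= 1" using K[of 0] N_pos[OF elim(3), of 0] by simp
  have ge: "1 / K <= Ls t w" if "t >= 0" for t
  proof -
   have u: "min_time t (\<tau> w) >= 0" by (rule min_time_bounds(1)[OF that])
   show ?thesis using K[OF u] K1 N_pos[OF elim(3) u] N_pos[OF elim(3), of 0] by (simp add: Ls_def stopped_def field_simps)
  qed
  obtain l where l: "(traj Ls w ---> l) at_top" using elim(2) by blast
  have "1 / K <= l" using ge by (intro tendsto_lowerbound[OF l]) (auto intro: eventually_mono[OF eventually_ge_at_top[of 0]])
  moreover have "0 < 1 / K" using K1 by simp
  ultimately show ?case using l by (intro exI[of _ l]) linarith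
 qed
qed

text \<open>The value of an admissible portfolio deflated by L is a nonnegative local martingale, so that the
 deflated claim \<open>L\<^sub>\<infinity> \<xi>\<close> costs at most x, for every x > 0.\<close>

lemma NUPBR_before:
 assumes S: "clm S"
 shows "NUPBR M G (stopped S \<tau>)"
 unfolding NUPBR_def
proof (rule notI, elim exE conjE)
 fix xi :: "'a => real"
 assume xim: "xi : meas (sigma_infinity M G)" and xi0: "ALL w:space M. 0 <= xi w" and pos: "0 < prob {w:space M. 0 < xi w}"
  and adm: "ALL x>0. EX \<theta> W Winf. admissible M G (stopped S \<tau>) x \<theta> W Winf & (AE w in M. xi w <= x + Winf w)"
 have A: "(UN t:{0..}. sets (G t)) <= sets M" using G_M by auto
 hence "(UN t:{0..}. sets (G t)) <= Pow (space M)" using sets.space_closed[of M] by (rule order_trans)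
 hence "sets (sigma_infinity M G) <= sets M" "space (sigma_infinity M G) = space M"
  unfolding sigma_infinity_def using sets.sigma_sets_subset[OF A] by (simp_all add: space_measure_of_conv)
 hence xiM[measurable]: "xi : meas M" using xim by (intro measurable_from_subalg[OF _ xim]) (simp add: subalgebra_def)
 have cX: "EG.cont_adapted (stopped S \<tau>)" by (rule EG.cont_adapted_stopped[OF cont_adapted_FG[OF clm_cont[OF S]] \<tau>_stopping])
 have XL: "EG.clm (%t w. stopped S \<tau> t w * Ls t w - Sint V (%_ _. 0) t w)"
  using clm_Ls_mult[OF S] by (simp add: Sint_def sint_def mult.commute)
 define l where "l w = lim (%n. Ls (real n) w)" for w
 have LM: "Ls (real n) : meas M" for n by (rule EG.cont_adapted_M[OF EG.clm_cont[OF clm_Ls]]) simp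
 have lM[measurable]: "l : meas M" unfolding l_def[abs_def] by (rule borel_measurable_lim_metric[OF LM])
 have l: "AE w in M. l w > 0 & (%n. Ls (real n) w) ----> l w"
  using Ls_limit
 proof eventually_elim
  case (elim w)
  then obtain c where c: "c > 0" "(traj Ls w ---> c) at_top" by blast
  have "(%n. Ls (real n) w) ----> c" by (rule filterlim_compose[OF c(2) filterlim_real_sequentially])
  thus ?case using limI[of "%n. Ls (real n) w" c] c(1) by (simp add: l_def)
 qed
 have le: "(\<integral>\<^sup>+w. ennreal (l w * xi w) \<partial>M) <= ennreal x" if x: "x > 0" for x
 proof -
  obtain \<theta> W Winf where W: "stochastic_integral M G (stopped S \<tau>) \<theta> W" "ALL t>=0. AE w in M. - x <= W t w"
   "AE w in M. (traj W w ---> Winf w) at_top" "AE w in M. xi w <= x + Winf w"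
   using adm x unfolding admissible_def by auto
  have "AE w in M. stieltjes V (%s w. 0) w & (ALL T. EX K. ALL s:{0<..T}. (0::real) = 0 | abs (\<theta> s w) <= K)"
   using V_path by eventually_elim simp
  note br = EG.stochastic_integral_bracket[OF W(1) cX clm_Ls XL this]
  define Q where "Q t w = W t w * Ls t w + x * Ls t w" for t w
  have Q: "EG.clm Q" using EG.clm_add[OF br(2) EG.clm_cmult[OF clm_Ls, of x]] by (simp add: Q_def[abs_def] Sint_def sint_def)
  have Q0: "AE w in M. Q 0 w = x"
  proof -
   have "AE w in M. W 0 w = 0" using W(1) by (simp add: stochastic_integral_def)
   thus ?thesis using Ls_path by eventually_elim (simp add: Q_def)
  qed
  have Wx: "AE w in M. ALL t>=0. W t w : {- x..}"
   by (rule EG.AE_all_times[OF EG.cont_right_cont[OF br(1)] closed_atLeast]) (use W(2) in simp)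
  have Qn: "AE w in M. ALL t>=0. Q t w >= 0"
   using Wx Ls_path
  proof (eventually_elim, intro allI impI)
   fix w and t :: real
   assume "ALL t>=0. W t w : {- x..}" "Ls 0 w = 1 & (ALL t>=0. Ls t w > 0) & continuous_on {0..} (traj Ls w) & lbm (%s. Ls s w / Z s w)" "0 <= t"
   hence "0 <= W t w + x" "0 < Ls t w" by force+
   thus "0 <= Q t w" by (simp add: Q_def distrib_right[symmetric])
  qed
  have QM: "Q (real n) : meas M" for n by (rule EG.cont_adapted_M[OF EG.clm_cont[OF Q]]) simp
  have "(\<integral>\<^sup>+w. ennreal (l w * xi w) \<partial>M) <= (\<integral>\<^sup>+w. liminf (%n. ennreal (Q (real n) w)) \<partial>M)"
  proof (rule nn_integral_mono_AE)
   show "AE w in M. ennreal (l w * xi w) <= liminf (%n. ennreal (Q (real n) w))"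
    using l W(3,4)
   proof eventually_elim
    case (elim w)
    have "(%n. W (real n) w) ----> Winf w" by (rule filterlim_compose[OF elim(2) filterlim_real_sequentially])
    hence "(%n. Q (real n) w) ----> Winf w * l w + x * l w" unfolding Q_def using elim(1) by (intro tendsto_intros) auto
    hence "liminf (%n. ennreal (Q (real n) w)) = ennreal (Winf w * l w + x * l w)" by (intro lim_imp_Liminf tendsto_ennrealI) auto
    moreover have "l w * xi w <= Winf w * l w + x * l w" using mult_left_mono[OF elim(3), of "l w"] elim(1) by (simp add: algebra_simps)
    ultimately show ?case by (simp add: ennreal_leI)
   qed
  qed
  also have "... <= liminf (%n. \<integral>\<^sup>+w. ennreal (Q (real n) w) \<partial>M)" using QM by (intro nn_integral_liminf) auto
  also have "... <= ennreal x"
   using EG.clm_nonneg_expectation[OF Q Q0 Qn] by (intro Liminf_le) (auto intro!: eventuallyI)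
  finally show ?thesis .
 qed
 have "(\<integral>\<^sup>+w. ennreal (l w * xi w) \<partial>M) <= 0"
  by (rule ennreal_le_epsilon) (use le in simp)
 hence "(\<integral>\<^sup>+w. ennreal (l w * xi w) \<partial>M) = 0" by simp
 hence "AE w in M. ennreal (l w * xi w) = 0" by (subst (asm) nn_integral_0_iff_AE) simp_all
 hence "AE w in M. ~ 0 < xi w"
  using l
 proof eventually_elim
  case (elim w)
  thus ?case by (auto simp: ennreal_eq_0_iff mult_le_0_iff)
 qed
 hence "prob {w:space M. 0 < xi w} = 0" by (subst prob_eq_0) simp_all
 thus False using pos by simp
qed

lemma deflator:
 assumes S: "clm S" and L: "AE w in M. ALL t>=0. Ls t w = L t w"
 shows "local_martingale_deflator M G (stopped S \<tau>) L"
 unfolding local_martingale_deflator_def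
proof (intro conjI)
 show "local_martingale M G L" by (rule EG.clm_local_martingale[OF EG.clm_cong[OF clm_Ls L]])
 have "AE w in M. ALL t>=0. Ls t w * stopped S \<tau> t w = L t w * stopped S \<tau> t w" using L by eventually_elim simp
 thus "local_martingale M G (%t w. L t w * stopped S \<tau> t w)"
  by (rule EG.clm_local_martingale[OF EG.clm_cong[OF clm_Ls_mult[OF S]]])
 show "AE w in M. ALL t>=0. 0 < L t w" "AE w in M. L 0 w = 1" using L Ls_path by (eventually_elim; force)+
 show "AE w in M. EX l>0. (traj L w ---> l) at_top"
  using L Ls_limit
 proof eventually_elim
  case (elim w)
  have "eventually (%t. Ls t w = L t w) at_top" using eventually_ge_at_top[of 0] by eventually_elim (use elim(1) in blast)
  thus ?case using elim(2) by (auto intro: Lim_transform_eventually)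
 qed
qed

end

theorem proposition6p1:
  fixes M :: "'a measure"
    and F G :: "real \<Rightarrow> 'a measure"
    and \<tau> :: "'a \<Rightarrow> ennreal"
    and S Z Ao m V mhat :: "real \<Rightarrow> 'a \<Rightarrow> real"
  assumes "prob_space M"
    and "usual_hypotheses M F"
    and "\<tau> \<in> borel_measurable M"
    and "G = progressive_enlargement M F \<tau>"
    and "local_martingale M F S"
    and "AE \<omega> in M. \<forall>t\<ge>0. S t \<omega> \<ge> 0"
    and "azema_supermartingale M F \<tau> Z"
    and "AE \<omega> in M. \<forall>t\<ge>0. Z t \<omega> > 0"
    and "dual_optional_projection M F (\<lambda>t \<omega>. if \<tau> \<omega> \<le> ennreal t then 1 else 0) Ao"
    and "m = (\<lambda>t \<omega>. Z t \<omega> + Ao t \<omega>)"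
    and "predictable_bracket M F m V"
    and "mhat = hat_process \<tau> Z m V"
    and all_martingales_continuous:
      "\<And>N. martingale M F N \<Longrightarrow> AE \<omega> in M. continuous_on {0..} (\<lambda>t. N t \<omega>)"
  shows "NUPBR M G (stopped S \<tau>) \<and>
    (\<exists>L. stochastic_integral M G mhat (\<lambda>t \<omega>. - (L t \<omega> / Z t \<omega>)) (\<lambda>t \<omega>. L t \<omega> - 1)) \<and>
    (\<forall>L. stochastic_integral M G mhat (\<lambda>t \<omega>. - (L t \<omega> / Z t \<omega>)) (\<lambda>t \<omega>. L t \<omega> - 1) \<longrightarrow>
         local_martingale_deflator M G (stopped S \<tau>) L)"
proof -
 interpret prob_space M by fact
 interpret R: random_time M F \<tau> Z Ao V
  using assms by unfold_locales auto
 have G: "G = R.G" unfolding R.G_def by fact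
 have "m = R.m" unfolding assms(10) R.m_def[abs_def] ..
 hence "mhat = hat_process \<tau> Z R.m V" using assms(12) by simp
 hence mh: "mhat = stopped R.U \<tau>" by (simp add: fun_eq_iff R.hat_process_U)
 have S: "R.clm S" by (rule R.local_martingale_clm) fact
 show ?thesis
  unfolding G mh using R.NUPBR_before[OF S] R.deflator_exists R.deflator[OF S R.deflator_unique] by blast
qed

end
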